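(* There is $c^*\in(0,1]$ such that the following holds. Let $c\in(0,c^* )$, let $0<\gamma<\gamma'<1$, and let $t_n\to\infty$ be a sequence with $$\mathbb{P}\big(\mathcal{M}(\Lambda_{t_n},ct_n)\subset\mathcal{C}_{e_1}(t_n^{\gamma})\big)\to1\quad(n\to\infty).$$ With $\theta_n=t_n^{-(1-\gamma')}$ and $S(t),S'(t)$ as in the context, there exists $C>0$ such that for all sufficiently large $n$, $$\mathrm{Var}\big[A^{ct_n}(S(t_n))-A^{ct_n}(S'(t_n))\big]\ge C\,t_n^{1-\gamma}.$$
   Context: $\mathbb{R}^2\cong\mathbb{C}$, $e_1=1$, $e_2=i$. $\omega$ is a homogeneous unit-intensity Poisson point process on $\mathbb{R}^2$. For $s>0$ and $S\subset\mathbb{R}^2$, $A^s(S)$ is the infimum of $\frac12\int_0^s|\dot\gamma(u)|^2du-\omega_{pp}(\gamma)$ over piecewise linear paths $\gamma:[0,s]\to\mathbb{R}^2$ with $\gamma(0)=0$, $\gamma(s)\in S$ visiting each Poisson point at most once ($\omega_{pp}(\gamma)$ = number of Poisson points touched), and $\mathcal{M}(S,s)$ is the a.s. unique minimizer. $\Lambda_t=\{(t,y):y\in\mathbb{R}\}$. For a unit vector $u$ and $w>0$, $\mathcal{C}_u(w)=\{z:\mathrm{dist}(z,\{au:a\in\mathbb{R}\})\le w\}$. For $t=t_n$ and $\theta=\theta_n$: $S(t)=\{te_1+ae_2:a\in[-\frac{t^{\gamma'}}2,\frac{3t^{\gamma'}}2]\}$ and $S'(t)=\{e^{i\theta}(te_1+ae_2):a\in[-\frac{3t^{\gamma'}}2,\frac{t^{\gamma'}}2]\}$.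 *)

theory Defs
  imports "HOL-Probability.Probability"
begin

text \<open>The plane R^2 is identified with the complex numbers; e1 = 1, e2 = i.
  A point configuration is a set of points (complex set).\<close>

definition poisson_pp :: "'a measure \<Rightarrow> ('a \<Rightarrow> complex set) \<Rightarrow> bool" where
  "poisson_pp M \<omega> \<longleftrightarrow>
     prob_space M \<and>
     (\<forall>x\<in>space M. \<forall>B::complex set. bounded B \<longrightarrow> finite (\<omega> x \<inter> B)) \<and>
     (\<forall>B\<in>sets lborel. bounded B \<longrightarrow>
        (\<lambda>x. card (\<omega> x \<inter> B)) \<in> measurable M (count_space UNIV) \<and>
        (\<forall>k::nat. measure M {x\<in>space M. card (\<omega> x \<inter> B) = k}
                   = (measure lborel B) ^ k / fact k * exp (- measure lborel B))) \<and>
     (\<forall>(I::nat set) (B::nat \<Rightarrow> complex set).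
        finite I \<longrightarrow> (\<forall>i\<in>I. B i \<in> sets lborel \<and> bounded (B i)) \<longrightarrow> disjoint_family_on B I \<longrightarrow>
        prob_space.indep_vars M (\<lambda>_. count_space UNIV) (\<lambda>i x. card (\<omega> x \<inter> B i)) I)"

definition piecewise_linear :: "real \<Rightarrow> (real \<Rightarrow> complex) \<Rightarrow> bool" where
  "piecewise_linear s g \<longleftrightarrow>
     (\<exists>T. finite T \<and> {0, s} \<subseteq> T \<and> T \<subseteq> {0..s} \<and>
        (\<forall>a\<in>T. \<forall>b\<in>T. a < b \<and> {a<..<b} \<inter> T = {} \<longrightarrow>
           (\<forall>u\<in>{a..b}. g u = g a + ((u - a) / (b - a)) *\<^sub>R (g b - g a))))"

text \<open>Admissible paths for A^s(S): piecewise linear on [0,s], start at 0, end in S,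
  and visit each Poisson point at most once (the set of times spent at a Poisson
  point is connected, i.e. empty or a single visit).\<close>
definition admissible :: "complex set \<Rightarrow> real \<Rightarrow> complex set \<Rightarrow> (real \<Rightarrow> complex) \<Rightarrow> bool" where
  "admissible P s S g \<longleftrightarrow> piecewise_linear s g \<and> g 0 = 0 \<and> g s \<in> S \<and>
     (\<forall>p\<in>P. connected {u\<in>{0..s}. g u = p})"

definition energy :: "real \<Rightarrow> (real \<Rightarrow> complex) \<Rightarrow> real" where
  "energy s g = 1/2 * integral {0..s} (\<lambda>u. (cmod (vector_derivative g (at u)))\<^sup>2)"

definition points_touched :: "complex set \<Rightarrow> real \<Rightarrow> (real \<Rightarrow> complex) \<Rightarrow> nat" where
  "points_touched P s g = card {p\<in>P. p \<in> g ` {0..s}}"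

definition path_action :: "complex set \<Rightarrow> real \<Rightarrow> (real \<Rightarrow> complex) \<Rightarrow> real" where
  "path_action P s g = energy s g - real (points_touched P s g)"

definition Action :: "complex set \<Rightarrow> real \<Rightarrow> complex set \<Rightarrow> real" where
  "Action P s S = Inf (path_action P s ` {g. admissible P s S g})"

definition is_minimizer :: "complex set \<Rightarrow> real \<Rightarrow> complex set \<Rightarrow> (real \<Rightarrow> complex) \<Rightarrow> bool" where
  "is_minimizer P s S g \<longleftrightarrow> admissible P s S g \<and> path_action P s g = Action P s S"

text \<open>M(S,s): the (a.s. unique) minimizer, as a path on [0,s] (set to 0 outside [0,s]).\<close>
definition minimizer :: "complex set \<Rightarrow> complex set \<Rightarrow> real \<Rightarrow> (real \<Rightarrow> complex)" where
  "minimizer P S s = (THE h. \<exists>g. is_minimizer P s S g \<and>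
                            h = (\<lambda>u. if u \<in> {0..s} then g u else 0))"

definition Lambda_line :: "real \<Rightarrow> complex set" where
  "Lambda_line t = {z. Re z = t}"

definition cylinder :: "complex \<Rightarrow> real \<Rightarrow> complex set" where
  "cylinder u w = {z. infdist z {complex_of_real a * u | a. True} \<le> w}"

definition S_set :: "real \<Rightarrow> real \<Rightarrow> complex set" where
  "S_set \<gamma>' t = {complex_of_real t + complex_of_real a * \<i> | a. a \<in> {- (t powr \<gamma>') / 2 .. 3 * t powr \<gamma>' / 2}}"

definition S'_set :: "real \<Rightarrow> real \<Rightarrow> real \<Rightarrow> complex set" where
  "S'_set \<gamma>' \<theta> t = {exp (\<i> * complex_of_real \<theta>) * (complex_of_real t + complex_of_real a * \<i>) | a.
                      a \<in> {- 3 * t powr \<gamma>' / 2 .. t powr \<gamma>' / 2}}"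

end

theory Submission
  imports Defs "HOL-Real_Asymp.Real_Asymp"
begin

text \<open>At its optimal constant speed a path of length \<open>L\<close> through \<open>k\<close> points has action
  \<open>L\<^sup>2 / (2 * s) - k\<close>, so the action is an infimum over chains of Poisson points. Almost surely the
  optimal chain is unique, which gives the minimizer of the hypothesis its intended meaning.\<close>

text \<open>Let \<open>N\<close> be the number of points in the slab \<open>D = [t/2, t] \<times> [-2 t\<^sup>\<gamma>, 2 t\<^sup>\<gamma>]\<close>. Its variance is
  \<open>2 t\<^sup>1\<^sup>+\<^sup>\<gamma>\<close>, so by Cauchy--Schwarz it suffices that the covariance of \<open>N\<close> with the difference of the actions is
  of order \<open>t\<close>. Divide \<open>D\<close> into small cells. Up to the square of the area of the cell, the covariance of
  an action with the number of points in a cell is minus the expected gain, that is, the expected increase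
  of the action when these points are removed, and the gains add up to at most the number of points of
  the optimal chain in \<open>D\<close>. For the rotated segment this number vanishes with probability tending to 1: by
  rotation invariance the optimal chain stays near the rotated axis, whose distance from \<open>D\<close> exceeds
  \<open>t\<^sup>\<gamma>\<close>; otherwise the number is \<open>O(t)\<close>. For the vertical segment the optimal chain crosses \<open>D\<close>. A detour
  through a point within a small multiple of \<open>c\<close> of it costs less than 1/2 and collects 1, so a
  total area of order \<open>t\<close> of cells has gain at least 1/2 once occupied.\<close>

section \<open>Chains of points\<close>

text \<open>The scales decide. The rotation by t^(\<gamma>'-1) lifts the axis over [t/2, t] by order
  t^\<gamma>', far beyond the strip width t^\<gamma>, so one slab can matter to the first action and
  be invisible to the second; squaring t and dividing by t^(1+\<gamma>) leaves t^(1-\<gamma>). Three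
  obstacles shape the rest. An infimum over chains means something only if chains cannot collect too
  many points; this is a linear bound with a random additive constant \<open>K\<close>, whose second
  moment also makes all covariances finite. Paths may not visit a point twice, so the polygon
  through an optimal chain can be inadmissible: in general the infimum over paths is only
  approximated by polygons, and only in general position is it attained at the polygon itself.
  Finally \<open>poisson_pp\<close> speaks of counts only, so measurability, independence of
  disjoint regions and rotation invariance are all derived through sigma-algebras generated by
  counts. Every c < 1 can be treated at once: the bounds on chain lengths are uniform in c, and the
  width of the detours is proportional to c.\<close>

fun plen :: "complex \<Rightarrow> complex list \<Rightarrow> real" where
  "plen a [] = 0"
| "plen a (p # ps) = dist a p + plen p ps"

text \<open>The last leg is charged by the distance to the target set, so the endpoint is optimized
  away and a chain consists of Poisson points only.\<close>

fun tlen :: "complex set \<Rightarrow> complex \<Rightarrow> complex list \<Rightarrow> real" where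
  "tlen T a [] = infdist a T"
| "tlen T a (p # ps) = dist a p + tlen T p ps"

definition chains :: "complex set \<Rightarrow> complex list set" where
  "chains P = {ps. distinct ps \<and> set ps \<subseteq> P}"

definition cval :: "real \<Rightarrow> complex set \<Rightarrow> complex list \<Rightarrow> real" where
  "cval s T ps = (tlen T 0 ps)\<^sup>2 / (2 * s) - real (length ps)"

definition cact :: "complex set \<Rightarrow> real \<Rightarrow> complex set \<Rightarrow> real" where
  "cact P s T = Inf (cval s T ` chains P)"

definition LF :: "complex set set" where
  "LF = {P. \<forall>B. bounded B \<longrightarrow> finite (P \<inter> B)}"

text \<open>A linear bound on the number of collected points loses against the quadratic energy;
  this is what keeps \<open>cval\<close> bounded below.\<close>

definition tame :: "real \<Rightarrow> real \<Rightarrow> complex set \<Rightarrow> bool" where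
  "tame b K P \<longleftrightarrow> (\<forall>ps\<in>chains P. real (length ps) \<le> b * plen 0 ps + K)"

lemma plen_nonneg: "0 \<le> plen a ps"
  by (induction ps arbitrary: a) auto

lemma tlen_nonneg: "0 \<le> tlen T a ps"
  by (induction ps arbitrary: a) (auto simp: infdist_nonneg)

lemma plen_le_tlen: "plen a ps \<le> tlen T a ps"
  by (induction ps arbitrary: a) (auto simp: infdist_nonneg)

lemma plen_append: "plen a (ps @ qs) = plen a ps + plen (last (a # ps)) qs"
proof (induction ps arbitrary: a)
  case (Cons p ps)
  show ?case by (simp only: append_Cons plen.simps Cons.IH[of p] last.simps(1)[of a "p # ps"] list.distinct if_False add.assoc)
qed simp

lemma tlen_append: "tlen T a (ps @ qs) = plen a ps + tlen T (last (a # ps)) qs"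
proof (induction ps arbitrary: a)
  case (Cons p ps)
  show ?case by (simp only: append_Cons plen.simps tlen.simps Cons.IH[of p] last.simps(1)[of a "p # ps"] list.distinct if_False add.assoc)
qed simp

lemma tlen_le_plen: "z \<in> T \<Longrightarrow> tlen T a ps \<le> plen a (ps @ [z])"
  by (induction ps arbitrary: a) (auto simp: infdist_le)

lemma tlen_eq_plen:
  assumes "closed T" "T \<noteq> {}"
  obtains z where "z \<in> T" "tlen T a ps = plen a (ps @ [z])"
    "infdist (last (a # ps)) T = dist (last (a # ps)) z"
proof -
  obtain z where z: "z \<in> T" "infdist (last (a # ps)) T = dist (last (a # ps)) z"
    using infdist_attains_inf[OF assms] by metis
  have "tlen T a (ps @ []) = plen a ps + tlen T (last (a # ps)) []"
    by (rule tlen_append)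
  then have "tlen T a ps = plen a (ps @ [z])" using z by (simp add: plen_append)
  with z show ?thesis using that by blast
qed

lemma tlen_triangle: "tlen T a ps \<le> dist a b + tlen T b ps"
proof (cases ps)
  case Nil
  then show ?thesis using infdist_triangle[of a T b] by simp
next
  case (Cons p qs)
  then show ?thesis using dist_triangle[of a p b] by simp
qed

lemma plen_triangle: "plen a ps \<le> dist a b + plen b ps"
  using dist_triangle[of a _ b] by (cases ps) (auto intro: order_trans)

lemma tlen_filter: "tlen T a (filter Q ps) \<le> tlen T a ps"
proof (induction ps arbitrary: a)
  case (Cons p ps)
  show ?case
  proof (cases "Q p")
    case False
    have "tlen T a (filter Q ps) \<le> dist a p + tlen T p (filter Q ps)" by (rule tlen_triangle)
    then show ?thesis using Cons[of p] False by simp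
  qed (use Cons in simp)
qed simp

lemma tlen_mono: "T \<subseteq> T' \<Longrightarrow> T \<noteq> {} \<Longrightarrow> tlen T' a ps \<le> tlen T a ps"
  by (induction ps arbitrary: a) (auto intro: infdist_mono)

text \<open>Every chain point is an endpoint of two legs, whence the factor 2. The Lipschitz
  dependence is what later makes conditions on chains open.\<close>

lemma tlen_perturb:
  assumes "list_all2 (\<lambda>x y. dist x y \<le> d) ps qs"
  shows "tlen T b qs \<le> tlen T a ps + dist a b + 2 * d * length ps"
  using assms
proof (induction ps qs arbitrary: a b rule: list_all2_induct)
  case Nil
  then show ?case using infdist_triangle[of b T a] by (simp add: dist_commute)
next
  case (Cons p ps q qs)
  have "dist b q \<le> dist b a + dist a p + dist p q"
    using dist_triangle[of b q a] dist_triangle[of a q p] by simp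
  then show ?case using Cons(3)[of q p] Cons(1) by (simp add: algebra_simps dist_commute)
qed

lemma plen_perturb:
  assumes "list_all2 (\<lambda>x y. dist x y \<le> d) ps qs"
  shows "plen b qs \<le> plen a ps + dist a b + 2 * d * length ps"
  using assms
proof (induction ps qs arbitrary: a b rule: list_all2_induct)
  case Nil
  then show ?case by simp
next
  case (Cons p ps q qs)
  have "dist b q \<le> dist b a + dist a p + dist p q"
    using dist_triangle[of b q a] dist_triangle[of a q p] by simp
  then show ?case using Cons(3)[of q p] Cons(1) by (simp add: algebra_simps dist_commute)
qed

lemma tlen_insert_perturb: "tlen T a (l1 @ x # l2) \<le> tlen T a (l1 @ y # l2) + 2 * dist x y"
proof -
  have "tlen T x l2 \<le> dist x y + tlen T y l2" by (rule tlen_triangle)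
  moreover have "dist (last (a # l1)) x \<le> dist (last (a # l1)) y + dist x y"
    using dist_triangle[of "last (a # l1)" x y] by (simp add: dist_commute)
  ultimately show ?thesis by (simp add: tlen_append)
qed

lemma dist_mem_le_plen: "p \<in> set ps \<Longrightarrow> dist a p \<le> plen a ps"
proof (induction ps arbitrary: a)
  case (Cons q ps)
  show ?case
  proof (cases "p = q")
    case False
    then have "dist q p \<le> plen q ps" using Cons by simp
    then show ?thesis using dist_triangle[of a p q] by simp
  qed (simp add: plen_nonneg)
qed simp

text \<open>The polygon runs from the left of the vertical line at \<open>r\<close> to the target at
  \<open>t\<close>, so some leg crosses it. A point inserted on a leg costs no length, and convexity
  of \<open>C\<close> keeps it in \<open>C\<close>. Such points are the places from which detours
  start.\<close>

lemma tlen_insert_crossing: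
  assumes "convex C" "z \<in> C" "\<And>x. x \<in> C \<Longrightarrow> \<exists>z\<in>T \<inter> C. dist x z = infdist x T \<and> Re z = t"
    and "a \<in> C" "set ps \<subseteq> C" "Re a \<le> r" "r \<le> t"
  shows "\<exists>l1 l2 y. ps = l1 @ l2 \<and> Re y = r \<and> y \<in> C \<and> tlen T a (l1 @ y # l2) \<le> tlen T a ps"
  using assms(4-)
proof (induction ps arbitrary: a)
  have cross: "\<exists>y\<in>C. Re y = r \<and> dist u y + dist y v = dist u v"
    if uv: "u \<in> C" "v \<in> C" "Re u \<le> r" "r \<le> Re v" for u v
  proof (cases "Re u = Re v")
    case True
    then show ?thesis using uv by (intro bexI[of _ u]) auto
  next
    case False
    define l where "l = (r - Re u) / (Re v - Re u)"
    have l: "0 \<le> l" "l \<le> 1" using uv False by (auto simp: l_def field_simps)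
    define y where "y = (1 - l) *\<^sub>R u + l *\<^sub>R v"
    have "y \<in> closed_segment u v" using l by (auto simp: y_def in_segment)
    moreover have "Re y = Re u + l * (Re v - Re u)" by (simp add: y_def algebra_simps)
    then have "Re y = r" using False by (simp add: l_def)
    ultimately show ?thesis
      using closed_segment_subset[OF uv(1,2) assms(1)] 
      by (metis between between_mem_segment subsetD)
  qed
  {
    case Nil
    obtain z where z: "z \<in> T \<inter> C" "dist a z = infdist a T" "Re z = t"
      using assms(3) Nil by metis
    obtain y where y: "y \<in> C" "Re y = r" "dist a y + dist y z = dist a z"
      using cross[of a z] Nil z by auto
    have "infdist y T \<le> dist y z" using z by (auto intro: infdist_le)
    then show ?case using y z by (intro exI[of _ "[]"] exI[of _ y]) auto
  next
    case (Cons p ps)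
    show ?case
    proof (cases "r \<le> Re p")
      case True
      obtain y where y: "y \<in> C" "Re y = r" "dist a y + dist y p = dist a p"
        using cross[of a p] Cons True by auto
      then show ?thesis
        by (intro exI[of _ "[]"] exI[of _ "p # ps"] exI[of _ y]) auto
    next
      case False
      then obtain l1 l2 y where "ps = l1 @ l2" "Re y = r" "y \<in> C" "tlen T p (l1 @ y # l2) \<le> tlen T p ps"
        using Cons.IH[of p] Cons.prems by auto
      then show ?thesis
        by (intro exI[of _ "p # l1"] exI[of _ l2] exI[of _ y]) auto
    qed
  }
qed

section \<open>Optimal chains in a tame configuration\<close>

lemma chains_mono: "P \<subseteq> Q \<Longrightarrow> chains P \<subseteq> chains Q"
  by (auto simp: chains_def)

lemma Nil_in_chains [simp]: "[] \<in> chains P"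
  by (simp add: chains_def)

lemma tame_subset: "tame b K P \<Longrightarrow> Q \<subseteq> P \<Longrightarrow> tame b K Q"
  using chains_mono[of Q P] by (auto simp: tame_def)

lemma LF_subset:
  assumes "P \<in> LF" "Q \<subseteq> P" shows "Q \<in> LF"
proof -
  have "finite (Q \<inter> B)" if "bounded B" for B
  proof (rule finite_subset)
    show "Q \<inter> B \<subseteq> P \<inter> B" using assms by blast
    show "finite (P \<inter> B)" using assms that by (simp add: LF_def)
  qed
  then show ?thesis by (simp add: LF_def)
qed

text \<open>Completing the square in the length \<open>L\<close>: the quadratic term beats the
  linear bound on the number of points up to \<open>b^2 * s / 2\<close>.\<close>

lemma cval_lower:
  assumes "tame b K P" "ps \<in> chains P" "s > 0" "b \<ge> 0"
  shows "- (b\<^sup>2 * s / 2) - K \<le> cval s T ps"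
proof -
  define L where "L = tlen T 0 ps"
  have "real (length ps) \<le> b * plen 0 ps + K" using assms by (auto simp: tame_def)
  also have "\<dots> \<le> b * L + K" using plen_le_tlen[of 0 ps T] assms by (auto simp: L_def mult_left_mono)
  finally have 1: "real (length ps) \<le> b * L + K" .
  have "0 \<le> (L - b * s)\<^sup>2 / (2 * s)" using assms by simp
  also have "(L - b * s)\<^sup>2 / (2 * s) = L\<^sup>2 / (2 * s) - b * L + b\<^sup>2 * s / 2"
    using assms by (simp add: power2_eq_square field_simps)
  finally show ?thesis using 1 by (simp add: cval_def L_def)
qed

lemma cval_bdd_below:
  assumes "tame b K P" "s > 0" "b \<ge> 0"
  shows "bdd_below (cval s T ` chains P)"
  using cval_lower[OF assms(1) _ assms(2,3)] by (intro bdd_belowI2) auto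

lemma cact_le:
  assumes "tame b K P" "s > 0" "b \<ge> 0" "ps \<in> chains P"
  shows "cact P s T \<le> cval s T ps"
  unfolding cact_def using assms by (intro cInf_lower cval_bdd_below) auto

lemma cact_lower:
  assumes "tame b K P" "s > 0" "b \<ge> 0"
  shows "- (b\<^sup>2 * s / 2) - K \<le> cact P s T"
  unfolding cact_def using cval_lower[OF assms(1) _ assms(2,3)]
  by (intro cInf_greatest) (auto intro: Nil_in_chains)

lemma length_bound:
  assumes "tame b K P" "ps \<in> chains P" "s > 0" "b \<ge> 0" "K \<ge> 0" "V \<ge> 0" "cval s T ps \<le> V"
  shows "(tlen T 0 ps)\<^sup>2 \<le> 4 * s * (V + b\<^sup>2 * s + K)"
proof -
  define L where "L = tlen T 0 ps"
  have "real (length ps) \<le> b * plen 0 ps + K" using assms by (auto simp: tame_def)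
  also have "\<dots> \<le> b * L + K" using plen_le_tlen[of 0 ps T] assms by (auto simp: L_def mult_left_mono)
  finally have "L\<^sup>2 / (2 * s) \<le> V + b * L + K" using assms(7) by (simp add: cval_def L_def)
  then have 1: "L\<^sup>2 \<le> 2 * s * V + 2 * s * b * L + 2 * s * K" using assms(3)
    by (simp add: field_simps)
  \<comment> \<open>Absorbs the linear term \<open>2 * s * b * L\<close> into half of
    \<open>L^2\<close>; the other half gives the bound.\<close>
  have "0 \<le> (L - 2 * b * s)\<^sup>2" by simp
  then have "4 * b * s * L \<le> L\<^sup>2 + 4 * b\<^sup>2 * s\<^sup>2" by (simp add: power2_eq_square algebra_simps)
  then show ?thesis using 1 unfolding L_def[symmetric] by (simp add: algebra_simps power2_eq_square)
qed

text \<open>Chains that are no worse than the empty chain have bounded length, hence stay in a ball,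
  where a locally finite configuration offers only finitely many of them.\<close>

lemma cact_attained:
  assumes "tame b K P" "s > 0" "b \<ge> 0" "K \<ge> 0" "P \<in> LF"
  obtains ps where "ps \<in> chains P" "cact P s T = cval s T ps"
proof -
  define V where "V = (cval s T [])"
  have V: "V \<ge> 0" using assms by (simp add: V_def cval_def)
  define A where "A = {ps\<in>chains P. cval s T ps \<le> V}"
  define R where "R = sqrt (4 * s * (V + b\<^sup>2 * s + K))"
  have "A \<subseteq> {ps. set ps \<subseteq> P \<inter> cball 0 R \<and> distinct ps}"
  proof safe
    fix ps p assume ps: "ps \<in> A" "p \<in> set ps"
    then show "p \<in> P" by (auto simp: A_def chains_def)
    have "(tlen T 0 ps)\<^sup>2 \<le> 4 * s * (V + b\<^sup>2 * s + K)"
      using length_bound[OF assms(1) _ assms(2-4) V] ps by (auto simp: A_def)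
    then have "tlen T 0 ps \<le> R" unfolding R_def by (rule real_le_rsqrt)
    then show "p \<in> cball 0 R"
      using dist_mem_le_plen[OF ps(2), of 0] plen_le_tlen[of 0 ps T] by simp
  qed (auto simp: A_def chains_def)
  moreover have "finite (P \<inter> cball 0 R)" using assms(5) by (auto simp: LF_def)
  ultimately have fin: "finite A"
    using finite_subset_distinct finite_subset by blast
  have ne: "[] \<in> A" by (simp add: A_def V_def)
  define ps where "ps = arg_min_on (cval s T) A"
  have ps: "ps \<in> A" "\<And>qs. qs \<in> A \<Longrightarrow> cval s T ps \<le> cval s T qs"
    using arg_min_if_finite[OF fin, of "cval s T"] ne arg_min_least[OF fin, of _ "cval s T"]
    by (auto simp: ps_def)
  have min: "cval s T ps \<le> cval s T qs" if "qs \<in> chains P" for qs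
  proof (cases "qs \<in> A")
    case False
    then have "cval s T qs > V" using that by (auto simp: A_def)
    then show ?thesis using ps(2)[OF ne] by (simp add: V_def)
  qed (rule ps)
  have "ps \<in> chains P" using ps by (auto simp: A_def)
  moreover have "cact P s T = cval s T ps"
    unfolding cact_def using min \<open>ps \<in> chains P\<close> by (intro cInf_eq_minimum) auto
  ultimately show ?thesis using that by blast
qed

lemma cact_mono_config:
  assumes "tame b K P" "s > 0" "b \<ge> 0" "Q \<subseteq> P"
  shows "cact P s T \<le> cact Q s T"
  unfolding cact_def
  using cval_bdd_below[OF assms(1-3)] chains_mono[OF assms(4)]
  by (intro cInf_superset_mono) (auto intro: Nil_in_chains)

lemma cval_filter:
  assumes "s > 0" "distinct ps" "finite (set ps - A)"
  shows "cval s T (filter (\<lambda>p. p \<notin> A) ps) \<le> cval s T ps + card (set ps \<inter> A)"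
proof -
  have "(tlen T 0 (filter (\<lambda>p. p \<notin> A) ps))\<^sup>2 \<le> (tlen T 0 ps)\<^sup>2"
    by (intro power_mono tlen_filter tlen_nonneg)
  then have 1: "(tlen T 0 (filter (\<lambda>p. p \<notin> A) ps))\<^sup>2 / (2 * s) \<le> (tlen T 0 ps)\<^sup>2 / (2 * s)"
    using assms by (simp add: divide_right_mono)
  have "length ps = card (set ps)" using assms by (simp add: distinct_card)
  also have "set ps = (set ps \<inter> A) \<union> set (filter (\<lambda>p. p \<notin> A) ps)" by auto
  also have "card \<dots> = card (set ps \<inter> A) + card (set (filter (\<lambda>p. p \<notin> A) ps))"
    by (rule card_Un_disjoint) auto
  also have "card (set (filter (\<lambda>p. p \<notin> A) ps)) = length (filter (\<lambda>p. p \<notin> A) ps)"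
    using assms distinct_card[of "filter (\<lambda>p. p \<notin> A) ps"] by simp
  finally show ?thesis using 1 by (simp add: cval_def)
qed

text \<open>Skipping the points of \<open>A\<close> in an optimal chain does not lengthen it, by the
  triangle inequality, and loses 1 per skipped point. This later bounds the gain of a cell by the
  optimal points in it.\<close>

lemma cact_remove:
  assumes "tame b K P" "s > 0" "b \<ge> 0" "ps \<in> chains P" "cact P s T = cval s T ps"
  shows "cact (P - A) s T \<le> cact P s T + card (set ps \<inter> A)"
proof -
  have "filter (\<lambda>p. p \<notin> A) ps \<in> chains (P - A)" using assms by (auto simp: chains_def)
  then have "cact (P - A) s T \<le> cval s T (filter (\<lambda>p. p \<notin> A) ps)"
    using assms tame_subset[OF assms(1), of "P - A"] by (intro cact_le) auto
  also have "\<dots> \<le> cval s T ps + card (set ps \<inter> A)"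
    using assms by (intro cval_filter) (auto simp: chains_def)
  finally show ?thesis using assms by simp
qed

section \<open>Energy of piecewise linear paths\<close>

text \<open>\<open>piecewise_linear\<close> informs only about neighbouring break points; relations
  that compose over adjacent intervals extend from there to all pairs.\<close>

lemma consecutive_induct:
  fixes T :: "real set"
  assumes "finite T" "a \<in> T" "b \<in> T" "a \<le> b"
    and refl: "\<And>a. a \<in> T \<Longrightarrow> R a a"
    and step: "\<And>a b. a \<in> T \<Longrightarrow> b \<in> T \<Longrightarrow> a < b \<Longrightarrow> {a<..<b} \<inter> T = {} \<Longrightarrow> R a b"
    and trans: "\<And>a b c. a \<in> T \<Longrightarrow> b \<in> T \<Longrightarrow> c \<in> T \<Longrightarrow> a < b \<Longrightarrow> b < c \<Longrightarrow> R a b \<Longrightarrow> R b c \<Longrightarrow> R a c"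
  shows "R a b"
  using assms(2-4)
proof (induction "card (T \<inter> {a<..<b})" arbitrary: a b rule: less_induct)
  case less
  show ?case
  proof (cases "a = b \<or> {a<..<b} \<inter> T = {}")
    case True
    then show ?thesis using refl step less by (cases "a = b") auto
  next
    case False
    then obtain m where m: "m \<in> T" "a < m" "m < b" by auto
    have "card (T \<inter> {a<..<m}) < card (T \<inter> {a<..<b})"
      using m assms(1) by (intro psubset_card_mono) auto
    moreover have "card (T \<inter> {m<..<b}) < card (T \<inter> {a<..<b})"
      using m assms(1) by (intro psubset_card_mono) auto
    ultimately have "R a m" "R m b" using less m by auto
    then show ?thesis using trans less m by blast
  qed
qed

abbreviation speed2 :: "(real \<Rightarrow> complex) \<Rightarrow> real \<Rightarrow> real" where
  "speed2 g \<equiv> \<lambda>u. (cmod (vector_derivative g (at u)))\<^sup>2"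

lemma piecewise_linearE:
  assumes "piecewise_linear s g"
  obtains T where "finite T" "{0, s} \<subseteq> T" "T \<subseteq> {0..s}"
    "\<And>a b u. a \<in> T \<Longrightarrow> b \<in> T \<Longrightarrow> a < b \<Longrightarrow> {a<..<b} \<inter> T = {} \<Longrightarrow> u \<in> {a..b} \<Longrightarrow>
       g u = g a + ((u - a) / (b - a)) *\<^sub>R (g b - g a)"
proof -
  obtain T where T: "finite T \<and> {0, s} \<subseteq> T \<and> T \<subseteq> {0..s} \<and>
      (\<forall>a\<in>T. \<forall>b\<in>T. a < b \<and> {a<..<b} \<inter> T = {} \<longrightarrow>
        (\<forall>u\<in>{a..b}. g u = g a + ((u - a) / (b - a)) *\<^sub>R (g b - g a)))"
    using assms unfolding piecewise_linear_def ..
  show ?thesis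
  proof (rule that[of T])
    show "finite T" by (rule conjunct1[OF T])
    show "{0, s} \<subseteq> T" by (rule conjunct1[OF conjunct2[OF T]])
    show "T \<subseteq> {0..s}" by (rule conjunct1[OF conjunct2[OF conjunct2[OF T]]])
    fix a b u assume "a \<in> T" "b \<in> T" "a < b" "{a<..<b} \<inter> T = {}" "u \<in> {a..b}"
    then show "g u = g a + ((u - a) / (b - a)) *\<^sub>R (g b - g a)" using conjunct2[OF conjunct2[OF conjunct2[OF T]]] by blast
  qed
qed

text \<open>The last clause exhibits each derivative as a difference quotient of \<open>g\<close>,
  so that a Lipschitz constant of \<open>g\<close> bounds its speed.\<close>

lemma piecewise_linear_derivative:
  assumes "piecewise_linear s g"
  obtains T where "finite T" "s \<ge> 0" "continuous_on {0..s} g" "speed2 g integrable_on {0..s}"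
    "\<And>u. u \<in> {0..s} - T \<Longrightarrow> (g has_vector_derivative vector_derivative g (at u)) (at u)"
    "\<And>u. u \<in> {0..s} - T \<Longrightarrow> \<exists>a b. 0 \<le> a \<and> a < b \<and> b \<le> s \<and> vector_derivative g (at u) = (g b - g a) /\<^sub>R (b - a)"
proof -
  obtain T where T: "finite T" "{0, s} \<subseteq> T" "T \<subseteq> {0..s}"
    "\<And>a b u. a \<in> T \<Longrightarrow> b \<in> T \<Longrightarrow> a < b \<Longrightarrow> {a<..<b} \<inter> T = {} \<Longrightarrow> u \<in> {a..b} \<Longrightarrow>
       g u = g a + ((u - a) / (b - a)) *\<^sub>R (g b - g a)"
    by (rule piecewise_linearE[OF assms]) (rule that)
  have s: "s \<ge> 0" using T(2,3) by auto
  define R where "R = (\<lambda>x y. continuous_on {x..y} g \<and> speed2 g integrable_on {x..y} \<and>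
    (\<forall>u\<in>{x..y} - T. (g has_vector_derivative vector_derivative g (at u)) (at u) \<and>
       (\<exists>a b. 0 \<le> a \<and> a < b \<and> b \<le> s \<and> vector_derivative g (at u) = (g b - g a) /\<^sub>R (b - a))))"
  have "R 0 s"
  proof (rule consecutive_induct[of T])
    show "finite T" "0 \<in> T" "s \<in> T" "0 \<le> s" using T s by auto
    show "R a a" if "a \<in> T" for a
      using that integrable_on_refl[of "speed2 g" a] by (auto simp: R_def)
  next
    fix a b assume ab: "a \<in> T" "b \<in> T" "a < b" "{a<..<b} \<inter> T = {}"
    define D where "D = (g b - g a) /\<^sub>R (b - a)"
    define l where "l = (\<lambda>u. g a + (u - a) *\<^sub>R D)"
    have gl: "g u = l u" if "u \<in> {a..b}" for u
      using T(4)[OF ab that] by (simp add: l_def D_def divide_inverse)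
    have l: "(l has_vector_derivative D) (at u)" for u
      unfolding l_def by (auto intro!: derivative_eq_intros)
    have g: "(g has_vector_derivative D) (at u)" if "u \<in> {a<..<b}" for u
      using l[of u] by (rule has_vector_derivative_transform_within_open[of _ _ _ "{a<..<b}"]) (use that gl in auto)
    then have vd: "vector_derivative g (at u) = D" if "u \<in> {a<..<b}" for u
      using that by (simp add: vector_derivative_at)
    have "continuous_on {a..b} l" unfolding l_def by (intro continuous_intros)
    then have "continuous_on {a..b} g" by (rule continuous_on_eq) (simp add: gl)
    moreover have "speed2 g integrable_on {a..b}"
      by (rule integrable_spike_finite[of "{a,b}" _ _ "\<lambda>_. (cmod D)\<^sup>2"]) (auto simp: vd integrable_const_ivl)
    moreover have "u \<in> {a<..<b}" if "u \<in> {a..b} - T" for u using that ab by (auto simp: less_le)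
    moreover have "0 \<le> a" "b \<le> s" using T ab by auto
    ultimately show "R a b" unfolding R_def using g vd ab(3)
      by (intro conjI ballI exI[of _ a] exI[of _ b]) (auto simp: D_def)
  next
    fix a b c assume *: "a < b" "b < c" "R a b" "R b c"
    have "{a..c} = {a..b} \<union> {b..c}" using * by auto
    moreover have "continuous_on ({a..b} \<union> {b..c}) g"
      using * by (intro continuous_on_closed_Un) (auto simp: R_def)
    moreover have "speed2 g integrable_on {a..c}"
      using * by (intro Henstock_Kurzweil_Integration.integrable_combine[of a b c]) (auto simp: R_def)
    moreover have "u \<in> {a..b} - T \<or> u \<in> {b..c} - T" if "u \<in> {a..c} - T" for u using that by auto
    ultimately show "R a c" using *(3,4) unfolding R_def by metis
  qed
  then have "continuous_on {0..s} g" "speed2 g integrable_on {0..s}"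
    and *: "\<And>u. u \<in> {0..s} - T \<Longrightarrow> (g has_vector_derivative vector_derivative g (at u)) (at u) \<and>
       (\<exists>a b. 0 \<le> a \<and> a < b \<and> b \<le> s \<and> vector_derivative g (at u) = (g b - g a) /\<^sub>R (b - a))"
    unfolding R_def by simp_all
  then show ?thesis by (intro that[OF T(1) s]) simp_all
qed

definition energy_on :: "(real \<Rightarrow> complex) \<Rightarrow> real \<Rightarrow> real \<Rightarrow> real" where
  "energy_on g a b = 1/2 * integral {a..b} (speed2 g)"

lemma energy_on_0: "energy_on g 0 s = energy s g"
  by (simp add: energy_on_def energy_def)

lemma energy_on_add:
  assumes "piecewise_linear s g" "0 \<le> a" "a \<le> b" "b \<le> c" "c \<le> s"
  shows "energy_on g a b + energy_on g b c = energy_on g a c"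
proof -
  have "speed2 g integrable_on {0..s}" using piecewise_linear_derivative[OF assms(1)] by metis
  then have "speed2 g integrable_on {a..c}"
    by (rule integrable_on_subinterval) (use assms in auto)
  from Henstock_Kurzweil_Integration.integral_combine[OF assms(3,4) this]
  show ?thesis by (simp add: energy_on_def)
qed

lemma energy_on_nonneg: "0 \<le> energy_on g a b"
  by (cases "speed2 g integrable_on {a..b}")
    (auto simp: energy_on_def not_integrable_integral intro!: Henstock_Kurzweil_Integration.integral_nonneg)

text \<open>Cauchy--Schwarz in time, obtained by integrating the squared deviation of the velocity
  from its mean \<open>w\<close>.\<close>

lemma dist_le_energy_on:
  assumes "piecewise_linear s g" "0 \<le> a" "a \<le> b" "b \<le> s"
  shows "(dist (g a) (g b))\<^sup>2 \<le> 2 * (b - a) * energy_on g a b"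
proof (cases "a = b")
  case False
  then have ab: "a < b" using assms by simp
  obtain T where T: "finite T" "s \<ge> 0" "continuous_on {0..s} g" "speed2 g integrable_on {0..s}"
    "\<And>u. u \<in> {0..s} - T \<Longrightarrow> (g has_vector_derivative vector_derivative g (at u)) (at u)"
    using piecewise_linear_derivative[OF assms(1)] by metis
  define w where "w = (g b - g a) /\<^sub>R (b - a)"
  let ?d = "\<lambda>u. vector_derivative g (at u)"
  have 1: "(?d has_integral (g b - g a)) {a..b}"
  proof (rule fundamental_theorem_of_calculus_interior_strong[OF T(1) assms(3)])
    show "continuous_on {a..b} g" using T(3) by (rule continuous_on_subset) (use assms in auto)
    show "(g has_vector_derivative ?d u) (at u)" if "u \<in> {a<..<b} - T" for u
      using T(5) that assms by auto
  qed
  have 2: "((\<lambda>u. ?d u \<bullet> w) has_integral ((g b - g a) \<bullet> w)) {a..b}"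
    using has_integral_linear[OF 1 bounded_linear_inner_left[of w]] by (simp add: o_def)
  have "speed2 g integrable_on {a..b}"
    using T(4) by (rule integrable_on_subinterval) (use assms in auto)
  then have 3: "(speed2 g has_integral (2 * energy_on g a b)) {a..b}"
    by (simp add: energy_on_def integrable_integral)
  have 4: "((\<lambda>_::real. (cmod w)\<^sup>2) has_integral ((b - a) * (cmod w)\<^sup>2)) {a..b}"
    using has_integral_const_real[of "(cmod w)\<^sup>2" a b] ab by simp
  have 5: "((\<lambda>u. (speed2 g u - 2 * (?d u \<bullet> w)) + (cmod w)\<^sup>2) has_integral
      (2 * energy_on g a b - 2 * ((g b - g a) \<bullet> w)) + (b - a) * (cmod w)\<^sup>2) {a..b}"
    by (intro has_integral_add has_integral_diff has_integral_mult_right 2 3 4)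
  have "0 \<le> (2 * energy_on g a b - 2 * ((g b - g a) \<bullet> w)) + (b - a) * (cmod w)\<^sup>2"
  proof (rule has_integral_nonneg[OF 5])
    fix u
    have "(cmod (?d u - w))\<^sup>2 = (speed2 g u - 2 * (?d u \<bullet> w)) + (cmod w)\<^sup>2"
      unfolding power2_norm_eq_inner by (simp add: inner_diff_left inner_diff_right inner_commute)
    then show "0 \<le> (speed2 g u - 2 * (?d u \<bullet> w)) + (cmod w)\<^sup>2" by (metis zero_le_power2)
  qed
  moreover have "(g b - g a) \<bullet> w = (cmod (g b - g a))\<^sup>2 / (b - a)"
    by (simp add: w_def power2_norm_eq_inner divide_inverse)
  moreover have "cmod w = cmod (g b - g a) / (b - a)"
    using ab by (simp add: w_def divide_inverse mult.commute)
  then have "(b - a) * (cmod w)\<^sup>2 = (cmod (g b - g a))\<^sup>2 / (b - a)"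
    using ab by (simp add: power2_eq_square)
  ultimately have "(cmod (g b - g a))\<^sup>2 / (b - a) \<le> 2 * energy_on g a b" by simp
  then show ?thesis using ab by (simp add: dist_norm norm_minus_commute field_simps)
qed simp

text \<open>Read \<open>x\<close>, \<open>y\<close> as durations and \<open>e\<close>,
  \<open>f\<close> as twice the energies of two consecutive pieces of a path. Equality then says
  that both pieces have the same mean power, which will force constant speed.\<close>

lemma cauchy_schwarz_sqrt:
  fixes x y e f :: real
  assumes "x \<ge> 0" "y \<ge> 0" "e \<ge> 0" "f \<ge> 0"
  shows "sqrt (x * e) + sqrt (y * f) \<le> sqrt ((x + y) * (e + f))"
    and "sqrt (x * e) + sqrt (y * f) = sqrt ((x + y) * (e + f)) \<Longrightarrow> x * f = y * e"
proof -
  define p q where "p = sqrt (x * f)" and "q = sqrt (y * e)"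
  have pq: "p\<^sup>2 = x * f" "q\<^sup>2 = y * e" using assms by (auto simp: p_def q_def)
  have pq': "sqrt (x * e) * sqrt (y * f) = p * q"
    by (simp add: p_def q_def real_sqrt_mult)
  have "(sqrt (x * e) + sqrt (y * f))\<^sup>2 = x * e + y * f + 2 * (sqrt (x * e) * sqrt (y * f))"
    using assms by (simp add: power2_sum)
  also have "\<dots> = (x + y) * (e + f) - (p - q)\<^sup>2"
    unfolding pq' power2_diff pq by (simp add: algebra_simps)
  finally have *: "(sqrt (x * e) + sqrt (y * f))\<^sup>2 = (x + y) * (e + f) - (p - q)\<^sup>2" .
  then show "sqrt (x * e) + sqrt (y * f) \<le> sqrt ((x + y) * (e + f))"
    by (intro real_le_rsqrt) simp
  assume "sqrt (x * e) + sqrt (y * f) = sqrt ((x + y) * (e + f))"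
  then have "(sqrt (x * e) + sqrt (y * f))\<^sup>2 = (x + y) * (e + f)" using assms by simp
  then have "p = q" using * by simp
  then show "x * f = y * e" using pq by metis
qed

text \<open>Bounds the distance between two positions by elapsed time and energy. It is
  superadditive over adjacent intervals, so it controls whole polygons of visited points.\<close>

definition edist :: "(real \<Rightarrow> complex) \<Rightarrow> real \<Rightarrow> real \<Rightarrow> real" where
  "edist g a b = sqrt ((b - a) * (2 * energy_on g a b))"

lemma dist_le_edist:
  assumes "piecewise_linear s g" "0 \<le> a" "a \<le> b" "b \<le> s"
  shows "dist (g a) (g b) \<le> edist g a b"
  using dist_le_energy_on[OF assms] unfolding edist_def by (intro real_le_rsqrt) (simp add: algebra_simps)

lemma edist_superadd:
  assumes "piecewise_linear s g" "0 \<le> a" "a \<le> b" "b \<le> c" "c \<le> s"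
  shows "edist g a b + edist g b c \<le> edist g a c"
proof -
  have "(b - a) + (c - b) = c - a" "2 * energy_on g a b + 2 * energy_on g b c = 2 * energy_on g a c"
    using energy_on_add[OF assms] by auto
  then show ?thesis
    using cauchy_schwarz_sqrt(1)[of "b - a" "c - b" "2 * energy_on g a b" "2 * energy_on g b c"]
      assms energy_on_nonneg by (simp add: edist_def)
qed

text \<open>\<open>D\<close> is kept abstract because it is instantiated both by
  \<open>edist\<close> and by \<open>v * (b - a)\<close>.\<close>

lemma plen_times_le:
  assumes "\<And>a b c. l \<le> a \<Longrightarrow> a \<le> b \<Longrightarrow> b \<le> c \<Longrightarrow> c \<le> s \<Longrightarrow> D a b + D b c \<le> (D a c :: real)"
    and "\<And>a b. l \<le> a \<Longrightarrow> a \<le> b \<Longrightarrow> b \<le> s \<Longrightarrow> dist (g a) (g b) \<le> D a b"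
    and "sorted us" "set us \<subseteq> {a..s}" "l \<le> a" "a \<le> s"
  shows "plen (g a) (map g us @ [g s]) \<le> D a s"
  using assms(3-)
proof (induction us arbitrary: a)
  case (Cons u us)
  have "plen (g u) (map g us @ [g s]) \<le> D u s" using Cons by (intro Cons.IH) auto
  moreover have "dist (g a) (g u) \<le> D a u" using Cons by (intro assms(2)) auto
  moreover have "D a u + D u s \<le> D a s" using Cons by (intro assms(1)) auto
  ultimately show ?case by simp
qed (auto intro: assms(2))

lemma finite_touched:
  assumes "P \<in> LF" "piecewise_linear s g"
  shows "finite {p\<in>P. p \<in> g ` {0..s}}"
proof -
  have "compact (g ` {0..s})"
    using piecewise_linear_derivative[OF assms(2)] compact_continuous_image compact_Icc by metis
  then have "finite (P \<inter> g ` {0..s})" using assms(1) compact_imp_bounded by (auto simp: LF_def)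
  then show ?thesis by (simp add: Int_def)
qed

text \<open>One visiting time is chosen for each touched point; sorting these times orders the
  touched points into a chain.\<close>

lemma path_times:
  assumes "P \<in> LF" "piecewise_linear s g"
  obtains us where "sorted us" "distinct us" "set us \<subseteq> {0..s}" "distinct (map g us)"
    "set (map g us) = {p\<in>P. p \<in> g ` {0..s}}"
proof -
  define F where "F = {p\<in>P. p \<in> g ` {0..s}}"
  define \<tau> where "\<tau> = (\<lambda>p. SOME u. u \<in> {0..s} \<and> g u = p)"
  have \<tau>: "\<tau> p \<in> {0..s} \<and> g (\<tau> p) = p" if "p \<in> F" for p
  proof -
    have "\<exists>u. u \<in> {0..s} \<and> g u = p" using that unfolding F_def by blast
    then show ?thesis unfolding \<tau>_def by (rule someI_ex)
  qed
  have fin: "finite F" using finite_touched[OF assms] by (simp add: F_def)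
  define us where "us = sorted_list_of_set (\<tau> ` F)"
  have set: "set us = \<tau> ` F" using fin by (simp add: us_def)
  have g\<tau>: "g (\<tau> p) = p" if "p \<in> F" for p using \<tau>[OF that] by (rule conjunct2)
  have inj: "inj_on g (set us)" unfolding set by (rule inj_onI) (metis g\<tau> imageE)
  have img: "g ` set us = F" unfolding set image_image using g\<tau> by simp
  show ?thesis
  proof (rule that[of us])
    show "sorted us" "distinct us" by (auto simp: us_def)
    then show "distinct (map g us)" using inj by (simp add: distinct_map)
    show "set us \<subseteq> {0..s}" unfolding set by (rule image_subsetI) (rule conjunct1[OF \<tau>])
    show "set (map g us) = {p\<in>P. p \<in> g ` {0..s}}" using img by (simp only: set_map F_def)
  qed
qed

lemma plen_le_energy:
  assumes "piecewise_linear s g" "sorted us" "set us \<subseteq> {0..s}" "0 \<le> s"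
  shows "plen (g 0) (map g us @ [g s]) \<le> sqrt (2 * s * energy s g)"
  using plen_times_le[where l=0 and a=0 and D="edist g" and g=g and s=s and us=us]
    edist_superadd[OF assms(1)] dist_le_edist[OF assms(1)] assms
  by (simp add: edist_def energy_on_0 mult_ac)

lemma energy_nonneg: "0 \<le> energy s g"
  using energy_on_nonneg[of g 0 s] by (simp add: energy_on_0)

text \<open>A path is at least as expensive as the straight polygon through the points it touches,
  run at constant speed. This is the half of the comparison of the two infima that needs no
  perturbation.\<close>

lemma path_chain_le:
  assumes "P \<in> LF" "admissible P s T g" "s > 0"
    and us: "sorted us" "distinct us" "set us \<subseteq> {0..s}" "distinct (map g us)"
    "set (map g us) = {p\<in>P. p \<in> g ` {0..s}}"
  shows "map g us \<in> chains P" "cval s T (map g us) \<le> path_action P s g"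
proof -
  have g: "piecewise_linear s g" "g 0 = 0" "g s \<in> T" using assms by (auto simp: admissible_def)
  show "map g us \<in> chains P" using us by (auto simp: chains_def)
  have "tlen T 0 (map g us) \<le> plen 0 (map g us @ [g s])" using g by (intro tlen_le_plen)
  also have "\<dots> \<le> sqrt (2 * s * energy s g)"
    using plen_le_energy[OF g(1) us(1,3)] assms g by simp
  finally have "(tlen T 0 (map g us))\<^sup>2 \<le> (sqrt (2 * s * energy s g))\<^sup>2"
    by (intro power_mono tlen_nonneg)
  then have "(tlen T 0 (map g us))\<^sup>2 \<le> 2 * s * energy s g"
    using assms energy_nonneg[of s g] by simp
  then have "(tlen T 0 (map g us))\<^sup>2 / (2 * s) \<le> energy s g" using assms by (simp add: field_simps)
  moreover have "length (map g us) = points_touched P s g"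
    unfolding points_touched_def us(5)[symmetric] using distinct_card[OF us(4)] by simp
  ultimately show "cval s T (map g us) \<le> path_action P s g" by (simp add: cval_def path_action_def)
qed

section \<open>Polygons run through at constant speed\<close>

fun arc :: "real \<Rightarrow> complex \<Rightarrow> complex list \<Rightarrow> real \<Rightarrow> complex" where
  "arc v a [] u = a"
| "arc v a (q # qs) u = (if v * u \<le> dist a q then a + (v * u / dist a q) *\<^sub>R (q - a)
     else arc v q qs (u - dist a q / v))"

lemma arc_0: "v > 0 \<Longrightarrow> arc v a qs 0 = a"
  by (cases qs) auto

lemma arc_shift:
  assumes "v > 0" "a \<noteq> q" "u \<ge> dist a q / v"
  shows "arc v a (q # qs) u = arc v q qs (u - dist a q / v)"
proof (cases "u = dist a q / v")
  case True
  then show ?thesis using assms by (simp add: arc_0)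
next
  case False
  then have "\<not> v * u \<le> dist a q" using assms by (simp add: field_simps)
  then show ?thesis by simp
qed

lemma arc_end: "v > 0 \<Longrightarrow> distinct (a # qs) \<Longrightarrow> arc v a qs (plen a qs / v) = last (a # qs)"
proof (induction qs arbitrary: a)
  case (Cons q qs)
  then show ?case
    by (subst arc_shift) (auto simp: field_simps plen_nonneg)
qed simp

lemma arc_lipschitz:
  assumes "v > 0" "0 \<le> u" "u \<le> u'"
  shows "dist (arc v a qs u) (arc v a qs u') \<le> v * (u' - u)"
  using assms(2,3)
proof (induction qs arbitrary: a u u')
  case (Cons q qs)
  define d where "d = dist a q"
  consider "v * u' \<le> d" | "v * u \<le> d" "v * u' > d" | "v * u > d"
    by linarith
  then show ?case
  proof cases
    case 1
    then have "v * u \<le> d" using Cons assms by (smt (verit) mult_left_mono)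
    then have "arc v a (q # qs) u = a + (v * u / d) *\<^sub>R (q - a)"
      "arc v a (q # qs) u' = a + (v * u' / d) *\<^sub>R (q - a)"
      using 1 by (simp_all add: d_def)
    then have "dist (arc v a (q # qs) u) (arc v a (q # qs) u') =
        norm ((v * u / d - v * u' / d) *\<^sub>R (q - a))"
      by (simp add: dist_norm scaleR_diff_left del: arc.simps)
    also have "\<dots> = \<bar>v * u / d - v * u' / d\<bar> * d" by (simp add: d_def dist_norm norm_minus_commute)
    also have "\<dots> \<le> v * (u' - u)"
    proof (cases "d = 0")
      case False
      then have "d > 0" by (simp add: d_def)
      have "v * u / d \<le> v * u' / d" using \<open>d > 0\<close> Cons assms by (simp add: divide_right_mono)
      then have "\<bar>v * u / d - v * u' / d\<bar> * d = v * (u' - u)" using \<open>d > 0\<close>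
        by (simp add: field_simps)
      then show ?thesis by simp
    qed (use Cons assms in simp)
    finally show ?thesis .
  next
    \<comment> \<open>The two times lie on different sides of the first vertex, so both distances
      are measured to \<open>q\<close>.\<close>
    case 2
    have 3: "dist (arc v a (q # qs) u) q \<le> d - v * u"
    proof (cases "d = 0")
      case True
      then show ?thesis using 2 by (simp add: d_def)
    next
      case False
      then have "d > 0" by (simp add: d_def)
      have "q - arc v a (q # qs) u = (1 - v * u / d) *\<^sub>R (q - a)"
        using 2 by (simp add: d_def[symmetric] algebra_simps)
      then have "norm (q - arc v a (q # qs) u) = \<bar>1 - v * u / d\<bar> * d"
        by (simp only: norm_scaleR) (simp add: d_def dist_norm norm_minus_commute)
      also have "\<dots> = d - v * u" using 2 \<open>d > 0\<close> by (simp add: field_simps)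
      finally show ?thesis by (simp add: dist_norm norm_minus_commute)
    qed
    have "dist (arc v q qs 0) (arc v q qs (u' - d / v)) \<le> v * ((u' - d / v) - 0)"
      using 2 assms by (intro Cons.IH) (auto simp: field_simps)
    moreover have "v * ((u' - d / v) - 0) = v * u' - d" using assms by (simp add: right_diff_distrib)
    ultimately have "dist q (arc v a (q # qs) u') \<le> v * u' - d"
      using 2 assms by (simp add: arc_0 d_def[symmetric])
    then show ?thesis using 3 dist_triangle[of "arc v a (q # qs) u" "arc v a (q # qs) u'" q]
      by (simp add: algebra_simps)
  next
    case 3
    then have "v * u' > d" using Cons assms by (smt (verit) mult_left_mono)
    moreover have "dist (arc v q qs (u - d / v)) (arc v q qs (u' - d / v)) \<le> v * ((u' - d / v) - (u - d / v))"
      using 3 Cons assms by (intro Cons.IH) (auto simp: field_simps)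
    ultimately show ?thesis using 3 by (simp add: d_def[symmetric])
  qed
qed (use assms in simp)

lemma arc_vertex:
  assumes "v > 0" "distinct (a # qs)" "p \<in> set (a # qs)"
  shows "\<exists>u\<in>{0..plen a qs / v}. arc v a qs u = p"
  using assms(2,3)
proof (induction qs arbitrary: a)
  case (Cons q qs)
  show ?case
  proof (cases "p = a")
    case True
    then show ?thesis using assms plen_nonneg[of a "q # qs"]
      by (intro bexI[of _ 0]) (auto simp: arc_0 simp del: arc.simps)
  next
    case False
    then obtain u where u: "u \<in> {0..plen q qs / v}" "arc v q qs u = p"
      using Cons.IH[of q] Cons.prems by auto
    have "arc v a (q # qs) (u + dist a q / v) = p"
      using u Cons assms by (subst arc_shift) auto
    moreover have "u + dist a q / v \<in> {0..plen a (q # qs) / v}"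
      using u assms by (auto simp: field_simps)
    ultimately show ?thesis by blast
  qed
qed (use assms in \<open>auto simp: arc_0\<close>)

lemma arc_piecewise_linear:
  assumes "v > 0" "distinct (a # qs)"
  shows "piecewise_linear (plen a qs / v) (arc v a qs)"
  using assms(2)
proof (induction qs arbitrary: a)
  case Nil
  show ?case unfolding piecewise_linear_def by (intro exI[of _ "{0}"]) auto
next
  case (Cons q qs)
  define d where "d = dist a q / v"
  have d: "d > 0" using Cons assms by (simp add: d_def)
  have dist: "dist a q = v * d" using assms by (simp add: d_def)
  define s where "s = plen q qs / v"
  have s: "plen a (q # qs) / v = d + s" using assms by (simp add: d_def s_def field_simps)
  define g where "g = arc v q qs"
  have g: "arc v a (q # qs) u = g (u - d)" if "u \<ge> d" for u
    using that Cons assms unfolding g_def d_def by (intro arc_shift) auto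
  have pl: "piecewise_linear s g" using Cons by (simp add: s_def g_def)
  obtain T where T: "finite T" "{0, s} \<subseteq> T" "T \<subseteq> {0..s}"
    "\<And>a b u. a \<in> T \<Longrightarrow> b \<in> T \<Longrightarrow> a < b \<Longrightarrow> {a<..<b} \<inter> T = {} \<Longrightarrow> u \<in> {a..b} \<Longrightarrow>
       g u = g a + ((u - a) / (b - a)) *\<^sub>R (g b - g a)"
    by (rule piecewise_linearE[OF pl]) (rule that)
  define T' where "T' = insert 0 ((+) d ` T)"
  have lin: "arc v a (q # qs) u = arc v a (q # qs) x +
      ((u - x) / (y - x)) *\<^sub>R (arc v a (q # qs) y - arc v a (q # qs) x)"
    if xy: "x \<in> T'" "y \<in> T'" "x < y" "{x<..<y} \<inter> T' = {}" "u \<in> {x..y}" for x y u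
  proof (cases "x = 0")
    case True
    have "d \<in> T'" using T by (auto simp: T'_def)
    moreover have "y \<ge> d" using xy True T by (auto simp: T'_def)
    ultimately have y: "y = d" using xy True d by (metis IntI emptyE greaterThanLessThan_iff less_le)
    have "arc v a (q # qs) u = a + (u / d) *\<^sub>R (q - a)"
      using xy True y assms by (simp add: dist)
    moreover have "arc v a (q # qs) d = q" using g[of d] assms by (simp add: g_def arc_0)
    ultimately show ?thesis using True y assms by (simp add: arc_0 del: arc.simps)
  next
    case False
    then obtain x0 where x0: "x = d + x0" "x0 \<in> T" using xy by (auto simp: T'_def)
    then have "0 \<le> x0" using T by auto
    then obtain y0 where y0: "y = d + y0" "y0 \<in> T" using xy x0 d by (auto simp: T'_def)
    have cons: "{x0<..<y0} \<inter> T = {}"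
    proof -
      { fix z assume "z \<in> {x0<..<y0} \<inter> T"
        then have "d + z \<in> {x<..<y} \<inter> T'" by (auto simp: x0 y0 T'_def)
        with xy have False by blast }
      then show ?thesis by blast
    qed
    have "g (u - d) = g x0 + ((u - d - x0) / (y0 - x0)) *\<^sub>R (g y0 - g x0)"
      using xy x0 y0 cons by (intro T(4)) auto
    moreover have "arc v a (q # qs) u = g (u - d)" "arc v a (q # qs) x = g x0" "arc v a (q # qs) y = g y0"
      using g[of u] g[of x] g[of y] xy x0 y0 \<open>0 \<le> x0\<close> by (auto simp del: arc.simps)
    moreover have "u - d - x0 = u - x" "y0 - x0 = y - x" by (auto simp: x0 y0)
    ultimately show ?thesis by metis
  qed
  have "0 \<le> s" using assms by (simp add: s_def plen_nonneg)
  then have "finite T'" "{0, d + s} \<subseteq> T'" "T' \<subseteq> {0..d + s}" using T d by (auto simp: T'_def)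
  then show ?case unfolding piecewise_linear_def s
    by (intro exI[of _ T'] conjI ballI impI lin) auto
qed

lemma energy_lipschitz:
  assumes "piecewise_linear s g" "v \<ge> 0"
    "\<And>u u'. 0 \<le> u \<Longrightarrow> u \<le> u' \<Longrightarrow> u' \<le> s \<Longrightarrow> dist (g u) (g u') \<le> v * (u' - u)"
  shows "energy s g \<le> v\<^sup>2 * s / 2"
proof -
  obtain T where T: "finite T" "s \<ge> 0" "speed2 g integrable_on {0..s}"
    "\<And>u. u \<in> {0..s} - T \<Longrightarrow> \<exists>a b. 0 \<le> a \<and> a < b \<and> b \<le> s \<and> vector_derivative g (at u) = (g b - g a) /\<^sub>R (b - a)"
    using piecewise_linear_derivative[OF assms(1)] by metis
  have "speed2 g u \<le> v\<^sup>2" if u: "u \<in> {0..s} - T" for u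
  proof -
    obtain a b where ab: "0 \<le> a" "a < b" "b \<le> s" "vector_derivative g (at u) = (g b - g a) /\<^sub>R (b - a)"
      using T(4)[OF u] by blast
    have "dist (g a) (g b) \<le> v * (b - a)" using ab by (intro assms) auto
    moreover have "cmod (vector_derivative g (at u)) = dist (g a) (g b) / (b - a)"
      using ab(2) unfolding ab(4) by (simp add: dist_norm norm_minus_commute divide_inverse mult.commute)
    ultimately have "cmod (vector_derivative g (at u)) \<le> v"
      using ab by (simp add: divide_le_eq)
    then show ?thesis by (intro power_mono) auto
  qed
  then have "integral ({0..s} - T) (speed2 g) \<le> integral ({0..s} - T) (\<lambda>_. v\<^sup>2)"
  proof (intro Henstock_Kurzweil_Integration.integral_le)
    have neg: "negligible {x \<in> {0..s} - ({0..s} - T). f x \<noteq> 0}" "negligible {x \<in> {0..s} - T - {0..s}. f x \<noteq> 0}"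
      for f :: "real \<Rightarrow> real"
      by (auto intro!: negligible_subset[OF negligible_finite[OF T(1)]])
    show "speed2 g integrable_on {0..s} - T" using T(3) by (rule integrable_spike_set[OF _ neg])
    show "(\<lambda>_. v\<^sup>2) integrable_on {0..s} - T"
      by (rule integrable_spike_set[OF _ neg]) (rule integrable_const_ivl)
  qed
  moreover have "integral ({0..s} - T) f = integral {0..s} f" for f :: "real \<Rightarrow> real"
    by (intro integral_subset_negligible negligible_subset[OF negligible_finite[OF T(1)]]) auto
  ultimately show ?thesis using T(2) by (simp add: energy_def mult_ac)
qed

text \<open>The legs may meet \<open>p\<close> only at their endpoints. For a polygon with distinct
  vertices, run through at constant speed, this makes a visit of \<open>p\<close> unique.\<close>

fun segok :: "complex \<Rightarrow> complex \<Rightarrow> complex list \<Rightarrow> bool" where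
  "segok p a [] = True"
| "segok p a (q # qs) = ((p \<in> closed_segment a q \<longrightarrow> p = a \<or> p = q) \<and> segok p q qs)"

lemma arc_first_segment:
  assumes "v > 0" "0 \<le> u" "v * u \<le> dist a q"
  shows "arc v a (q # qs) u \<in> closed_segment a q"
proof -
  have "0 \<le> v * u / dist a q" "v * u / dist a q \<le> 1" using assms by (auto simp: divide_le_eq_1)
  then show ?thesis using assms
    by (auto simp: in_segment algebra_simps intro!: exI[of _ "v * u / dist a q"])
qed

lemma arc_mem_vertices:
  assumes "v > 0" "0 \<le> u" "segok (arc v a qs u) a qs"
  shows "arc v a qs u \<in> set (a # qs)"
  using assms(2,3)
proof (induction qs arbitrary: a u)
  case (Cons q qs)
  show ?case
  proof (cases "v * u \<le> dist a q")
    case True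
    then have "arc v a (q # qs) u = a \<or> arc v a (q # qs) u = q"
      using arc_first_segment[OF assms(1) Cons(2) True, of qs] Cons(3) by (simp del: arc.simps)
    then show ?thesis by (metis list.set_intros)
  next
    case False
    then have "0 \<le> u - dist a q / v" using assms by (simp add: field_simps)
    then show ?thesis using Cons.IH[of "u - dist a q / v" q] Cons(3) False by auto
  qed
qed simp

lemma arc_inj:
  assumes "v > 0" "distinct (a # qs)" "segok p a qs" "u \<in> {0..plen a qs / v}" "u' \<in> {0..plen a qs / v}"
    "arc v a qs u = p" "arc v a qs u' = p"
  shows "u = u'"
  using assms(2-)
proof (induction qs arbitrary: a u u')
  case (Cons q qs)
  define d where "d = dist a q / v"
  have d: "d > 0" "v * d = dist a q" using Cons assms by (auto simp: d_def)
  have tail: "u \<ge> d \<and> u - d \<in> {0..plen q qs / v} \<and> arc v q qs (u - d) = p"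
    if u: "u \<in> {0..plen a (q # qs) / v}" "arc v a (q # qs) u = p" "u \<noteq> 0" for u
  proof -
    have "u \<ge> d"
    proof (rule ccontr)
      assume "\<not> u \<ge> d"
      then have less: "v * u < dist a q" using assms(1) d by (metis mult_less_cancel_left_pos not_le)
      then have "p \<in> closed_segment a q"
        using arc_first_segment[of v u a q qs] u assms by auto
      then consider "p = a" | "p = q" using Cons.prems by auto
      then show False
      proof cases
        case 1
        then have "(v * u / dist a q) *\<^sub>R (q - a) = 0" using u less by simp
        then show False using assms u d Cons.prems by auto
      next
        case 2
        have "dist a p = norm ((v * u / dist a q) *\<^sub>R (q - a))" using u less by (auto simp: dist_norm)
        also have "\<dots> = v * u" using u assms Cons.prems by (simp add: dist_norm norm_minus_commute)
        finally show False using less 2 by simp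
      qed
    qed
    moreover have "plen a (q # qs) / v = d + plen q qs / v" by (simp add: d_def add_divide_distrib)
    moreover have "arc v q qs (u - d) = p"
      using u \<open>u \<ge> d\<close> Cons.prems assms(1) unfolding d_def by (subst arc_shift[symmetric]) auto
    ultimately show ?thesis using u by auto
  qed
  have no: "u = 0" if "p = a" "u \<in> {0..plen a (q # qs) / v}" "arc v a (q # qs) u = p" for u
  proof (rule ccontr)
    assume "u \<noteq> 0"
    then have "0 \<le> u - d" "arc v q qs (u - d) = p" using tail[OF that(2,3)] by auto
    moreover have "segok p q qs" using Cons.prems by simp
    ultimately have "p \<in> set (q # qs)" using arc_mem_vertices[of v "u - d" q qs] assms(1) by auto
    then show False using that Cons.prems by auto
  qed
  show ?case
  proof (cases "p = a")
    case True
    then show ?thesis using no Cons.prems by metis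
  next
    case False
    then have "u \<noteq> 0" "u' \<noteq> 0" using Cons.prems assms(1) arc_0[of v a "q # qs"] by auto
    then have "u - d = u' - d"
      using tail[of u] tail[of u'] Cons.prems by (intro Cons.IH[of q]) auto
    then show ?thesis by simp
  qed
qed simp

lemma arc_admissible:
  assumes "s > 0" "distinct (0 # ms)" "ms \<noteq> []" "last ms \<in> T" "\<And>p. p \<in> P \<Longrightarrow> segok p 0 ms"
  defines "g \<equiv> arc (plen 0 ms / s) 0 ms"
  shows "admissible P s T g" "energy s g \<le> (plen 0 ms)\<^sup>2 / (2 * s)" "set (0 # ms) \<subseteq> g ` {0..s}"
proof -
  define v where "v = plen 0 ms / s"
  have L: "plen 0 ms > 0"
    using assms(2,3) plen_nonneg by (cases ms) (auto simp: add_pos_nonneg)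
  then have v: "v > 0" "plen 0 ms / v = s" using assms(1) by (auto simp: v_def)
  have g: "g = arc v 0 ms" by (simp add: g_def v_def)
  have pl: "piecewise_linear s g"
    using arc_piecewise_linear[OF v(1) assms(2)] by (simp add: v g)
  have "connected {u \<in> {0..s}. g u = p}" if "p \<in> P" for p
  proof -
    have "u = u'" if "u \<in> {u \<in> {0..s}. g u = p}" "u' \<in> {u \<in> {0..s}. g u = p}" for u u'
      using arc_inj[OF v(1) assms(2) assms(5)[OF \<open>p \<in> P\<close>], of u u'] that by (simp add: v g)
    then have "{u \<in> {0..s}. g u = p} = {} \<or> (\<exists>u. {u \<in> {0..s}. g u = p} = {u})" by blast
    then show ?thesis using connected_sing connected_empty by metis
  qed
  moreover have "g 0 = 0" using v by (simp add: g arc_0)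
  moreover have "g s = last ms"
    using arc_end[OF v(1) assms(2)] assms(3) by (simp add: v g)
  ultimately show "admissible P s T g" using pl assms(4) by (simp add: admissible_def)
  have "energy s g \<le> v\<^sup>2 * s / 2"
    using v arc_lipschitz[OF v(1)] by (intro energy_lipschitz[OF pl]) (auto simp: g)
  also have "\<dots> = (plen 0 ms)\<^sup>2 / (2 * s)" using assms(1) by (simp add: v_def power2_eq_square)
  finally show "energy s g \<le> (plen 0 ms)\<^sup>2 / (2 * s)" .
  show "set (0 # ms) \<subseteq> g ` {0..s}"
  proof
    fix p assume "p \<in> set (0 # ms)"
    then obtain u where "u \<in> {0..s}" "g u = p"
      using arc_vertex[OF v(1) assms(2)] by (metis g v(2))
    then show "p \<in> g ` {0..s}" by blast
  qed
qed

lemma points_touched_ge: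
  assumes "P \<in> LF" "piecewise_linear s g" "ps \<in> chains P" "set ps \<subseteq> g ` {0..s}"
  shows "length ps \<le> points_touched P s g"
proof -
  have "length ps = card (set ps)" using assms by (simp add: chains_def distinct_card)
  also have "\<dots> \<le> card {p\<in>P. p \<in> g ` {0..s}}"
    using assms finite_touched[OF assms(1,2)] by (intro card_mono) (auto simp: chains_def)
  finally show ?thesis by (simp add: points_touched_def)
qed

text \<open>A point farther away than the length of the polygon cannot lie on it, so only finitely
  many points of a locally finite set have to be avoided.\<close>

lemma segok_far: "dist a p > plen a ms \<Longrightarrow> segok p a ms"
proof (induction ms arbitrary: a)
  case (Cons q ms)
  have "p \<notin> closed_segment a q"
  proof
    assume "p \<in> closed_segment a q"
    then have "dist a p \<le> dist a q" by (metis between_mem_segment between zero_le_dist le_add_same_cancel1)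
    then show False using Cons.prems plen_nonneg[of q ms] by simp
  qed
  moreover have "dist q p > plen q ms" using Cons.prems dist_triangle[of a p q] by simp
  ultimately show ?case using Cons.IH by simp
qed simp

text \<open>The set is the shadow that \<open>p\<close> casts when seen from \<open>a\<close>; it
  lies on the line through both.\<close>

lemma negligible_behind: "p \<noteq> a \<Longrightarrow> negligible {m::complex. p \<in> closed_segment a m}"
proof -
  assume p: "p \<noteq> a"
  define n where "n = \<i> * (p - a)"
  have n: "n \<noteq> 0" "n \<bullet> (p - a) = 0" using p by (auto simp: n_def inner_complex_def algebra_simps)
  have "{m. p \<in> closed_segment a m} \<subseteq> {m. n \<bullet> m = n \<bullet> a}"
  proof clarsimp
    fix m assume "p \<in> closed_segment a m"
    then obtain l where "p = (1 - l) *\<^sub>R a + l *\<^sub>R m" by (auto simp: in_segment)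
    then have l: "p - a = l *\<^sub>R (m - a)" by (simp add: algebra_simps)
    then have "l \<noteq> 0" using p by auto
    moreover have "l * (n \<bullet> (m - a)) = 0" using n(2) unfolding l by simp
    ultimately show "n \<bullet> m = n \<bullet> a" by (simp add: inner_diff_right)
  qed
  moreover have "negligible {m. n \<bullet> m = n \<bullet> a}" using n by (intro negligible_hyperplane) simp
  ultimately show ?thesis by (rule negligible_subset[rotated])
qed

text \<open>A detour through a generic point near the midpoint of each segment keeps the path away from
  all points of \<open>F\<close> that are not vertices.\<close>

lemma perturb_polygon:
  assumes "finite F"
  shows "finite V \<Longrightarrow> distinct (a # qs) \<Longrightarrow> d > 0 \<Longrightarrow>
    \<exists>ms. distinct (a # ms) \<and> set qs \<subseteq> set ms \<and> set ms \<inter> V \<subseteq> set qs \<and> last (a # ms) = last (a # qs) \<and>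
      plen a ms \<le> plen a qs + d \<and> (\<forall>p\<in>F. segok p a ms)"
proof (induction qs arbitrary: a V d)
  case Nil
  then show ?case by (intro exI[of _ "[]"]) auto
next
  case (Cons q qs)
  \<comment> \<open>Adding \<open>a\<close> to the forbidden vertices keeps the detours of the tail
    off \<open>a\<close>. Half of the budget \<open>d\<close> is reserved for the detour on the
    first leg.\<close>
  obtain ms where ms: "distinct (q # ms)" "set qs \<subseteq> set ms" "set ms \<inter> insert a V \<subseteq> set qs"
    "last (q # ms) = last (q # qs)" "plen q ms \<le> plen q qs + d / 2" "\<forall>p\<in>F. segok p q ms"
    using Cons.IH[of "insert a V" q "d / 2"] Cons.prems by auto
  \<comment> \<open>All that the new vertex must avoid: other vertices, the points of
    \<open>F\<close>, and their shadows seen from \<open>a\<close> and from \<open>q\<close>. A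
    vertex within \<open>d / 4\<close> of the midpoint lengthens the leg by at most
    \<open>d / 2\<close>.\<close>
  define B where "B = V \<union> set ms \<union> {a, q} \<union> F \<union> (\<Union>p\<in>F - {a}. {m. p \<in> closed_segment a m})
    \<union> (\<Union>p\<in>F - {q}. {m. p \<in> closed_segment q m})"
  have "negligible (\<Union>p\<in>F - {x}. {m. p \<in> closed_segment x m})" for x
    using assms negligible_behind by (intro negligible_Union) auto
  then have "negligible B" unfolding B_def using assms Cons.prems
    by (intro negligible_Un) (auto intro: negligible_finite)
  then have "\<not> ball (midpoint a q) (d / 4) \<subseteq> B"
    using negligible_subset open_not_negligible[of "ball (midpoint a q) (d / 4)"] Cons.prems by auto
  then obtain m where "m \<in> ball (midpoint a q) (d / 4)" and mB: "m \<notin> B" by blast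
  then have m: "dist (midpoint a q) m < d / 4" "m \<notin> B" by simp_all
  have "dist a m + dist m q \<le> dist a q + d / 2"
    using m(1) dist_triangle[of a m "midpoint a q"] dist_triangle[of m q "midpoint a q"]
    by (simp add: dist_midpoint dist_commute)
  then have "plen a (m # q # ms) \<le> plen a (q # qs) + d" using ms by simp
  moreover have "a \<notin> set ms" using ms Cons.prems by auto
  then have "distinct (a # m # q # ms)" using ms m(2) Cons.prems by (auto simp: B_def)
  moreover have "segok p a (m # q # ms)" if "p \<in> F" for p
    using ms that m(2) by (auto simp: B_def closed_segment_commute[of m q])
  moreover have "set (m # q # ms) \<inter> V \<subseteq> set (q # qs)" using ms m(2) by (auto simp: B_def)
  ultimately show ?case using ms by (intro exI[of _ "m # q # ms"]) auto
qed

lemma tlen_pos: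
  assumes "closed T" "T \<noteq> {}" "0 \<notin> T"
  shows "tlen T 0 ps > 0"
proof -
  have "0 < infdist 0 T" using assms infdist_pos_not_in_closed by blast
  also have "infdist 0 T \<le> tlen T 0 ps" using tlen_filter[of T 0 "\<lambda>_. False" ps] by simp
  finally show ?thesis .
qed

text \<open>The polygon through \<open>ps\<close> may fail to be admissible: a leg can run through
  further points of \<open>P\<close>, and its endpoint can be a point of \<open>P\<close> or a
  vertex. Moving the endpoint and bending the legs cost at most \<open>d\<close> each; the condition
  on balls supplies endpoints off the finitely many nearby points.\<close>

lemma chain_approx_path:
  assumes "P \<in> LF" "closed T" "T \<noteq> {}" "0 \<notin> T" "\<And>z e. z \<in> T \<Longrightarrow> e > 0 \<Longrightarrow> infinite (T \<inter> ball z e)"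
    and "s > 0" "ps \<in> chains P" "e > 0"
  shows "\<exists>g. admissible P s T g \<and> path_action P s g \<le> cval s T ps + e"
proof -
  define L where "L = tlen T 0 ps"
  have L: "L \<ge> 0" by (simp add: L_def tlen_nonneg)
  \<comment> \<open>A path starts at the origin and touches a point there for free; dropping it
    keeps the vertices distinct.\<close>
  define ps0 where "ps0 = filter (\<lambda>p. p \<noteq> 0) ps"
  obtain z where z: "z \<in> T" "tlen T 0 ps0 = plen 0 (ps0 @ [z])" using tlen_eq_plen[OF assms(2,3)] by metis
  \<comment> \<open>Chosen so that lengthening by \<open>2 * d\<close> raises the squared length by
    at most \<open>2 * s * e\<close>.\<close>
  define d where "d = min 1 (s * e / (2 * (L + 1)))"
  have d: "d > 0" "d \<le> 1" "d \<le> s * e / (2 * (L + 1))" using assms L by (auto simp: d_def)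
  have "finite (P \<inter> ball z d)" using assms(1) by (auto simp: LF_def)
  then have "infinite (T \<inter> ball z d - (P \<inter> ball z d \<union> {0} \<union> set ps0))"
    using assms(5)[OF z(1) d(1)] by (intro Diff_infinite_finite) auto
  then have "T \<inter> ball z d - (P \<inter> ball z d \<union> {0} \<union> set ps0) \<noteq> {}" by (rule infinite_imp_nonempty)
  then obtain z' where "z' \<in> T \<inter> ball z d - (P \<inter> ball z d \<union> {0} \<union> set ps0)" by blast
  then have z': "z' \<in> T" "dist z z' < d" "z' \<notin> P" "z' \<noteq> 0" "z' \<notin> set ps0" by auto
  have 0: "distinct (0 # ps0 @ [z'])" using z' assms(7) by (auto simp: ps0_def chains_def)
  have "plen 0 (ps0 @ [z']) \<le> plen 0 (ps0 @ [z]) + d"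
    using z'(2) dist_triangle[of "last (0 # ps0)" z' z] by (simp add: plen_append)
  moreover have "tlen T 0 ps0 \<le> L" unfolding L_def ps0_def by (rule tlen_filter)
  ultimately have len: "plen 0 (ps0 @ [z']) \<le> L + d" using z(2) by simp
  define F where "F = P \<inter> cball 0 (L + 2 * d)"
  have "finite F" using assms(1) by (auto simp: F_def LF_def)
  from perturb_polygon[OF this, of "{}" 0 "ps0 @ [z']" d] 0 d obtain ms where ms:
    "distinct (0 # ms)" "set (ps0 @ [z']) \<subseteq> set ms" "last (0 # ms) = last (0 # ps0 @ [z'])"
    "plen 0 ms \<le> plen 0 (ps0 @ [z']) + d" "\<forall>p\<in>F. segok p 0 ms" by auto
  have len2: "plen 0 ms \<le> L + 2 * d" using ms len by simp
  have ne: "ms \<noteq> []" using ms(2) by auto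
  have seg: "segok p 0 ms" if "p \<in> P" for p
  proof (cases "p \<in> F")
    case False
    then have "dist 0 p > plen 0 ms" using that len2 by (simp add: F_def)
    then show ?thesis by (rule segok_far)
  qed (use ms in blast)
  have last: "last ms \<in> T" using ms(3) ne z' by simp
  define g where "g = arc (plen 0 ms / s) 0 ms"
  have *: "admissible P s T g" "energy s g \<le> (plen 0 ms)\<^sup>2 / (2 * s)" "set (0 # ms) \<subseteq> g ` {0..s}"
    unfolding g_def by (rule arc_admissible[where P=P, OF assms(6) ms(1) ne last], erule seg)+
  have "set ps \<subseteq> set (0 # ms)" using ms(2) by (auto simp: ps0_def)
  then have "set ps \<subseteq> g ` {0..s}" using *(3) by (rule order_trans)
  then have "real (length ps) \<le> points_touched P s g"
    using points_touched_ge[OF assms(1) _ assms(7), of s g] *(1) by (simp add: admissible_def)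
  moreover have "(plen 0 ms)\<^sup>2 \<le> (L + 2 * d)\<^sup>2" using len2 by (intro power_mono plen_nonneg)
  moreover have "(L + 2 * d)\<^sup>2 \<le> L\<^sup>2 + 2 * s * e"
  proof -
    have "d * d \<le> d" using d by (simp add: mult_left_le)
    then have "(L + 2 * d)\<^sup>2 \<le> L\<^sup>2 + d * (4 * (L + 1))" by (simp add: power2_eq_square algebra_simps)
    moreover have "d * (4 * (L + 1)) \<le> (s * e / (2 * (L + 1))) * (4 * (L + 1))"
      using d L by (intro mult_right_mono) auto
    moreover have "(s * e / (2 * (L + 1))) * (4 * (L + 1)) = 2 * s * e"
      using L by (simp add: field_simps)
    ultimately show ?thesis by simp
  qed
  ultimately have "(plen 0 ms)\<^sup>2 / (2 * s) \<le> (L\<^sup>2 + 2 * s * e) / (2 * s)"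
    and touched: "real (length ps) \<le> points_touched P s g"
    using assms(6) by (auto intro!: divide_right_mono)
  then have "path_action P s g \<le> (L\<^sup>2 + 2 * s * e) / (2 * s) - real (length ps)"
    using *(2) by (simp add: path_action_def)
  also have "\<dots> = cval s T ps + e" using assms(6) by (simp add: cval_def L_def add_divide_distrib)
  finally show ?thesis using *(1) by blast
qed

text \<open>Stated without boundedness: for sets unbounded below, both infima are the same junk value.\<close>

lemma Inf_eq_if_interleaved:
  fixes A B :: "real set"
  assumes "\<And>a. a \<in> A \<Longrightarrow> \<exists>b\<in>B. b \<le> a" "\<And>b e. b \<in> B \<Longrightarrow> e > 0 \<Longrightarrow> \<exists>a\<in>A. a \<le> b + e"
  shows "Inf A = Inf B"
proof -
  have "(\<forall>x\<in>uminus ` A. x \<le> z) \<longleftrightarrow> (\<forall>x\<in>uminus ` B. x \<le> z)" for z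
  proof
    assume l: "\<forall>x\<in>uminus ` A. x \<le> z"
    have "- b \<le> z" if b: "b \<in> B" for b
    proof (rule field_le_epsilon)
      fix e :: real assume "e > 0"
      then obtain a where "a \<in> A" "a \<le> b + e" using assms(2) b by blast
      then show "- b \<le> z + e" using l by force
    qed
    then show "\<forall>x\<in>uminus ` B. x \<le> z" by auto
  next
    assume l: "\<forall>x\<in>uminus ` B. x \<le> z"
    have "- a \<le> z" if a: "a \<in> A" for a
    proof -
      obtain b where "b \<in> B" "b \<le> a" using assms(1) a by blast
      then show ?thesis using l by force
    qed
    then show "\<forall>x\<in>uminus ` A. x \<le> z" by auto
  qed
  then show ?thesis by (simp add: Inf_real_def Sup_real_def)
qed

lemma Action_eq_cact:
  assumes "P \<in> LF" "closed T" "T \<noteq> {}" "0 \<notin> T" "\<And>z e. z \<in> T \<Longrightarrow> e > 0 \<Longrightarrow> infinite (T \<inter> ball z e)"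
    and "s > 0"
  shows "Action P s T = cact P s T"
  unfolding Action_def cact_def
proof (rule Inf_eq_if_interleaved)
  fix a assume "a \<in> path_action P s ` {g. admissible P s T g}"
  then obtain g where g: "admissible P s T g" "a = path_action P s g" by blast
  then have pl: "piecewise_linear s g" by (simp add: admissible_def)
  obtain us where "sorted us" "distinct us" "set us \<subseteq> {0..s}" "distinct (map g us)"
    "set (map g us) = {p\<in>P. p \<in> g ` {0..s}}" by (rule path_times[OF assms(1) pl]) (rule that)
  from path_chain_le[OF assms(1) g(1) assms(6) this]
  show "\<exists>b\<in>cval s T ` chains P. b \<le> a" unfolding g(2) by (intro bexI[of _ "cval s T (map g us)"] imageI)
next
  fix b e :: real assume "b \<in> cval s T ` chains P" "e > 0"
  then show "\<exists>a\<in>path_action P s ` {g. admissible P s T g}. a \<le> b + e"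
    using chain_approx_path[OF assms, of _ e] by blast
qed

section \<open>Minimizing paths are polygons through optimal chains\<close>

text \<open>The two bounds leave no slack in the triangle inequality, so \<open>x\<close> lies on
  the segment at the prescribed ratio.\<close>

lemma split_segment_unique:
  fixes a x b :: complex
  assumes "dist a x \<le> \<alpha>" "dist x b \<le> \<beta>" "dist a b = \<alpha> + \<beta>"
  shows "x = a + (\<alpha> / dist a b) *\<^sub>R (b - a)"
proof (cases "dist a b = 0")
  case True
  have "0 \<le> dist a x" "0 \<le> dist x b" by auto
  then have "\<alpha> = 0" using assms True by linarith
  then show ?thesis using assms(1) True by simp
next
  case False
  have eq: "dist a x = \<alpha>" "dist x b = \<beta>" using assms dist_triangle[of a b x] by auto
  then have "dist a b = dist a x + dist x b" using assms by simp
  then have "norm (a - x) *\<^sub>R (x - b) = norm (x - b) *\<^sub>R (a - x)" by (simp add: dist_triangle_eq)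
  then have "\<alpha> *\<^sub>R (x - b) = \<beta> *\<^sub>R (a - x)" using eq by (simp add: dist_norm)
  then have "(\<alpha> + \<beta>) *\<^sub>R (x - a) = \<alpha> *\<^sub>R (b - a)" by (simp add: algebra_simps)
  then have "dist a b *\<^sub>R (x - a) = \<alpha> *\<^sub>R (b - a)" using assms by simp
  then have "x - a = (\<alpha> / dist a b) *\<^sub>R (b - a)" using False
    by (metis divide_inverse_commute scaleR_scaleR scaleR_one left_inverse)
  then show ?thesis by (simp add: algebra_simps)
qed

text \<open>A path of speed at most \<open>v\<close> that needs all its time for the polygon has no
  slack on any leg, so each leg is straight and run at full speed.\<close>

lemma tight_path_is_arc:
  assumes "v > 0" and lip: "\<And>a b. l \<le> a \<Longrightarrow> a \<le> b \<Longrightarrow> b \<le> s \<Longrightarrow> dist (g a) (g b) \<le> v * (b - a)"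
    and "sorted us" "set us \<subseteq> {a..s}" "l \<le> a" "a \<le> s" "v * (s - a) \<le> plen (g a) (map g us @ [g s])"
    and "u \<in> {a..s}"
  shows "g u = arc v (g a) (map g us @ [g s]) (u - a)"
  using assms(3-)
proof (induction us arbitrary: a)
  case Nil
  have "dist (g a) (g s) = v * (u - a) + v * (s - u)"
    using lip[of a s] Nil by (auto simp: algebra_simps)
  then have "g u = g a + (v * (u - a) / dist (g a) (g s)) *\<^sub>R (g s - g a)"
    using Nil by (intro split_segment_unique[OF lip lip]) auto
  moreover have "v * (u - a) \<le> dist (g a) (g s)" using Nil assms(1) by (auto intro: order_trans[rotated])
  ultimately show ?case by simp
next
  case (Cons w us)
  have w: "a \<le> w" "w \<le> s" using Cons by auto
  have tail: "plen (g w) (map g us @ [g s]) \<le> v * (s - w)"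
    by (rule plen_times_le[where D="\<lambda>a b. v * (b - a)" and l=l])
      (use Cons lip w in \<open>auto simp: algebra_simps\<close>)
  have d: "dist (g a) (g w) = v * (w - a)"
    using tail Cons.prems lip[of a w] w by (auto simp: algebra_simps)
  show ?case
  proof (cases "u \<le> w")
    case True
    have "dist (g a) (g w) = v * (u - a) + v * (w - u)" by (simp add: d algebra_simps)
    then have "g u = g a + (v * (u - a) / dist (g a) (g w)) *\<^sub>R (g w - g a)"
      using Cons w True by (intro split_segment_unique[OF lip lip]) auto
    moreover have "v * (u - a) \<le> dist (g a) (g w)" using d assms(1) True by simp
    ultimately show ?thesis by simp
  next
    case False
    have "v * (s - w) \<le> plen (g w) (map g us @ [g s])"
      using Cons.prems d by (auto simp: algebra_simps)
    then have "g u = arc v (g w) (map g us @ [g s]) (u - w)"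
      using Cons.prems w False by (intro Cons.IH) auto
    moreover have eq: "(u - a) - dist (g a) (g w) / v = u - w" using d assms(1) by simp
    moreover have no: "(v * (u - a) \<le> dist (g a) (g w)) = False" using False assms(1) d by simp
    ultimately show ?thesis by (simp only: list.map append_Cons arc.simps if_False)
  qed
qed

text \<open>The time \<open>u\<close> need not be a visiting time. If it falls inside a leg, that
  leg is split at \<open>g u\<close> by the triangle inequality.\<close>

lemma plen_split_time:
  assumes "\<And>a b c. l \<le> a \<Longrightarrow> a \<le> b \<Longrightarrow> b \<le> c \<Longrightarrow> c \<le> s \<Longrightarrow> D a b + D b c \<le> (D a c :: real)"
    and "\<And>a b. l \<le> a \<Longrightarrow> a \<le> b \<Longrightarrow> b \<le> s \<Longrightarrow> dist (g a) (g b) \<le> D a b"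
    and "sorted us" "set us \<subseteq> {a..s}" "l \<le> a" "a \<le> u" "u \<le> s"
  shows "plen (g a) (map g us @ [g s]) \<le> D a u + D u s"
  using assms(3-)
proof (induction us arbitrary: a)
  case Nil
  then have "dist (g a) (g u) \<le> D a u" "dist (g u) (g s) \<le> D u s" by (auto intro!: assms(2))
  then show ?case using dist_triangle[of "g a" "g s" "g u"] by simp
next
  case (Cons w us)
  show ?case
  proof (cases "u \<le> w")
    case True
    have sub: "set (w # us) \<subseteq> {u..s}"
    proof
      fix x assume x: "x \<in> set (w # us)"
      then have "w \<le> x" using Cons.prems(1) by auto
      moreover have "x \<le> s" using x Cons.prems(2) by (meson atLeastAtMost_iff subsetD)
      ultimately show "x \<in> {u..s}" using True by simp
    qed
    have "plen (g u) (map g (w # us) @ [g s]) \<le> D u s"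
      by (rule plen_times_le[where D=D and l=l, OF assms(1,2) Cons.prems(1) sub])
        (use Cons.prems in auto)
    moreover have "plen (g a) (map g (w # us) @ [g s]) \<le> dist (g a) (g u) + plen (g u) (map g (w # us) @ [g s])"
      by (rule plen_triangle)
    ultimately show ?thesis using assms(2)[of a u] Cons.prems by simp
  next
    case False
    have "plen (g w) (map g us @ [g s]) \<le> D w u + D u s" using Cons False by (intro Cons.IH) auto
    moreover have "dist (g a) (g w) \<le> D a w" using Cons.prems False by (intro assms(2)) auto
    moreover have "D a w + D w u \<le> D a u" using Cons.prems False by (intro assms(1)) auto
    ultimately show ?thesis by simp
  qed
qed

text \<open>For an optimal path every inequality between polygon length, distance bound and energy
  is an equality. The chain of touched points is then the unique optimal one, the speed is constant,
  and the path is forced onto the polygon.\<close>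

lemma optimal_path_is_arc:
  assumes "P \<in> LF" "s > 0" "admissible P s T g" "path_action P s g = cact P s T"
    and "tame b K P" "b \<ge> 0" "closed T" "T \<noteq> {}" "0 \<notin> T"
    and uniq: "\<And>qs. qs \<in> chains P \<Longrightarrow> cval s T qs = cact P s T \<Longrightarrow> qs = ps"
    and nearest: "\<And>x. x \<in> T \<Longrightarrow> dist (last (0 # ps)) x \<le> infdist (last (0 # ps)) T \<Longrightarrow> x = z"
    and u: "u \<in> {0..s}"
  shows "g u = arc (tlen T 0 ps / s) 0 (ps @ [z]) u"
proof -
  have g: "piecewise_linear s g" "g 0 = 0" "g s \<in> T" using assms by (auto simp: admissible_def)
  obtain us where us: "sorted us" "distinct us" "set us \<subseteq> {0..s}" "distinct (map g us)"
    "set (map g us) = {p\<in>P. p \<in> g ` {0..s}}" by (rule path_times[OF assms(1) g(1)]) (rule that)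
  note chain = path_chain_le[OF assms(1,3,2) us]
  have "cval s T (map g us) = cact P s T"
    using cact_le[OF assms(5,2,6) chain(1), of T] chain(2) assms(4) by simp
  then have ps: "map g us = ps" using uniq chain(1) by blast
  define L where "L = tlen T 0 ps"
  have L: "L > 0" unfolding L_def by (rule tlen_pos[OF assms(7-9)])
  have "length (map g us) = points_touched P s g"
    unfolding points_touched_def us(5)[symmetric] using distinct_card[OF us(4)] by simp
  then have "L\<^sup>2 / (2 * s) = energy s g"
    using \<open>cval s T (map g us) = cact P s T\<close> assms(4) unfolding ps
    by (simp add: cval_def path_action_def L_def)
  then have E: "L\<^sup>2 = 2 * s * energy s g" using assms(2) by (simp add: field_simps)
  have Ls: "edist g 0 s = L" using L E[symmetric]
    by (simp add: edist_def energy_on_0 mult_ac)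
  have lower: "L \<le> plen 0 (map g us @ [g s])" unfolding L_def ps[symmetric] using g by (intro tlen_le_plen)
  note sup = edist_superadd[OF g(1)] and de = dist_le_edist[OF g(1)]
  have upper: "plen 0 (map g us @ [g s]) \<le> L"
    using plen_times_le[where l=0 and a=0 and D="edist g" and g=g and s=s and us=us] sup de us g assms(2) Ls by simp
  \<comment> \<open>Equality in Cauchy--Schwarz at every splitting time makes the energy grow
    linearly in time.\<close>
  have lin: "energy_on g 0 w = w * energy s g / s" if w: "w \<in> {0..s}" for w
  proof -
    have "plen (g 0) (map g us @ [g s]) \<le> edist g 0 w + edist g w s"
      by (rule plen_split_time[where l=0]) (use sup de us w in auto)
    then have "edist g 0 w + edist g w s = edist g 0 s"
      using lower sup[of 0 w s] w Ls g by auto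
    moreover have sum: "energy_on g 0 w + energy_on g w s = energy_on g 0 s"
      using energy_on_add[OF g(1), of 0 w s] w by simp
    ultimately have "sqrt ((w - 0) * (2 * energy_on g 0 w)) + sqrt ((s - w) * (2 * energy_on g w s)) =
        sqrt (((w - 0) + (s - w)) * (2 * energy_on g 0 w + 2 * energy_on g w s))"
      by (simp add: edist_def flip: distrib_left)
    then have "(w - 0) * (2 * energy_on g w s) = (s - w) * (2 * energy_on g 0 w)"
      using w energy_on_nonneg by (intro cauchy_schwarz_sqrt(2)) auto
    then have "s * energy_on g 0 w = w * (energy_on g 0 w + energy_on g w s)" by (simp add: algebra_simps)
    then have "s * energy_on g 0 w = w * energy s g" unfolding sum energy_on_0[of g s] .
    then show ?thesis using assms(2) by (simp add: eq_divide_eq mult.commute)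
  qed
  define v where "v = L / s"
  have v: "v > 0" using L assms(2) by (simp add: v_def)
  have lip: "dist (g a) (g b) \<le> v * (b - a)" if ab: "0 \<le> a" "a \<le> b" "b \<le> s" for a b
  proof -
    have "energy_on g a b = (b - a) * energy s g / s"
      using energy_on_add[OF g(1), of 0 a b] lin[of a] lin[of b] ab
      by (simp add: diff_divide_distrib left_diff_distrib)
    also have "2 * \<dots> = (b - a) * v\<^sup>2"
      using E assms(2) by (simp add: v_def power_divide) (simp add: power2_eq_square)
    finally have "edist g a b = sqrt (((b - a) * v)\<^sup>2)"
      by (simp add: edist_def power2_eq_square mult_ac)
    then show ?thesis using de[of a b] ab v by (simp add: mult_ac)
  qed
  have gs: "g s = z"
  proof (rule nearest[OF g(3)])
    have "plen 0 ps + dist (last (0 # ps)) (g s) \<le> L" using upper unfolding ps by (simp add: plen_append)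
    moreover have "L = plen 0 ps + infdist (last (0 # ps)) T"
      using tlen_append[of T 0 ps "[]"] by (simp add: L_def)
    ultimately show "dist (last (0 # ps)) (g s) \<le> infdist (last (0 # ps)) T" by simp
  qed
  have "v * (s - 0) \<le> plen (g 0) (map g us @ [g s])" using lower g assms(2) by (simp add: v_def)
  then have "g u = arc v (g 0) (map g us @ [g s]) (u - 0)"
    using lip us u assms(2) by (intro tight_path_is_arc[OF v, of 0 s]) auto
  then show ?thesis unfolding ps gs by (simp add: g v_def L_def)
qed

text \<open>Chosen so that the optimal polygon is admissible without bending: the last leg to a
  vertical line is horizontal, so distinct imaginary parts clear it, and the last clause clears all
  other legs.\<close>

definition generic :: "real \<Rightarrow> complex set \<Rightarrow> bool" where
  "generic t P \<longleftrightarrow> 0 \<notin> P \<and> (\<forall>p\<in>P. Re p \<noteq> t) \<and>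
    (\<forall>p\<in>P. \<forall>a\<in>insert 0 P. a \<noteq> p \<longrightarrow> Im p \<noteq> Im a) \<and>
    (\<forall>p\<in>P. \<forall>a\<in>insert 0 P. \<forall>b\<in>P. a \<noteq> p \<longrightarrow> b \<noteq> p \<longrightarrow> a \<noteq> b \<longrightarrow> dist a p + dist p b \<noteq> dist a b)"

lemma generic_Im:
  assumes "generic t P" "p \<in> P" "a \<in> insert 0 P" "a \<noteq> p"
  shows "Im p \<noteq> Im a"
proof -
  have "\<forall>p\<in>P. \<forall>a\<in>insert 0 P. a \<noteq> p \<longrightarrow> Im p \<noteq> Im a"
    using assms(1) unfolding generic_def by (elim conjE)
  from mp[OF bspec[OF bspec[OF this assms(2)] assms(3)] assms(4)] show ?thesis .
qed

lemma generic_dist: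
  assumes "generic t P" "p \<in> P" "a \<in> insert 0 P" "b \<in> P" "a \<noteq> p" "b \<noteq> p" "a \<noteq> b"
  shows "dist a p + dist p b \<noteq> dist a b"
proof -
  have "\<forall>p\<in>P. \<forall>a\<in>insert 0 P. \<forall>b\<in>P. a \<noteq> p \<longrightarrow> b \<noteq> p \<longrightarrow> a \<noteq> b \<longrightarrow> dist a p + dist p b \<noteq> dist a b"
    using assms(1) unfolding generic_def by (elim conjE)
  from mp[OF mp[OF mp[OF bspec[OF bspec[OF bspec[OF this assms(2)] assms(3)] assms(4)] assms(5)] assms(6)] assms(7)]
  show ?thesis .
qed

lemma generic_segok:
  assumes "generic t P" "p \<in> P" "a \<in> insert 0 P" "set ps \<subseteq> P" "distinct (a # ps)"
  shows "segok p a (ps @ [Complex t (Im (last (a # ps)))])"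
  using assms(3-)
proof (induction ps arbitrary: a)
  case Nil
  have "p = a" if seg: "p \<in> closed_segment a (Complex t (Im a))"
  proof (rule ccontr)
    assume "p \<noteq> a"
    obtain l where "p = (1 - l) *\<^sub>R a + l *\<^sub>R Complex t (Im a)" using seg by (auto simp: in_segment)
    then have "Im p = (1 - l) * Im a + l * Im a" by simp
    then have "Im p = Im a" by (simp add: algebra_simps)
    moreover have "Im p \<noteq> Im a" using assms(1,2) Nil(1) \<open>p \<noteq> a\<close> by (intro generic_Im) auto
    ultimately show False by simp
  qed
  then show ?case by auto
next
  case (Cons q ps)
  have "p = a \<or> p = q" if "p \<in> closed_segment a q"
  proof -
    have "dist a q = dist a p + dist p q" using that by (metis between between_mem_segment)
    moreover have "a \<noteq> q" "q \<in> P" using Cons by auto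
    ultimately show ?thesis using generic_dist[OF assms(1,2) Cons.prems(1), of q] by metis
  qed
  moreover have "segok p q (ps @ [Complex t (Im (last (q # ps)))])"
    using Cons by (intro Cons.IH) auto
  ultimately show ?case by simp
qed

section \<open>The vertical target line\<close>

lemma infdist_Lambda: "infdist a (Lambda_line t) = \<bar>Re a - t\<bar>"
proof (rule antisym)
  have "infdist a (Lambda_line t) \<le> dist a (Complex t (Im a))"
    by (intro infdist_le) (simp add: Lambda_line_def)
  also have "\<dots> = \<bar>Re a - t\<bar>" by (simp add: dist_norm cmod_def)
  finally show "infdist a (Lambda_line t) \<le> \<bar>Re a - t\<bar>" .
  have "\<bar>Re a - t\<bar> \<le> dist a x" if "x \<in> Lambda_line t" for x
    using abs_Re_le_cmod[of "a - x"] that by (simp add: Lambda_line_def dist_norm)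
  moreover have "Lambda_line t \<noteq> {}" using complex.sel(1)[of t 0] unfolding Lambda_line_def by blast
  ultimately show "\<bar>Re a - t\<bar> \<le> infdist a (Lambda_line t)"
    by (simp add: infdist_notempty cINF_greatest)
qed

lemma nearest_Lambda:
  assumes "x \<in> Lambda_line t" "dist a x \<le> infdist a (Lambda_line t)"
  shows "x = Complex t (Im a)"
proof -
  have "Re x = t" using assms by (simp add: Lambda_line_def)
  have "(dist a x)\<^sup>2 \<le> (\<bar>Re a - t\<bar>)\<^sup>2" using assms by (intro power_mono) (auto simp: infdist_Lambda)
  then have "(Im a - Im x)\<^sup>2 \<le> 0" using \<open>Re x = t\<close> by (simp add: dist_norm cmod_power2)
  then show ?thesis using \<open>Re x = t\<close> by (simp add: complex_eq_iff)
qed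

lemma closed_Lambda: "closed (Lambda_line t)"
  unfolding Lambda_line_def by (intro closed_Collect_eq continuous_intros)

lemma Lambda_nonempty: "Lambda_line t \<noteq> {}"
  using complex.sel(1)[of t 0] unfolding Lambda_line_def by blast

lemma Lambda_infinite: "z \<in> Lambda_line t \<Longrightarrow> e > 0 \<Longrightarrow> infinite (Lambda_line t \<inter> ball z e)"
proof -
  assume z: "z \<in> Lambda_line t" "e > 0"
  have "inj_on (\<lambda>y. Complex t (Im z + y)) {0<..<e}" by (auto simp: inj_on_def)
  moreover have "(\<lambda>y. Complex t (Im z + y)) ` {0<..<e} \<subseteq> Lambda_line t \<inter> ball z e"
    using z by (auto simp: Lambda_line_def dist_norm cmod_def)
  ultimately show ?thesis using infinite_Ioo[OF z(2)] by (metis finite_imageD finite_subset)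
qed

text \<open>The minimizing path is the polygon through its optimal chain, so a minimizer inside \<open>C\<close>
  makes the optimal chain lie in \<open>C\<close>.\<close>

lemma minimizer_in_chain_in:
  assumes P: "P \<in> LF" "tame b K P" "b \<ge> 0" "K \<ge> 0" "generic t P" and "s > 0" "t > 0"
    and uniq: "\<And>ps qs. ps \<in> chains P \<Longrightarrow> qs \<in> chains P \<Longrightarrow> cval s (Lambda_line t) ps = cval s (Lambda_line t) qs \<Longrightarrow> ps = qs"
    and sub: "minimizer P (Lambda_line t) s ` {0..s} \<subseteq> C"
  shows "cact (P \<inter> C) s (Lambda_line t) = cact P s (Lambda_line t)"
proof -
  let ?T = "Lambda_line t"
  have T: "closed ?T" "?T \<noteq> {}" "0 \<notin> ?T"
    using closed_Lambda Lambda_nonempty assms(7) by (auto simp: Lambda_line_def)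
  have Act: "Action P s ?T = cact P s ?T"
    using P T assms(6) Lambda_infinite by (intro Action_eq_cact) auto
  obtain ps where ps: "ps \<in> chains P" "cact P s ?T = cval s ?T ps"
    by (rule cact_attained[OF P(2) assms(6) P(3,4,1)]) (rule that)
  define z where "z = Complex t (Im (last (0 # ps)))"
  have zT: "z \<in> ?T" by (simp add: z_def Lambda_line_def)
  have dist: "distinct (0 # ps @ [z])"
  proof -
    have "z \<notin> P" using P(5) by (auto simp: generic_def z_def)
    moreover have "z \<noteq> 0" using assms(7) by (auto simp: z_def complex_eq_iff)
    ultimately show ?thesis using P(5) ps by (auto simp: generic_def chains_def)
  qed
  have tl: "tlen ?T 0 ps = plen 0 (ps @ [z])"
  proof -
    have "dist (last (0 # ps)) z = infdist (last (0 # ps)) ?T"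
      unfolding z_def infdist_Lambda by (simp only: dist_norm) (simp add: cmod_def)
    then show ?thesis using tlen_append[of ?T 0 ps "[]"] by (simp add: plen_append)
  qed
  \<comment> \<open>In generic position the polygon itself is admissible, so the infimum over paths
    is attained.\<close>
  define g where "g = arc (plen 0 (ps @ [z]) / s) 0 (ps @ [z])"
  have g: "admissible P s ?T g" "energy s g \<le> (plen 0 (ps @ [z]))\<^sup>2 / (2 * s)" "set (0 # ps @ [z]) \<subseteq> g ` {0..s}"
    unfolding g_def z_def
    by (rule arc_admissible; use assms(6) dist zT P(5) ps generic_segok[OF P(5)] in \<open>auto simp: z_def chains_def simp del: last.simps\<close>)+
  have "real (length ps) \<le> points_touched P s g"
    using points_touched_ge[OF P(1) _ ps(1)] g by (auto simp: admissible_def)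
  then have "path_action P s g \<le> cact P s ?T" using g(2) ps(2) tl by (simp add: path_action_def cval_def)
  moreover have "cact P s ?T \<le> path_action P s g"
  proof -
    have pl: "piecewise_linear s g" using g by (simp add: admissible_def)
    obtain us where "sorted us" "distinct us" "set us \<subseteq> {0..s}" "distinct (map g us)"
      "set (map g us) = {p\<in>P. p \<in> g ` {0..s}}" by (rule path_times[OF P(1) pl]) (rule that)
    note chain = path_chain_le[OF P(1) g(1) assms(6) this]
    show ?thesis using cact_le[OF P(2) assms(6) P(3) chain(1)] chain(2) by (rule order_trans)
  qed
  ultimately have opt: "path_action P s g = cact P s ?T" by simp
  have any: "h u = g u" if h: "is_minimizer P s ?T h" and u: "u \<in> {0..s}" for h u
    unfolding g_def tl[symmetric]
  proof (rule optimal_path_is_arc[OF P(1) assms(6) _ _ P(2,3) T])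
    show "admissible P s ?T h" "path_action P s h = cact P s ?T"
      using h by (auto simp: is_minimizer_def Act)
    show "qs = ps" if "qs \<in> chains P" "cval s ?T qs = cact P s ?T" for qs
      using uniq[OF that(1) ps(1)] that(2) ps(2) by simp
    show "x = z" if "x \<in> ?T" "dist (last (0 # ps)) x \<le> infdist (last (0 # ps)) ?T" for x
      unfolding z_def using that by (rule nearest_Lambda)
  qed (rule u)
  \<comment> \<open>By \<open>any\<close> all minimizing paths agree on \<open>{0..s}\<close>, and
    \<open>minimizer\<close> replaces their values elsewhere by 0; hence the description has exactly
    one solution.\<close>
  have "minimizer P ?T s = (\<lambda>u. if u \<in> {0..s} then g u else 0)"
    unfolding minimizer_def
  proof (rule the_equality)
    show "\<exists>f. is_minimizer P s ?T f \<and> (\<lambda>u. if u \<in> {0..s} then g u else 0) = (\<lambda>u. if u \<in> {0..s} then f u else 0)"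
      using g(1) opt by (intro exI[of _ g]) (simp add: is_minimizer_def Act)
    fix h assume "\<exists>f. is_minimizer P s ?T f \<and> h = (\<lambda>u. if u \<in> {0..s} then f u else 0)"
    then show "h = (\<lambda>u. if u \<in> {0..s} then g u else 0)" using any by (auto simp: fun_eq_iff)
  qed
  then have "minimizer P ?T s ` {0..s} = g ` {0..s}" by (auto simp: image_def)
  then have "set ps \<subseteq> C" using sub g(3) by auto
  then have "ps \<in> chains (P \<inter> C)" using ps by (auto simp: chains_def)
  then have "cact (P \<inter> C) s ?T \<le> cval s ?T ps"
    using tame_subset[OF P(2), of "P \<inter> C"] P assms(6) by (intro cact_le) auto
  moreover have "cact P s ?T \<le> cact (P \<inter> C) s ?T"
    using P assms(6) by (intro cact_mono_config) auto
  ultimately show ?thesis using ps by simp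
qed

section \<open>The measurable space of configurations\<close>

text \<open>Lists make the intersection of two cylinder events a concatenation, and their positions
  later serve to number the atoms.\<close>

definition tests :: "complex set \<Rightarrow> (complex set \<times> nat) list set" where
  "tests D = {l. \<forall>(B, k)\<in>set l. B \<in> sets borel \<and> bounded B \<and> B \<subseteq> D}"

definition cyl_set :: "(complex set \<times> nat) list \<Rightarrow> complex set set" where
  "cyl_set l = {P\<in>LF. \<forall>(B, k)\<in>set l. card (P \<inter> B) = k}"

text \<open>The space is the same for every \<open>D\<close>; only the sigma-algebra records what is
  seen in \<open>D\<close>. Thus one random variable \<open>\<omega>\<close>, regarded with two
  disjoint regions, is independent of itself.\<close>

definition cfg :: "complex set \<Rightarrow> complex set measure" where
  "cfg D = sigma LF (cyl_set ` tests D)"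

lemma space_cfg [simp]: "space (cfg D) = LF"
  unfolding cfg_def by (rule space_measure_of) (auto simp: cyl_set_def)

lemma sets_cfg: "sets (cfg D) = sigma_sets LF (cyl_set ` tests D)"
  unfolding cfg_def by (rule sets_measure_of) (auto simp: cyl_set_def)

lemma cyl_set_in_cfg: "l \<in> tests D \<Longrightarrow> cyl_set l \<in> sets (cfg D)"
  unfolding sets_cfg by (intro sigma_sets.Basic imageI)

lemma Int_stable_cyl: "Int_stable (cyl_set ` tests D)"
proof -
  have "cyl_set l \<inter> cyl_set l' \<in> cyl_set ` tests D" if "l \<in> tests D" "l' \<in> tests D" for l l'
    using that by (intro image_eqI[of _ _ "l @ l'"]) (auto simp: cyl_set_def tests_def ball_Un)
  then show ?thesis by (auto simp: Int_stable_def)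
qed

lemma count_in_cfg:
  assumes "B \<in> sets borel" "bounded B" "B \<subseteq> D"
  shows "{P\<in>LF. card (P \<inter> B) = k} \<in> sets (cfg D)"
  using cyl_set_in_cfg[of "[(B, k)]" D] assms by (simp add: tests_def cyl_set_def)

lemma count_measurable_cfg:
  assumes "B \<in> sets borel" "bounded B" "B \<subseteq> D"
  shows "(\<lambda>P. card (P \<inter> B)) \<in> measurable (cfg D) (count_space UNIV)"
proof (subst measurable_count_space_eq_countable)
  show "countable (UNIV :: nat set)" by simp
  show "(\<lambda>P. card (P \<inter> B)) \<in> space (cfg D) \<rightarrow> UNIV \<and>
      (\<forall>k\<in>UNIV. (\<lambda>P. card (P \<inter> B)) -` {k} \<inter> space (cfg D) \<in> sets (cfg D))"
    using count_in_cfg[OF assms] by (auto simp: vimage_def Int_def conj_commute)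
qed

lemma sets_cfg_mono: "D \<subseteq> D' \<Longrightarrow> sets (cfg D) \<subseteq> sets (cfg D')"
  unfolding sets_cfg by (intro sigma_sets_mono') (auto simp: tests_def image_iff; blast)

lemma measurable_cfg_mono: "f \<in> measurable (cfg D) N \<Longrightarrow> D \<subseteq> D' \<Longrightarrow> f \<in> measurable (cfg D') N"
  using sets_cfg_mono[of D D'] unfolding measurable_def by auto

section \<open>Dyadic cells\<close>

definition cidx :: "nat \<Rightarrow> complex \<Rightarrow> int \<times> int" where
  "cidx m z = (\<lfloor>2 ^ m * Re z\<rfloor>, \<lfloor>2 ^ m * Im z\<rfloor>)"

definition cell :: "nat \<Rightarrow> int \<times> int \<Rightarrow> complex set" where
  "cell m i = {z. cidx m z = i}"

lemma cell_borel [measurable]: "cell m i \<in> sets borel"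
proof -
  have "cell m i = {z. \<lfloor>2 ^ m * Re z\<rfloor> = fst i \<and> \<lfloor>2 ^ m * Im z\<rfloor> = snd i}"
    by (auto simp: cell_def cidx_def)
  also have "\<dots> \<in> sets borel" by measurable
  finally show ?thesis .
qed

lemma cell_dist:
  assumes "x \<in> cell m i" "y \<in> cell m i"
  shows "dist x y < 2 / 2 ^ m"
proof -
  have "\<lfloor>2 ^ m * Re x\<rfloor> = \<lfloor>2 ^ m * Re y\<rfloor>" "\<lfloor>2 ^ m * Im x\<rfloor> = \<lfloor>2 ^ m * Im y\<rfloor>"
    using assms by (auto simp: cell_def cidx_def)
  then have "\<bar>2 ^ m * Re x - 2 ^ m * Re y\<bar> < 1" "\<bar>2 ^ m * Im x - 2 ^ m * Im y\<bar> < 1" by linarith+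
  moreover have "2 ^ m * Re x - 2 ^ m * Re y = 2 ^ m * Re (x - y)"
    "2 ^ m * Im x - 2 ^ m * Im y = 2 ^ m * Im (x - y)" by (auto simp: algebra_simps)
  ultimately have "\<bar>2 ^ m * Re (x - y)\<bar> < 1" "\<bar>2 ^ m * Im (x - y)\<bar> < 1" by metis+
  then have "\<bar>Re (x - y)\<bar> < 1 / 2 ^ m" "\<bar>Im (x - y)\<bar> < 1 / 2 ^ m"
    unfolding abs_mult by (simp_all add: pos_less_divide_eq mult.commute)
  then show ?thesis using cmod_le[of "x - y"] by (simp add: dist_norm)
qed

lemma cell_bounded: "bounded (cell m i)"
proof (cases "cell m i = {}")
  case False
  then obtain x where x: "x \<in> cell m i" by blast
  have "cell m i \<subseteq> ball x (2 / 2 ^ m)" using cell_dist[OF x] by auto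
  then show ?thesis using bounded_subset bounded_ball by blast
qed simp

lemma exists_small_cell:
  assumes "d > 0" shows "\<exists>m. \<forall>m'\<ge>m. 2 / 2 ^ m' < (d :: real)"
proof -
  obtain m where m: "(1 / 2) ^ m < d / 2" using real_arch_pow_inv[of "d / 2" "1 / 2"] assms by auto
  have "2 / 2 ^ m' < d" if "m' \<ge> m" for m'
  proof -
    have "(1 / 2 :: real) ^ m' \<le> (1 / 2) ^ m" using that by (intro power_decreasing) auto
    with m show ?thesis by (simp add: power_one_over)
  qed
  then show ?thesis by blast
qed

lemma separate_points:
  fixes ps :: "complex list" and d :: real
  assumes "distinct ps" "d > 0"
  shows "\<exists>m0. \<forall>m\<ge>m0. distinct (map (cidx m) ps) \<and> 2 / 2 ^ m < d"
proof -
  define e where "e = Min (insert d ((\<lambda>(x, y). dist x y) ` {(x, y) \<in> set ps \<times> set ps. x \<noteq> y}))"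
  have "finite {(x, y) \<in> set ps \<times> set ps. x \<noteq> y}"
    by (rule finite_subset[of _ "set ps \<times> set ps"]) auto
  then have fin: "finite (insert d ((\<lambda>(x, y). dist x y) ` {(x, y) \<in> set ps \<times> set ps. x \<noteq> y}))"
    by (intro finite.insertI finite_imageI)
  have "e > 0" unfolding e_def using assms by (subst Min_gr_iff[OF fin]) auto
  then obtain m0 where m0: "\<forall>m\<ge>m0. 2 / 2 ^ m < e" using exists_small_cell by blast
  have "inj_on (cidx m) (set ps)" if "m \<ge> m0" for m
  proof (rule inj_onI, rule ccontr)
    fix x y assume xy: "x \<in> set ps" "y \<in> set ps" "cidx m x = cidx m y" "x \<noteq> y"
    then have "dist x y < 2 / 2 ^ m" by (intro cell_dist[of x m "cidx m x"]) (auto simp: cell_def)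
    moreover have "e \<le> dist x y" unfolding e_def using xy by (intro Min_le[OF fin]) auto
    ultimately show False using m0 that by force
  qed
  moreover have "e \<le> d" unfolding e_def by (intro Min_le[OF fin]) auto
  ultimately show ?thesis using m0 assms(1) by (intro exI[of _ m0]) (auto simp: distinct_map intro: less_le_trans)
qed

section \<open>Open conditions on chains and measurability\<close>

definition chain_open :: "(complex list \<Rightarrow> bool) \<Rightarrow> bool" where
  "chain_open Q \<longleftrightarrow> (\<forall>ps. Q ps \<longrightarrow> (\<exists>d>0. \<forall>qs. list_all2 (\<lambda>x y. dist x y \<le> d) ps qs \<longrightarrow> Q qs))"

text \<open>A chain satisfying an open condition can be detected on a sufficiently fine grid from the
  occupied cells alone.\<close>

lemma open_chain_event:
  assumes "chain_open Q" "D \<in> sets borel"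
  shows "{P\<in>LF. \<exists>ps\<in>chains (P \<inter> D). Q ps} \<in> sets (cfg D)"
proof -
  \<comment> \<open>Cell lists for which any choice of one point per cell satisfies
    \<open>Q\<close>; distinct cells guarantee that such a choice is a chain.\<close>
  define good where "good = (\<lambda>m. {cs. distinct cs \<and> (\<forall>ps. list_all2 (\<lambda>p c. p \<in> cell m c) ps cs \<longrightarrow> Q ps)})"
  have "{P\<in>LF. \<exists>ps\<in>chains (P \<inter> D). Q ps} =
    (\<Union>m. \<Union>cs\<in>good m. {P\<in>LF. \<forall>c\<in>set cs. card (P \<inter> (cell m c \<inter> D)) \<noteq> 0})"
  proof (intro set_eqI iffI)
    fix P assume "P \<in> {P\<in>LF. \<exists>ps\<in>chains (P \<inter> D). Q ps}"
    then obtain ps where ps: "P \<in> LF" "distinct ps" "set ps \<subseteq> P \<inter> D" "Q ps" by (auto simp: chains_def)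
    obtain d where d: "d > 0" "\<And>qs. list_all2 (\<lambda>x y. dist x y \<le> d) ps qs \<Longrightarrow> Q qs"
      using assms(1) ps(4) unfolding chain_open_def by blast
    obtain m where m: "distinct (map (cidx m) ps)" "2 / 2 ^ m < d"
      using separate_points[OF ps(2) d(1)] by blast
    have "Q qs" if "list_all2 (\<lambda>p c. p \<in> cell m c) qs (map (cidx m) ps)" for qs
    proof (rule d(2))
      show "list_all2 (\<lambda>x y. dist x y \<le> d) ps qs"
        using that m(2)
        by (auto simp: list_all2_conv_all_nth dist_commute cell_def intro!: less_imp_le[OF less_trans[OF cell_dist]])
    qed
    then have "map (cidx m) ps \<in> good m" using m by (simp add: good_def)
    moreover have "card (P \<inter> (cell m c \<inter> D)) \<noteq> 0" if "c \<in> set (map (cidx m) ps)" for c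
    proof -
      have "finite (P \<inter> (cell m c \<inter> D))"
        using ps(1) cell_bounded[of m c] by (auto simp: LF_def intro: bounded_subset)
      moreover have "P \<inter> (cell m c \<inter> D) \<noteq> {}" using that ps(3) by (auto simp: cell_def)
      ultimately show ?thesis by simp
    qed
    ultimately show "P \<in> (\<Union>m. \<Union>cs\<in>good m. {P\<in>LF. \<forall>c\<in>set cs. card (P \<inter> (cell m c \<inter> D)) \<noteq> 0})"
      using ps(1) by blast
  next
    fix P assume "P \<in> (\<Union>m. \<Union>cs\<in>good m. {P\<in>LF. \<forall>c\<in>set cs. card (P \<inter> (cell m c \<inter> D)) \<noteq> 0})"
    then obtain m cs where cs: "P \<in> LF" "cs \<in> good m" "\<forall>c\<in>set cs. card (P \<inter> (cell m c \<inter> D)) \<noteq> 0" by blast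
    define pt where "pt = (\<lambda>c. SOME p. p \<in> P \<inter> (cell m c \<inter> D))"
    have pt: "pt c \<in> P \<inter> (cell m c \<inter> D)" if "c \<in> set cs" for c
    proof -
      have "P \<inter> (cell m c \<inter> D) \<noteq> {}" using cs(3) that by force
      then show ?thesis unfolding pt_def by (rule some_in_eq[THEN iffD2])
    qed
    have "inj_on pt (set cs)"
    proof (rule inj_onI)
      fix c c' assume "c \<in> set cs" "c' \<in> set cs" "pt c = pt c'"
      then have "pt c \<in> cell m c" "pt c \<in> cell m c'" using pt[of c] pt[of c'] by auto
      then show "c = c'" by (simp add: cell_def)
    qed
    then have "map pt cs \<in> chains (P \<inter> D)" using pt cs(2) by (auto simp: chains_def distinct_map good_def)
    moreover have "Q (map pt cs)"
    proof -
      have "list_all2 (\<lambda>p c. p \<in> cell m c) (map pt cs) cs"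
        using pt by (auto simp: list_all2_conv_all_nth)
      then show ?thesis using cs(2) by (simp add: good_def)
    qed
    ultimately show "P \<in> {P\<in>LF. \<exists>ps\<in>chains (P \<inter> D). Q ps}" using cs(1) by blast
  qed
  also have "\<dots> \<in> sets (cfg D)"
  proof (intro sets.countable_UN'' countableI_type)
    fix m cs
    have "{P\<in>LF. \<forall>c\<in>set cs. card (P \<inter> (cell m c \<inter> D)) \<noteq> 0} =
        {P\<in>space (cfg D). \<forall>c\<in>set cs. card (P \<inter> (cell m c \<inter> D)) \<noteq> 0}" by simp
    also have "\<dots> \<in> sets (cfg D)"
    proof (intro sets.sets_Collect_finite_All)
      fix c
      have "(\<lambda>P. card (P \<inter> (cell m c \<inter> D))) \<in> measurable (cfg D) (count_space UNIV)"
        using assms(2) cell_bounded[of m c]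
        by (intro count_measurable_cfg) (auto intro: bounded_subset)
      then show "{P \<in> space (cfg D). card (P \<inter> (cell m c \<inter> D)) \<noteq> 0} \<in> sets (cfg D)"
        by measurable
    qed simp
    finally show "{P\<in>LF. \<forall>c\<in>set cs. card (P \<inter> (cell m c \<inter> D)) \<noteq> 0} \<in> sets (cfg D)" .
  qed
  finally show ?thesis .
qed

text \<open>Below a level the infimum is decided by an open condition, but only where it is bounded
  below. The event of unboundedness is the intersection of all \<open>low (- n)\<close> and is
  treated separately.\<close>

lemma chain_Inf_measurable:
  fixes f :: "complex list \<Rightarrow> real"
  assumes "\<And>a. chain_open (\<lambda>ps. f ps < a)" "D \<in> sets borel"
  shows "(\<lambda>P. Inf (f ` chains (P \<inter> D))) \<in> borel_measurable (cfg D)"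
proof -
  \<comment> \<open>The default value of \<open>Inf\<close> on sets unbounded below: no upper bound
    of the negated set exists, so the least one is that of an unsatisfiable predicate.\<close>
  define c0 where "c0 = - (LEAST z::real. False)"
  define low where "low = (\<lambda>a. {P\<in>LF. \<exists>ps\<in>chains (P \<inter> D). f ps < a})"
  have low: "low a \<in> sets (cfg D)" for a
    unfolding low_def by (intro open_chain_event assms)
  have bdd: "bdd_below (f ` chains (P \<inter> D)) \<longleftrightarrow> P \<notin> (\<Inter>n::nat. low (- real n))" if "P \<in> LF" for P
  proof
    assume "bdd_below (f ` chains (P \<inter> D))"
    then obtain b where b: "\<And>ps. ps \<in> chains (P \<inter> D) \<Longrightarrow> b \<le> f ps" by (auto simp: bdd_below_def)
    obtain n :: nat where "- b < n" using reals_Archimedean2 by blast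
    then have "P \<notin> low (- real n)" using b by (force simp: low_def)
    then show "P \<notin> (\<Inter>n::nat. low (- real n))" by blast
  next
    assume "P \<notin> (\<Inter>n::nat. low (- real n))"
    then obtain n :: nat where "P \<notin> low (- real n)" by blast
    then have "- real n \<le> f ps" if "ps \<in> chains (P \<inter> D)" for ps
      using that \<open>P \<in> LF\<close> by (auto simp: low_def not_less)
    then show "bdd_below (f ` chains (P \<inter> D))" by (intro bdd_belowI2)
  qed
  have unb: "Inf X = c0" if "\<not> bdd_below X" for X :: "real set"
  proof -
    have "(\<lambda>z. \<forall>x\<in>uminus ` X. x \<le> z) = (\<lambda>_. False)"
      using that by (auto simp: bdd_below_def fun_eq_iff) (metis minus_le_iff)
    then show ?thesis unfolding Inf_real_def Sup_real_def c0_def by (simp only:)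
  qed
  have set: "{P \<in> LF. Inf (f ` chains (P \<inter> D)) < a} =
     (low a - (\<Inter>n::nat. low (- real n))) \<union> ((\<Inter>n::nat. low (- real n)) \<inter> (if c0 < a then LF else {}))" for a
  proof (intro set_eqI iffI)
    fix P assume P: "P \<in> {P \<in> LF. Inf (f ` chains (P \<inter> D)) < a}"
    show "P \<in> (low a - (\<Inter>n::nat. low (- real n))) \<union> ((\<Inter>n::nat. low (- real n)) \<inter> (if c0 < a then LF else {}))"
    proof (cases "bdd_below (f ` chains (P \<inter> D))")
      case True
      have "f ` chains (P \<inter> D) \<noteq> {}" using Nil_in_chains by blast
      moreover have "Inf (f ` chains (P \<inter> D)) < a" using P by simp
      ultimately have "\<exists>x\<in>f ` chains (P \<inter> D). x < a" by (rule cInf_lessD)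
      then have "\<exists>ps\<in>chains (P \<inter> D). f ps < a" by blast
      then show ?thesis using P bdd True by (simp add: low_def)
    next
      case False
      then show ?thesis using P bdd unb[OF False] by auto
    qed
  next
    fix P assume P: "P \<in> (low a - (\<Inter>n::nat. low (- real n))) \<union> ((\<Inter>n::nat. low (- real n)) \<inter> (if c0 < a then LF else {}))"
    then have LF: "P \<in> LF" by (auto simp: low_def split: if_splits)
    show "P \<in> {P \<in> LF. Inf (f ` chains (P \<inter> D)) < a}"
    proof (cases "bdd_below (f ` chains (P \<inter> D))")
      case True
      then have "P \<in> low a" using P bdd LF by blast
      then have "\<exists>x\<in>f ` chains (P \<inter> D). x < a" by (auto simp: low_def)
      then have "Inf (f ` chains (P \<inter> D)) < a" using True by (auto intro: cInf_lower le_less_trans)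
      then show ?thesis using LF by simp
    next
      case False
      then have "c0 < a" using P bdd LF by (auto split: if_splits)
      then show ?thesis using unb[OF False] LF by simp
    qed
  qed
  show ?thesis
  proof (rule borel_measurableI_less)
    fix a
    have "LF \<in> sets (cfg D)" using sets.top[of "cfg D"] by simp
    then show "{P \<in> space (cfg D). Inf (f ` chains (P \<inter> D)) < a} \<in> sets (cfg D)"
      unfolding space_cfg set using low by (auto intro!: sets.Un sets.Diff sets.Int sets.countable_INT'')
  qed
qed

lemma chain_open_Lipschitz:
  fixes G :: "complex list \<Rightarrow> real" and h :: "nat \<Rightarrow> real \<Rightarrow> real"
  assumes lip: "\<And>d ps qs. 0 \<le> d \<Longrightarrow> list_all2 (\<lambda>x y. dist x y \<le> d) ps qs \<Longrightarrow> G qs \<le> G ps + 2 * d * (length ps + 1)"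
    and cont: "\<And>n. continuous_on UNIV (h n)"
  shows "chain_open (\<lambda>ps. h (length ps) (G ps) < a)"
  unfolding chain_open_def
proof (intro allI impI)
  fix ps assume less: "h (length ps) (G ps) < a"
  have "open {x. h (length ps) x < a}" using cont by (intro open_Collect_less continuous_intros) auto
  then obtain e where e: "e > 0" "\<And>x. dist x (G ps) < e \<Longrightarrow> h (length ps) x < a"
    using less unfolding open_dist by blast
  define N where "N = real (length ps) + 1"
  have N: "N > 0" by (simp add: N_def)
  define d where "d = e / (4 * N)"
  have d: "d > 0" "2 * d * N < e" using e(1) N by (auto simp: d_def)
  have "h (length qs) (G qs) < a" if qs: "list_all2 (\<lambda>x y. dist x y \<le> d) ps qs" for qs
  proof -
    have len: "length qs = length ps" using list_all2_lengthD[OF qs] by simp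
    have "list_all2 (\<lambda>x y. dist x y \<le> d) qs ps"
      using qs by (auto simp: list_all2_conv_all_nth dist_commute)
    from lip[OF _ qs] lip[OF _ this] have "G qs - G ps \<le> 2 * d * N" "G ps - G qs \<le> 2 * d * N"
      using d len by (simp_all add: N_def algebra_simps)
    then have "dist (G qs) (G ps) < e" using d(2) by (simp add: dist_real_def)
    then show ?thesis using e(2) len by simp
  qed
  then show "\<exists>d>0. \<forall>qs. list_all2 (\<lambda>x y. dist x y \<le> d) ps qs \<longrightarrow> h (length qs) (G qs) < a" using d(1) by blast
qed

lemma chain_open_cval:
  assumes "s > 0" shows "chain_open (\<lambda>ps. cval s T ps < a)"
proof -
  have "chain_open (\<lambda>ps. (\<lambda>n x. x\<^sup>2 / (2 * s) - real n) (length ps) (tlen T 0 ps) < a)"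
  proof (rule chain_open_Lipschitz[where G="tlen T 0" and h="\<lambda>n x. x\<^sup>2 / (2 * s) - real n"])
    fix d :: real and ps qs :: "complex list" assume "0 \<le> d" and l: "list_all2 (\<lambda>x y. dist x y \<le> d) ps qs"
    then show "tlen T 0 qs \<le> tlen T 0 ps + 2 * d * (length ps + 1)"
      using tlen_perturb[OF l, of T 0 0] l by (cases "ps = []") (auto simp: algebra_simps)
  qed (intro continuous_intros, use assms in auto)
  then show ?thesis by (simp add: cval_def)
qed

lemma cact_measurable:
  assumes "s > 0" "D \<in> sets borel"
  shows "(\<lambda>P. cact (P \<inter> D) s T) \<in> borel_measurable (cfg D)"
  unfolding cact_def using assms by (intro chain_Inf_measurable chain_open_cval)

lemma cact_measurable_UNIV: "s > 0 \<Longrightarrow> (\<lambda>P. cact P s T) \<in> borel_measurable (cfg UNIV)"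
  using cact_measurable[of s UNIV T] by simp

lemma chain_open_excess: "chain_open (\<lambda>ps. b * plen 0 ps - length ps < a)"
proof -
  have "chain_open (\<lambda>ps. (\<lambda>n x. b * x - real n) (length ps) (plen 0 ps) < a)"
  proof (rule chain_open_Lipschitz[where G="plen 0" and h="\<lambda>n x. b * x - real n"])
    fix d :: real and ps qs :: "complex list" assume "0 \<le> d" and l: "list_all2 (\<lambda>x y. dist x y \<le> d) ps qs"
    then show "plen 0 qs \<le> plen 0 ps + 2 * d * (length ps + 1)"
      using plen_perturb[OF l, of 0 0] l by (cases "ps = []") (auto simp: algebra_simps)
  qed (intro continuous_intros)
  then show ?thesis by simp
qed

text \<open>Prepares the measurability of \<open>good_cell\<close>; the insertion position is
  constant among chains of equal length.\<close>

lemma chain_open_insertion: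
  assumes "s > 0"
  shows "chain_open (\<lambda>ps. \<exists>i\<le>length ps. (tlen T 0 (take i ps @ x # drop i ps) + r)\<^sup>2 / (2 * s) - real (length ps) < a)"
proof -
  have "chain_open (\<lambda>ps. (\<lambda>n y. (y + r)\<^sup>2 / (2 * s) - real n) (length ps) (tlen T 0 (take i ps @ x # drop i ps)) < a)" for i
  proof (rule chain_open_Lipschitz[where G="\<lambda>ps. tlen T 0 (take i ps @ x # drop i ps)" and h="\<lambda>n y. (y + r)\<^sup>2 / (2 * s) - real n"])
    fix d :: real and ps qs :: "complex list" assume d: "0 \<le> d" and l: "list_all2 (\<lambda>x y. dist x y \<le> d) ps qs"
    show "tlen T 0 (take i qs @ x # drop i qs) \<le> tlen T 0 (take i ps @ x # drop i ps) + 2 * d * (length ps + 1)"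
    proof -
      have "list_all2 (\<lambda>x y. dist x y \<le> d) (take i ps @ x # drop i ps) (take i qs @ x # drop i qs)"
        using l d by (intro list_all2_appendI list_all2_takeI) (auto intro: list_all2_dropI)
      from tlen_perturb[OF this, of T 0 0] have "tlen T 0 (take i qs @ x # drop i qs) \<le>
          tlen T 0 (take i ps @ x # drop i ps) + 2 * d * real (length (take i ps @ x # drop i ps))" by simp
      moreover have "length (take i ps @ x # drop i ps) = length ps + 1" by auto
      ultimately show ?thesis by metis
    qed
  qed (intro continuous_intros, use assms in auto)
  then have "\<exists>d>0. \<forall>qs. list_all2 (\<lambda>x y. dist x y \<le> d) ps qs \<longrightarrow>
      (tlen T 0 (take i qs @ x # drop i qs) + r)\<^sup>2 / (2 * s) - real (length qs) < a"
    if "(tlen T 0 (take i ps @ x # drop i ps) + r)\<^sup>2 / (2 * s) - real (length ps) < a" for i ps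
    using that unfolding chain_open_def by blast
  then show ?thesis unfolding chain_open_def by (metis list_all2_lengthD)
qed

section \<open>Poisson processes\<close>

text \<open>The independence clause of \<^const>\<open>poisson_pp\<close> is indexed by natural numbers, hence the encoding of the
  atoms of the algebra generated by a list of sets.\<close>

definition atom :: "(complex set \<times> nat) list \<Rightarrow> complex \<Rightarrow> nat" where
  "atom l z = set_encode {i. i < length l \<and> z \<in> fst (l ! i)}"

text \<open>Code 0 belongs to the points outside all listed sets. Its atom need not be bounded, so
  the clauses about counts do not apply to it.\<close>

definition atoms :: "(complex set \<times> nat) list \<Rightarrow> nat set" where
  "atoms l = range (atom l) - {0}"

definition atom_set :: "(complex set \<times> nat) list \<Rightarrow> nat \<Rightarrow> complex set" where
  "atom_set l j = {z. atom l z = j}"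

definition atoms_in :: "(complex set \<times> nat) list \<Rightarrow> nat \<Rightarrow> nat set" where
  "atoms_in l i = {j \<in> atoms l. i \<in> set_decode j}"

lemma set_decode_atom: "set_decode (atom l z) = {i. i < length l \<and> z \<in> fst (l ! i)}"
  unfolding atom_def by (rule set_encode_inverse) simp

lemma finite_atoms: "finite (atoms l)"
proof (rule finite_subset)
  show "atoms l \<subseteq> set_encode ` Pow {..<length l}" by (auto simp: atoms_def atom_def)
qed simp

lemma atom_set_subset: "j \<in> atoms_in l i \<Longrightarrow> atom_set l j \<subseteq> fst (l ! i)"
  using set_decode_atom[of l] by (auto simp: atoms_in_def atom_set_def)

lemma atoms_decompose: "i < length l \<Longrightarrow> fst (l ! i) = (\<Union>j\<in>atoms_in l i. atom_set l j)"
proof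
  assume i: "i < length l"
  show "fst (l ! i) \<subseteq> (\<Union>j\<in>atoms_in l i. atom_set l j)"
  proof
    fix z assume z: "z \<in> fst (l ! i)"
    then have "i \<in> set_decode (atom l z)" using i by (simp add: set_decode_atom)
    moreover from this have "atom l z \<noteq> 0" by (intro notI) (simp add: set_decode_def)
    ultimately have "atom l z \<in> atoms_in l i" by (auto simp: atoms_in_def atoms_def)
    then show "z \<in> (\<Union>j\<in>atoms_in l i. atom_set l j)" by (auto simp: atom_set_def)
  qed
qed (use atom_set_subset in blast)

lemma atom_set_nonempty: "j \<in> atoms l \<Longrightarrow> atom_set l j \<noteq> {}"
  by (auto simp: atoms_def atom_set_def)

lemma disjoint_atom_sets: "disjoint_family_on (atom_set l) I"
  by (auto simp: disjoint_family_on_def atom_set_def)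

lemma atom_set_borel:
  assumes "l \<in> tests UNIV" "j \<in> atoms l"
  shows "atom_set l j \<in> sets borel" "bounded (atom_set l j)"
proof -
  have B: "fst (l ! i) \<in> sets borel" "bounded (fst (l ! i))" if "i < length l" for i
    using assms(1) nth_mem[OF that] by (auto simp: tests_def split_beta)
  obtain z0 where z0: "atom l z0 = j" "j \<noteq> 0" using assms(2) by (auto simp: atoms_def)
  have sub: "set_decode j \<subseteq> {..<length l}" unfolding z0(1)[symmetric] set_decode_atom by auto
  have "atom l z = j \<longleftrightarrow> (\<forall>i<length l. z \<in> fst (l ! i) \<longleftrightarrow> i \<in> set_decode j)" for z
  proof -
    have "atom l z = j \<longleftrightarrow> set_decode (atom l z) = set_decode j" by (metis set_decode_inverse)
    then show ?thesis using sub by (auto simp: set_decode_atom)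
  qed
  then have "atom_set l j = {z\<in>space borel. \<forall>i\<in>{..<length l}. z \<in> fst (l ! i) \<longleftrightarrow> i \<in> set_decode j}"
    by (auto simp: atom_set_def)
  also have "\<dots> \<in> sets borel"
  proof (rule sets.sets_Collect_finite_All)
    fix i assume "i \<in> {..<length l}"
    then have [measurable]: "fst (l ! i) \<in> sets borel" using B by simp
    show "{z \<in> space borel. z \<in> fst (l ! i) \<longleftrightarrow> i \<in> set_decode j} \<in> sets borel" by measurable
  qed simp
  finally show "atom_set l j \<in> sets borel" .
  have "set_decode j \<noteq> {}" using z0(2) by (metis set_decode_inverse set_encode_empty)
  then obtain i where "i \<in> set_decode j" by blast
  then have "atom_set l j \<subseteq> fst (l ! i)" "i < length l"
    using atom_set_subset[of j l i] assms(2) sub by (auto simp: atoms_in_def)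
  then show "bounded (atom_set l j)" using B bounded_subset by blast
qed

lemma card_atoms:
  assumes "l \<in> tests UNIV" "P \<in> LF" "i < length l"
  shows "card (P \<inter> fst (l ! i)) = (\<Sum>j\<in>atoms_in l i. card (P \<inter> atom_set l j))"
proof -
  have "P \<inter> fst (l ! i) = (\<Union>j\<in>atoms_in l i. P \<inter> atom_set l j)" using atoms_decompose[OF assms(3)] by blast
  also have "card \<dots> = (\<Sum>j\<in>atoms_in l i. card (P \<inter> atom_set l j))"
  proof (rule card_UN_disjoint)
    show "finite (atoms_in l i)" using finite_atoms[of l] by (simp add: atoms_in_def)
    show "\<forall>j\<in>atoms_in l i. finite (P \<inter> atom_set l j)"
      using assms(2) atom_set_borel[OF assms(1)] by (auto simp: LF_def atoms_in_def)
    show "\<forall>j\<in>atoms_in l i. \<forall>k\<in>atoms_in l i. j \<noteq> k \<longrightarrow> (P \<inter> atom_set l j) \<inter> (P \<inter> atom_set l k) = {}"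
      by (auto simp: atom_set_def)
  qed
  finally show ?thesis .
qed

lemma mem_cyl_set_nth: "P \<in> cyl_set l \<longleftrightarrow> P \<in> LF \<and> (\<forall>i<length l. card (P \<inter> fst (l ! i)) = snd (l ! i))"
  by (auto simp: cyl_set_def all_set_conv_all_nth split_beta)

lemma measurable_sum_components:
  assumes "finite A" "A \<subseteq> I"
  shows "(\<lambda>f. \<Sum>j\<in>A. f j) \<in> measurable (PiM I (\<lambda>_. count_space UNIV)) (count_space (UNIV :: nat set))"
  using assms
proof (induction A rule: finite_induct)
  case (insert a A)
  have "(\<lambda>f. (f a, \<Sum>j\<in>A. f j)) \<in>
      measurable (PiM I (\<lambda>_. count_space UNIV)) (count_space (UNIV :: nat set) \<Otimes>\<^sub>M count_space (UNIV :: nat set))"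
    using insert by (intro measurable_Pair measurable_component_singleton) auto
  then have "(\<lambda>f. (f a, \<Sum>j\<in>A. f j)) \<in>
      measurable (PiM I (\<lambda>_. count_space UNIV)) (count_space (UNIV :: (nat \<times> nat) set))"
    by (simp add: pair_measure_countable)
  from measurable_compose[OF this, of "\<lambda>p. fst p + snd p"] show ?case using insert by simp
qed simp

section \<open>Counts in disjoint regions: independence and moments\<close>

locale poisson = prob_space M for M :: "'a measure" +
  fixes \<omega> :: "'a \<Rightarrow> complex set"
  assumes pp: "poisson_pp M \<omega>"
begin

lemma omega_LF [simp]: "x \<in> space M \<Longrightarrow> \<omega> x \<in> LF"
  using pp by (auto simp: poisson_pp_def LF_def)

lemma count_rv: "B \<in> sets borel \<Longrightarrow> bounded B \<Longrightarrow> (\<lambda>x. card (\<omega> x \<inter> B)) \<in> measurable M (count_space UNIV)"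
  using pp by (simp add: poisson_pp_def)

lemma count_prob: "B \<in> sets borel \<Longrightarrow> bounded B \<Longrightarrow> prob {x\<in>space M. card (\<omega> x \<inter> B) = k}
     = (measure lborel B) ^ k / fact k * exp (- measure lborel B)"
  using pp by (simp add: poisson_pp_def)

lemma count_indep:
  assumes "finite (I :: nat set)" "\<And>i. i \<in> I \<Longrightarrow> B i \<in> sets borel" "\<And>i. i \<in> I \<Longrightarrow> bounded (B i)" "disjoint_family_on B I"
  shows "indep_vars (\<lambda>_. count_space UNIV) (\<lambda>i x. card (\<omega> x \<inter> B i)) I"
  using pp assms unfolding poisson_pp_def by (simp add: sets_lborel)

lemma omega_measurable [measurable]: "\<omega> \<in> measurable M (cfg D)"
  unfolding cfg_def
proof (rule measurable_measure_of)
  fix A assume "A \<in> cyl_set ` tests D"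
  then obtain l where l: "A = cyl_set l" "l \<in> tests D" by blast
  have "\<omega> -` A \<inter> space M = {x\<in>space M. \<forall>b\<in>set l. card (\<omega> x \<inter> fst b) = snd b}"
    by (auto simp: l(1) cyl_set_def split_beta)
  also have "\<dots> \<in> sets M"
  proof (rule sets.sets_Collect_finite_All)
    fix b assume "b \<in> set l"
    then have [measurable]: "(\<lambda>x. card (\<omega> x \<inter> fst b)) \<in> measurable M (count_space UNIV)"
      using l(2) by (intro count_rv) (auto simp: tests_def split_beta)
    show "{x \<in> space M. card (\<omega> x \<inter> fst b) = snd b} \<in> sets M" by measurable
  qed simp
  finally show "\<omega> -` A \<inter> space M \<in> sets M" .
qed (auto simp: cyl_set_def)

text \<open>The sets of both lists are cut into common atoms, whose counts are independent. Each
  nonempty atom lies in at most one of the two regions, so the two events depend on disjoint groups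
  of counts.\<close>

lemma indep_cyl_sets:
  assumes "D \<inter> D' = {}" "l \<in> tests D" "l' \<in> tests D'"
  shows "prob ({x\<in>space M. \<omega> x \<in> cyl_set l} \<inter> {x\<in>space M. \<omega> x \<in> cyl_set l'}) =
    prob {x\<in>space M. \<omega> x \<in> cyl_set l} * prob {x\<in>space M. \<omega> x \<in> cyl_set l'}"
proof -
  define ls where "ls = l @ l'"
  define N where "N = (\<lambda>j x. card (\<omega> x \<inter> atom_set ls j))"
  have ls: "ls \<in> tests UNIV" using assms by (auto simp: ls_def tests_def)
  have ind: "indep_vars (\<lambda>_. count_space UNIV) N (atoms ls)"
    unfolding N_def using finite_atoms atom_set_borel[OF ls] disjoint_atom_sets by (intro count_indep) auto
  have l_sub: "fst (l ! i) \<subseteq> D" if "i < length l" for i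
    using assms(2) nth_mem[OF that] by (auto simp: tests_def split_beta)
  have l'_sub: "fst (l' ! i) \<subseteq> D'" if "i < length l'" for i
    using assms(3) nth_mem[OF that] by (auto simp: tests_def split_beta)
  define I where "I = {j\<in>atoms ls. atom_set ls j \<subseteq> D}"
  define I' where "I' = {j\<in>atoms ls. atom_set ls j \<subseteq> D'}"
  have "I \<inter> I' = {}" using atom_set_nonempty[of _ ls] assms(1) by (auto simp: I_def I'_def)
  from indep_var_restrict[OF ind this] have ind2: "indep_var (PiM I (\<lambda>_. count_space UNIV)) (\<lambda>x. restrict (\<lambda>i. N i x) I)
      (PiM I' (\<lambda>_. count_space UNIV)) (\<lambda>x. restrict (\<lambda>i. N i x) I')"
    by (auto simp: I_def I'_def)
  have in_I: "atoms_in ls i \<subseteq> I" if "i < length l" for i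
    using atom_set_subset[of _ ls i] l_sub[OF that] that by (auto simp: I_def atoms_in_def ls_def nth_append)
  have in_I': "atoms_in ls (length l + i) \<subseteq> I'" if "i < length l'" for i
    using atom_set_subset[of _ ls "length l + i"] l'_sub[OF that] that by (auto simp: I'_def atoms_in_def ls_def nth_append)
  define S where "S = {f \<in> space (PiM I (\<lambda>_. count_space UNIV)). \<forall>i\<in>{..<length l}. (\<Sum>j\<in>atoms_in ls i. f j) = snd (l ! i)}"
  define S' where "S' = {f \<in> space (PiM I' (\<lambda>_. count_space UNIV)). \<forall>i\<in>{..<length l'}. (\<Sum>j\<in>atoms_in ls (length l + i). f j) = snd (l' ! i)}"
  have meas: "{f \<in> space (PiM I (\<lambda>_. count_space UNIV)). (\<Sum>j\<in>A. f j) = (k::nat)} \<in> sets (PiM I (\<lambda>_. count_space UNIV))"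
    if "A \<subseteq> I" "finite A" for A and I :: "nat set" and k
  proof -
    have [measurable]: "(\<lambda>f. \<Sum>j\<in>A. f j) \<in> measurable (PiM I (\<lambda>_. count_space UNIV)) (count_space (UNIV :: nat set))"
      using that by (intro measurable_sum_components)
    show ?thesis by measurable
  qed
  have fin: "finite (atoms_in ls i)" for i using finite_atoms[of ls] by (simp add: atoms_in_def)
  have "S \<in> sets (PiM I (\<lambda>_. count_space UNIV))"
    unfolding S_def using in_I fin by (intro sets.sets_Collect_finite_All meas) auto
  moreover have "S' \<in> sets (PiM I' (\<lambda>_. count_space UNIV))"
    unfolding S'_def using in_I' fin by (intro sets.sets_Collect_finite_All meas) auto
  ultimately have eq: "prob ((\<lambda>x. (restrict (\<lambda>i. N i x) I, restrict (\<lambda>i. N i x) I')) -` (S \<times> S') \<inter> space M) =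
      prob ((\<lambda>x. restrict (\<lambda>i. N i x) I) -` S \<inter> space M) * prob ((\<lambda>x. restrict (\<lambda>i. N i x) I') -` S' \<inter> space M)"
    by (rule indep_varD[OF ind2])
  have sum_eq: "(\<Sum>j\<in>A. restrict (\<lambda>i. N i x) I j) = (\<Sum>j\<in>A. N j x)" if "A \<subseteq> I" for A I x
    using that by (intro sum.cong) auto
  have "restrict (\<lambda>i. N i x) I \<in> S \<longleftrightarrow> \<omega> x \<in> cyl_set l" if "x \<in> space M" for x
  proof -
    have "(\<Sum>j\<in>atoms_in ls i. restrict (\<lambda>i. N i x) I j) = card (\<omega> x \<inter> fst (l ! i))" if "i < length l" for i
      using card_atoms[OF ls omega_LF[OF \<open>x \<in> space M\<close>], of i] that sum_eq[OF in_I[OF that]]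
      by (simp add: N_def ls_def nth_append)
    then show ?thesis using that by (simp add: S_def space_PiM mem_cyl_set_nth Ball_def)
  qed
  moreover have "restrict (\<lambda>i. N i x) I' \<in> S' \<longleftrightarrow> \<omega> x \<in> cyl_set l'" if "x \<in> space M" for x
  proof -
    have "(\<Sum>j\<in>atoms_in ls (length l + i). restrict (\<lambda>i. N i x) I' j) = card (\<omega> x \<inter> fst (l' ! i))" if "i < length l'" for i
      using card_atoms[OF ls omega_LF[OF \<open>x \<in> space M\<close>], of "length l + i"] that sum_eq[OF in_I'[OF that]]
      by (simp add: N_def ls_def nth_append)
    then show ?thesis using that by (simp add: S'_def space_PiM mem_cyl_set_nth Ball_def)
  qed
  ultimately have "(\<lambda>x. restrict (\<lambda>i. N i x) I) -` S \<inter> space M = {x\<in>space M. \<omega> x \<in> cyl_set l}"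
    "(\<lambda>x. restrict (\<lambda>i. N i x) I') -` S' \<inter> space M = {x\<in>space M. \<omega> x \<in> cyl_set l'}"
    "(\<lambda>x. (restrict (\<lambda>i. N i x) I, restrict (\<lambda>i. N i x) I')) -` (S \<times> S') \<inter> space M =
      {x\<in>space M. \<omega> x \<in> cyl_set l} \<inter> {x\<in>space M. \<omega> x \<in> cyl_set l'}" by auto
  with eq show ?thesis by simp
qed

text \<open>The cylinder events are stable under intersection, so their independence passes to the
  generated sigma-algebras.\<close>

lemma cfg_indep:
  assumes "D \<inter> D' = {}" shows "indep_var (cfg D) \<omega> (cfg D') \<omega>"
proof -
  define G where "G = (\<lambda>D. (\<lambda>l. {x\<in>space M. \<omega> x \<in> cyl_set l}) ` tests D)"
  have stable: "Int_stable (G D)" for D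
  proof -
    have "{x\<in>space M. \<omega> x \<in> cyl_set l} \<inter> {x\<in>space M. \<omega> x \<in> cyl_set l'} \<in> G D"
      if "l \<in> tests D" "l' \<in> tests D" for l l'
      unfolding G_def using that by (intro image_eqI[of _ _ "l @ l'"]) (auto simp: cyl_set_def tests_def ball_Un)
    then show ?thesis by (auto simp: Int_stable_def G_def)
  qed
  have ev: "G D \<subseteq> events" for D
  proof
    fix A assume "A \<in> G D"
    then obtain l where l: "l \<in> tests D" "A = {x\<in>space M. \<omega> x \<in> cyl_set l}" by (auto simp: G_def)
    have [measurable]: "cyl_set l \<in> sets (cfg D)" by (rule cyl_set_in_cfg[OF l(1)])
    show "A \<in> events" unfolding l(2) by measurable
  qed
  have "indep_set (G D) (G D')"
    using indep_cyl_sets[OF assms] ev by (intro indep_setI) (auto simp: G_def)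
  then have ind: "indep_set (sigma_sets (space M) (G D)) (sigma_sets (space M) (G D'))"
    by (intro indep_set_sigma_sets stable)
  have "{\<omega> -` A \<inter> space M |A. A \<in> sets (cfg D)} \<subseteq> sigma_sets (space M) (G D)" for D
  proof -
    have sp: "G D \<subseteq> Pow (space M)" by (auto simp: G_def)
    have "\<omega> \<in> measurable (sigma (space M) (G D)) (cfg D)"
      unfolding cfg_def
    proof (rule measurable_measure_of)
      show "\<omega> \<in> space (sigma (space M) (G D)) \<rightarrow> LF" using sp by simp
      fix A assume "A \<in> cyl_set ` tests D"
      then obtain l where l: "A = cyl_set l" "l \<in> tests D" by blast
      have "\<omega> -` A \<inter> space M = {x\<in>space M. \<omega> x \<in> cyl_set l}" by (auto simp: l)
      then have "\<omega> -` A \<inter> space M \<in> G D" using l(2) by (auto simp: G_def)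
      then show "\<omega> -` A \<inter> space (sigma (space M) (G D)) \<in> sets (sigma (space M) (G D))"
        using sp by (simp add: sigma_sets.Basic)
    qed (auto simp: cyl_set_def)
    from measurable_sets[OF this] have "\<omega> -` A \<inter> space M \<in> sigma_sets (space M) (G D)" if "A \<in> sets (cfg D)" for A
      using that sp by simp
    then show ?thesis by blast
  qed
  then have "sigma_sets (space M) {\<omega> -` A \<inter> space M |A. A \<in> sets (cfg D)} \<subseteq> sigma_sets (space M) (G D)" for D
    by (intro sigma_sets_mono) auto
  then have "indep_set (sigma_sets (space M) {\<omega> -` A \<inter> space M |A. A \<in> sets (cfg D)})
      (sigma_sets (space M) {\<omega> -` A \<inter> space M |A. A \<in> sets (cfg D')})"
    unfolding indep_set_def
    by (intro indep_sets_mono_sets[OF ind[unfolded indep_set_def]]) (simp split: bool.split)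
  then show ?thesis unfolding indep_var_eq by simp
qed

lemma cfg_indep_prob:
  assumes "D \<inter> D' = {}" "E \<in> sets (cfg D)" "E' \<in> sets (cfg D')"
  shows "prob {x\<in>space M. \<omega> x \<in> E \<and> \<omega> x \<in> E'} = prob {x\<in>space M. \<omega> x \<in> E} * prob {x\<in>space M. \<omega> x \<in> E'}"
proof -
  have "(\<lambda>x. (\<omega> x, \<omega> x)) -` (E \<times> E') \<inter> space M = {x\<in>space M. \<omega> x \<in> E \<and> \<omega> x \<in> E'}"
    "\<omega> -` E \<inter> space M = {x\<in>space M. \<omega> x \<in> E}" "\<omega> -` E' \<inter> space M = {x\<in>space M. \<omega> x \<in> E'}" by auto
  then show ?thesis using indep_varD[OF cfg_indep[OF assms(1)] assms(2,3)] by simp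
qed

lemma count_distr:
  assumes "B \<in> sets borel" "bounded B"
  shows "distr M (count_space UNIV) (\<lambda>x. card (\<omega> x \<inter> B)) =
    density (count_space UNIV) (\<lambda>k. ennreal ((measure lborel B) ^ k / fact k * exp (- measure lborel B)))"
proof (rule measure_eqI_countable[of _ UNIV])
  fix k :: nat
  have [measurable]: "(\<lambda>x. card (\<omega> x \<inter> B)) \<in> measurable M (count_space UNIV)" using count_rv assms by simp
  have "emeasure (distr M (count_space UNIV) (\<lambda>x. card (\<omega> x \<inter> B))) {k} = emeasure M {x\<in>space M. card (\<omega> x \<inter> B) = k}"
    by (subst emeasure_distr) (auto intro!: arg_cong[where f="emeasure M"])
  also have "\<dots> = ennreal ((measure lborel B) ^ k / fact k * exp (- measure lborel B))"
    by (simp add: emeasure_eq_measure count_prob assms)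
  finally show "emeasure (distr M (count_space UNIV) (\<lambda>x. card (\<omega> x \<inter> B))) {k} =
    emeasure (density (count_space UNIV) (\<lambda>k. ennreal ((measure lborel B) ^ k / fact k * exp (- measure lborel B)))) {k}"
    by (simp add: emeasure_density nn_integral_count_space_indicator nn_integral_indicator_singleton)
qed auto

lemma count_integral:
  fixes f :: "nat \<Rightarrow> real"
  assumes "B \<in> sets borel" "bounded B" "\<And>k. f k \<ge> 0"
    and "(\<lambda>k. (measure lborel B) ^ k / fact k * exp (- measure lborel B) * f k) sums v"
  shows "integrable M (\<lambda>x. f (card (\<omega> x \<inter> B)))" "expectation (\<lambda>x. f (card (\<omega> x \<inter> B))) = v"
proof -
  have [measurable]: "(\<lambda>x. card (\<omega> x \<inter> B)) \<in> measurable M (count_space UNIV)" using count_rv assms by simp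
  define p where "p = (\<lambda>k. (measure lborel B) ^ k / fact k * exp (- measure lborel B))"
  have p: "p k \<ge> 0" for k by (simp add: p_def)
  have "(\<integral>\<^sup>+x. ennreal (f (card (\<omega> x \<inter> B))) \<partial>M) =
      (\<integral>\<^sup>+k. ennreal (f k) \<partial>distr M (count_space UNIV) (\<lambda>x. card (\<omega> x \<inter> B)))"
    by (subst nn_integral_distr) auto
  also have "\<dots> = (\<integral>\<^sup>+k. ennreal (p k) * ennreal (f k) \<partial>count_space UNIV)"
    unfolding count_distr[OF assms(1,2)] p_def by (subst nn_integral_density) auto
  also have "\<dots> = (\<Sum>k. ennreal (p k * f k))"
    by (subst nn_integral_count_space_nat) (simp add: ennreal_mult p assms(3))
  also have "\<dots> = ennreal v"
  proof (rule suminf_ennreal_eq)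
    show "(\<lambda>k. p k * f k) sums v" using assms(4) unfolding p_def .
  qed (simp add: p assms(3))
  finally have *: "(\<integral>\<^sup>+x. ennreal (f (card (\<omega> x \<inter> B))) \<partial>M) = ennreal v" .
  have "v \<ge> 0" using assms(3,4) p unfolding p_def[symmetric] by (intro sums_le[OF _ sums_zero assms(4)[folded p_def]]) auto
  then show "integrable M (\<lambda>x. f (card (\<omega> x \<inter> B)))" "expectation (\<lambda>x. f (card (\<omega> x \<inter> B))) = v"
    using * nn_integral_eq_integrable[of "\<lambda>x. f (card (\<omega> x \<inter> B))" M v] assms(3) by auto
qed

text \<open>Factorial moments are used because with weights \<open>k\<close> and
  \<open>k * (k - 1)\<close> the Poisson series reproduces itself under an index shift. The second
  one bounds the effect of cells holding several points.\<close>

lemma count_moments: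
  assumes "B \<in> sets borel" "bounded B"
  defines "r \<equiv> measure lborel B"
  shows "integrable M (\<lambda>x. real (card (\<omega> x \<inter> B)))" "expectation (\<lambda>x. real (card (\<omega> x \<inter> B))) = r"
    "integrable M (\<lambda>x. real (card (\<omega> x \<inter> B)) * (real (card (\<omega> x \<inter> B)) - 1))"
    "expectation (\<lambda>x. real (card (\<omega> x \<inter> B)) * (real (card (\<omega> x \<inter> B)) - 1)) = r\<^sup>2"
proof -
  have 0: "(\<lambda>k. r ^ k / fact k * exp (- r)) sums 1"
    using sums_mult2[OF exp_converges[of r], of "exp (- r)"] by (simp add: divide_inverse mult_ac exp_minus)
  have "(\<lambda>k. r ^ Suc k / fact (Suc k) * exp (- r) * real (Suc k)) = (\<lambda>k. r * (r ^ k / fact k * exp (- r)))"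
    unfolding fact_Suc power_Suc by (simp add: fun_eq_iff del: of_nat_Suc)
  then have "(\<lambda>k. r ^ Suc k / fact (Suc k) * exp (- r) * real (Suc k)) sums (r * 1)" using sums_mult[OF 0, of r] by simp
  then have 1: "(\<lambda>k. r ^ k / fact k * exp (- r) * real k) sums r"
    using sums_Suc_iff[of "\<lambda>k. r ^ k / fact k * exp (- r) * real k" r] by simp
  have "(\<lambda>k. r ^ Suc k / fact (Suc k) * exp (- r) * (real (Suc k) * (real (Suc k) - 1))) = (\<lambda>k. r * (r ^ k / fact k * exp (- r) * real k))"
    unfolding fact_Suc power_Suc by (auto simp: fun_eq_iff simp del: of_nat_Suc)
  then have "(\<lambda>k. r ^ Suc k / fact (Suc k) * exp (- r) * (real (Suc k) * (real (Suc k) - 1))) sums (r * r)"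
    using sums_mult[OF 1, of r] by simp
  then have 2: "(\<lambda>k. r ^ k / fact k * exp (- r) * (real k * (real k - 1))) sums r\<^sup>2"
    using sums_Suc_iff[of "\<lambda>k. r ^ k / fact k * exp (- r) * (real k * (real k - 1))" "r * r"] by (simp add: power2_eq_square)
  have nn: "0 \<le> real k * (real k - 1)" for k by (cases k) auto
  show "integrable M (\<lambda>x. real (card (\<omega> x \<inter> B)))" "expectation (\<lambda>x. real (card (\<omega> x \<inter> B))) = r"
    using count_integral[OF assms(1,2), of real r] 1 by (auto simp: r_def)
  show "integrable M (\<lambda>x. real (card (\<omega> x \<inter> B)) * (real (card (\<omega> x \<inter> B)) - 1))"
    "expectation (\<lambda>x. real (card (\<omega> x \<inter> B)) * (real (card (\<omega> x \<inter> B)) - 1)) = r\<^sup>2"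
    using count_integral[OF assms(1,2), of "\<lambda>k. real k * (real k - 1)" "r\<^sup>2"] 2 nn by (auto simp: r_def)
qed

lemma prob_nonempty:
  assumes "B \<in> sets borel" "bounded B"
  shows "prob {x\<in>space M. card (\<omega> x \<inter> B) \<noteq> 0} = 1 - exp (- measure lborel B)"
proof -
  have [measurable]: "(\<lambda>x. card (\<omega> x \<inter> B)) \<in> measurable M (count_space UNIV)" using count_rv assms by simp
  have "prob {x\<in>space M. \<not> card (\<omega> x \<inter> B) = 0} = 1 - prob {x\<in>space M. card (\<omega> x \<inter> B) = 0}"
    by (intro prob_neg) measurable
  then show ?thesis using count_prob[OF assms, of 0] by simp
qed

lemma prob_nonempty_le:
  assumes "B \<in> sets borel" "bounded B"
  shows "prob {x\<in>space M. card (\<omega> x \<inter> B) \<noteq> 0} \<le> measure lborel B"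
  using prob_nonempty[OF assms] exp_ge_add_one_self[of "- measure lborel B"] by simp

lemma prob_all_nonempty_le:
  assumes "distinct is" "\<And>i. i \<in> set is \<Longrightarrow> B i \<in> sets borel" "\<And>i. i \<in> set is \<Longrightarrow> bounded (B i)"
    "disjoint_family_on B (set is)" 
  shows "prob {x\<in>space M. \<forall>i\<in>set is. card (\<omega> x \<inter> B i) \<noteq> 0} \<le> (\<Prod>i\<leftarrow>is. measure lborel (B i))"
  using assms
proof (induction "is")
  case Nil
  then show ?case by simp
next
  case (Cons i "is")
  define U where "U = (\<Union>j\<in>set is. B j)"
  have disj: "B i \<inter> U = {}" using Cons.prems by (force simp: U_def disjoint_family_on_def)
  have E: "{P\<in>LF. card (P \<inter> B i) \<noteq> 0} \<in> sets (cfg (B i))"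
  proof -
    have "(\<lambda>P. card (P \<inter> B i)) \<in> measurable (cfg (B i)) (count_space UNIV)"
      using Cons.prems by (intro count_measurable_cfg) auto
    then have "{P\<in>space (cfg (B i)). card (P \<inter> B i) \<noteq> 0} \<in> sets (cfg (B i))" by measurable
    then show ?thesis by simp
  qed
  have "{P\<in>space (cfg U). \<forall>j\<in>set is. card (P \<inter> B j) \<noteq> 0} \<in> sets (cfg U)"
  proof (rule sets.sets_Collect_finite_All)
    fix j assume "j \<in> set is"
    then have "(\<lambda>P. card (P \<inter> B j)) \<in> measurable (cfg U) (count_space UNIV)"
      using Cons.prems by (intro count_measurable_cfg) (auto simp: U_def)
    then show "{P\<in>space (cfg U). card (P \<inter> B j) \<noteq> 0} \<in> sets (cfg U)" by measurable
  qed simp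
  then have E': "{P\<in>LF. \<forall>j\<in>set is. card (P \<inter> B j) \<noteq> 0} \<in> sets (cfg U)" by simp
  have "prob {x\<in>space M. \<forall>j\<in>set (i # is). card (\<omega> x \<inter> B j) \<noteq> 0} =
      prob {x\<in>space M. \<omega> x \<in> {P\<in>LF. card (P \<inter> B i) \<noteq> 0} \<and> \<omega> x \<in> {P\<in>LF. \<forall>j\<in>set is. card (P \<inter> B j) \<noteq> 0}}"
    by (intro arg_cong[where f=prob]) auto
  also have "\<dots> = prob {x\<in>space M. \<omega> x \<in> {P\<in>LF. card (P \<inter> B i) \<noteq> 0}} *
      prob {x\<in>space M. \<omega> x \<in> {P\<in>LF. \<forall>j\<in>set is. card (P \<inter> B j) \<noteq> 0}}"
    by (rule cfg_indep_prob[OF disj E E'])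
  also have "\<dots> = prob {x\<in>space M. card (\<omega> x \<inter> B i) \<noteq> 0} * prob {x\<in>space M. \<forall>j\<in>set is. card (\<omega> x \<inter> B j) \<noteq> 0}"
    by (intro arg_cong2[where f="(*)"] arg_cong[where f=prob]) auto
  also have "\<dots> \<le> measure lborel (B i) * (\<Prod>j\<leftarrow>is. measure lborel (B j))"
    using Cons by (intro mult_mono prob_nonempty_le Cons.IH) (auto simp: disjoint_family_on_def)
  finally show ?case by simp
qed

end

text \<open>Counts in atoms are independent Poisson variables with the areas as parameters, which
  fixes all probabilities on an intersection-stable generator. The application is to a process and
  its rotated copy.\<close>

lemma poisson_law_unique:
  assumes "poisson M \<omega>" "poisson M \<omega>'"
  shows "distr M (cfg UNIV) \<omega> = distr M (cfg UNIV) \<omega>'"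
proof -
  interpret W: poisson M \<omega> by fact
  interpret W': poisson M \<omega>' by fact
  have *: "measure M {x\<in>space M. \<omega> x \<in> cyl_set l} = measure M {x\<in>space M. \<omega>' x \<in> cyl_set l}" if l: "l \<in> tests UNIV" for l
  \<comment> \<open>The characterization of independence by a product law in the second case
    requires a nonempty index set.\<close>
  proof (cases "atoms l = {}")
    case True
    have "fst (l ! i) = {}" if "i < length l" for i
      using atoms_decompose[OF that] True by (auto simp: atoms_in_def)
    then have "P \<in> cyl_set l \<longleftrightarrow> (\<forall>i<length l. 0 = snd (l ! i))" if "P \<in> LF" for P
      using that by (auto simp: mem_cyl_set_nth)
    then have "{x\<in>space M. \<omega> x \<in> cyl_set l} = {x\<in>space M. \<omega>' x \<in> cyl_set l}" by auto
    then show ?thesis by simp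
  next
    case False
    let ?I = "atoms l" and ?C = "\<lambda>_::nat. count_space (UNIV :: nat set)"
    define N where "N = (\<lambda>j x. card (\<omega> x \<inter> atom_set l j))"
    define N' where "N' = (\<lambda>j x. card (\<omega>' x \<inter> atom_set l j))"
    have [measurable]: "N j \<in> measurable M (count_space UNIV)" "N' j \<in> measurable M (count_space UNIV)" if "j \<in> ?I" for j
      unfolding N_def N'_def using that atom_set_borel[OF l] by (auto intro: W.count_rv W'.count_rv)
    have ind: "W.indep_vars ?C N ?I" "W.indep_vars ?C N' ?I"
      unfolding N_def N'_def
      using W.count_indep[OF finite_atoms _ _ disjoint_atom_sets] W'.count_indep[OF finite_atoms _ _ disjoint_atom_sets]
        atom_set_borel[OF l] by blast+
    have "distr M (count_space UNIV) (N j) = distr M (count_space UNIV) (N' j)" if "j \<in> ?I" for j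
      unfolding N_def N'_def using W.count_distr W'.count_distr atom_set_borel[OF l that] by simp
    then have eq: "distr M (PiM ?I ?C) (\<lambda>x. \<lambda>i\<in>?I. N i x) = distr M (PiM ?I ?C) (\<lambda>x. \<lambda>i\<in>?I. N' i x)"
      using ind W.indep_vars_iff_distr_eq_PiM'[OF False, where M'="?C" and X=N]
        W.indep_vars_iff_distr_eq_PiM'[OF False, where M'="?C" and X=N']
      by (simp cong: PiM_cong)
    define S where "S = {f \<in> space (PiM ?I ?C). \<forall>i\<in>{..<length l}. (\<Sum>j\<in>atoms_in l i. f j) = snd (l ! i)}"
    have fin: "finite (atoms_in l i)" for i using finite_atoms[of l] by (simp add: atoms_in_def)
    have S: "S \<in> sets (PiM ?I ?C)"
      unfolding S_def
    proof (rule sets.sets_Collect_finite_All)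
      fix i
      have "(\<lambda>f. \<Sum>j\<in>atoms_in l i. f j) \<in> measurable (PiM ?I ?C) (count_space (UNIV :: nat set))"
        using fin by (intro measurable_sum_components) (auto simp: atoms_in_def)
      then show "{f \<in> space (PiM ?I ?C). (\<Sum>j\<in>atoms_in l i. f j) = snd (l ! i)} \<in> sets (PiM ?I ?C)" by measurable
    qed simp
    have char: "restrict (\<lambda>j. card (P \<inter> atom_set l j)) ?I \<in> S \<longleftrightarrow> P \<in> cyl_set l" if "P \<in> LF" for P
    proof -
      have "(\<Sum>j\<in>atoms_in l i. restrict (\<lambda>j. card (P \<inter> atom_set l j)) ?I j) = card (P \<inter> fst (l ! i))" if "i < length l" for i
        unfolding card_atoms[OF l \<open>P \<in> LF\<close> that] by (intro sum.cong) (auto simp: atoms_in_def)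
      then show ?thesis using that by (simp add: S_def space_PiM mem_cyl_set_nth Ball_def)
    qed
    have m: "(\<lambda>x. \<lambda>i\<in>?I. N i x) \<in> measurable M (PiM ?I ?C)" "(\<lambda>x. \<lambda>i\<in>?I. N' i x) \<in> measurable M (PiM ?I ?C)"
      by (intro measurable_restrict; simp)+
    have "measure M {x\<in>space M. \<omega> x \<in> cyl_set l} = measure (distr M (PiM ?I ?C) (\<lambda>x. \<lambda>i\<in>?I. N i x)) S"
      unfolding measure_distr[OF m(1) S] using char W.omega_LF by (intro arg_cong[where f="measure M"]) (auto simp: N_def)
    also have "\<dots> = measure M {x\<in>space M. \<omega>' x \<in> cyl_set l}"
      unfolding eq measure_distr[OF m(2) S] using char W'.omega_LF by (intro arg_cong[where f="measure M"]) (auto simp: N'_def)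
    finally show ?thesis .
  qed
  show ?thesis
  proof (rule measure_eqI_generator_eq[OF Int_stable_cyl[of UNIV], where \<Omega>=LF and A="\<lambda>_. LF"])
    show "cyl_set ` tests UNIV \<subseteq> Pow LF" by (auto simp: cyl_set_def)
    fix X assume "X \<in> cyl_set ` tests UNIV"
    then obtain l where l: "l \<in> tests UNIV" "X = cyl_set l" by blast
    have X: "X \<in> sets (cfg UNIV)" unfolding l(2) by (rule cyl_set_in_cfg[OF l(1)])
    have "\<omega> -` X \<inter> space M = {x\<in>space M. \<omega> x \<in> cyl_set l}" "\<omega>' -` X \<inter> space M = {x\<in>space M. \<omega>' x \<in> cyl_set l}"
      by (auto simp: l)
    then show "emeasure (distr M (cfg UNIV) \<omega>) X = emeasure (distr M (cfg UNIV) \<omega>') X"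
      using X *[OF l(1)] by (simp add: emeasure_distr W.emeasure_eq_measure)
  next
    show "range (\<lambda>_. LF) \<subseteq> cyl_set ` tests UNIV"
      by (auto simp: cyl_set_def tests_def image_iff intro!: exI[of _ "[]"])
    interpret D: prob_space "distr M (cfg UNIV) \<omega>" by (rule W.prob_space_distr) simp
    show "emeasure (distr M (cfg UNIV) \<omega>) LF \<noteq> \<infinity>" by simp
  qed (auto simp: sets_cfg)
qed

section \<open>Chains grow at most linearly\<close>

text \<open>Union bound over the chains of occupied cells of a grid; a cell is occupied with probability at most
  its area \<open>1 / 4 ^ m\<close>. Subtracting 2 makes \<open>gdist\<close> a lower bound for the distance of points of
  the two cells.\<close>

definition gdist :: "nat \<Rightarrow> int \<times> int \<Rightarrow> int \<times> int \<Rightarrow> real" where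
  "gdist m i j = (real_of_int \<bar>fst i - fst j\<bar> + real_of_int \<bar>snd i - snd j\<bar> - 2) / (2 * 2 ^ m)"

fun glen :: "nat \<Rightarrow> int \<times> int \<Rightarrow> (int \<times> int) list \<Rightarrow> real" where
  "glen m i [] = 0"
| "glen m i (c # cs) = gdist m i c + glen m c cs"

text \<open>The bound for the probability that all cells are occupied, times the exponential
  Chebyshev factor \<open>exp (k - 64 * glen)\<close>. As a product over legs it can be summed like
  powers of a transfer matrix.\<close>

fun gweight :: "nat \<Rightarrow> int \<times> int \<Rightarrow> (int \<times> int) list \<Rightarrow> real" where
  "gweight m i [] = 1"
| "gweight m i (c # cs) = 1 / 4 ^ m * exp (1 - 64 * gdist m i c) * gweight m c cs"

lemma gdist_le_dist:
  assumes "x \<in> cell m i" "y \<in> cell m j"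
  shows "gdist m i j \<le> dist x y"
proof -
  have "\<lfloor>2 ^ m * Re x\<rfloor> = fst i" "\<lfloor>2 ^ m * Im x\<rfloor> = snd i" "\<lfloor>2 ^ m * Re y\<rfloor> = fst j" "\<lfloor>2 ^ m * Im y\<rfloor> = snd j"
    using assms by (auto simp: cell_def cidx_def)
  then have "real_of_int \<bar>fst i - fst j\<bar> - 1 \<le> \<bar>2 ^ m * Re x - 2 ^ m * Re y\<bar>"
    "real_of_int \<bar>snd i - snd j\<bar> - 1 \<le> \<bar>2 ^ m * Im x - 2 ^ m * Im y\<bar>" by linarith+
  moreover have "\<bar>2 ^ m * Re x - 2 ^ m * Re y\<bar> = 2 ^ m * \<bar>Re (x - y)\<bar>"
    "\<bar>2 ^ m * Im x - 2 ^ m * Im y\<bar> = 2 ^ m * \<bar>Im (x - y)\<bar>"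
    by (simp_all add: abs_mult flip: right_diff_distrib)
  moreover have "2 ^ m * \<bar>Re (x - y)\<bar> \<le> 2 ^ m * dist x y" "2 ^ m * \<bar>Im (x - y)\<bar> \<le> 2 ^ m * dist x y"
    using abs_Re_le_cmod[of "x - y"] abs_Im_le_cmod[of "x - y"] by (simp_all add: dist_norm)
  ultimately have "real_of_int \<bar>fst i - fst j\<bar> - 1 \<le> 2 ^ m * dist x y"
    "real_of_int \<bar>snd i - snd j\<bar> - 1 \<le> 2 ^ m * dist x y" by linarith+
  then have "real_of_int \<bar>fst i - fst j\<bar> + real_of_int \<bar>snd i - snd j\<bar> - 2 \<le> dist x y * (2 * 2 ^ m)"
    by (simp only: mult_ac)
  then show ?thesis by (simp add: gdist_def divide_le_eq)
qed

lemma glen_le_plen: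
  assumes "list_all2 (\<lambda>p c. p \<in> cell m c) ps cs" "x \<in> cell m i"
  shows "glen m i cs \<le> plen x ps"
  using assms by (induction ps cs arbitrary: x i rule: list_all2_induct) (auto intro: add_mono gdist_le_dist)

lemma gweight_eq: "gweight m i cs = (1 / 4 ^ m) ^ length cs * exp (length cs - 64 * glen m i cs)"
proof (induction cs arbitrary: i)
  case (Cons c cs)
  have "exp (real (length (c # cs)) - 64 * glen m i (c # cs)) =
      exp (1 - 64 * gdist m i c) * exp (length cs - 64 * glen m c cs)"
    by (simp add: exp_add[symmetric] algebra_simps)
  then show ?case using Cons[of c] by simp
qed simp

lemma sum_exp_int_le:
  assumes "finite A" "k > 0"
  shows "(\<Sum>a\<in>A. exp (- (k * real_of_int \<bar>i - a\<bar>))) \<le> 2 * (1 + k) / k"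
proof -
  let ?f = "\<lambda>a. exp (- (k * real_of_int \<bar>i - a\<bar>))"
  define N where "N = Suc (nat (Max (insert 0 ((\<lambda>a. \<bar>i - a\<bar>) ` A))))"
  define r where "r = exp (- k)"
  have r: "0 < r" "r < 1" using assms by (auto simp: r_def)
  have sub: "A \<subseteq> (\<lambda>n. i + int n) ` {..<N} \<union> (\<lambda>n. i - int n) ` {..<N}"
  proof
    fix a assume a: "a \<in> A"
    have "\<bar>i - a\<bar> \<le> Max (insert 0 ((\<lambda>a. \<bar>i - a\<bar>) ` A))" using assms(1) a by (intro Max_ge) auto
    then have "nat \<bar>i - a\<bar> < N" by (simp add: N_def)
    then show "a \<in> (\<lambda>n. i + int n) ` {..<N} \<union> (\<lambda>n. i - int n) ` {..<N}"
      by (cases "i \<le> a") (auto simp: image_iff intro!: bexI[of _ "nat \<bar>i - a\<bar>"])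
  qed
  have geo: "(\<Sum>n<N. r ^ n) \<le> 1 / (1 - r)"
    using r by (simp add: sum_gp_strict divide_right_mono)
  have pw: "exp (- (k * real n)) = r ^ n" for n
    by (simp add: r_def exp_of_nat_mult[symmetric] mult.commute)
  have "sum ?f A \<le> sum ?f ((\<lambda>n. i + int n) ` {..<N} \<union> (\<lambda>n. i - int n) ` {..<N})"
    using sub by (intro sum_mono2) auto
  also have "\<dots> \<le> sum ?f ((\<lambda>n. i + int n) ` {..<N}) + sum ?f ((\<lambda>n. i - int n) ` {..<N})"
    by (subst sum_Un) (auto intro!: sum_nonneg)
  also have "sum ?f ((\<lambda>n. i + int n) ` {..<N}) = (\<Sum>n<N. r ^ n)"
    by (subst sum.reindex) (auto simp: inj_on_def pw)
  also have "sum ?f ((\<lambda>n. i - int n) ` {..<N}) = (\<Sum>n<N. r ^ n)"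
    by (subst sum.reindex) (auto simp: inj_on_def pw)
  also have "(\<Sum>n<N. r ^ n) + (\<Sum>n<N. r ^ n) \<le> 2 * (1 / (1 - r))" using geo by simp
  also have "1 / (1 - r) \<le> (1 + k) / k"
  proof -
    have "1 + k \<le> exp k" by (rule exp_ge_add_one_self)
    then have "r * (1 + k) \<le> 1" using assms by (simp add: r_def exp_minus field_simps)
    then have "k \<le> (1 + k) * (1 - r)" by (simp add: algebra_simps)
    then show ?thesis using r assms by (simp add: field_simps)
  qed
  finally show ?thesis by simp
qed

text \<open>The distance adds over coordinates, so the sum factorizes. The rate 64 makes each
  one-dimensional sum at most 1/4, once \<open>m \<ge> 6\<close> gives \<open>k \<le> 1/2\<close>;
  the factor \<open>exp 1 \<le> 3\<close> is then affordable. A row sum of 1/2 leads to geometric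
  decay in the number of points.\<close>

lemma gweight_row_le:
  assumes "finite C" "m \<ge> 6"
  shows "(\<Sum>c\<in>C. 1 / 4 ^ m * exp (1 - 64 * gdist m i c)) \<le> 1 / 2"
proof -
  define h :: real where "h = 1 / 2 ^ m"
  define k where "k = 32 * h"
  have "(2::real) ^ 6 \<le> 2 ^ m" using assms(2) by (intro power_increasing) auto
  then have k: "0 < k" "k \<le> 1 / 2" by (auto simp: k_def h_def field_simps)
  define f where "f = (\<lambda>i a. h * exp (k - k * real_of_int \<bar>i - a\<bar>))"
  have row: "(\<Sum>a\<in>A. f i a) \<le> 1 / 4" if "finite A" for A i
  proof -
    have "(\<Sum>a\<in>A. f i a) = h * exp k * (\<Sum>a\<in>A. exp (- (k * real_of_int \<bar>i - a\<bar>)))"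
      by (simp add: f_def sum_distrib_left exp_diff exp_minus field_simps)
    also have "\<dots> \<le> h * exp k * (2 * (1 + k) / k)"
      using sum_exp_int_le[OF that k(1)] by (intro mult_left_mono) (auto simp: h_def)
    also have "\<dots> = exp k * (1 + k) / 16" using k by (simp add: k_def)
    also have "\<dots> \<le> 2 * 2 / 16"
    proof -
      have "exp k \<le> exp (1 / 2)" using k by simp
      also have "\<dots> \<le> 2" by (rule exp_half_le2)
      finally show ?thesis using k by (intro divide_right_mono mult_mono) auto
    qed
    finally show ?thesis by simp
  qed
  have "1 / 4 ^ m * exp (1 - 64 * gdist m i c) = exp 1 * (f (fst i) (fst c) * f (snd i) (snd c))" for c
  proof -
    have "64 * gdist m i c = k * real_of_int \<bar>fst i - fst c\<bar> + k * real_of_int \<bar>snd i - snd c\<bar> - 2 * k"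
      by (simp add: gdist_def k_def h_def field_simps)
    then have "exp (1 - 64 * gdist m i c) =
        exp 1 * (exp (k - k * real_of_int \<bar>fst i - fst c\<bar>) * exp (k - k * real_of_int \<bar>snd i - snd c\<bar>))"
      by (simp add: exp_add[symmetric])
    moreover have "1 / 4 ^ m = h * h" by (simp add: h_def power_mult_distrib[symmetric])
    ultimately show ?thesis by (simp add: f_def)
  qed
  then have "(\<Sum>c\<in>C. 1 / 4 ^ m * exp (1 - 64 * gdist m i c)) = exp 1 * (\<Sum>c\<in>C. f (fst i) (fst c) * f (snd i) (snd c))"
    by (simp add: sum_distrib_left)
  also have "(\<Sum>c\<in>C. f (fst i) (fst c) * f (snd i) (snd c)) \<le>
      (\<Sum>c\<in>fst ` C \<times> snd ` C. f (fst i) (fst c) * f (snd i) (snd c))"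
  proof (rule sum_mono2)
    show "finite (fst ` C \<times> snd ` C)" using assms(1) by simp
    show "C \<subseteq> fst ` C \<times> snd ` C" by (force simp: image_iff)
    show "0 \<le> f (fst i) (fst c) * f (snd i) (snd c)" for c by (simp add: f_def h_def)
  qed
  also have "\<dots> = (\<Sum>a\<in>fst ` C. f (fst i) a) * (\<Sum>b\<in>snd ` C. f (snd i) b)"
    by (simp add: sum_product sum.cartesian_product split_beta)
  also have "\<dots> \<le> 1 / 4 * (1 / 4)"
    using assms(1) by (intro mult_mono row sum_nonneg) (auto simp: f_def h_def)
  also have "exp 1 * (1 / 4 * (1 / 4)) \<le> (1 / 2 :: real)" using exp_le by simp
  finally show ?thesis by simp
qed

lemma gweight_sum_le:
  assumes "finite C" "m \<ge> 6"
  shows "(\<Sum>cs\<in>{cs. set cs \<subseteq> C \<and> length cs = k}. gweight m i cs) \<le> (1 / 2) ^ k"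
proof (induction k arbitrary: i)
  case 0
  have "{cs. set cs \<subseteq> C \<and> length cs = 0} = {[]}" by auto
  then show ?case by simp
next
  case (Suc k)
  let ?A = "\<lambda>k. {cs. set cs \<subseteq> C \<and> length cs = k}"
  have nn: "0 \<le> 1 / 4 ^ m * exp (1 - 64 * gdist m i c)" for c by simp
  have "?A (Suc k) = (\<lambda>(c, cs). c # cs) ` (C \<times> ?A k)" by (auto simp: image_iff length_Suc_conv)
  then have "(\<Sum>cs\<in>?A (Suc k). gweight m i cs) = (\<Sum>(c, cs)\<in>C \<times> ?A k. gweight m i (c # cs))"
    by (simp add: sum.reindex inj_on_def split_beta)
  also have "\<dots> = (\<Sum>c\<in>C. 1 / 4 ^ m * exp (1 - 64 * gdist m i c) * (\<Sum>cs\<in>?A k. gweight m c cs))"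
    by (simp add: sum.cartesian_product[symmetric] sum_distrib_left)
  also have "\<dots> \<le> (\<Sum>c\<in>C. 1 / 4 ^ m * exp (1 - 64 * gdist m i c) * (1 / 2) ^ k)"
    using Suc nn by (intro sum_mono mult_left_mono) auto
  also have "\<dots> = (\<Sum>c\<in>C. 1 / 4 ^ m * exp (1 - 64 * gdist m i c)) * (1 / 2) ^ k"
    by (simp add: sum_distrib_right)
  also have "\<dots> \<le> 1 / 2 * (1 / 2) ^ k" using gweight_row_le[OF assms] by (intro mult_right_mono) auto
  finally show ?case by simp
qed

lemma measure_cell_le: "measure lborel (cell m c) \<le> 1 / 4 ^ m"
proof -
  define a b where "a = Complex (fst c / 2 ^ m) (snd c / 2 ^ m)" and "b = Complex ((fst c + 1) / 2 ^ m) ((snd c + 1) / 2 ^ m)"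
  have "cell m c \<subseteq> cbox a b"
  proof
    fix z assume "z \<in> cell m c"
    then have "\<lfloor>2 ^ m * Re z\<rfloor> = fst c" "\<lfloor>2 ^ m * Im z\<rfloor> = snd c" by (auto simp: cell_def cidx_def)
    then have "real_of_int (fst c) \<le> 2 ^ m * Re z" "2 ^ m * Re z \<le> fst c + 1"
      "real_of_int (snd c) \<le> 2 ^ m * Im z" "2 ^ m * Im z \<le> snd c + 1" by linarith+
    then show "z \<in> cbox a b" by (auto simp: in_cbox_complex_iff a_def b_def field_simps)
  qed
  then have "measure lborel (cell m c) \<le> measure lborel (cbox a b)"
    by (intro measure_mono_fmeasurable) (auto simp: fmeasurable_cbox)
  also have "\<dots> = 1 / 4 ^ m"
  proof -
    have "b - a = Complex (1 / 2 ^ m) (1 / 2 ^ m)" by (simp add: a_def b_def complex_eq_iff flip: diff_divide_distrib)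
    then have "measure lborel (cbox a b) = 1 / 2 ^ m * (1 / 2 ^ m)"
      by (subst measure_lborel_cbox_eq) (auto simp: Basis_complex_def a_def b_def inner_complex_def divide_right_mono)
    then show ?thesis by (simp flip: power_mult_distrib)
  qed
  finally show ?thesis .
qed

lemma chain_open_length_conj:
  assumes "chain_open Q" shows "chain_open (\<lambda>ps. length ps = k \<and> Q ps)"
  using assms unfolding chain_open_def by (metis list_all2_lengthD)

section \<open>Union bound and the random excess K\<close>

context poisson begin

text \<open>With cells of side \<open>1 / 2 ^ m\<close> these indices cover a square of half side
  \<open>2 ^ m\<close>, so every chain is eventually inside.\<close>

definition grid :: "nat \<Rightarrow> (int \<times> int) set" where
  "grid m = {-(4^m)..4^m} \<times> {-(4^m)..4^m}"

definition grid_event :: "nat \<Rightarrow> nat \<Rightarrow> real \<Rightarrow> 'a set" where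
  "grid_event m k a = (\<Union>cs\<in>{cs. set cs \<subseteq> grid m \<and> length cs = k \<and> distinct cs \<and> a < k - 64 * glen m (0, 0) cs}.
     {x\<in>space M. \<forall>c\<in>set cs. card (\<omega> x \<inter> cell m c) \<noteq> 0})"

lemma finite_grid_lists: "finite {cs. set cs \<subseteq> grid m \<and> length cs = k}"
  by (rule finite_lists_length_eq) (simp add: grid_def)

lemma all_nonempty_event: "{x\<in>space M. \<forall>c\<in>set cs. card (\<omega> x \<inter> cell m c) \<noteq> 0} \<in> events"
proof (rule sets.sets_Collect_finite_All)
  fix c
  have [measurable]: "(\<lambda>x. card (\<omega> x \<inter> cell m c)) \<in> measurable M (count_space UNIV)"
    using cell_bounded by (intro count_rv) auto
  show "{x\<in>space M. card (\<omega> x \<inter> cell m c) \<noteq> 0} \<in> events" by measurable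
qed simp

lemma grid_event_sets: "grid_event m k a \<in> events"
  unfolding grid_event_def
  by (intro sets.finite_UN all_nonempty_event) (auto intro: finite_subset[OF _ finite_grid_lists])

text \<open>On each summand the exponent \<open>k - 64 * glen - a\<close> is positive, so the
  exponential of it may be inserted; this produces \<open>gweight\<close>, and the row sums give
  \<open>(1 / 2) ^ k\<close>.\<close>

lemma prob_grid_event:
  assumes "m \<ge> 6"
  shows "prob (grid_event m k a) \<le> exp (- a) * (1 / 2) ^ k"
proof -
  let ?A = "{cs. set cs \<subseteq> grid m \<and> length cs = k \<and> distinct cs \<and> a < k - 64 * glen m (0, 0) cs}"
  have finA: "finite ?A" by (rule finite_subset[OF _ finite_grid_lists[of m k]]) auto
  have "prob (grid_event m k a) \<le> (\<Sum>cs\<in>?A. prob {x\<in>space M. \<forall>c\<in>set cs. card (\<omega> x \<inter> cell m c) \<noteq> 0})"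
    unfolding grid_event_def using finA all_nonempty_event by (intro finite_measure_subadditive_finite) auto
  also have "\<dots> \<le> (\<Sum>cs\<in>?A. exp (- a) * gweight m (0, 0) cs)"
  proof (rule sum_mono)
    fix cs assume cs: "cs \<in> ?A"
    have "prob {x\<in>space M. \<forall>c\<in>set cs. card (\<omega> x \<inter> cell m c) \<noteq> 0} \<le> (\<Prod>c\<leftarrow>cs. measure lborel (cell m c))"
    proof (rule prob_all_nonempty_le)
      show "disjoint_family_on (cell m) (set cs)" by (auto simp: disjoint_family_on_def cell_def)
    qed (use cs cell_bounded in auto)
    also have "\<dots> \<le> (1 / 4 ^ m) ^ length cs"
    proof (induction cs)
      case (Cons c cs)
      have "0 \<le> (\<Prod>c\<leftarrow>cs. measure lborel (cell m c))" by (induction cs) auto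
      then have "measure lborel (cell m c) * (\<Prod>c\<leftarrow>cs. measure lborel (cell m c)) \<le> 1 / 4 ^ m * (1 / 4 ^ m) ^ length cs"
        using Cons by (intro mult_mono measure_cell_le) auto
      then show ?case by simp
    qed simp
    also have "\<dots> \<le> (1 / 4 ^ m) ^ length cs * exp (length cs - 64 * glen m (0, 0) cs - a)"
    proof -
      have "0 \<le> real (length cs) - 64 * glen m (0, 0) cs - a" using cs by auto
      then have "1 \<le> exp (real (length cs) - 64 * glen m (0, 0) cs - a)" by simp
      from mult_left_mono[OF this, of "(1 / 4 ^ m) ^ length cs"] show ?thesis by simp
    qed
    also have "\<dots> = exp (- a) * gweight m (0, 0) cs"
      unfolding gweight_eq by (simp add: exp_add[symmetric] algebra_simps)
    finally show "prob {x\<in>space M. \<forall>c\<in>set cs. card (\<omega> x \<inter> cell m c) \<noteq> 0} \<le> exp (- a) * gweight m (0, 0) cs" .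
  qed
  also have "\<dots> = exp (- a) * (\<Sum>cs\<in>?A. gweight m (0, 0) cs)" by (simp add: sum_distrib_left)
  also have "\<dots> \<le> exp (- a) * (\<Sum>cs\<in>{cs. set cs \<subseteq> grid m \<and> length cs = k}. gweight m (0, 0) cs)"
    using finite_grid_lists[of m k] by (intro mult_left_mono sum_mono2) (auto simp: gweight_eq)
  also have "\<dots> \<le> exp (- a) * (1 / 2) ^ k"
    using assms by (intro mult_left_mono gweight_sum_le) (auto simp: grid_def)
  finally show ?thesis .
qed

definition chain_event :: "nat \<Rightarrow> real \<Rightarrow> 'a set" where
  "chain_event k a = {x\<in>space M. \<exists>ps\<in>chains (\<omega> x). length ps = k \<and> 64 * plen 0 ps - real (length ps) < - a}"

lemma chain_event_sets: "chain_event k a \<in> events"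
proof -
  have [measurable]: "{P\<in>LF. \<exists>ps\<in>chains (P \<inter> UNIV). length ps = k \<and> 64 * plen 0 ps - real (length ps) < - a} \<in> sets (cfg UNIV)"
    by (intro open_chain_event chain_open_length_conj chain_open_excess) auto
  have "chain_event k a = {x\<in>space M. \<omega> x \<in> {P\<in>LF. \<exists>ps\<in>chains (P \<inter> UNIV). length ps = k \<and> 64 * plen 0 ps - real (length ps) < - a}}"
    by (auto simp: chain_event_def)
  also have "\<dots> \<in> events" by measurable
  finally show ?thesis .
qed

lemma chain_event_eventually_grid:
  assumes "x \<in> chain_event k a"
  shows "\<exists>n. \<forall>m\<ge>n. x \<in> grid_event m k a"
proof -
  obtain ps where ps: "x \<in> space M" "ps \<in> chains (\<omega> x)" "length ps = k" "64 * plen 0 ps - real k < - a"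
    using assms by (auto simp: chain_event_def)
  obtain n1 where n1: "\<forall>m\<ge>n1. distinct (map (cidx m) ps)"
    using separate_points[of ps 1] ps(2) by (auto simp: chains_def)
  obtain r where r: "\<And>p. p \<in> set ps \<Longrightarrow> cmod p \<le> r" using finite_imp_bounded[of "set ps"] by (auto simp: bounded_iff)
  obtain n2 where n2: "r + 1 < 2 ^ n2" using real_arch_pow[of 2 "r + 1"] by auto
  have "x \<in> grid_event m k a" if m: "m \<ge> max n1 n2" for m
  proof -
    define cs where "cs = map (cidx m) ps"
    have all2: "list_all2 (\<lambda>p c. p \<in> cell m c) ps cs" by (simp add: cs_def list_all2_conv_all_nth cell_def)
    have "(0 :: complex) \<in> cell m (0, 0)" by (simp add: cell_def cidx_def)
    then have "a < k - 64 * glen m (0, 0) cs" using glen_le_plen[OF all2] ps(4) by fastforce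
    moreover have "set cs \<subseteq> grid m"
    proof
      fix c assume "c \<in> set cs"
      then obtain p where p: "p \<in> set ps" "c = cidx m p" by (auto simp: cs_def)
      have "(2::real) ^ n2 \<le> 2 ^ m" using m by (intro power_increasing) auto
      then have "cmod p + 1 \<le> 2 ^ m" using r[OF p(1)] n2 by linarith
      then have "2 ^ m * \<bar>Re p\<bar> \<le> 2 ^ m * (2 ^ m - 1)" "2 ^ m * \<bar>Im p\<bar> \<le> 2 ^ m * (2 ^ m - 1)"
        using abs_Re_le_cmod[of p] abs_Im_le_cmod[of p] by auto
      moreover have "(2::real) ^ m * 2 ^ m = 4 ^ m" by (simp flip: power_mult_distrib)
      moreover have "(1::real) \<le> 2 ^ m" by simp
      moreover have "\<bar>2 ^ m * Re p\<bar> = 2 ^ m * \<bar>Re p\<bar>" "\<bar>2 ^ m * Im p\<bar> = 2 ^ m * \<bar>Im p\<bar>"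
        by (simp_all add: abs_mult)
      ultimately have "\<bar>2 ^ m * Re p\<bar> \<le> 4 ^ m - 1" "\<bar>2 ^ m * Im p\<bar> \<le> 4 ^ m - 1"
        unfolding right_diff_distrib by linarith+
      then have "2 ^ m * Re p \<le> real_of_int (4 ^ m)" "real_of_int (- (4 ^ m)) \<le> 2 ^ m * Re p"
        "2 ^ m * Im p \<le> real_of_int (4 ^ m)" "real_of_int (- (4 ^ m)) \<le> 2 ^ m * Im p" by (auto simp: abs_le_iff)
      then show "c \<in> grid m" unfolding p grid_def cidx_def
        by (auto simp: le_floor_iff floor_le_iff simp del: of_int_power of_int_minus intro: order_le_less_trans)
    qed
    moreover have "distinct cs" "length cs = k" using n1 m ps(3) by (auto simp: cs_def)
    moreover have "card (\<omega> x \<inter> cell m c) \<noteq> 0" if "c \<in> set cs" for c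
    proof -
      have "finite (\<omega> x \<inter> cell m c)" using omega_LF[OF ps(1)] cell_bounded by (auto simp: LF_def)
      moreover have "\<omega> x \<inter> cell m c \<noteq> {}" using that ps(2) by (auto simp: cs_def chains_def cell_def)
      ultimately show ?thesis by simp
    qed
    ultimately show ?thesis using ps(1) by (auto simp: grid_event_def)
  qed
  then show ?thesis by blast
qed

text \<open>A chain is detected by all sufficiently fine grids. The event therefore lies in the
  increasing union of the \<open>F n\<close>, and the bound, uniform in the mesh, passes to the
  limit.\<close>

lemma prob_chain_event: "prob (chain_event k a) \<le> exp (- a) * (1 / 2) ^ k"
proof -
  define F where "F = (\<lambda>n. \<Inter>m\<in>{n..}. grid_event m k a)"
  have F: "F n \<in> events" for n unfolding F_def using grid_event_sets by (intro sets.countable_INT') auto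
  have "incseq F" by (intro incseq_SucI) (auto simp: F_def)
  then have lim: "(\<lambda>n. prob (F n)) \<longlonglongrightarrow> prob (\<Union>n. F n)"
    using F by (intro finite_Lim_measure_incseq) auto
  have "prob (F n) \<le> exp (- a) * (1 / 2) ^ k" for n
  proof -
    have "prob (F n) \<le> prob (grid_event (max n 6) k a)"
      using grid_event_sets by (intro finite_measure_mono) (auto simp: F_def)
    also have "\<dots> \<le> exp (- a) * (1 / 2) ^ k" by (rule prob_grid_event) simp
    finally show ?thesis .
  qed
  then have "prob (\<Union>n. F n) \<le> exp (- a) * (1 / 2) ^ k"
    using lim by (intro LIMSEQ_le_const2) auto
  moreover have "chain_event k a \<subseteq> (\<Union>n. F n)" using chain_event_eventually_grid by (fastforce simp: F_def)
  then have "prob (chain_event k a) \<le> prob (\<Union>n. F n)" using F by (intro finite_measure_mono) auto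
  ultimately show ?thesis by simp
qed

definition excess_event :: "real \<Rightarrow> 'a set" where
  "excess_event a = {x\<in>space M. \<exists>ps\<in>chains (\<omega> x). 64 * plen 0 ps - real (length ps) < - a}"

lemma excess_event_UN: "excess_event a = (\<Union>k. chain_event k a)"
  by (auto simp: excess_event_def chain_event_def)

lemma excess_event_sets [measurable]: "excess_event a \<in> events"
  unfolding excess_event_UN using chain_event_sets by auto

lemma prob_excess_event:
  assumes "a \<ge> 0" shows "prob (excess_event a) \<le> exp (- a)"
proof -
  have "chain_event 0 a = {}" using assms by (auto simp: chain_event_def)
  then have eq: "excess_event a = (\<Union>k. chain_event (Suc k) a)"
    unfolding excess_event_UN
  proof (intro equalityI subsetI)
    fix x assume "chain_event 0 a = {}" "x \<in> (\<Union>k. chain_event k a)"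
    then obtain k where "x \<in> chain_event k a" "k \<noteq> 0" by (metis UN_E empty_iff)
    then show "x \<in> (\<Union>k. chain_event (Suc k) a)" using not0_implies_Suc by blast
  qed blast
  have geo: "(\<lambda>k. exp (- a) * (1 / 2) ^ Suc k) sums exp (- a)"
    using sums_mult[OF power_half_series, of "exp (- a)"] by simp
  have sm: "summable (\<lambda>k. prob (chain_event (Suc k) a))"
  proof (rule summable_comparison_test[OF _ sums_summable[OF geo]], intro exI allI impI)
    show "norm (prob (chain_event (Suc k) a)) \<le> exp (- a) * (1 / 2) ^ Suc k" for k
      using prob_chain_event[of "Suc k" a] by (simp only: real_norm_def abs_of_nonneg measure_nonneg)
  qed
  have "prob (\<Union>k. chain_event (Suc k) a) \<le> (\<Sum>k. prob (chain_event (Suc k) a))"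
    using chain_event_sets sm by (intro finite_measure_subadditive_countably) auto
  also have "\<dots> \<le> (\<Sum>k. exp (- a) * (1 / 2) ^ Suc k)"
    by (intro suminf_le prob_chain_event sm sums_summable[OF geo])
  also have "\<dots> = exp (- a)" using sums_unique[OF geo] by simp
  finally show ?thesis unfolding eq .
qed

text \<open>Almost surely the infimum is over a set that is bounded below; otherwise it is a junk value.\<close>

definition K :: "'a \<Rightarrow> real" where
  "K x = - Inf ((\<lambda>ps. 64 * plen 0 ps - real (length ps)) ` chains (\<omega> x))"

lemma K_measurable [measurable]: "K \<in> borel_measurable M"
proof -
  have [measurable]: "(\<lambda>P. Inf ((\<lambda>ps. 64 * plen 0 ps - real (length ps)) ` chains (P \<inter> UNIV))) \<in> borel_measurable (cfg UNIV)"
    by (intro chain_Inf_measurable chain_open_excess) auto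
  have "(\<lambda>x. - Inf ((\<lambda>ps. 64 * plen 0 ps - real (length ps)) ` chains (\<omega> x \<inter> UNIV))) \<in> borel_measurable M"
    by measurable
  then show ?thesis by (simp add: K_def[abs_def])
qed

lemma AE_bdd_below: "AE x in M. bdd_below ((\<lambda>ps. 64 * plen 0 ps - real (length ps)) ` chains (\<omega> x))"
proof -
  define N where "N = (\<Inter>n::nat. excess_event (real n))"
  have N: "N \<in> events" unfolding N_def by (intro sets.countable_INT) auto
  have "prob N \<le> exp (- real n)" for n
    using prob_excess_event[of "real n"] finite_measure_mono[of N "excess_event (real n)"]
    by (fastforce simp: N_def)
  moreover have "(\<lambda>n. exp (- real n)) \<longlonglongrightarrow> 0" 
    using LIMSEQ_power_zero[of "exp (-1::real)"] by (simp add: exp_of_nat_mult[symmetric])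
  ultimately have "prob N \<le> 0" by (intro LIMSEQ_le_const) auto
  then have "N \<in> null_sets M" using N by (intro null_setsI) (simp_all add: emeasure_eq_measure measure_le_0_iff)
  then have "AE x in M. x \<notin> N" by (rule AE_not_in)
  then show ?thesis
  proof (rule AE_mp, intro AE_I2 impI)
    fix x assume "x \<in> space M" "x \<notin> N"
    then obtain n where "\<And>ps. ps \<in> chains (\<omega> x) \<Longrightarrow> - real n \<le> 64 * plen 0 ps - real (length ps)"
      by (auto simp: N_def excess_event_def not_less)
    then show "bdd_below ((\<lambda>ps. 64 * plen 0 ps - real (length ps)) ` chains (\<omega> x))" by (rule bdd_belowI2)
  qed
qed

lemma AE_tame: "AE x in M. K x \<ge> 0 \<and> tame 64 (K x) (\<omega> x)"
  using AE_bdd_below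
proof (rule AE_mp, intro AE_I2 impI)
  fix x assume b: "bdd_below ((\<lambda>ps. 64 * plen 0 ps - real (length ps)) ` chains (\<omega> x))"
  have "- K x \<le> 64 * plen 0 ps - real (length ps)" if "ps \<in> chains (\<omega> x)" for ps
    unfolding K_def using that by (auto intro: cInf_lower b)
  moreover from this[of "[]"] have "K x \<ge> 0" by simp
  ultimately show "K x \<ge> 0 \<and> tame 64 (K x) (\<omega> x)" by (force simp: tame_def)
qed

lemma AE_K_excess: "AE x in M. \<forall>a. K x > a \<longrightarrow> x \<in> excess_event a"
  using AE_bdd_below
proof (rule AE_mp, intro AE_I2 impI allI)
  fix x a assume x: "x \<in> space M" and "a < K x"
    and b: "bdd_below ((\<lambda>ps. 64 * plen 0 ps - real (length ps)) ` chains (\<omega> x))"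
  then have "Inf ((\<lambda>ps. 64 * plen 0 ps - real (length ps)) ` chains (\<omega> x)) < - a" by (simp add: K_def)
  moreover have "(\<lambda>ps. 64 * plen 0 ps - real (length ps)) ` chains (\<omega> x) \<noteq> {}" using Nil_in_chains by blast
  ultimately have "\<exists>y\<in>(\<lambda>ps. 64 * plen 0 ps - real (length ps)) ` chains (\<omega> x). y < - a" by (intro cInf_lessD)
  then show "x \<in> excess_event a" using x by (auto simp: excess_event_def)
qed

text \<open>Layer-cake summation: with \<open>n\<close> the ceiling of \<open>K x\<close>, the
  square is at most the sum of \<open>2 * j + 1\<close> over \<open>j < n\<close>, and every such
  \<open>j\<close> witnesses the excess event of level \<open>j\<close>, of probability at most
  \<open>exp (- j)\<close>.\<close>

lemma K_square_integrable: "integrable M (\<lambda>x. (K x)\<^sup>2)"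
proof (rule integrableI_bounded)
  have pt: "AE x in M. ennreal (norm ((K x)\<^sup>2)) \<le> (\<Sum>j. ennreal (2 * real j + 1) * indicator (excess_event (real j)) x)"
    using AE_K_excess AE_tame
  proof (rule AE_mp[OF AE_conjI], intro AE_I2 impI)
    fix x assume *: "(\<forall>a. a < K x \<longrightarrow> x \<in> excess_event a) \<and> 0 \<le> K x \<and> tame 64 (K x) (\<omega> x)"
    define n where "n = nat \<lceil>K x\<rceil>"
    have n: "K x \<le> real n" "\<And>j. j < n \<Longrightarrow> real j < K x" using * unfolding n_def by linarith+
    have sq: "(\<Sum>j<n. 2 * real j + 1) = (real n)\<^sup>2" for n :: nat
      by (induction n) (auto simp: power2_eq_square algebra_simps)
    have "ennreal (norm ((K x)\<^sup>2)) \<le> ennreal (\<Sum>j<n. 2 * real j + 1)"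
      using * n by (intro ennreal_leI) (simp add: sq power_mono)
    also have "\<dots> = (\<Sum>j<n. ennreal (2 * real j + 1))" by (subst sum_ennreal) auto
    also have "\<dots> = (\<Sum>j<n. ennreal (2 * real j + 1) * indicator (excess_event (real j)) x)"
      using * n by (intro sum.cong) auto
    also have "\<dots> \<le> (\<Sum>j. ennreal (2 * real j + 1) * indicator (excess_event (real j)) x)"
      by (rule sum_le_suminf) auto
    finally show "ennreal (norm ((K x)\<^sup>2)) \<le> (\<Sum>j. ennreal (2 * real j + 1) * indicator (excess_event (real j)) x)" .
  qed
  have tail: "(2 * real j + 1) * exp (- real j) \<le> 4 * exp (- 1 / 2) ^ j" for j
  proof -
    have "1 + real j / 2 \<le> exp (real j / 2)" by (rule exp_ge_add_one_self)
    then have "2 * real j + 1 \<le> 4 * exp (real j / 2)" by linarith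
    then have "(2 * real j + 1) * exp (- real j) \<le> 4 * exp (real j / 2) * exp (- real j)"
      by (intro mult_right_mono) auto
    also have "\<dots> = 4 * exp (- 1 / 2) ^ j"
      by (simp add: exp_of_nat_mult[symmetric] exp_add[symmetric] mult.assoc)
    finally show ?thesis .
  qed
  have "(\<integral>\<^sup>+x. ennreal (norm ((K x)\<^sup>2)) \<partial>M) \<le> (\<integral>\<^sup>+x. (\<Sum>j. ennreal (2 * real j + 1) * indicator (excess_event (real j)) x) \<partial>M)"
    by (rule nn_integral_mono_AE[OF pt])
  also have "\<dots> = (\<Sum>j. \<integral>\<^sup>+x. ennreal (2 * real j + 1) * indicator (excess_event (real j)) x \<partial>M)"
    by (rule nn_integral_suminf) auto
  also have "\<dots> = (\<Sum>j. ennreal ((2 * real j + 1) * prob (excess_event (real j))))"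
    by (simp add: nn_integral_cmult_indicator emeasure_eq_measure ennreal_mult)
  also have "\<dots> \<le> (\<Sum>j. ennreal (4 * exp (- 1 / 2) ^ j))"
  proof (intro suminf_le ennreal_leI)
    fix j
    have "(2 * real j + 1) * prob (excess_event (real j)) \<le> (2 * real j + 1) * exp (- real j)"
      by (intro mult_left_mono prob_excess_event) auto
    then show "(2 * real j + 1) * prob (excess_event (real j)) \<le> 4 * exp (- 1 / 2) ^ j"
      using tail[of j] by (rule order_trans)
  qed auto
  also have "\<dots> < \<infinity>"
  proof -
    have "summable (\<lambda>j. 4 * exp (- 1 / 2 :: real) ^ j)" by (intro summable_mult summable_geometric) simp
    then have "(\<Sum>j. ennreal (4 * exp (- 1 / 2) ^ j)) = ennreal (\<Sum>j. 4 * exp (- 1 / 2) ^ j)"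
      by (intro suminf_ennreal2) auto
    then show ?thesis by simp
  qed
  finally show "(\<integral>\<^sup>+x. ennreal (norm ((K x)\<^sup>2)) \<partial>M) < \<infinity>" .
qed measurable

lemma K_integrable: "integrable M K"
  by (rule square_integrable_imp_integrable[OF K_measurable K_square_integrable])

end

section \<open>Null sets\<close>

lemma lborel_complex: "(lborel :: complex measure) = distr (lborel \<Otimes>\<^sub>M lborel) borel (\<lambda>(x, y). Complex x y)"
proof (rule lborel_eqI)
  have [measurable]: "(\<lambda>(x, y). Complex x y) \<in> borel_measurable (borel \<Otimes>\<^sub>M borel)"
    unfolding Complex_eq split_beta by measurable
  fix l u :: complex assume *: "\<And>b. b \<in> Basis \<Longrightarrow> l \<bullet> b \<le> u \<bullet> b"
  have le: "Re l \<le> Re u" "Im l \<le> Im u"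
    using *[of 1] *[of \<i>] by (auto simp: Basis_complex_def inner_complex_def)
  have "(\<lambda>(x, y). Complex x y) -` box l u \<inter> space (lborel \<Otimes>\<^sub>M lborel) = {Re l<..<Re u} \<times> {Im l<..<Im u}"
    by (auto simp: in_box_complex_iff space_pair_measure)
  then have "emeasure (distr (lborel \<Otimes>\<^sub>M lborel) borel (\<lambda>(x, y). Complex x y)) (box l u) =
      emeasure (lborel \<Otimes>\<^sub>M lborel) ({Re l<..<Re u} \<times> {Im l<..<Im u})"
    by (simp add: emeasure_distr)
  also have "\<dots> = emeasure lborel {Re l<..<Re u} * emeasure lborel {Im l<..<Im u}"
    by (rule lborel.emeasure_pair_measure_Times) auto
  also have "\<dots> = ennreal ((Re u - Re l) * (Im u - Im l))" using le by (simp add: ennreal_mult)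
  also have "(Re u - Re l) * (Im u - Im l) = (\<Prod>b\<in>Basis. (u - l) \<bullet> b)"
    by (simp add: Basis_complex_def inner_complex_def)
  finally show "emeasure (distr (lborel \<Otimes>\<^sub>M lborel) borel (\<lambda>(x, y). Complex x y)) (box l u) = (\<Prod>b\<in>Basis. (u - l) \<bullet> b)"
    by (simp add: prod_ennreal)
qed simp

lemma emeasure_complex_slices:
  assumes [measurable]: "N \<in> sets borel"
  shows "emeasure lborel N = (\<integral>\<^sup>+x. emeasure lborel {y. Complex x y \<in> N} \<partial>lborel)"
    and "emeasure lborel N = (\<integral>\<^sup>+y. emeasure lborel {x. Complex x y \<in> N} \<partial>lborel)"
proof -
  have [measurable]: "(\<lambda>(x, y). Complex x y) \<in> borel_measurable (borel \<Otimes>\<^sub>M borel)"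
    unfolding Complex_eq split_beta by measurable
  define A where "A = (\<lambda>(x, y). Complex x y) -` N \<inter> space (borel \<Otimes>\<^sub>M borel)"
  have A: "A \<in> sets (lborel \<Otimes>\<^sub>M lborel)" unfolding A_def
    using measurable_sets[of "\<lambda>(x, y). Complex x y" "borel \<Otimes>\<^sub>M borel" borel N]
    by (simp cong: sets_pair_measure_cong)
  have "emeasure lborel N = emeasure (lborel \<Otimes>\<^sub>M lborel) A"
    by (subst lborel_complex) (simp add: emeasure_distr A_def space_pair_measure)
  then show "emeasure lborel N = (\<integral>\<^sup>+x. emeasure lborel {y. Complex x y \<in> N} \<partial>lborel)"
    "emeasure lborel N = (\<integral>\<^sup>+y. emeasure lborel {x. Complex x y \<in> N} \<partial>lborel)"
    using lborel.emeasure_pair_measure_alt[OF A] lborel_pair.emeasure_pair_measure_alt2[OF A]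
    by (simp_all add: A_def space_pair_measure vimage_def)
qed

lemma null_if_countable_slices:
  assumes "N \<in> sets borel" "(\<forall>x. countable {y. Complex x y \<in> N}) \<or> (\<forall>y. countable {x. Complex x y \<in> N})"
  shows "N \<in> null_sets lborel"
proof -
  have "emeasure lborel N = 0"
    using assms(2) emeasure_complex_slices[OF assms(1)]
    by (auto simp: emeasure_lborel_countable)
  then show ?thesis using assms(1) by (intro null_setsI) auto
qed

text \<open>A zero with nonvanishing derivative is isolated. Zeros with isolation radius
  \<open>1 / (n + 1)\<close> are told apart by the integer part of
  \<open>(n + 1) * r\<close>.\<close>

lemma countable_simple_zeros:
  fixes f :: "real \<Rightarrow> real"
  shows "countable {r. f r = 0 \<and> (\<exists>d. d \<noteq> 0 \<and> (f has_field_derivative d) (at r))}" (is "countable ?A")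
proof -
  define B where "B = (\<lambda>n::nat. {r. f r = 0 \<and> (\<forall>r'. 0 < \<bar>r' - r\<bar> \<and> \<bar>r' - r\<bar> < 1 / real (Suc n) \<longrightarrow> f r' \<noteq> 0)})"
  have sub: "?A \<subseteq> (\<Union>n. B n)"
  proof
    fix r assume "r \<in> ?A"
    then obtain d where d: "f r = 0" "d \<noteq> 0" "(f has_field_derivative d) (at r)" by blast
    then have "((\<lambda>y. (f y - f r) / (y - r)) \<longlongrightarrow> d) (at r)" by (simp add: has_field_derivative_iff)
    then have "eventually (\<lambda>y. (f y - f r) / (y - r) \<noteq> 0) (at r)" using d(2) by (rule tendsto_imp_eventually_ne)
    then obtain e where e: "e > 0" "\<And>y. y \<noteq> r \<Longrightarrow> dist y r < e \<Longrightarrow> (f y - f r) / (y - r) \<noteq> 0"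
      by (auto simp: eventually_at)
    obtain n where n: "1 / real (Suc n) < e" using nat_approx_posE[OF e(1)] by blast
    have "f r' \<noteq> 0" if "0 < \<bar>r' - r\<bar>" "\<bar>r' - r\<bar> < 1 / real (Suc n)" for r'
      using e(2)[of r'] that n d(1) by (auto simp: dist_real_def)
    then show "r \<in> (\<Union>n. B n)" using d(1) by (auto simp: B_def)
  qed
  have "countable (B n)" for n
  proof -
    have "inj_on (\<lambda>r. \<lfloor>real (Suc n) * r\<rfloor>) (B n)"
    proof (rule inj_onI, rule ccontr)
      fix r r' assume r: "r \<in> B n" "r' \<in> B n" "\<lfloor>real (Suc n) * r\<rfloor> = \<lfloor>real (Suc n) * r'\<rfloor>" "r \<noteq> r'"
      then have "\<bar>real (Suc n) * r - real (Suc n) * r'\<bar> < 1" by linarith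
      then have "real (Suc n) * \<bar>r' - r\<bar> < 1"
        by (metis abs_minus_commute abs_mult abs_of_nat right_diff_distrib)
      then have "\<bar>r' - r\<bar> < 1 / real (Suc n)" by (simp add: pos_less_divide_eq mult.commute)
      then show False using r by (auto simp: B_def)
    qed
    then show ?thesis by (rule countable_image_inj_on[rotated]) simp
  qed
  then have "countable (\<Union>n. B n)" by simp
  then show ?thesis by (rule countable_subset[OF sub])
qed

text \<open>Along horizontal lines the zeros at which the horizontal derivative does not vanish are isolated,
  and similarly for vertical lines, so Fubini applies.\<close>

lemma null_regular_level_set:
  fixes f :: "complex \<Rightarrow> real" and G :: "complex \<Rightarrow> complex"
  assumes [measurable]: "f \<in> borel_measurable borel" "G \<in> borel_measurable borel" "N \<in> sets borel"
    and deriv: "\<And>x. x \<notin> N \<Longrightarrow> (f has_derivative (\<lambda>h. G x \<bullet> h)) (at x)"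
  shows "{x. f x = 0 \<and> x \<notin> N \<and> G x \<noteq> 0} \<in> null_sets lborel"
proof -
  define A where "A = {x. f x = 0 \<and> x \<notin> N \<and> Re (G x) \<noteq> 0}"
  define B where "B = {x. f x = 0 \<and> x \<notin> N \<and> Im (G x) \<noteq> 0}"
  have [measurable]: "A \<in> sets borel" "B \<in> sets borel" unfolding A_def B_def by measurable
  have "countable {x. Complex x y \<in> A}" for y
  proof (rule countable_subset[OF _ countable_simple_zeros[of "\<lambda>x. f (Complex x y)"]], safe)
    fix x assume x: "Complex x y \<in> A"
    then show "f (Complex x y) = 0" by (simp add: A_def)
    have 1: "((\<lambda>x. Complex x y) has_derivative (\<lambda>h. complex_of_real h)) (at x)"
    proof -
      have "(\<lambda>x. Complex x y) = (\<lambda>x. complex_of_real x + \<i> * complex_of_real y)" by (simp add: fun_eq_iff Complex_eq)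
      then show ?thesis by (auto intro!: derivative_eq_intros)
    qed
    have "((\<lambda>x. f (Complex x y)) has_derivative (\<lambda>h. G (Complex x y) \<bullet> complex_of_real h)) (at x)"
      using has_derivative_compose[OF 1 deriv, of] x by (simp add: A_def)
    moreover have "(\<lambda>h. G (Complex x y) \<bullet> complex_of_real h) = (*) (Re (G (Complex x y)))"
      by (simp add: inner_complex_def fun_eq_iff)
    ultimately have "((\<lambda>x. f (Complex x y)) has_field_derivative Re (G (Complex x y))) (at x)"
      unfolding has_field_derivative_def by metis
    then show "\<exists>d. d \<noteq> 0 \<and> ((\<lambda>x. f (Complex x y)) has_field_derivative d) (at x)" using x by (auto simp: A_def)
  qed
  then have "A \<in> null_sets lborel" by (intro null_if_countable_slices) auto
  moreover have "countable {y. Complex x y \<in> B}" for x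
  proof (rule countable_subset[OF _ countable_simple_zeros[of "\<lambda>y. f (Complex x y)"]], safe)
    fix y assume y: "Complex x y \<in> B"
    then show "f (Complex x y) = 0" by (simp add: B_def)
    have 1: "((\<lambda>y. Complex x y) has_derivative (\<lambda>h. \<i> * complex_of_real h)) (at y)"
    proof -
      have "(\<lambda>y. Complex x y) = (\<lambda>y. complex_of_real x + \<i> * complex_of_real y)" by (simp add: fun_eq_iff Complex_eq)
      then show ?thesis by (auto intro!: derivative_eq_intros)
    qed
    have "((\<lambda>y. f (Complex x y)) has_derivative (\<lambda>h. G (Complex x y) \<bullet> (\<i> * complex_of_real h))) (at y)"
      using has_derivative_compose[OF 1 deriv, of] y by (simp add: B_def)
    moreover have "(\<lambda>h. G (Complex x y) \<bullet> (\<i> * complex_of_real h)) = (*) (Im (G (Complex x y)))"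
      by (simp add: inner_complex_def fun_eq_iff)
    ultimately have "((\<lambda>y. f (Complex x y)) has_field_derivative Im (G (Complex x y))) (at y)"
      unfolding has_field_derivative_def by metis
    then show "\<exists>d. d \<noteq> 0 \<and> ((\<lambda>y. f (Complex x y)) has_field_derivative d) (at y)" using y by (auto simp: B_def)
  qed
  then have "B \<in> null_sets lborel" by (intro null_if_countable_slices) auto
  moreover have "{x. f x = 0 \<and> x \<notin> N \<and> G x \<noteq> 0} = A \<union> B" by (auto simp: A_def B_def complex_eq_iff)
  ultimately show ?thesis by auto
qed

lemma null_line:
  assumes "n \<noteq> (0 :: complex)" shows "{x. n \<bullet> x = c} \<in> null_sets lborel"
proof -
  have "negligible {x. n \<bullet> x = c}" using assms by (intro negligible_hyperplane) simp
  then have "{x. n \<bullet> x = c} \<in> null_sets lebesgue" by (simp add: negligible_iff_null_sets)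
  moreover have "{x. n \<bullet> x = c} \<in> sets borel" by measurable
  ultimately show ?thesis by (simp add: null_sets_def)
qed

text \<open>A neighbour of a point in a chain is another point, or (\<open>None\<close>) the target line at its end.\<close>

fun site_dist :: "real \<Rightarrow> complex option \<Rightarrow> complex \<Rightarrow> real" where
  "site_dist t (Some v) x = dist v x"
| "site_dist t None x = \<bar>Re x - t\<bar>"

fun site_grad :: "real \<Rightarrow> complex option \<Rightarrow> complex \<Rightarrow> complex" where
  "site_grad t (Some v) x = sgn (x - v)"
| "site_grad t None x = complex_of_real (sgn (Re x - t))"

text \<open>Where \<open>site_dist\<close> fails to be differentiable; everywhere else its gradient
  \<open>site_grad\<close> is a unit vector.\<close>

fun site_set :: "real \<Rightarrow> complex option \<Rightarrow> complex set" where
  "site_set t (Some v) = {v}"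
| "site_set t None = {x. Re x = t}"

lemma site_dist_measurable [measurable]: "site_dist t a \<in> borel_measurable borel"
  by (cases a) (auto simp: fun_eq_iff[symmetric] site_dist.simps[abs_def])

lemma site_grad_measurable [measurable]: "site_grad t a \<in> borel_measurable borel"
proof (cases a)
  case None
  have "(\<lambda>x. complex_of_real (sgn (Re x - t))) \<in> borel_measurable borel" by measurable
  then show ?thesis using None by (simp add: site_grad.simps[abs_def])
next
  case (Some v)
  have "(\<lambda>x. sgn (x - v)) \<in> borel_measurable borel" unfolding sgn_div_norm by measurable
  then show ?thesis using Some by (simp add: site_grad.simps[abs_def])
qed

lemma site_set_null: "site_set t a \<in> null_sets lborel"
proof (cases a)
  case None
  have "{x::complex. 1 \<bullet> x = t} \<in> null_sets lborel" by (rule null_line) simp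
  then show ?thesis using None by (simp add: inner_complex_def)
qed (auto intro: countable_imp_null_set_lborel)

lemma site_dist_derivative:
  assumes "x \<notin> site_set t a"
  shows "(site_dist t a has_derivative (\<lambda>h. site_grad t a x \<bullet> h)) (at x)"
proof (cases a)
  case (Some v)
  have 1: "((\<lambda>x. x - v) has_derivative (\<lambda>h. h)) (at x)" by (auto intro!: derivative_eq_intros)
  have "(norm has_derivative (\<lambda>h. h \<bullet> sgn (x - v))) (at (x - v))"
    using assms Some by (intro has_derivative_norm) auto
  from has_derivative_compose[OF 1 this] have "((\<lambda>x. norm (x - v)) has_derivative (\<lambda>h. h \<bullet> sgn (x - v))) (at x)" .
  moreover have "site_dist t a = (\<lambda>x. norm (x - v))" by (simp add: Some fun_eq_iff dist_norm norm_minus_commute)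
  ultimately show ?thesis by (simp add: Some inner_commute)
next
  case None
  have 1: "((\<lambda>x. Re x - t) has_derivative (\<lambda>h. Re h)) (at x)" by (auto intro!: derivative_eq_intros)
  have "(norm has_derivative (\<lambda>h. h \<bullet> sgn (Re x - t))) (at (Re x - t))"
    using assms None by (intro has_derivative_norm) auto
  from has_derivative_compose[OF 1 this] have "((\<lambda>x. \<bar>Re x - t\<bar>) has_derivative (\<lambda>h. Re h * sgn (Re x - t))) (at x)" by simp
  moreover have "site_dist t a = (\<lambda>x. \<bar>Re x - t\<bar>)" by (simp add: None fun_eq_iff)
  ultimately show ?thesis by (simp add: None inner_complex_def mult.commute)
qed

lemma site_grad_norm: "x \<notin> site_set t a \<Longrightarrow> cmod (site_grad t a x) = 1"
  by (cases a) (auto simp: norm_sgn sgn_if)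

text \<open>Parallel gradients put \<open>x\<close> on the line through the two points, or, if one
  site is the target line, on the horizontal through the other.\<close>

lemma site_grad_parallel_null:
  assumes "a \<noteq> b"
  obtains H where "H \<in> null_sets lborel"
    "\<And>x. site_grad t a x = site_grad t b x \<or> site_grad t a x = - site_grad t b x \<Longrightarrow> x \<in> H"
proof -
  have case1: "\<exists>H\<in>null_sets lborel. \<forall>x. sgn (x - v) = sgn (x - w) \<or> sgn (x - v) = - sgn (x - w) \<longrightarrow> x \<in> H"
    if "v \<noteq> w" for v w :: complex
  proof -
    define n where "n = \<i> * (v - w)"
    have n: "n \<noteq> 0" "n \<bullet> (v - w) = 0" using that by (auto simp: n_def inner_complex_def algebra_simps)
    have "x \<in> {x. n \<bullet> x = n \<bullet> v}" if par: "sgn (x - v) = sgn (x - w) \<or> sgn (x - v) = - sgn (x - w)" for x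
    proof -
      have "\<exists>e::real. sgn (x - v) = e *\<^sub>R sgn (x - w)"
        using par by (elim disjE) (auto intro: exI[of _ 1] exI[of _ "-1"])
      then obtain e :: real where e: "sgn (x - v) = e *\<^sub>R sgn (x - w)" by blast
      have "x - v = cmod (x - v) *\<^sub>R sgn (x - v)" by (cases "x = v") (simp_all add: sgn_div_norm)
      also have "\<dots> = (cmod (x - v) * e / cmod (x - w)) *\<^sub>R (x - w)"
        unfolding e by (simp add: sgn_div_norm divide_inverse)
      finally obtain l where l: "x - v = l *\<^sub>R (x - w)" by blast
      have "n \<bullet> (x - w) = n \<bullet> (x - v)" using n(2) by (simp add: inner_diff_right)
      moreover have "n \<bullet> (x - v) = l * (n \<bullet> (x - w))" unfolding l by simp
      ultimately have "(1 - l) * (n \<bullet> (x - v)) = 0" by (simp add: algebra_simps)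
      moreover have "l \<noteq> 1" using l \<open>v \<noteq> w\<close> by auto
      ultimately show ?thesis by (simp add: inner_diff_right)
    qed
    then show ?thesis using null_line[OF n(1), of "n \<bullet> v"] by blast
  qed
  have case2: "\<exists>H\<in>null_sets lborel. \<forall>x. Im (sgn (x - v)) = 0 \<longrightarrow> x \<in> H" for v :: complex
  proof -
    have null: "{x. \<i> \<bullet> x = Im v} \<in> null_sets lborel" by (rule null_line) simp
    show ?thesis
    proof (rule bexI[OF _ null], intro allI impI)
      fix x assume "Im (sgn (x - v)) = 0"
      then show "x \<in> {x. \<i> \<bullet> x = Im v}"
        by (cases "x = v") (simp_all add: inner_complex_def sgn_div_norm)
    qed
  qed
  have "\<exists>H\<in>null_sets lborel. \<forall>x. site_grad t a x = site_grad t b x \<or> site_grad t a x = - site_grad t b x \<longrightarrow> x \<in> H"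
  proof (cases a; cases b)
    fix v assume ab: "a = Some v" "b = None"
    obtain H where H: "H \<in> null_sets lborel" "\<forall>x. Im (sgn (x - v)) = 0 \<longrightarrow> x \<in> H" using case2 by blast
    have "Im z = 0" if "z = complex_of_real y \<or> z = - complex_of_real y" for z y using that by auto
    then show ?thesis using ab H(2) by (intro bexI[OF _ H(1)]) (metis site_grad.simps)
  next
    fix v assume ab: "b = Some v" "a = None"
    obtain H where H: "H \<in> null_sets lborel" "\<forall>x. Im (sgn (x - v)) = 0 \<longrightarrow> x \<in> H" using case2 by blast
    have "Im z = 0" if "complex_of_real y = z \<or> complex_of_real y = - z" for z y
      using that by (auto simp: complex_eq_iff)
    then show ?thesis using ab H(2) by (intro bexI[OF _ H(1)]) (metis site_grad.simps)
  next
    fix v w assume "a = Some v" "b = Some w"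
    then show ?thesis using case1[of v w] assms by simp
  qed (use assms in auto)
  then show ?thesis using that by blast
qed

text \<open>For unit numbers the conjugate is the inverse, so a nonzero sum also determines the
  product, and with it the quadratic polynomial whose roots are the two numbers.\<close>

lemma unit_pair_unique:
  fixes z1 z2 w1 w2 :: complex
  assumes "cmod z1 = 1" "cmod z2 = 1" "cmod w1 = 1" "cmod w2 = 1" "z1 + z2 = w1 + w2" "z1 + z2 \<noteq> 0"
  shows "w1 = z1 \<or> w1 = z2"
proof -
  have prod: "z1 * z2 * cnj (z1 + z2) = z1 + z2" if "cmod z1 = 1" "cmod z2 = 1" for z1 z2
  proof -
    have "z1 * cnj z1 = 1" "z2 * cnj z2 = 1" using that by (simp_all flip: complex_norm_square)
    then show ?thesis by (simp add: algebra_simps)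
  qed
  have "z1 * z2 * cnj (z1 + z2) = w1 * w2 * cnj (z1 + z2)"
    using prod[OF assms(1,2)] prod[OF assms(3,4)] assms(5) by simp
  then have "z1 * z2 = w1 * w2" using assms(6) by (simp del: complex_cnj_add)
  moreover have "w2 = z1 + z2 - w1" using assms(5) by simp
  ultimately have "(w1 - z1) * (w1 - z2) = 0" by (simp add: algebra_simps)
  then show ?thesis by auto
qed

text \<open>Where the gradient vanishes, two pairs of unit vectors have equal sums and so agree as
  pairs; off finitely many lines equal gradients mean equal sites, contrary to the assumption on the
  pairs. Elsewhere the level set is regular.\<close>

lemma null_site_difference:
  assumes "a \<noteq> b" "a' \<noteq> b'" "{a, b} \<noteq> {a', b'}"
  shows "{x. site_dist t a x + site_dist t b x - site_dist t a' x - site_dist t b' x = r} \<in> null_sets lborel"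
proof -
  define f where "f = (\<lambda>x. site_dist t a x + site_dist t b x - site_dist t a' x - site_dist t b' x - r)"
  define G where "G = (\<lambda>x. site_grad t a x + site_grad t b x - site_grad t a' x - site_grad t b' x)"
  define N where "N = site_set t a \<union> site_set t b \<union> site_set t a' \<union> site_set t b'"
  have N: "N \<in> null_sets lborel" unfolding N_def by (intro null_sets.Un site_set_null)
  define par where "par = (\<lambda>a b. SOME H. H \<in> null_sets lborel \<and>
    (\<forall>x. site_grad t a x = site_grad t b x \<or> site_grad t a x = - site_grad t b x \<longrightarrow> x \<in> H))"
  have par: "par a b \<in> null_sets lborel \<and>
    (\<forall>x. site_grad t a x = site_grad t b x \<or> site_grad t a x = - site_grad t b x \<longrightarrow> x \<in> par a b)" if ne: "a \<noteq> b" for a b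
    unfolding par_def by (rule someI_ex) (metis site_grad_parallel_null[OF ne])
  \<comment> \<open>The two pairs may share a site, and equal sites have equal gradients everywhere;
    they must not contribute an exceptional set.\<close>
  define par' where "par' = (\<lambda>a b. if a = b then {} else par a b)"
  have par': "par' a b \<in> null_sets lborel" for a b using par by (auto simp: par'_def)
  have par'D: "x \<in> par' a b" if "a \<noteq> b" "site_grad t a x = site_grad t b x \<or> site_grad t a x = - site_grad t b x" for a b x
    using par that by (auto simp: par'_def)
  define H where "H = par' a b \<union> par' a' b' \<union> par' a a' \<union> par' a b' \<union> par' b a' \<union> par' b b'"
  have H: "H \<in> null_sets lborel" unfolding H_def by (intro null_sets.Un par')
  have "{x. f x = 0 \<and> x \<notin> N \<and> G x \<noteq> 0} \<in> null_sets lborel"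
  proof (rule null_regular_level_set)
    show "f \<in> borel_measurable borel" unfolding f_def by measurable
    show "G \<in> borel_measurable borel" unfolding G_def by measurable
    show "N \<in> sets borel" using N by auto
    show "(f has_derivative (\<lambda>h. G x \<bullet> h)) (at x)" if "x \<notin> N" for x
      using that unfolding f_def G_def N_def
      by (auto intro!: derivative_eq_intros site_dist_derivative simp: inner_diff_left inner_add_left)
  qed
  moreover have "x \<in> H \<union> N" if "G x = 0" for x
  proof (rule ccontr)
    assume x: "x \<notin> H \<union> N"
    define g where "g = (\<lambda>a. site_grad t a x)"
    have nrm: "cmod (g a) = 1" "cmod (g b) = 1" "cmod (g a') = 1" "cmod (g b') = 1"
      using x by (auto simp: g_def N_def intro!: site_grad_norm)
    have ne: "g u \<noteq> g w" if "u \<in> {a, b, a', b'}" "w \<in> {a, b, a', b'}" "u \<noteq> w"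
      "{u, w} \<in> {{a, b}, {a', b'}, {a, a'}, {a, b'}, {b, a'}, {b, b'}}" for u w
    proof
      assume "g u = g w"
      then have "x \<in> par' u w" "x \<in> par' w u" using par'D[of u w x] par'D[of w u x] that(3) by (auto simp: g_def)
      then show False using x that(4) by (auto simp: H_def doubleton_eq_iff)
    qed
    have "g a + g b \<noteq> 0"
    proof
      assume "g a + g b = 0"
      then have "x \<in> par' a b" using assms(1) by (intro par'D) (auto simp: g_def add_eq_0_iff2)
      then show False using x by (simp add: H_def)
    qed
    moreover have sum: "g a + g b = g a' + g b'" using that by (simp add: G_def g_def algebra_simps)
    ultimately have "g a' = g a \<or> g a' = g b" using nrm by (intro unit_pair_unique)
    then show False
    proof
      assume *: "g a' = g a"
      then have "g b' = g b" using sum by simp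
      then have "a' = a" "b' = b" using * ne[of a' a] ne[of b' b] by (auto simp: insert_commute)
      then show False using assms(3) by simp
    next
      assume *: "g a' = g b"
      then have "g b' = g a" using sum by (simp add: algebra_simps)
      then have "a' = b" "b' = a" using * ne[of a' b] ne[of b' a] by (auto simp: insert_commute)
      then show False using assms(3) by (simp add: insert_commute)
    qed
  qed
  then have "{x. site_dist t a x + site_dist t b x - site_dist t a' x - site_dist t b' x = r} \<subseteq>
      {x. f x = 0 \<and> x \<notin> N \<and> G x \<noteq> 0} \<union> (H \<union> N)" by (auto simp: f_def)
  moreover have "{x. site_dist t a x + site_dist t b x - site_dist t a' x - site_dist t b' x = r} \<in> sets lborel"
    by measurable
  ultimately show ?thesis using H N by (meson null_sets.Un null_sets_subset)
qed

lemma null_site_sum: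
  assumes "a \<noteq> b"
  shows "{x. site_dist t a x + site_dist t b x = r} \<in> null_sets lborel"
proof -
  define f where "f = (\<lambda>x. site_dist t a x + site_dist t b x - r)"
  define G where "G = (\<lambda>x. site_grad t a x + site_grad t b x)"
  define N where "N = site_set t a \<union> site_set t b"
  have N: "N \<in> null_sets lborel" unfolding N_def by (intro null_sets.Un site_set_null)
  obtain H where H: "H \<in> null_sets lborel"
    "\<And>x. site_grad t a x = site_grad t b x \<or> site_grad t a x = - site_grad t b x \<Longrightarrow> x \<in> H"
    using site_grad_parallel_null[OF assms] by metis
  have "{x. f x = 0 \<and> x \<notin> N \<and> G x \<noteq> 0} \<in> null_sets lborel"
  proof (rule null_regular_level_set)
    show "f \<in> borel_measurable borel" unfolding f_def by measurable
    show "G \<in> borel_measurable borel" unfolding G_def by measurable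
    show "N \<in> sets borel" using N by auto
    show "(f has_derivative (\<lambda>h. G x \<bullet> h)) (at x)" if "x \<notin> N" for x
      using that unfolding f_def G_def N_def
      by (auto intro!: derivative_eq_intros site_dist_derivative simp: inner_add_left)
  qed
  moreover have "x \<in> H" if "G x = 0" for x using H(2)[of x] that by (simp add: G_def add_eq_0_iff2)
  then have "{x. site_dist t a x + site_dist t b x = r} \<subseteq> {x. f x = 0 \<and> x \<notin> N \<and> G x \<noteq> 0} \<union> (H \<union> N)"
    by (auto simp: f_def)
  moreover have "{x. site_dist t a x + site_dist t b x = r} \<in> sets lborel" by measurable
  ultimately show ?thesis using H(1) N by (meson null_sets.Un null_sets_subset)
qed

text \<open>With a default \<open>d\<close> outside \<open>c\<close>, a value in \<open>c\<close>
  certifies that the point in \<open>c\<close> is unique.\<close>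

definition pt :: "complex set \<Rightarrow> complex \<Rightarrow> complex set \<Rightarrow> complex" where
  "pt c d P = (if card (P \<inter> c) = 1 then the_elem (P \<inter> c) else d)"

lemma pt_eq: "P \<inter> c = {z} \<Longrightarrow> pt c d P = z"
  by (simp add: pt_def)

lemma pt_measurable:
  assumes "c \<in> sets borel" "bounded c"
  shows "pt c d \<in> measurable (cfg c) borel"
proof (rule measurableI)
  fix A :: "complex set" assume A: "A \<in> sets borel"
  have [measurable]: "(\<lambda>P. card (P \<inter> c)) \<in> measurable (cfg c) (count_space UNIV)"
    "(\<lambda>P. card (P \<inter> (c \<inter> A))) \<in> measurable (cfg c) (count_space UNIV)"
    using assms A by (auto intro!: count_measurable_cfg intro: bounded_subset)
  have "pt c d -` A \<inter> space (cfg c) =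
      {P\<in>space (cfg c). (card (P \<inter> c) = 1 \<and> card (P \<inter> (c \<inter> A)) = 1) \<or> (card (P \<inter> c) \<noteq> 1 \<and> d \<in> A)}"
  proof -
    have "pt c d P \<in> A \<longleftrightarrow> card (P \<inter> (c \<inter> A)) = 1" if one: "card (P \<inter> c) = 1" for P
    proof -
      obtain z where z: "P \<inter> c = {z}" using one by (auto simp: card_1_singleton_iff)
      then have "P \<inter> (c \<inter> A) = (if z \<in> A then {z} else {})" by auto
      then show ?thesis using pt_eq[OF z] by simp
    qed
    moreover have "pt c d P = d" if "card (P \<inter> c) \<noteq> 1" for P using that by (simp add: pt_def)
    ultimately show ?thesis by auto metis+
  qed
  also have "\<dots> \<in> sets (cfg c)" by measurable
  finally show "pt c d -` A \<inter> space (cfg c) \<in> sets (cfg c)" .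
qed simp

context poisson begin

text \<open>Given the rest of the configuration, the unique point in \<open>c\<close> has an absolutely continuous law.\<close>

lemma AE_pt_null:
  assumes c: "c \<in> sets borel" "bounded c" "d \<notin> c" "c \<inter> D = {}"
    and Y: "Y \<in> measurable (cfg D) L" and U: "U \<in> sets (borel \<Otimes>\<^sub>M L)"
    and null: "\<And>y. y \<in> space L \<Longrightarrow> \<exists>N\<in>null_sets lborel. {x. (x, y) \<in> U} \<subseteq> N"
  shows "AE w in M. card (\<omega> w \<inter> c) = 1 \<longrightarrow> (pt c d (\<omega> w), Y (\<omega> w)) \<notin> U"
proof -
  let ?dc = "distr M (cfg c) \<omega>" and ?dD = "distr M (cfg D) \<omega>"
  \<comment> \<open>Both components are \<open>\<omega>\<close>, yet the joint law is a product
    since \<open>c\<close> and \<open>D\<close> are disjoint. Fubini then fixes the configuration in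
    \<open>D\<close> and integrates over that in \<open>c\<close>.\<close>
  have eq: "?dc \<Otimes>\<^sub>M ?dD = distr M (cfg c \<Otimes>\<^sub>M cfg D) (\<lambda>w. (\<omega> w, \<omega> w))"
    using cfg_indep[OF c(4)] by (simp add: indep_var_distribution_eq)
  interpret Dc: prob_space ?dc by (rule prob_space_distr) simp
  interpret DD: prob_space ?dD by (rule prob_space_distr) simp
  interpret DcD: pair_prob_space ?dc ?dD ..
  note [measurable] = pt_measurable[OF c(1,2), of d] Y U
  define U' where "U' = U \<inter> (c \<times> space L)"
  have U' [measurable]: "U' \<in> sets (borel \<Otimes>\<^sub>M L)" unfolding U'_def using U c(1) by auto
  define W where "W = {p\<in>space (cfg c \<Otimes>\<^sub>M cfg D). (pt c d (fst p), Y (snd p)) \<in> U'}"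
  have W [measurable]: "W \<in> sets (cfg c \<Otimes>\<^sub>M cfg D)" unfolding W_def by measurable
  have zero: "emeasure ?dc ((\<lambda>P. (P, Q)) -` W) = 0" if Q: "Q \<in> LF" for Q
  proof -
    have y: "Y Q \<in> space L" using measurable_space[OF Y, of Q] Q by simp
    define A where "A = (\<lambda>x. (x, Y Q)) -` U'"
    have A: "A \<in> sets borel" unfolding A_def using U' by (rule sets_Pair2)
    obtain N where N: "N \<in> null_sets lborel" "{x. (x, Y Q) \<in> U} \<subseteq> N" using null[OF y] by blast
    have sub: "A \<subseteq> N" using N(2) by (auto simp: A_def U'_def)
    have "A \<in> sets lborel" using A by simp
    then have "A \<in> null_sets lborel" using null_sets_subset N(1) sub by metis
    then have A0: "measure lborel A = 0" by (auto simp: null_sets_def measure_def)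
    have Ac: "A \<subseteq> c" by (auto simp: A_def U'_def)
    then have bA: "bounded A" using c(2) bounded_subset by blast
    have "prob {w\<in>space M. pt c d (\<omega> w) \<in> A} \<le> prob {w\<in>space M. card (\<omega> w \<inter> A) \<noteq> 0}"
    proof (rule finite_measure_mono)
      show "{w\<in>space M. pt c d (\<omega> w) \<in> A} \<subseteq> {w\<in>space M. card (\<omega> w \<inter> A) \<noteq> 0}"
      proof
        fix w assume "w \<in> {w\<in>space M. pt c d (\<omega> w) \<in> A}"
        then have w: "w \<in> space M" "pt c d (\<omega> w) \<in> A" by auto
        have "card (\<omega> w \<inter> c) = 1" using w Ac c(3) by (auto simp: pt_def split: if_splits)
        then obtain z where z: "\<omega> w \<inter> c = {z}" by (auto simp: card_1_singleton_iff)
        then have "z \<in> \<omega> w \<inter> A" using w pt_eq[OF z] by auto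
        moreover have "finite (\<omega> w \<inter> A)" using omega_LF[OF w(1)] bA by (auto simp: LF_def)
        ultimately have "card (\<omega> w \<inter> A) \<noteq> 0" by auto
        then show "w \<in> {w\<in>space M. card (\<omega> w \<inter> A) \<noteq> 0}" using w by simp
      qed
      have [measurable]: "(\<lambda>w. card (\<omega> w \<inter> A)) \<in> measurable M (count_space UNIV)" by (rule count_rv[OF A bA])
      show "{w\<in>space M. card (\<omega> w \<inter> A) \<noteq> 0} \<in> events" by measurable
    qed
    also have "\<dots> \<le> 0" using prob_nonempty_le[OF A bA] A0 by simp
    finally have "prob {w\<in>space M. pt c d (\<omega> w) \<in> A} = 0" by (simp add: measure_le_0_iff)
    moreover have "(\<lambda>P. (P, Q)) -` W \<in> sets (cfg c)" using W by (rule sets_Pair2)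
    moreover have "\<omega> -` (\<lambda>P. (P, Q)) -` W \<inter> space M = {w\<in>space M. pt c d (\<omega> w) \<in> A}"
      using Q by (auto simp: W_def A_def space_pair_measure)
    ultimately show ?thesis by (simp add: emeasure_distr emeasure_eq_measure)
  qed
  have "emeasure M ((\<lambda>w. (\<omega> w, \<omega> w)) -` W \<inter> space M) = emeasure (?dc \<Otimes>\<^sub>M ?dD) W"
    unfolding eq by (simp add: emeasure_distr)
  also have "\<dots> = (\<integral>\<^sup>+Q. emeasure ?dc ((\<lambda>P. (P, Q)) -` W) \<partial>?dD)"
    by (rule DcD.emeasure_pair_measure_alt2) (simp cong: sets_pair_measure_cong)
  also have "\<dots> = (\<integral>\<^sup>+Q. 0 \<partial>?dD)"
    by (intro nn_integral_cong) (simp add: zero)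
  finally have "emeasure M ((\<lambda>w. (\<omega> w, \<omega> w)) -` W \<inter> space M) = 0" by simp
  then have "(\<lambda>w. (\<omega> w, \<omega> w)) -` W \<inter> space M \<in> null_sets M" by (intro null_setsI) auto
  then have "AE w in M. w \<notin> (\<lambda>w. (\<omega> w, \<omega> w)) -` W \<inter> space M" by (rule AE_not_in)
  then show ?thesis
  proof (rule AE_mp, intro AE_I2 impI)
    fix w assume w: "w \<in> space M" "w \<notin> (\<lambda>w. (\<omega> w, \<omega> w)) -` W \<inter> space M" "card (\<omega> w \<inter> c) = 1"
    obtain z where z: "\<omega> w \<inter> c = {z}" using w(3) by (auto simp: card_1_singleton_iff)
    then have "pt c d (\<omega> w) \<in> c" using pt_eq[OF z] by auto
    moreover have "Y (\<omega> w) \<in> space L" using measurable_space[OF Y, of "\<omega> w"] w(1) by simp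
    ultimately show "(pt c d (\<omega> w), Y (\<omega> w)) \<notin> U" using w by (auto simp: U'_def W_def space_pair_measure)
  qed
qed

text \<open>A sufficiently fine grid isolates finitely many distinct points in cells of their own.
  For each of the countably many choices of cells, the cell of \<open>x\<close> is independent of
  the others, so \<open>x\<close> avoids the null set that the other points determine.\<close>

lemma AE_tuple:
  fixes k :: nat
  defines "L \<equiv> PiM {..<k} (\<lambda>_. borel :: complex measure)"
  assumes meas: "{p\<in>space (borel \<Otimes>\<^sub>M L). Z (fst p) (snd p)} \<in> sets (borel \<Otimes>\<^sub>M L)"
    and null: "\<And>y. y \<in> space L \<Longrightarrow> \<exists>N\<in>null_sets lborel. {x. Z x y} \<subseteq> N"
  shows "AE w in M. \<forall>x ys. distinct (x # ys) \<and> length ys = k \<and> insert x (set ys) \<subseteq> \<omega> w \<longrightarrow>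
    \<not> Z x (\<lambda>i\<in>{..<k}. ys ! i)"
proof -
  define U where "U = {p\<in>space (borel \<Otimes>\<^sub>M L). Z (fst p) (snd p)}"
  define d where "d = (\<lambda>m c. SOME z. z \<notin> cell m c)"
  have d: "d m c \<notin> cell m c" for m c
  proof -
    have "\<exists>z. z \<notin> cell m c" using cell_bounded[of m c] not_bounded_UNIV by (metis UNIV_eq_I)
    then show ?thesis unfolding d_def by (rule someI_ex)
  qed
  define Y where "Y = (\<lambda>m cs P. \<lambda>i\<in>{..<k}. pt (cell m (cs ! i)) 0 P)"
  have "AE w in M. distinct (c # cs) \<and> length cs = k \<longrightarrow> card (\<omega> w \<inter> cell m c) = 1 \<longrightarrow>
      (pt (cell m c) (d m c) (\<omega> w), Y m cs (\<omega> w)) \<notin> U" for m c cs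
  proof (cases "distinct (c # cs) \<and> length cs = k")
    case True
    define D where "D = (\<Union>c\<in>set cs. cell m c)"
    have "AE w in M. card (\<omega> w \<inter> cell m c) = 1 \<longrightarrow> (pt (cell m c) (d m c) (\<omega> w), Y m cs (\<omega> w)) \<notin> U"
    proof (rule AE_pt_null[where D=D and L=L])
      show "cell m c \<inter> D = {}" using True by (auto simp: D_def cell_def)
      show "Y m cs \<in> measurable (cfg D) L" unfolding Y_def L_def
      proof (rule measurable_restrict)
        fix i assume "i \<in> {..<k}"
        then have "cs ! i \<in> set cs" using True by simp
        then show "pt (cell m (cs ! i)) 0 \<in> borel_measurable (cfg D)"
          using cell_bounded by (intro measurable_cfg_mono[OF pt_measurable]) (auto simp: D_def)
      qed
      show "U \<in> sets (borel \<Otimes>\<^sub>M L)" unfolding U_def by (rule meas)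
      show "\<exists>N\<in>null_sets lborel. {x. (x, y) \<in> U} \<subseteq> N" if "y \<in> space L" for y
        using null[OF that] by (auto simp: U_def)
    qed (use cell_bounded d in auto)
    then show ?thesis by eventually_elim simp
  next
    case False
    then show ?thesis by (intro AE_I2) blast
  qed
  then have "AE w in M. \<forall>m c cs. distinct (c # cs) \<and> length cs = k \<longrightarrow> card (\<omega> w \<inter> cell m c) = 1 \<longrightarrow>
      (pt (cell m c) (d m c) (\<omega> w), Y m cs (\<omega> w)) \<notin> U"
    by (simp add: AE_all_countable)
  then show ?thesis
  proof (rule AE_mp, intro AE_I2 impI allI)
    fix w x ys
    assume w: "w \<in> space M" and *: "\<forall>m c cs. distinct (c # cs) \<and> length cs = k \<longrightarrow> card (\<omega> w \<inter> cell m c) = 1 \<longrightarrow>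
      (pt (cell m c) (d m c) (\<omega> w), Y m cs (\<omega> w)) \<notin> U"
      and xs: "distinct (x # ys) \<and> length ys = k \<and> insert x (set ys) \<subseteq> \<omega> w"
    \<comment> \<open>All points within distance 1 of the tuple, not just the tuple: separating
      these ensures that each cell in question holds a single point of the configuration.\<close>
    define F where "F = \<omega> w \<inter> (\<Union>p\<in>set (x # ys). cball p 1)"
    have "bounded (\<Union>p\<in>set (x # ys). cball p 1)" by (intro bounded_UN) auto
    then have "finite F" using omega_LF[OF w] unfolding F_def LF_def by blast
    then obtain zs where zs: "set zs = F" "distinct zs" using finite_distinct_list by blast
    obtain m where m: "distinct (map (cidx m) zs)" "2 / 2 ^ m < (1::real)"
      using separate_points[OF zs(2), of 1] by auto
    have one: "\<omega> w \<inter> cell m (cidx m p) = {p}" if p: "p \<in> set (x # ys)" for p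
    proof -
      have nearF: "q \<in> F" if "q \<in> \<omega> w" "dist p q \<le> 1" for q
        unfolding F_def using that p by (intro IntI UN_I[of p]) auto
      have "p \<in> \<omega> w" using p xs by auto
      then have pF: "p \<in> F" by (intro nearF) auto
      have "q = p" if q: "q \<in> \<omega> w \<inter> cell m (cidx m p)" for q
      proof -
        have "dist p q < 2 / 2 ^ m" using q by (intro cell_dist[of p m "cidx m p"]) (auto simp: cell_def)
        then have "dist p q \<le> 1" using m(2) by linarith
        then have "q \<in> F" using q by (intro nearF) auto
        moreover have "cidx m q = cidx m p" using q by (simp add: cell_def)
        ultimately show ?thesis using m(1) pF unfolding zs(1)[symmetric] by (auto simp: distinct_map inj_on_def)
      qed
      moreover have "p \<in> \<omega> w \<inter> cell m (cidx m p)" using p xs by (auto simp: cell_def)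
      ultimately show ?thesis by blast
    qed
    have "inj_on (cidx m) (set (x # ys))"
    proof (rule inj_onI)
      fix p q assume p: "p \<in> set (x # ys)" and q: "q \<in> set (x # ys)" and eq: "cidx m p = cidx m q"
      have "{p} = {q}" unfolding one[OF p, symmetric] one[OF q, symmetric] eq ..
      then show "p = q" by simp
    qed
    then have "distinct (cidx m x # map (cidx m) ys)" using xs by (auto simp: distinct_map inj_on_def)
    moreover have "card (\<omega> w \<inter> cell m (cidx m x)) = 1" using one[of x] by simp
    ultimately have "(pt (cell m (cidx m x)) (d m (cidx m x)) (\<omega> w), Y m (map (cidx m) ys) (\<omega> w)) \<notin> U"
      using *[rule_format, of "cidx m x" "map (cidx m) ys" m] xs by simp
    moreover have "pt (cell m (cidx m x)) (d m (cidx m x)) (\<omega> w) = x" using one[of x] by (simp add: pt_eq)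
    moreover have "Y m (map (cidx m) ys) (\<omega> w) = (\<lambda>i\<in>{..<k}. ys ! i)"
      unfolding Y_def using xs one by (intro restrict_ext) (auto simp: pt_eq)
    ultimately show "\<not> Z x (\<lambda>i\<in>{..<k}. ys ! i)"
      by (auto simp: U_def space_pair_measure L_def space_PiM)
  qed
qed

end

section \<open>Almost sure uniqueness of the optimal chain\<close>

lemma component_measurable:
  "i < k \<Longrightarrow> (\<lambda>p. snd p i) \<in> borel_measurable (borel \<Otimes>\<^sub>M PiM {..<k} (\<lambda>_. borel :: complex measure))"
  by (rule measurable_compose[OF measurable_snd measurable_component_singleton]) simp

lemma tlen_measurable:
  assumes "a \<in> borel_measurable N" "\<And>f. f \<in> set fs \<Longrightarrow> f \<in> borel_measurable N"
  shows "(\<lambda>p. tlen T (a p) (map (\<lambda>f. f p) fs)) \<in> borel_measurable N"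
  using assms
proof (induction fs arbitrary: a)
  case Nil
  have "(\<lambda>x. infdist x T) \<in> borel_measurable borel"
    by (intro borel_measurable_continuous_onI continuous_on_infdist continuous_on_id)
  from measurable_compose[OF Nil(1) this] show ?case by simp
next
  case (Cons f fs)
  then have [measurable]: "a \<in> borel_measurable N" "f \<in> borel_measurable N"
    "(\<lambda>p. tlen T (f p) (map (\<lambda>f. f p) fs)) \<in> borel_measurable N" by auto
  show ?case by simp
qed

lemma null_Im_line: "{x. Im x = c} \<in> null_sets lborel"
proof -
  have "{x::complex. \<i> \<bullet> x = c} \<in> null_sets lborel" by (rule null_line) simp
  then show ?thesis by (simp add: inner_complex_def)
qed

lemma null_ellipse: "a \<noteq> (b :: complex) \<Longrightarrow> {x. dist a x + dist x b = r} \<in> null_sets lborel"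
  using null_site_sum[of "Some a" "Some b" 0 r] by (simp add: dist_commute)

text \<open>The clauses of \<open>generic\<close> are grouped by the number of further points
  involved: none, one or two. The exceptional sets are lines and degenerate ellipses.\<close>

lemma (in poisson) AE_generic: "AE w in M. generic t (\<omega> w)"
proof -
  have 0: "AE w in M. \<forall>x ys. distinct (x # ys) \<and> length ys = 0 \<and> insert x (set ys) \<subseteq> \<omega> w \<longrightarrow>
      \<not> (Re x = t \<or> Im x = 0)"
  proof (rule AE_tuple[where Z="\<lambda>x y. Re x = t \<or> Im x = 0" and k=0])
    have "{x. Re x = t \<or> Im x = 0} = site_set t None \<union> {x. Im x = 0}" by auto
    then show "\<exists>N\<in>null_sets lborel. {x. Re x = t \<or> Im x = 0} \<subseteq> N"
      using null_sets.Un[OF site_set_null[of t None] null_Im_line[of 0]] by auto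
  qed measurable
  have 1: "AE w in M. \<forall>x ys. distinct (x # ys) \<and> length ys = 1 \<and> insert x (set ys) \<subseteq> \<omega> w \<longrightarrow>
      \<not> (\<lambda>x y. Im x = Im (y 0) \<or> (y 0 \<noteq> 0 \<and> dist 0 x + dist x (y 0) = dist 0 (y 0))) x (\<lambda>i\<in>{..<1}. ys ! i)"
  proof (rule AE_tuple)
    have [measurable]: "(\<lambda>p. snd p 0) \<in> borel_measurable (borel \<Otimes>\<^sub>M PiM {..<1::nat} (\<lambda>_. borel :: complex measure))"
      by (rule component_measurable) simp
    show "{p \<in> space (borel \<Otimes>\<^sub>M PiM {..<1::nat} (\<lambda>_. borel :: complex measure)). Im (fst p) = Im (snd p 0) \<or>
        snd p 0 \<noteq> 0 \<and> dist 0 (fst p) + dist (fst p) (snd p 0) = dist 0 (snd p 0)} \<in>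
      sets (borel \<Otimes>\<^sub>M PiM {..<1::nat} (\<lambda>_. borel :: complex measure))" by measurable
    fix y :: "nat \<Rightarrow> complex"
    show "\<exists>N\<in>null_sets lborel. {x. Im x = Im (y 0) \<or> y 0 \<noteq> 0 \<and> dist 0 x + dist x (y 0) = dist 0 (y 0)} \<subseteq> N"
    proof (cases "y 0 = 0")
      case True
      then show ?thesis using null_Im_line[of 0] by auto
    next
      case False
      then show ?thesis using null_sets.Un[OF null_Im_line[of "Im (y 0)"] null_ellipse[of 0 "y 0" "dist 0 (y 0)"]]
        by (intro bexI[of _ "{x. Im x = Im (y 0)} \<union> {x. dist 0 x + dist x (y 0) = dist 0 (y 0)}"]) auto
    qed
  qed
  have 2: "AE w in M. \<forall>x ys. distinct (x # ys) \<and> length ys = 2 \<and> insert x (set ys) \<subseteq> \<omega> w \<longrightarrow>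
      \<not> (\<lambda>x y. y 0 \<noteq> y 1 \<and> dist (y 0) x + dist x (y 1) = dist (y 0) (y 1)) x (\<lambda>i\<in>{..<2}. ys ! i)"
  proof (rule AE_tuple)
    have [measurable]: "(\<lambda>p. snd p 0) \<in> borel_measurable (borel \<Otimes>\<^sub>M PiM {..<2::nat} (\<lambda>_. borel :: complex measure))"
      "(\<lambda>p. snd p 1) \<in> borel_measurable (borel \<Otimes>\<^sub>M PiM {..<2::nat} (\<lambda>_. borel :: complex measure))"
      by (rule component_measurable; simp)+
    show "{p \<in> space (borel \<Otimes>\<^sub>M PiM {..<2::nat} (\<lambda>_. borel :: complex measure)).
        snd p 0 \<noteq> snd p 1 \<and> dist (snd p 0) (fst p) + dist (fst p) (snd p 1) = dist (snd p 0) (snd p 1)} \<in>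
      sets (borel \<Otimes>\<^sub>M PiM {..<2::nat} (\<lambda>_. borel :: complex measure))" by measurable
    fix y :: "nat \<Rightarrow> complex"
    show "\<exists>N\<in>null_sets lborel. {x. y 0 \<noteq> y 1 \<and> dist (y 0) x + dist x (y 1) = dist (y 0) (y 1)} \<subseteq> N"
      using null_ellipse[of "y 0" "y 1" "dist (y 0) (y 1)"] by (cases "y 0 = y 1") auto
  qed
  show ?thesis
    using 0 1 2
  proof eventually_elim
    fix w
    assume h: "\<forall>x ys. distinct (x # ys) \<and> length ys = 0 \<and> insert x (set ys) \<subseteq> \<omega> w \<longrightarrow> \<not> (Re x = t \<or> Im x = 0)"
      "\<forall>x ys. distinct (x # ys) \<and> length ys = 1 \<and> insert x (set ys) \<subseteq> \<omega> w \<longrightarrow>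
      \<not> (\<lambda>x y. Im x = Im (y 0) \<or> (y 0 \<noteq> 0 \<and> dist 0 x + dist x (y 0) = dist 0 (y 0))) x (\<lambda>i\<in>{..<1}. ys ! i)"
      "\<forall>x ys. distinct (x # ys) \<and> length ys = 2 \<and> insert x (set ys) \<subseteq> \<omega> w \<longrightarrow>
      \<not> (\<lambda>x y. y 0 \<noteq> y 1 \<and> dist (y 0) x + dist x (y 1) = dist (y 0) (y 1)) x (\<lambda>i\<in>{..<2}. ys ! i)"
    have h0: "Re x \<noteq> t" "Im x \<noteq> 0" if "x \<in> \<omega> w" for x using h(1)[rule_format, of x "[]"] that by auto
    have h1: "Im x \<noteq> Im a" "a \<noteq> 0 \<longrightarrow> dist 0 x + dist x a \<noteq> dist 0 a" if "x \<in> \<omega> w" "a \<in> \<omega> w" "a \<noteq> x" for x a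
      using h(2)[rule_format, of x "[a]"] that by auto
    have h2: "dist a x + dist x b \<noteq> dist a b" if "x \<in> \<omega> w" "a \<in> \<omega> w" "b \<in> \<omega> w" "a \<noteq> x" "b \<noteq> x" "a \<noteq> b" for x a b
      using h(3)[rule_format, of x "[a, b]"] that by auto
    have zero: "0 \<notin> \<omega> w" using h0[of 0] by auto
    show "generic t (\<omega> w)"
      unfolding generic_def
    proof (intro conjI ballI impI)
      fix p a assume "p \<in> \<omega> w" "a \<in> insert 0 (\<omega> w)" "a \<noteq> p"
      then show "Im p \<noteq> Im a" using h0(2)[of p] h1(1)[of p a] by auto
    next
      fix p a b assume p: "p \<in> \<omega> w" "a \<in> insert 0 (\<omega> w)" "b \<in> \<omega> w" "a \<noteq> p" "b \<noteq> p" "a \<noteq> b"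
      then show "dist a p + dist p b \<noteq> dist a b"
        using h1(2)[of p b] h2[of p a b] zero by (cases "a = 0") auto
    qed (use h0 zero in auto)
  qed
qed

text \<open>Codes of the neighbours of a point in a chain: \<open>None\<close> is the target line, \<open>Some None\<close> the origin and
  \<open>Some (Some i)\<close> the \<open>i\<close>-th point.\<close>

definition siteof :: "(nat \<Rightarrow> complex) \<Rightarrow> nat option option \<Rightarrow> complex option" where
  "siteof y = map_option (case_option 0 y)"

text \<open>For a point inserted between two index lists, \<open>lcode\<close> of the first and
  \<open>rcode\<close> of the second are its neighbours; an empty first list means the origin, an
  empty second list the target line.\<close>

definition lcode :: "nat list \<Rightarrow> nat option option" where
  "lcode l = Some (if l = [] then None else Some (last l))"

definition rcode :: "nat list \<Rightarrow> nat option option" where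
  "rcode l = (case l of [] \<Rightarrow> None | j # _ \<Rightarrow> Some (Some j))"

definition proper :: "nat \<Rightarrow> (nat \<Rightarrow> complex) \<Rightarrow> bool" where
  "proper k y \<longleftrightarrow> (\<forall>i\<in>{..<k}. y i \<noteq> 0) \<and> (\<forall>i\<in>{..<k}. \<forall>j\<in>{..<k}. i \<noteq> j \<longrightarrow> y i \<noteq> y j)"

definition codes :: "nat \<Rightarrow> nat option option set" where
  "codes k = insert None (insert (Some None) ((\<lambda>i. Some (Some i)) ` {..<k}))"

lemma siteof_inj: "proper k y \<Longrightarrow> inj_on (siteof y) (codes k)"
  by (auto simp: inj_on_def siteof_def codes_def proper_def)

lemma lcode_in: "set l \<subseteq> {..<k} \<Longrightarrow> lcode l \<in> codes k"
proof (cases "l = []")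
  case False
  assume "set l \<subseteq> {..<k}"
  then have "last l \<in> {..<k}" using last_in_set[OF False] by blast
  then show ?thesis using False by (simp add: lcode_def codes_def)
qed (simp add: lcode_def codes_def)

lemma rcode_in: "set l \<subseteq> {..<k} \<Longrightarrow> rcode l \<in> codes k"
  by (cases l) (auto simp: rcode_def codes_def)

text \<open>Isolates the dependence on a single point: the length is a constant plus the distances
  of \<open>x\<close> to its two neighbours.\<close>

lemma tlen_sites:
  "tlen (Lambda_line t) 0 (map y l1 @ x # map y l2) = plen 0 (map y l1) +
    site_dist t (siteof y (lcode l1)) x + site_dist t (siteof y (rcode l2)) x +
    (case l2 of [] \<Rightarrow> 0 | j # js \<Rightarrow> tlen (Lambda_line t) (y j) (map y js))"
proof -
  have "dist (last (0 # map y l1)) x = site_dist t (siteof y (lcode l1)) x"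
    by (simp add: siteof_def lcode_def last_map)
  moreover have "tlen (Lambda_line t) x (map y l2) = site_dist t (siteof y (rcode l2)) x +
    (case l2 of [] \<Rightarrow> 0 | j # js \<Rightarrow> tlen (Lambda_line t) (y j) (map y js))"
    by (cases l2) (auto simp: siteof_def rcode_def infdist_Lambda dist_commute)
  ultimately show ?thesis by (simp only: tlen_append tlen.simps)
qed

lemma proper_measurable:
  "{p \<in> space (borel \<Otimes>\<^sub>M PiM {..<k} (\<lambda>_. borel :: complex measure)). proper k (snd p)} \<in>
    sets (borel \<Otimes>\<^sub>M PiM {..<k} (\<lambda>_. borel :: complex measure))"
proof -
  have [measurable]: "(\<lambda>p. snd p i) \<in> borel_measurable (borel \<Otimes>\<^sub>M PiM {..<k} (\<lambda>_. borel :: complex measure))"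
    if "i \<in> {..<k}" for i using that by (intro component_measurable) simp
  show ?thesis unfolding proper_def
    by (intro sets.sets_Collect_conj sets.sets_Collect_finite_All finite_lessThan sets.sets_Collect_imp) measurable
qed

lemma tlen_index_measurable:
  assumes "set l1 \<subseteq> {..<k}" "set l2 \<subseteq> {..<k}"
  shows "(\<lambda>p. tlen T 0 (map (snd p) l1 @ fst p # map (snd p) l2)) \<in>
      borel_measurable (borel \<Otimes>\<^sub>M PiM {..<k} (\<lambda>_. borel :: complex measure))"
    and "(\<lambda>p. tlen T 0 (map (snd p) l1)) \<in>
      borel_measurable (borel \<Otimes>\<^sub>M PiM {..<k} (\<lambda>_. borel :: complex measure))"
proof -
  have "(\<lambda>p. tlen T 0 (map (\<lambda>f. f p) (map (\<lambda>i p. snd p i) l1 @ fst # map (\<lambda>i p. snd p i) l2))) \<in>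
      borel_measurable (borel \<Otimes>\<^sub>M PiM {..<k} (\<lambda>_. borel :: complex measure))"
    using assms by (intro tlen_measurable) (auto intro: component_measurable)
  then show "(\<lambda>p. tlen T 0 (map (snd p) l1 @ fst p # map (snd p) l2)) \<in>
      borel_measurable (borel \<Otimes>\<^sub>M PiM {..<k} (\<lambda>_. borel :: complex measure))" by (simp add: o_def)
  have "(\<lambda>p. tlen T 0 (map (\<lambda>f. f p) (map (\<lambda>i p. snd p i) l1))) \<in>
      borel_measurable (borel \<Otimes>\<^sub>M PiM {..<k} (\<lambda>_. borel :: complex measure))"
    using assms by (intro tlen_measurable) (auto intro: component_measurable)
  then show "(\<lambda>p. tlen T 0 (map (snd p) l1)) \<in>
      borel_measurable (borel \<Otimes>\<^sub>M PiM {..<k} (\<lambda>_. borel :: complex measure))" by (simp add: o_def)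
qed

definition idx_lists :: "nat \<Rightarrow> nat list set" where
  "idx_lists k = {l. set l \<subseteq> {..<k}}"

context poisson begin

text \<open>Ties between chains of which only one contains \<open>x\<close>: given the other points,
  a tie prescribes the sum of two site distances of \<open>x\<close>, a null event.\<close>

lemma AE_no_tie_point:
  assumes "s > 0"
  shows "AE w in M. \<forall>k l1 l2 l'. distinct (l1 @ l2) \<longrightarrow> l1 \<in> idx_lists k \<longrightarrow> l2 \<in> idx_lists k \<longrightarrow> l' \<in> idx_lists k \<longrightarrow>
    (\<forall>x ys. distinct (x # ys) \<and> length ys = k \<and> insert x (set ys) \<subseteq> \<omega> w \<longrightarrow>
      \<not> (\<lambda>x y. proper k y \<and> cval s (Lambda_line t) (map y l1 @ x # map y l2) = cval s (Lambda_line t) (map y l'))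
        x (\<lambda>i\<in>{..<k}. ys ! i))"
  unfolding AE_all_countable
proof (intro allI)
  fix k l1 l2 l'
  show "AE w in M. distinct (l1 @ l2) \<longrightarrow> l1 \<in> idx_lists k \<longrightarrow> l2 \<in> idx_lists k \<longrightarrow> l' \<in> idx_lists k \<longrightarrow>
    (\<forall>x ys. distinct (x # ys) \<and> length ys = k \<and> insert x (set ys) \<subseteq> \<omega> w \<longrightarrow>
      \<not> (\<lambda>x y. proper k y \<and> cval s (Lambda_line t) (map y l1 @ x # map y l2) = cval s (Lambda_line t) (map y l'))
        x (\<lambda>i\<in>{..<k}. ys ! i))"
  proof (cases "distinct (l1 @ l2) \<and> l1 \<in> idx_lists k \<and> l2 \<in> idx_lists k \<and> l' \<in> idx_lists k")
    case True
    then have sub: "set l1 \<subseteq> {..<k}" "set l2 \<subseteq> {..<k}" "set l' \<subseteq> {..<k}" by (auto simp: idx_lists_def)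
    note [measurable] = tlen_index_measurable(1)[OF sub(1,2)] tlen_index_measurable(2)[OF sub(3,3)]
    have ne: "lcode l1 \<noteq> rcode l2" using True by (cases l2) (auto simp: lcode_def rcode_def)
    have "AE w in M. (\<forall>x ys. distinct (x # ys) \<and> length ys = k \<and> insert x (set ys) \<subseteq> \<omega> w \<longrightarrow>
      \<not> (\<lambda>x y. proper k y \<and> cval s (Lambda_line t) (map y l1 @ x # map y l2) = cval s (Lambda_line t) (map y l'))
        x (\<lambda>i\<in>{..<k}. ys ! i))"
    proof (rule AE_tuple)
      show "{p \<in> space (borel \<Otimes>\<^sub>M PiM {..<k} (\<lambda>_. borel)). proper k (snd p) \<and>
          cval s (Lambda_line t) (map (snd p) l1 @ fst p # map (snd p) l2) = cval s (Lambda_line t) (map (snd p) l')} \<in>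
        sets (borel \<Otimes>\<^sub>M PiM {..<k} (\<lambda>_. borel))"
        unfolding cval_def length_append list.size length_map by (intro sets.sets_Collect_conj proper_measurable) measurable
      fix y
      show "\<exists>N\<in>null_sets lborel. {x. proper k y \<and> cval s (Lambda_line t) (map y l1 @ x # map y l2) =
          cval s (Lambda_line t) (map y l')} \<subseteq> N"
      proof (cases "proper k y")
        case True
        define a b where "a = siteof y (lcode l1)" and "b = siteof y (rcode l2)"
        have ab: "a \<noteq> b" unfolding a_def b_def
          using ne siteof_inj[OF True] lcode_in[OF sub(1)] rcode_in[OF sub(2)] by (auto simp: inj_on_def)
        define e where "e = plen 0 (map y l1) + (case l2 of [] \<Rightarrow> 0 | j # js \<Rightarrow> tlen (Lambda_line t) (y j) (map y js))"
        \<comment> \<open>The squared length at which a tie occurs; the 0 in the list is a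
          placeholder for \<open>x\<close> and affects only the count.\<close>
        define v where "v = 2 * s * (cval s (Lambda_line t) (map y l') + real (length (map y l1 @ 0 # map y l2)))"
        have "site_dist t a x + site_dist t b x = sqrt v - e"
          if "cval s (Lambda_line t) (map y l1 @ x # map y l2) = cval s (Lambda_line t) (map y l')" for x
        proof -
          have eq: "tlen (Lambda_line t) 0 (map y l1 @ x # map y l2) = site_dist t a x + site_dist t b x + e"
            unfolding tlen_sites a_def b_def e_def by simp
          have "(tlen (Lambda_line t) 0 (map y l1 @ x # map y l2))\<^sup>2 =
              2 * s * (cval s (Lambda_line t) (map y l1 @ x # map y l2) + real (length (map y l1 @ 0 # map y l2)))"
            using assms by (simp add: cval_def)
          then have "(tlen (Lambda_line t) 0 (map y l1 @ x # map y l2))\<^sup>2 = v"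
            unfolding v_def that .
          then have "tlen (Lambda_line t) 0 (map y l1 @ x # map y l2) = sqrt v"
            using tlen_nonneg by (metis real_sqrt_unique)
          then show ?thesis using eq by simp
        qed
        then show ?thesis by (intro bexI[OF _ null_site_sum[OF ab, of t "sqrt v - e"]]) blast
      qed auto
    qed
    then show ?thesis by eventually_elim blast
  next
    case False
    then show ?thesis by (intro AE_I2) blast
  qed
qed

text \<open>Ties between chains that both contain \<open>x\<close>, but with different pairs of
  neighbours.\<close>

lemma AE_no_tie_order:
  "AE w in M. \<forall>k l1 l2 l1' l2'. distinct (l1 @ l2) \<longrightarrow> distinct (l1' @ l2') \<longrightarrow>
    l1 \<in> idx_lists k \<longrightarrow> l2 \<in> idx_lists k \<longrightarrow> l1' \<in> idx_lists k \<longrightarrow> l2' \<in> idx_lists k \<longrightarrow>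
    {lcode l1, rcode l2} \<noteq> {lcode l1', rcode l2'} \<longrightarrow>
    (\<forall>x ys. distinct (x # ys) \<and> length ys = k \<and> insert x (set ys) \<subseteq> \<omega> w \<longrightarrow>
      \<not> (\<lambda>x y. proper k y \<and> tlen (Lambda_line t) 0 (map y l1 @ x # map y l2) = tlen (Lambda_line t) 0 (map y l1' @ x # map y l2'))
        x (\<lambda>i\<in>{..<k}. ys ! i))"
  unfolding AE_all_countable
proof (intro allI)
  fix k l1 l2 l1' l2'
  show "AE w in M. distinct (l1 @ l2) \<longrightarrow> distinct (l1' @ l2') \<longrightarrow>
    l1 \<in> idx_lists k \<longrightarrow> l2 \<in> idx_lists k \<longrightarrow> l1' \<in> idx_lists k \<longrightarrow> l2' \<in> idx_lists k \<longrightarrow>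
    {lcode l1, rcode l2} \<noteq> {lcode l1', rcode l2'} \<longrightarrow>
    (\<forall>x ys. distinct (x # ys) \<and> length ys = k \<and> insert x (set ys) \<subseteq> \<omega> w \<longrightarrow>
      \<not> (\<lambda>x y. proper k y \<and> tlen (Lambda_line t) 0 (map y l1 @ x # map y l2) = tlen (Lambda_line t) 0 (map y l1' @ x # map y l2'))
        x (\<lambda>i\<in>{..<k}. ys ! i))"
  proof (cases "distinct (l1 @ l2) \<and> distinct (l1' @ l2') \<and> l1 \<in> idx_lists k \<and> l2 \<in> idx_lists k \<and>
      l1' \<in> idx_lists k \<and> l2' \<in> idx_lists k \<and> {lcode l1, rcode l2} \<noteq> {lcode l1', rcode l2'}")
    case True
    then have sub: "set l1 \<subseteq> {..<k}" "set l2 \<subseteq> {..<k}" "set l1' \<subseteq> {..<k}" "set l2' \<subseteq> {..<k}" by (auto simp: idx_lists_def)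
    note [measurable] = tlen_index_measurable(1)[OF sub(1,2)] tlen_index_measurable(1)[OF sub(3,4)]
    have ne: "lcode l1 \<noteq> rcode l2" "lcode l1' \<noteq> rcode l2'"
      using True by (cases l2; auto simp: lcode_def rcode_def) (use True in \<open>cases l2'; auto simp: lcode_def rcode_def\<close>)
    have "AE w in M. (\<forall>x ys. distinct (x # ys) \<and> length ys = k \<and> insert x (set ys) \<subseteq> \<omega> w \<longrightarrow>
      \<not> (\<lambda>x y. proper k y \<and> tlen (Lambda_line t) 0 (map y l1 @ x # map y l2) = tlen (Lambda_line t) 0 (map y l1' @ x # map y l2'))
        x (\<lambda>i\<in>{..<k}. ys ! i))"
    proof (rule AE_tuple)
      show "{p \<in> space (borel \<Otimes>\<^sub>M PiM {..<k} (\<lambda>_. borel)). proper k (snd p) \<and>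
          tlen (Lambda_line t) 0 (map (snd p) l1 @ fst p # map (snd p) l2) =
          tlen (Lambda_line t) 0 (map (snd p) l1' @ fst p # map (snd p) l2')} \<in>
        sets (borel \<Otimes>\<^sub>M PiM {..<k} (\<lambda>_. borel))"
        by (intro sets.sets_Collect_conj proper_measurable) measurable
      fix y
      show "\<exists>N\<in>null_sets lborel. {x. proper k y \<and> tlen (Lambda_line t) 0 (map y l1 @ x # map y l2) =
          tlen (Lambda_line t) 0 (map y l1' @ x # map y l2')} \<subseteq> N"
      proof (cases "proper k y")
        case True
        define a b a' b' where "a = siteof y (lcode l1)" and "b = siteof y (rcode l2)"
          and "a' = siteof y (lcode l1')" and "b' = siteof y (rcode l2')"
        note inj = inj_on_eq_iff[OF siteof_inj[OF True]]
        note mem = lcode_in[OF sub(1)] rcode_in[OF sub(2)] lcode_in[OF sub(3)] rcode_in[OF sub(4)]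
        have ab: "a \<noteq> b" "a' \<noteq> b'" unfolding a_def b_def a'_def b'_def using ne mem by (simp_all add: inj)
        have ab': "{a, b} \<noteq> {a', b'}"
        proof
          assume "{a, b} = {a', b'}"
          then have "siteof y ` {lcode l1, rcode l2} = siteof y ` {lcode l1', rcode l2'}"
            by (simp add: a_def b_def a'_def b'_def)
          then have "{lcode l1, rcode l2} = {lcode l1', rcode l2'}"
            using mem by (subst (asm) inj_on_image_eq_iff[OF siteof_inj[OF True]]) auto
          then show False using \<open>distinct (l1 @ l2) \<and> distinct (l1' @ l2') \<and> l1 \<in> idx_lists k \<and> l2 \<in> idx_lists k \<and>
      l1' \<in> idx_lists k \<and> l2' \<in> idx_lists k \<and> {lcode l1, rcode l2} \<noteq> {lcode l1', rcode l2'}\<close> by blast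
        qed
        define e where "e = plen 0 (map y l1) + (case l2 of [] \<Rightarrow> 0 | j # js \<Rightarrow> tlen (Lambda_line t) (y j) (map y js))"
        define e' where "e' = plen 0 (map y l1') + (case l2' of [] \<Rightarrow> 0 | j # js \<Rightarrow> tlen (Lambda_line t) (y j) (map y js))"
        have "site_dist t a x + site_dist t b x - site_dist t a' x - site_dist t b' x = e' - e"
          if "tlen (Lambda_line t) 0 (map y l1 @ x # map y l2) = tlen (Lambda_line t) 0 (map y l1' @ x # map y l2')" for x
          using that unfolding tlen_sites a_def b_def a'_def b'_def e_def e'_def by simp
        then show ?thesis by (intro bexI[OF _ null_site_difference[OF ab ab', of t "e' - e"]]) blast
      qed auto
    qed
    then show ?thesis by eventually_elim blast
  next
    case False
    then show ?thesis by (intro AE_I2) blast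
  qed
qed

end

lemma index_list:
  assumes "set ps \<subseteq> set ys"
  shows "\<exists>l\<in>idx_lists (length ys). map (\<lambda>i\<in>{..<length ys}. ys ! i) l = ps"
  using assms
proof (induction ps)
  case Nil
  then show ?case by (intro bexI[of _ "[]"]) (auto simp: idx_lists_def)
next
  case (Cons p ps)
  then obtain l where l: "l \<in> idx_lists (length ys)" "map (\<lambda>i\<in>{..<length ys}. ys ! i) l = ps" by auto
  obtain i where "i < length ys" "ys ! i = p" using Cons by (auto simp: in_set_conv_nth)
  then show ?case using l by (intro bexI[of _ "i # l"]) (auto simp: idx_lists_def)
qed

lemma proper_nth: "distinct ys \<Longrightarrow> 0 \<notin> set ys \<Longrightarrow> proper (length ys) (\<lambda>i\<in>{..<length ys}. ys ! i)"
  by (auto simp: proper_def nth_eq_iff_index_eq in_set_conv_nth)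

text \<open>Chains with different point sets are separated at a point of only one of them. For equal
  sets the lengths tie, and at the first discrepancy some point has different neighbours: the common
  predecessor, or, if the chains differ from the start, the first point of one chain, which
  neighbours the origin only there.\<close>

lemma (in poisson) AE_unique_chain_value:
  assumes "s > 0"
  shows "AE w in M. \<forall>ps\<in>chains (\<omega> w). \<forall>qs\<in>chains (\<omega> w).
    cval s (Lambda_line t) ps = cval s (Lambda_line t) qs \<longrightarrow> ps = qs"
  using AE_no_tie_point[OF assms, of t] AE_no_tie_order[of t] AE_generic[of t]
proof eventually_elim
  fix w
  let ?T = "Lambda_line t" and ?P = "\<omega> w"
  assume A: "\<forall>k l1 l2 l'. distinct (l1 @ l2) \<longrightarrow> l1 \<in> idx_lists k \<longrightarrow> l2 \<in> idx_lists k \<longrightarrow> l' \<in> idx_lists k \<longrightarrow>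
    (\<forall>x ys. distinct (x # ys) \<and> length ys = k \<and> insert x (set ys) \<subseteq> ?P \<longrightarrow>
      \<not> (\<lambda>x y. proper k y \<and> cval s ?T (map y l1 @ x # map y l2) = cval s ?T (map y l')) x (\<lambda>i\<in>{..<k}. ys ! i))"
    and B: "\<forall>k l1 l2 l1' l2'. distinct (l1 @ l2) \<longrightarrow> distinct (l1' @ l2') \<longrightarrow>
    l1 \<in> idx_lists k \<longrightarrow> l2 \<in> idx_lists k \<longrightarrow> l1' \<in> idx_lists k \<longrightarrow> l2' \<in> idx_lists k \<longrightarrow>
    {lcode l1, rcode l2} \<noteq> {lcode l1', rcode l2'} \<longrightarrow>
    (\<forall>x ys. distinct (x # ys) \<and> length ys = k \<and> insert x (set ys) \<subseteq> ?P \<longrightarrow>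
      \<not> (\<lambda>x y. proper k y \<and> tlen ?T 0 (map y l1 @ x # map y l2) = tlen ?T 0 (map y l1' @ x # map y l2'))
        x (\<lambda>i\<in>{..<k}. ys ! i))"
    and "generic t ?P"
  then have zero: "0 \<notin> ?P" by (simp add: generic_def)
  have diff: "set ps \<subseteq> set qs" if ps: "ps \<in> chains ?P" and qs: "qs \<in> chains ?P" and eq: "cval s ?T ps = cval s ?T qs" for ps qs
  proof (rule ccontr)
    assume "\<not> set ps \<subseteq> set qs"
    then obtain x where x: "x \<in> set ps" "x \<notin> set qs" by blast
    obtain p1 p2 where split: "ps = p1 @ x # p2" using split_list[OF x(1)] by blast
    obtain ys where ys: "set ys = set p1 \<union> set p2 \<union> set qs" "distinct ys"
      using finite_distinct_list[of "set p1 \<union> set p2 \<union> set qs"] by auto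
    let ?y = "\<lambda>i\<in>{..<length ys}. ys ! i"
    have xys: "distinct (x # ys)" "insert x (set ys) \<subseteq> ?P" using ys x split ps qs by (auto simp: chains_def)
    have pr: "proper (length ys) ?y" using ys xys zero by (intro proper_nth) auto
    obtain l1 where l1: "l1 \<in> idx_lists (length ys)" "map ?y l1 = p1" using index_list[of p1 ys] ys by auto
    obtain l2 where l2: "l2 \<in> idx_lists (length ys)" "map ?y l2 = p2" using index_list[of p2 ys] ys by auto
    obtain l' where l': "l' \<in> idx_lists (length ys)" "map ?y l' = qs" using index_list[of qs ys] ys by auto
    have "distinct (map ?y (l1 @ l2))" using l1 l2 split ps by (auto simp: chains_def)
    then have "distinct (l1 @ l2)" by (simp only: distinct_map)
    from A[rule_format, OF this l1(1) l2(1) l'(1), of x ys] show False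
      using xys pr eq l1(2) l2(2) l'(2) split by simp
  qed
  show "\<forall>ps\<in>chains ?P. \<forall>qs\<in>chains ?P. cval s ?T ps = cval s ?T qs \<longrightarrow> ps = qs"
  proof (intro ballI impI, rule ccontr)
    fix ps qs assume ps: "ps \<in> chains ?P" and qs: "qs \<in> chains ?P" and eq: "cval s ?T ps = cval s ?T qs" and "ps \<noteq> qs"
    have sets: "set ps = set qs" using diff[OF ps qs eq] diff[OF qs ps eq[symmetric]] by blast
    then have len: "length ps = length qs" using ps qs by (metis (mono_tags) chains_def distinct_card mem_Collect_eq)
    have "(tlen ?T 0 ps)\<^sup>2 = (tlen ?T 0 qs)\<^sup>2" using eq len assms by (simp add: cval_def)
    then have tl: "tlen ?T 0 ps = tlen ?T 0 qs" using tlen_nonneg by (simp add: power2_eq_iff_nonneg)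
    have tie: False if split: "ps = p1 @ x # p2" "qs = q1 @ x # q2"
      and code: "\<And>l1 l2 l1' l2' y. map y l1 = p1 \<Longrightarrow> map y l2 = p2 \<Longrightarrow> map y l1' = q1 \<Longrightarrow> map y l2' = q2 \<Longrightarrow>
        {lcode l1, rcode l2} \<noteq> {lcode l1', rcode l2'}" for p1 p2 q1 q2 x
    proof -
      obtain ys where ys: "set ys = set ps - {x}" "distinct ys" using finite_distinct_list[of "set ps - {x}"] by auto
      let ?y = "\<lambda>i\<in>{..<length ys}. ys ! i"
      have xys: "distinct (x # ys)" "insert x (set ys) \<subseteq> ?P" using ys split ps by (auto simp: chains_def)
      have pr: "proper (length ys) ?y" using ys xys zero by (intro proper_nth) auto
      have sub: "set p1 \<subseteq> set ys" "set p2 \<subseteq> set ys" "set q1 \<subseteq> set ys" "set q2 \<subseteq> set ys"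
        using ps qs split ys sets by (auto simp: chains_def)
      obtain l1 where l1: "l1 \<in> idx_lists (length ys)" "map ?y l1 = p1" using index_list[OF sub(1)] by auto
      obtain l2 where l2: "l2 \<in> idx_lists (length ys)" "map ?y l2 = p2" using index_list[OF sub(2)] by auto
      obtain l1' where l1': "l1' \<in> idx_lists (length ys)" "map ?y l1' = q1" using index_list[OF sub(3)] by auto
      obtain l2' where l2': "l2' \<in> idx_lists (length ys)" "map ?y l2' = q2" using index_list[OF sub(4)] by auto
      have "distinct (map ?y (l1 @ l2))" using l1 l2 split ps by (auto simp: chains_def)
      then have d: "distinct (l1 @ l2)" by (simp only: distinct_map)
      have "distinct (map ?y (l1' @ l2'))" using l1' l2' split qs by (auto simp: chains_def)
      then have d': "distinct (l1' @ l2')" by (simp only: distinct_map)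
      from B[rule_format, OF d d' l1(1) l2(1) l1'(1) l2'(1) code[OF l1(2) l2(2) l1'(2) l2'(2)], of x ys] show False
        using xys pr tl l1(2) l2(2) l1'(2) l2'(2) split by simp
    qed
    obtain pre a r b r' where pre: "ps = pre @ a # r" "qs = pre @ b # r'" "a \<noteq> b"
      using same_length_different[OF \<open>ps \<noteq> qs\<close> len] by auto
    show False
    proof (cases "pre = []")
      case True
      then have "a \<in> set qs" using pre sets by auto
      then obtain q1 q2 where q: "qs = q1 @ a # q2" using split_list by metis
      then have "q1 \<noteq> []" using pre True by auto
      show False
      proof (rule tie[of "[]" a r q1 q2])
        show "ps = [] @ a # r" using pre True by simp
        show "qs = q1 @ a # q2" by (rule q)
        fix l1 l2 l1' l2' and y :: "nat \<Rightarrow> complex"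
        assume "map y l1 = []" "map y l1' = q1"
        then show "{lcode l1, rcode l2} \<noteq> {lcode l1', rcode l2'}"
          using \<open>q1 \<noteq> []\<close> by (cases l2') (auto simp: lcode_def rcode_def doubleton_eq_iff)
      qed
    next
      case False
      then obtain pre' x where x: "pre = pre' @ [x]" by (metis rev_exhaust)
      have dp: "distinct ps" "distinct qs" using ps qs by (auto simp: chains_def)
      show False
      proof (rule tie[of pre' x "a # r" pre' "b # r'"])
        show "ps = pre' @ x # a # r" "qs = pre' @ x # b # r'" using pre x by auto
        fix l1 l2 l1' l2' and y :: "nat \<Rightarrow> complex"
        assume m: "map y l1 = pre'" "map y l2 = a # r" "map y l1' = pre'" "map y l2' = b # r'"
        then obtain i "is" j js where l: "l2 = i # is" "y i = a" "l2' = j # js" "y j = b" by auto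
        have "lcode l1 \<noteq> Some (Some j)"
        proof
          assume "lcode l1 = Some (Some j)"
          then have "j \<in> set l1" by (auto simp: lcode_def split: if_splits)
          then have "b \<in> set pre'" using m(1) l(4) by auto
          then show False using dp(2) pre x by auto
        qed
        moreover have "i \<noteq> j" using l pre(3) by auto
        ultimately show "{lcode l1, rcode l2} \<noteq> {lcode l1', rcode l2'}"
          using l by (auto simp: rcode_def doubleton_eq_iff)
      qed
    qed
  qed
qed

section \<open>Rotations and strips\<close>

lemma lborel_real_shift:
  fixes S :: "real set"
  assumes "S \<in> sets borel"
  shows "emeasure lborel {x. x + c \<in> S} = emeasure lborel S"
proof -
  have "emeasure lborel S = emeasure (distr lborel borel ((+) c)) S" by (simp add: lborel_distr_plus)
  also have "\<dots> = emeasure lborel ((+) c -` S \<inter> space lborel)" using assms by (intro emeasure_distr) auto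
  also have "(+) c -` S \<inter> space lborel = {x. x + c \<in> S}" by (auto simp: add.commute)
  finally show ?thesis by simp
qed

lemma emeasure_shear_Re:
  assumes B: "B \<in> sets borel"
  shows "emeasure lborel {z. Complex (Re z + a * Im z) (Im z) \<in> B} = emeasure lborel B"
proof -
  have [measurable]: "(\<lambda>z. Complex (Re z + a * Im z) (Im z)) \<in> borel_measurable borel"
    unfolding Complex_eq by measurable
  have N: "{z. Complex (Re z + a * Im z) (Im z) \<in> B} \<in> sets borel" using B by measurable
  have "emeasure lborel {x. Complex (x + a * y) y \<in> B} = emeasure lborel {x. Complex x y \<in> B}" for y
  proof -
    have "(\<lambda>x. Complex x y) \<in> borel_measurable borel" unfolding Complex_eq by measurable
    then have "{x. Complex x y \<in> B} \<in> sets borel" using B by measurable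
    from lborel_real_shift[OF this, of "a * y"] show ?thesis by simp
  qed
  then show ?thesis unfolding emeasure_complex_slices(2)[OF N] emeasure_complex_slices(2)[OF B] by simp
qed

lemma emeasure_shear_Im:
  assumes B: "B \<in> sets borel"
  shows "emeasure lborel {z. Complex (Re z) (Im z + a * Re z) \<in> B} = emeasure lborel B"
proof -
  have [measurable]: "(\<lambda>z. Complex (Re z) (Im z + a * Re z)) \<in> borel_measurable borel"
    unfolding Complex_eq by measurable
  have N: "{z. Complex (Re z) (Im z + a * Re z) \<in> B} \<in> sets borel" using B by measurable
  have "emeasure lborel {y. Complex x (y + a * x) \<in> B} = emeasure lborel {y. Complex x y \<in> B}" for x
  proof -
    have "(\<lambda>y. Complex x y) \<in> borel_measurable borel" unfolding Complex_eq by measurable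
    then have "{y. Complex x y \<in> B} \<in> sets borel" using B by measurable
    from lborel_real_shift[OF this, of "a * x"] show ?thesis by simp
  qed
  then show ?thesis unfolding emeasure_complex_slices(1)[OF N] emeasure_complex_slices(1)[OF B] by simp
qed

text \<open>A rotation other than the half turn is a product of three shears.\<close>

lemma emeasure_rotation:
  assumes u: "cmod u = 1" "Re u \<noteq> -1" and B: "B \<in> sets borel"
  shows "emeasure lborel ((*) u -` B) = emeasure lborel B"
proof -
  \<comment> \<open>The classical shear factor: for \<open>u = cis \<phi>\<close> this is
    \<open>- tan (\<phi> / 2)\<close>.\<close>
  define a where "a = - Im u / (1 + Re u)"
  define h where "h = (\<lambda>z. Complex (Re z + a * Im z) (Im z))"
  define v where "v = (\<lambda>z. Complex (Re z) (Im z + Im u * Re z))"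
  have [measurable]: "h \<in> borel_measurable borel" "v \<in> borel_measurable borel"
    unfolding h_def v_def Complex_eq by measurable
  have nz: "1 + Re u \<noteq> 0" using u(2) by simp
  have "(Re u)\<^sup>2 + (Im u)\<^sup>2 = 1" using u(1) by (metis cmod_power2 one_power2)
  then have "Im u * Im u = (1 - Re u) * (1 + Re u)" by (simp add: power2_eq_square algebra_simps)
  then have ab: "a * Im u = Re u - 1" using nz by (simp add: a_def field_simps)
  have ac: "a * (1 + Re u) = - Im u" using nz by (simp add: a_def)
  have rot: "u * z = h (v (h z))" for z
  proof (rule complex_eqI)
    have "Re (h (v (h z))) = Re z * (1 + a * Im u) + Im z * (a * (1 + (1 + a * Im u)))"
      by (simp add: h_def v_def algebra_simps)
    also have "\<dots> = Re (u * z)" unfolding ab using ac by (simp add: algebra_simps)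
    finally show "Re (u * z) = Re (h (v (h z)))" by simp
    have "Im (h (v (h z))) = Im u * Re z + Im z * (1 + a * Im u)"
      by (simp add: h_def v_def algebra_simps)
    also have "\<dots> = Im (u * z)" unfolding ab by (simp add: algebra_simps)
    finally show "Im (u * z) = Im (h (v (h z)))" by simp
  qed
  have B1: "{z. h z \<in> B} \<in> sets borel" using B by measurable
  have B2: "{z. v z \<in> {z. h z \<in> B}} \<in> sets borel" using B by measurable
  have "(*) u -` B = {z. h z \<in> {z. v z \<in> {z. h z \<in> B}}}" by (auto simp: rot)
  then show ?thesis
    using emeasure_shear_Re[OF B2, of a] emeasure_shear_Im[OF B1, of "Im u"] emeasure_shear_Re[OF B, of a]
    by (simp add: h_def v_def)
qed

lemma poisson_rotation:
  assumes "poisson M \<omega>" and u: "cmod u = 1" "Re u \<noteq> -1"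
  shows "poisson M (\<lambda>x. (*) u ` \<omega> x)"
proof -
  interpret poisson M \<omega> by fact
  have inj: "inj_on ((*) u) A" for A using u(1) by (auto simp: inj_on_def)
  have card: "card ((*) u ` P \<inter> B) = card (P \<inter> (*) u -` B)" for P B
  proof -
    have "(*) u ` P \<inter> B = (*) u ` (P \<inter> (*) u -` B)" by auto
    then show ?thesis by (simp add: card_image inj)
  qed
  have bnd: "bounded ((*) u -` B)" if B: "bounded B" for B
  proof -
    obtain r where r: "\<And>z. z \<in> B \<Longrightarrow> cmod z \<le> r" using B by (auto simp: bounded_iff)
    have "cmod z \<le> r" if "z \<in> (*) u -` B" for z using r[of "u * z"] that u(1) by (simp add: norm_mult)
    then show ?thesis by (auto simp: bounded_iff)
  qed
  have bor: "(*) u -` B \<in> sets borel" if "B \<in> sets borel" for B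
    using measurable_sets[of "(*) u" borel borel B] that by simp
  have meas: "measure lborel ((*) u -` B) = measure lborel B" if "B \<in> sets borel" for B
    using emeasure_rotation[OF u that] by (simp add: measure_def)
  have "poisson_pp M (\<lambda>x. (*) u ` \<omega> x)"
    unfolding poisson_pp_def
  proof (intro conjI ballI allI impI)
    show "prob_space M" by (rule prob_space_axioms)
    fix x B assume x: "x \<in> space M" and B: "bounded (B :: complex set)"
    have "finite (\<omega> x \<inter> (*) u -` B)" using omega_LF[OF x] bnd[OF B] by (auto simp: LF_def)
    moreover have "(*) u ` \<omega> x \<inter> B = (*) u ` (\<omega> x \<inter> (*) u -` B)" by auto
    ultimately show "finite ((*) u ` \<omega> x \<inter> B)" by simp
  next
    fix B :: "complex set" assume B: "B \<in> sets lborel" "bounded B"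
    then show "(\<lambda>x. card ((*) u ` \<omega> x \<inter> B)) \<in> measurable M (count_space UNIV)"
      unfolding card using bor bnd by (intro count_rv) auto
    show "prob {x \<in> space M. card ((*) u ` \<omega> x \<inter> B) = k} =
        measure lborel B ^ k / fact k * exp (- measure lborel B)" for k
      unfolding card using B bor bnd meas[of B] by (subst count_prob) auto
  next
    fix I :: "nat set" and B :: "nat \<Rightarrow> complex set"
    assume "finite I" "\<forall>i\<in>I. B i \<in> sets lborel \<and> bounded (B i)" "disjoint_family_on B I"
    then show "indep_vars (\<lambda>_. count_space UNIV) (\<lambda>i x. card ((*) u ` \<omega> x \<inter> B i)) I"
      unfolding card using bor bnd
      by (intro count_indep) (auto simp: disjoint_family_on_def)
  qed
  then show ?thesis by unfold_locales
qed

section \<open>Rotating chains and actions\<close>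

lemma dist_rotation: "cmod u = 1 \<Longrightarrow> dist (u * x) (u * y) = dist x y"
  by (simp add: dist_norm norm_mult flip: right_diff_distrib)

lemma infdist_rotation:
  assumes "cmod u = 1" "T \<noteq> {}" shows "infdist (u * x) ((*) u ` T) = infdist x T"
  using assms by (simp add: infdist_notempty image_image dist_rotation)

lemma tlen_rotation:
  "cmod u = 1 \<Longrightarrow> T \<noteq> {} \<Longrightarrow> tlen ((*) u ` T) (u * a) (map ((*) u) ps) = tlen T a ps"
  by (induction ps arbitrary: a) (auto simp: infdist_rotation dist_rotation)

lemma plen_rotation: "cmod u = 1 \<Longrightarrow> plen (u * a) (map ((*) u) ps) = plen a ps"
  by (induction ps arbitrary: a) (auto simp: dist_rotation)

lemma chains_rotation:
  assumes "cmod u = 1" shows "chains ((*) u ` P) = map ((*) u) ` chains P"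
proof (intro equalityI subsetI)
  have inj: "inj_on ((*) u) A" for A using assms by (auto simp: inj_on_def)
  fix ps assume ps: "ps \<in> chains ((*) u ` P)"
  define qs where "qs = map ((*) (cnj u)) ps"
  have uu: "u * cnj u = 1" using assms by (simp flip: complex_norm_square)
  then have "map ((*) u) qs = ps" by (simp add: qs_def o_def map_idI mult.assoc[symmetric])
  moreover have "qs \<in> chains P"
  proof -
    have "distinct qs" using ps \<open>map ((*) u) qs = ps\<close> by (metis (mono_tags) chains_def mem_Collect_eq distinct_map)
    moreover have "set qs \<subseteq> P"
    proof
      fix q assume "q \<in> set qs"
      then have "u * q \<in> set ps" using \<open>map ((*) u) qs = ps\<close> by force
      then obtain p where "p \<in> P" "u * q = u * p" using ps by (auto simp: chains_def)
      then show "q \<in> P" using assms by auto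
    qed
    ultimately show ?thesis by (simp add: chains_def)
  qed
  ultimately show "ps \<in> map ((*) u) ` chains P" by blast
next
  have inj: "inj_on ((*) u) A" for A using assms by (auto simp: inj_on_def)
  fix ps assume "ps \<in> map ((*) u) ` chains P"
  then obtain qs where qs: "distinct qs" "set qs \<subseteq> P" "ps = map ((*) u) qs" by (auto simp: chains_def)
  then show "ps \<in> chains ((*) u ` P)"
    using image_mono[OF qs(2), of "(*) u"] inj by (simp add: chains_def distinct_map)
qed

lemma cval_rotation:
  assumes "cmod u = 1" "T \<noteq> {}"
  shows "cval s ((*) u ` T) (map ((*) u) ps) = cval s T ps"
  using tlen_rotation[OF assms, of 0 ps] by (simp add: cval_def)

lemma cact_rotation:
  assumes "cmod u = 1" "T \<noteq> {}"
  shows "cact ((*) u ` P) s ((*) u ` T) = cact P s T"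
  unfolding cact_def chains_rotation[OF assms(1)] image_image cval_rotation[OF assms] ..

lemma tame_rotation: "cmod u = 1 \<Longrightarrow> tame b K P \<Longrightarrow> tame b K ((*) u ` P)"
  using plen_rotation[of u 0] by (auto simp: tame_def chains_rotation)

section \<open>The strip about the axis\<close>

definition strip :: "real \<Rightarrow> complex set" where
  "strip w = {z. \<bar>Im z\<bar> \<le> w}"

lemma cylinder_1: "cylinder 1 w = strip w"
proof -
  have "infdist z {complex_of_real a * 1 | a. True} = \<bar>Im z\<bar>" for z
  proof (rule antisym)
    have "infdist z {complex_of_real a * 1 | a. True} \<le> dist z (complex_of_real (Re z))"
      by (intro infdist_le) auto
    also have "\<dots> = \<bar>Im z\<bar>" by (simp add: dist_norm cmod_def)
    finally show "infdist z {complex_of_real a * 1 | a. True} \<le> \<bar>Im z\<bar>" .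
    have "\<bar>Im z\<bar> \<le> dist z x" if "x \<in> {complex_of_real a * 1 | a. True}" for x
      using that abs_Im_le_cmod[of "z - x"] by (auto simp: dist_norm)
    then show "\<bar>Im z\<bar> \<le> infdist z {complex_of_real a * 1 | a. True}"
      by (subst infdist_notempty) (auto intro!: cINF_greatest)
  qed
  then show ?thesis by (simp add: cylinder_def strip_def)
qed

lemma strip_borel [measurable]: "strip w \<in> sets borel"
  unfolding strip_def by measurable

lemma convex_strip: "convex (strip w)"
proof -
  have "strip w = {z. \<i> \<bullet> z \<le> w} \<inter> {z. \<i> \<bullet> z \<ge> - w}" by (auto simp: strip_def inner_complex_def)
  then show ?thesis by (simp only: convex_Int convex_halfspace_le convex_halfspace_ge)
qed

text \<open>If the optimal chain to the whole line stays in the strip, it is also optimal for any part of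
  the line that contains the end of the strip.\<close>

lemma strip_optimal_chain:
  assumes P: "P \<in> LF" "tame b K P" "b \<ge> 0" "K \<ge> 0" and "s > 0" "w \<ge> 0"
    and good: "cact (P \<inter> strip w) s (Lambda_line t) = cact P s (Lambda_line t)"
    and T: "T \<subseteq> Lambda_line t" "\<And>y. \<bar>y\<bar> \<le> w \<Longrightarrow> Complex t y \<in> T"
  obtains ps where "ps \<in> chains P" "set ps \<subseteq> strip w" "cact P s T = cval s T ps"
    "\<And>x. x \<in> strip w \<Longrightarrow> \<exists>z\<in>T \<inter> strip w. dist x z = infdist x T \<and> Re z = t"
proof -
  let ?L = "Lambda_line t"
  have Tne: "T \<noteq> {}" using T(2)[of 0] assms(6) by auto
  \<comment> \<open>From a point of the strip the nearest point of the whole line is at the same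
    height, hence in \<open>T\<close>; inside the strip the two targets are
    indistinguishable.\<close>
  have inf: "infdist x T = infdist x ?L" and near: "\<exists>z\<in>T \<inter> strip w. dist x z = infdist x T \<and> Re z = t"
    if x: "x \<in> strip w" for x
  proof -
    have z: "Complex t (Im x) \<in> T" using T(2) x by (simp add: strip_def)
    have d: "dist x (Complex t (Im x)) = infdist x ?L" by (simp add: infdist_Lambda dist_norm cmod_def)
    have "infdist x T \<le> infdist x ?L" unfolding d[symmetric] by (rule infdist_le[OF z])
    moreover have "infdist x ?L \<le> infdist x T" using T(1) Tne by (rule infdist_mono)
    ultimately show eq: "infdist x T = infdist x ?L" by simp
    show "\<exists>z\<in>T \<inter> strip w. dist x z = infdist x T \<and> Re z = t"
      using z d eq x by (intro bexI[of _ "Complex t (Im x)"]) (auto simp: strip_def)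
  qed
  have "P \<inter> strip w \<in> LF" using LF_subset[OF P(1)] by auto
  then obtain ps where ps: "ps \<in> chains (P \<inter> strip w)" "cact (P \<inter> strip w) s ?L = cval s ?L ps"
    using cact_attained[OF tame_subset[OF P(2)] assms(5) P(3,4), of "P \<inter> strip w" ?L] by auto
  have sub: "set ps \<subseteq> strip w" using ps by (auto simp: chains_def)
  have ps': "ps \<in> chains P" using ps(1) chains_mono[of "P \<inter> strip w" P] by auto
  have "tlen T a ps = tlen ?L a ps" if "a \<in> strip w" for a
    using that sub by (induction ps arbitrary: a) (auto simp: inf)
  then have eq: "cval s T ps = cval s ?L ps" using assms(6) by (simp add: cval_def strip_def)
  have "cact P s T = cval s T ps"
  proof (rule antisym)
    show "cact P s T \<le> cval s T ps" using P assms(5) ps' by (intro cact_le) auto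
    have "cval s T ps \<le> cval s T qs" if "qs \<in> chains P" for qs
    proof -
      have "cval s T ps = cact P s ?L" using eq ps(2) good by simp
      also have "\<dots> \<le> cval s ?L qs" using P assms(5) that by (intro cact_le) auto
      also have "\<dots> \<le> cval s T qs" using tlen_mono[OF T(1) Tne, of 0 qs] tlen_nonneg[of ?L 0 qs] assms(5)
        by (simp add: cval_def divide_right_mono power_mono)
      finally show ?thesis .
    qed
    then show "cval s T ps \<le> cact P s T" unfolding cact_def
      by (intro cInf_greatest) (auto intro: Nil_in_chains)
  qed
  then show ?thesis using that[OF ps' sub _ near] by blast
qed

section \<open>Vertical segments as targets\<close>

definition vseg :: "real \<Rightarrow> real \<Rightarrow> real \<Rightarrow> complex set" where
  "vseg t l r = Complex t ` {l..r}"

lemma compact_vseg: "compact (vseg t l r)"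
  unfolding vseg_def Complex_eq by (intro compact_continuous_image continuous_intros compact_Icc)

lemma vseg_subset: "vseg t l r \<subseteq> Lambda_line t"
  by (auto simp: vseg_def Lambda_line_def)

lemma vseg_infinite:
  assumes "l < r" "z \<in> vseg t l r" "e > 0"
  shows "infinite (vseg t l r \<inter> ball z e)"
proof -
  obtain y where y: "z = Complex t y" "l \<le> y" "y \<le> r" using assms(2) by (auto simp: vseg_def)
  obtain a b where ab: "a < b" "l \<le> a" "b \<le> r" "\<And>x. x \<in> {a<..<b} \<Longrightarrow> \<bar>x - y\<bar> < e"
  proof (cases "y < r")
    case True
    then show ?thesis using y assms(3) by (intro that[of y "min r (y + e)"]) auto
  next
    case False
    then show ?thesis using y assms by (intro that[of "max l (y - e)" y]) auto
  qed
  have "inj_on (Complex t) {a<..<b}" by (auto simp: inj_on_def)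
  moreover have "Complex t ` {a<..<b} \<subseteq> vseg t l r \<inter> ball z e"
    using ab y by (auto simp: vseg_def dist_norm cmod_def abs_minus_commute)
  ultimately show ?thesis using infinite_Ioo[OF ab(1)] by (metis finite_imageD finite_subset)
qed

lemma Action_vseg_rotated:
  assumes "P \<in> LF" "cmod u = 1" "l < r" "t > 0" "s > 0"
  shows "Action P s ((*) u ` vseg t l r) = cact P s ((*) u ` vseg t l r)"
proof (rule Action_eq_cact[OF assms(1)])
  have "compact ((*) u ` vseg t l r)"
    by (intro compact_continuous_image continuous_intros compact_vseg)
  then show "closed ((*) u ` vseg t l r)" by (rule compact_imp_closed)
  show "(*) u ` vseg t l r \<noteq> {}" using assms(3) by (auto simp: vseg_def)
  have "u \<noteq> 0" using assms(2) by auto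
  moreover have "0 \<notin> vseg t l r" using assms(4) by (auto simp: vseg_def complex_eq_iff)
  ultimately show "0 \<notin> (*) u ` vseg t l r" by auto
  fix z e assume z: "z \<in> (*) u ` vseg t l r" "e > (0::real)"
  then obtain z0 where z0: "z0 \<in> vseg t l r" "z = u * z0" by blast
  have inj: "inj_on ((*) u) A" for A using assms(2) by (auto simp: inj_on_def)
  have "infinite ((*) u ` (vseg t l r \<inter> ball z0 e))"
    using vseg_infinite[OF assms(3) z0(1) z(2)] inj finite_imageD by blast
  moreover have "(*) u ` (vseg t l r \<inter> ball z0 e) \<subseteq> (*) u ` vseg t l r \<inter> ball z e"
    using z0 dist_rotation[OF assms(2)] by auto
  ultimately show "infinite ((*) u ` vseg t l r \<inter> ball z e)" using finite_subset by blast
qed (rule assms(5))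

context poisson begin

text \<open>Turns the hypothesis about the minimizing path into an event about chain actions, which
  is measurable and can be transported by rotation. Only the larger event has to be measurable for
  the inequality.\<close>

lemma minimizer_event_le:
  assumes "s > 0" "t > 0"
  shows "prob {x\<in>space M. minimizer (\<omega> x) (Lambda_line t) s ` {0..s} \<subseteq> strip w} \<le>
    prob {x\<in>space M. cact (\<omega> x \<inter> strip w) s (Lambda_line t) = cact (\<omega> x) s (Lambda_line t)}"
proof -
  let ?T = "Lambda_line t"
  have [measurable]: "(\<lambda>P. cact P s ?T) \<in> borel_measurable (cfg UNIV)" by (rule cact_measurable_UNIV[OF assms(1)])
  have [measurable]: "(\<lambda>P. cact (P \<inter> strip w) s ?T) \<in> borel_measurable (cfg UNIV)"
    by (rule measurable_cfg_mono[OF cact_measurable]) (auto intro: assms)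
  show ?thesis
  proof (rule finite_measure_mono_AE)
    show "AE x in M. x \<in> {x\<in>space M. minimizer (\<omega> x) ?T s ` {0..s} \<subseteq> strip w} \<longrightarrow>
        x \<in> {x\<in>space M. cact (\<omega> x \<inter> strip w) s ?T = cact (\<omega> x) s ?T}"
      using AE_tame AE_generic[of t] AE_unique_chain_value[OF assms(1), of t] AE_space
    proof eventually_elim
      fix x assume x: "0 \<le> K x \<and> tame 64 (K x) (\<omega> x)" "generic t (\<omega> x)"
        "\<forall>ps\<in>chains (\<omega> x). \<forall>qs\<in>chains (\<omega> x). cval s ?T ps = cval s ?T qs \<longrightarrow> ps = qs" "x \<in> space M"
      have "cact (\<omega> x \<inter> strip w) s ?T = cact (\<omega> x) s ?T"
        if "minimizer (\<omega> x) ?T s ` {0..s} \<subseteq> strip w"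
        using x assms that by (intro minimizer_in_chain_in[where b=64 and K="K x"]) auto
      then show "x \<in> {x\<in>space M. minimizer (\<omega> x) ?T s ` {0..s} \<subseteq> strip w} \<longrightarrow>
        x \<in> {x\<in>space M. cact (\<omega> x \<inter> strip w) s ?T = cact (\<omega> x) s ?T}" using x(4) by blast
    qed
    show "{x\<in>space M. cact (\<omega> x \<inter> strip w) s ?T = cact (\<omega> x) s ?T} \<in> events" by measurable
  qed
qed

end

lemma prob_strip_rotation:
  assumes "poisson M \<omega>" "poisson M \<omega>'" "s > 0"
  shows "measure M {x\<in>space M. cact (\<omega> x \<inter> strip w) s T = cact (\<omega> x) s T} =
    measure M {x\<in>space M. cact (\<omega>' x \<inter> strip w) s T = cact (\<omega>' x) s T}"
proof -
  interpret W: poisson M \<omega> by fact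
  interpret W': poisson M \<omega>' by fact
  have [measurable]: "(\<lambda>P. cact P s T) \<in> borel_measurable (cfg UNIV)" by (rule cact_measurable_UNIV[OF assms(3)])
  have [measurable]: "(\<lambda>P. cact (P \<inter> strip w) s T) \<in> borel_measurable (cfg UNIV)"
    by (rule measurable_cfg_mono[OF cact_measurable]) (auto intro: assms)
  define G where "G = {P\<in>space (cfg UNIV). cact (P \<inter> strip w) s T = cact P s T}"
  have G: "G \<in> sets (cfg UNIV)" unfolding G_def by measurable
  have "measure (distr M (cfg UNIV) \<omega>) G = measure (distr M (cfg UNIV) \<omega>') G"
    using poisson_law_unique[OF assms(1,2)] by simp
  moreover have "\<omega> -` G \<inter> space M = {x\<in>space M. cact (\<omega> x \<inter> strip w) s T = cact (\<omega> x) s T}"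
    "\<omega>' -` G \<inter> space M = {x\<in>space M. cact (\<omega>' x \<inter> strip w) s T = cact (\<omega>' x) s T}"
    by (auto simp: G_def)
  ultimately show ?thesis using G by (simp add: measure_distr)
qed

section \<open>Covariance with the number of points\<close>

lemma integrable_prod_of_squares:
  fixes f g :: "'a \<Rightarrow> real"
  assumes [measurable]: "f \<in> borel_measurable M" "g \<in> borel_measurable M"
    and "integrable M (\<lambda>x. (f x)\<^sup>2)" "integrable M (\<lambda>x. (g x)\<^sup>2)"
  shows "integrable M (\<lambda>x. f x * g x)"
proof (rule Bochner_Integration.integrable_bound)
  show "integrable M (\<lambda>x. (f x)\<^sup>2 + (g x)\<^sup>2)" using assms(3,4) by simp
  show "AE x in M. norm (f x * g x) \<le> norm ((f x)\<^sup>2 + (g x)\<^sup>2)"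
  proof (intro AE_I2)
    fix x
    have "0 \<le> (\<bar>f x\<bar> - \<bar>g x\<bar>)\<^sup>2" by simp
    then have "2 * (\<bar>f x\<bar> * \<bar>g x\<bar>) \<le> (f x)\<^sup>2 + (g x)\<^sup>2" by (simp add: power2_diff)
    moreover have "0 \<le> \<bar>f x\<bar> * \<bar>g x\<bar>" by simp
    ultimately have "\<bar>f x\<bar> * \<bar>g x\<bar> \<le> (f x)\<^sup>2 + (g x)\<^sup>2" by linarith
    then show "norm (f x * g x) \<le> norm ((f x)\<^sup>2 + (g x)\<^sup>2)" by (simp add: abs_mult)
  qed
qed measurable

lemma (in prob_space) variance_ge_covariance:
  fixes f n :: "'a \<Rightarrow> real"
  assumes [measurable]: "f \<in> borel_measurable M" "n \<in> borel_measurable M"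
    and sq: "integrable M (\<lambda>x. (f x)\<^sup>2)" "integrable M (\<lambda>x. (n x)\<^sup>2)"
    and n: "expectation n = 0" "expectation (\<lambda>x. (n x)\<^sup>2) \<le> l" "l > 0"
  shows "(expectation (\<lambda>x. f x * n x))\<^sup>2 / l \<le> variance f"
proof -
  have int: "integrable M f" "integrable M n"
    by (rule square_integrable_imp_integrable[OF _ sq(1)] square_integrable_imp_integrable[OF _ sq(2)]; measurable)+
  have fn: "integrable M (\<lambda>x. f x * n x)" using sq by (intro integrable_prod_of_squares) auto
  define m where "m = expectation f"
  define c where "c = expectation (\<lambda>x. f x * n x)"
  \<comment> \<open>The minimizer of the quadratic \<open>2 * a * c + a^2 * l\<close>.\<close>
  define a where "a = - c / l"
  have V: "integrable M (\<lambda>x. (f x - m)\<^sup>2)" using sq int by (simp add: power2_diff)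
  have cov: "expectation (\<lambda>x. (f x - m) * n x) = c"
    using fn int n(1) by (simp add: left_diff_distrib c_def)
  have icov: "integrable M (\<lambda>x. (f x - m) * n x)" using fn int by (simp add: left_diff_distrib)
  have "0 \<le> expectation (\<lambda>x. ((f x - m) + a * n x)\<^sup>2)" by simp
  also have "\<dots> = expectation (\<lambda>x. (f x - m)\<^sup>2 + (2 * a) * ((f x - m) * n x) + a\<^sup>2 * (n x)\<^sup>2)"
    by (intro Bochner_Integration.integral_cong) (auto simp: power2_eq_square algebra_simps)
  also have "\<dots> = variance f + 2 * a * c + a\<^sup>2 * expectation (\<lambda>x. (n x)\<^sup>2)"
    using V icov sq(2) by (simp add: cov[unfolded m_def] m_def)
  also have "\<dots> \<le> variance f + 2 * a * c + a\<^sup>2 * l" using n(2) by (intro add_left_mono mult_left_mono) auto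
  finally have "0 \<le> variance f + 2 * a * c + a\<^sup>2 * l" .
  moreover have "2 * a * c + a\<^sup>2 * l = - (c\<^sup>2 / l)" using n(3) by (simp add: a_def power2_eq_square)
  ultimately have "c\<^sup>2 / l \<le> variance f" by linarith
  then show ?thesis unfolding c_def .
qed

section \<open>Gains of cells\<close>

context poisson begin

definition cnt :: "complex set \<Rightarrow> 'a \<Rightarrow> real" where
  "cnt B x = real (card (\<omega> x \<inter> B))"

lemma cnt_measurable: "B \<in> sets borel \<Longrightarrow> bounded B \<Longrightarrow> cnt B \<in> borel_measurable M"
  unfolding cnt_def[abs_def] by (rule measurable_compose[OF count_rv]) auto

lemma cnt_moments:
  assumes "B \<in> sets borel" "bounded B"
  defines "r \<equiv> measure lborel B"
  shows "integrable M (cnt B)" "expectation (cnt B) = r" "integrable M (\<lambda>x. (cnt B x)\<^sup>2)"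
    "expectation (\<lambda>x. cnt B x * (cnt B x - 1)) = r\<^sup>2" "integrable M (\<lambda>x. cnt B x * (cnt B x - 1))"
    "integrable M (\<lambda>x. (cnt B x - r)\<^sup>2)" "expectation (\<lambda>x. (cnt B x - r)\<^sup>2) = r"
proof -
  note m = count_moments[OF assms(1,2), folded r_def]
  show 1: "integrable M (cnt B)" "expectation (cnt B) = r"
    and 2: "expectation (\<lambda>x. cnt B x * (cnt B x - 1)) = r\<^sup>2" "integrable M (\<lambda>x. cnt B x * (cnt B x - 1))"
    using m by (simp_all add: cnt_def[abs_def])
  have eq: "(\<lambda>x. (cnt B x)\<^sup>2) = (\<lambda>x. cnt B x * (cnt B x - 1) + cnt B x)" by (simp add: fun_eq_iff power2_eq_square algebra_simps)
  show 3: "integrable M (\<lambda>x. (cnt B x)\<^sup>2)" unfolding eq using 1 2 by simp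
  show "integrable M (\<lambda>x. (cnt B x - r)\<^sup>2)" using 1 3 by (simp add: power2_diff)
  have "expectation (\<lambda>x. (cnt B x)\<^sup>2) = r\<^sup>2 + r" unfolding eq using 1 2 by simp
  then show "expectation (\<lambda>x. (cnt B x - r)\<^sup>2) = r"
    using 1 3 prob_space by (simp add: power2_diff) (simp add: power2_eq_square)
qed

definition act :: "real \<Rightarrow> complex set \<Rightarrow> complex set \<Rightarrow> 'a \<Rightarrow> real" where
  "act s T D x = cact (\<omega> x \<inter> D) s T"

lemma act_measurable: "s > 0 \<Longrightarrow> D \<in> sets borel \<Longrightarrow> act s T D \<in> borel_measurable M"
  unfolding act_def[abs_def] by (rule measurable_compose[OF omega_measurable cact_measurable])

text \<open>The lower bound is that of tame configurations, with \<open>2048 = 64^2 / 2\<close>; the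
  upper one is the value of the empty chain.\<close>

lemma AE_act_bound:
  assumes "s > 0"
  shows "AE x in M. \<bar>act s T D x\<bar> \<le> 2048 * s + (infdist 0 T)\<^sup>2 / (2 * s) + K x"
  using AE_tame
proof eventually_elim
  fix x assume x: "0 \<le> K x \<and> tame 64 (K x) (\<omega> x)"
  then have t: "tame 64 (K x) (\<omega> x \<inter> D)" using tame_subset by blast
  have "- (64\<^sup>2 * s / 2) - K x \<le> act s T D x" unfolding act_def by (rule cact_lower[OF t assms]) simp
  then have "- (2048 * s) - K x \<le> act s T D x" by simp
  moreover have "act s T D x \<le> cval s T []" unfolding act_def by (rule cact_le[OF t assms]) auto
  then have "act s T D x \<le> (infdist 0 T)\<^sup>2 / (2 * s)" by (simp add: cval_def)
  moreover have "0 \<le> (infdist 0 T)\<^sup>2 / (2 * s)" using assms by simp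
  ultimately show "\<bar>act s T D x\<bar> \<le> 2048 * s + (infdist 0 T)\<^sup>2 / (2 * s) + K x"
    using x assms by (intro abs_leI; linarith)
qed

lemma act_square_integrable:
  assumes "s > 0" "D \<in> sets borel"
  shows "integrable M (\<lambda>x. (act s T D x)\<^sup>2)"
proof (rule Bochner_Integration.integrable_bound)
  define A where "A = 2048 * s + (infdist 0 T)\<^sup>2 / (2 * s)"
  show "integrable M (\<lambda>x. (A + K x)\<^sup>2)"
    using K_integrable K_square_integrable by (simp add: power2_sum)
  show "AE x in M. norm ((act s T D x)\<^sup>2) \<le> norm ((A + K x)\<^sup>2)"
    using AE_act_bound[OF assms(1), of T D]
  proof eventually_elim
    fix x assume "\<bar>act s T D x\<bar> \<le> 2048 * s + (infdist 0 T)\<^sup>2 / (2 * s) + K x"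
    then have "\<bar>act s T D x\<bar> ^ 2 \<le> (A + K x)\<^sup>2" unfolding A_def by (intro power_mono) auto
    then show "norm ((act s T D x)\<^sup>2) \<le> norm ((A + K x)\<^sup>2)" by simp
  qed
  have [measurable]: "act s T D \<in> borel_measurable M" by (rule act_measurable[OF assms])
  show "(\<lambda>x. (act s T D x)\<^sup>2) \<in> borel_measurable M" by measurable
qed

definition gain :: "real \<Rightarrow> complex set \<Rightarrow> complex set \<Rightarrow> 'a \<Rightarrow> real" where
  "gain s T c x = act s T (- c) x - act s T UNIV x"

lemma act_uncorrelated:
  assumes "s > 0" "c \<in> sets borel" "bounded c"
  shows "expectation (\<lambda>x. act s T (- c) x * (cnt c x - measure lborel c)) = 0"
proof -
  have "indep_var borel ((\<lambda>P. cact (P \<inter> - c) s T) \<circ> \<omega>) borel ((\<lambda>P. real (card (P \<inter> c))) \<circ> \<omega>)"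
  proof (rule indep_var_compose[OF cfg_indep])
    show "- c \<inter> c = {}" by auto
    show "(\<lambda>P. cact (P \<inter> - c) s T) \<in> borel_measurable (cfg (- c))"
      using assms by (intro cact_measurable) auto
    show "(\<lambda>P. real (card (P \<inter> c))) \<in> borel_measurable (cfg c)"
      using count_measurable_cfg[OF assms(2,3), of c] by measurable
  qed
  then have ind: "indep_var borel (act s T (- c)) borel (cnt c)" by (simp add: o_def act_def[abs_def] cnt_def[abs_def])
  have sq: "integrable M (\<lambda>x. (act s T (- c) x)\<^sup>2)" using assms by (intro act_square_integrable) auto
  have [measurable]: "act s T (- c) \<in> borel_measurable M" "cnt c \<in> borel_measurable M"
    using assms act_measurable cnt_measurable by auto
  have 1: "integrable M (act s T (- c))" by (rule square_integrable_imp_integrable[OF _ sq]) measurable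
  note 2 = cnt_moments[OF assms(2,3)]
  have "expectation (\<lambda>x. act s T (- c) x * cnt c x) = expectation (act s T (- c)) * expectation (cnt c)"
    by (rule indep_var_lebesgue_integral[OF ind 1 2(1)])
  moreover have "integrable M (\<lambda>x. act s T (- c) x * cnt c x)"
    using sq 2 by (intro integrable_prod_of_squares) auto
  ultimately show ?thesis using 1 2 by (simp add: right_diff_distrib)
qed

lemma AE_gain:
  assumes "s > 0" "bounded c"
  shows "AE x in M. 0 \<le> gain s T c x \<and> gain s T c x \<le> cnt c x"
  using AE_tame AE_space
proof eventually_elim
  fix x assume x: "0 \<le> K x \<and> tame 64 (K x) (\<omega> x)" and "x \<in> space M"
  then have LF: "\<omega> x \<in> LF" by simp
  have "cact (\<omega> x) s T \<le> cact (\<omega> x \<inter> - c) s T" using x assms by (intro cact_mono_config[of 64 "K x"]) auto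
  moreover obtain ps where ps: "ps \<in> chains (\<omega> x)" "cact (\<omega> x) s T = cval s T ps"
    using cact_attained[of 64 "K x" "\<omega> x" s T] x assms LF by auto
  have "cact (\<omega> x - c) s T \<le> cact (\<omega> x) s T + card (set ps \<inter> c)"
    using x assms ps by (intro cact_remove[of 64 "K x"]) auto
  moreover have "card (set ps \<inter> c) \<le> card (\<omega> x \<inter> c)"
    using ps LF assms(2) by (intro card_mono) (auto simp: chains_def LF_def)
  ultimately show "0 \<le> gain s T c x \<and> gain s T c x \<le> cnt c x"
    by (auto simp: gain_def act_def cnt_def Diff_eq)
qed

lemma gain_integrable:
  assumes "s > 0" "c \<in> sets borel"
  shows "gain s T c \<in> borel_measurable M" "integrable M (\<lambda>x. (gain s T c x)\<^sup>2)" "integrable M (gain s T c)"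
proof -
  have [measurable]: "act s T (- c) \<in> borel_measurable M" "act s T UNIV \<in> borel_measurable M"
    using assms by (auto intro: act_measurable)
  have sq: "integrable M (\<lambda>x. (act s T (- c) x)\<^sup>2)" "integrable M (\<lambda>x. (act s T UNIV x)\<^sup>2)"
    using assms by (auto intro: act_square_integrable)
  show m: "gain s T c \<in> borel_measurable M" unfolding gain_def[abs_def] by measurable
  have "integrable M (\<lambda>x. act s T (- c) x * act s T UNIV x)" using sq by (intro integrable_prod_of_squares) auto
  then show i: "integrable M (\<lambda>x. (gain s T c x)\<^sup>2)" unfolding gain_def power2_diff using sq by (simp add: mult.assoc)
  show "integrable M (gain s T c)" by (rule square_integrable_imp_integrable[OF m i])
qed

text \<open>The action is the one without the points of \<open>c\<close>, which is independent of
  the count, minus the gain. The gain vanishes on empty cells and is at most the count, so its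
  product with the count differs from it only for two or more points, an event controlled by the
  factorial moment \<open>r^2\<close>.\<close>

lemma covariance_cell:
  assumes "s > 0" "c \<in> sets borel" "bounded c"
  defines "r \<equiv> measure lborel c"
  shows "expectation (gain s T c) - r\<^sup>2 \<le> - expectation (\<lambda>x. act s T UNIV x * (cnt c x - r))"
    and "- expectation (\<lambda>x. act s T UNIV x * (cnt c x - r)) \<le> expectation (gain s T c) + r\<^sup>2"
proof -
  let ?g = "gain s T c" and ?n = "cnt c"
  note n = cnt_moments[OF assms(2,3), folded r_def]
  note g = gain_integrable[OF assms(1,2), of T]
  have [measurable]: "act s T (- c) \<in> borel_measurable M" "act s T UNIV \<in> borel_measurable M"
    "?n \<in> borel_measurable M" "?g \<in> borel_measurable M"
    using assms g by (auto intro: act_measurable cnt_measurable)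
  have i1: "integrable M (\<lambda>x. act s T (- c) x * (?n x - r))" "integrable M (\<lambda>x. act s T UNIV x * (?n x - r))"
    "integrable M (\<lambda>x. ?g x * ?n x)"
    using n g assms act_square_integrable by (auto intro!: integrable_prod_of_squares)
  have "- expectation (\<lambda>x. act s T UNIV x * (?n x - r)) =
      expectation (\<lambda>x. act s T (- c) x * (?n x - r)) - expectation (\<lambda>x. act s T UNIV x * (?n x - r))"
    using act_uncorrelated[OF assms(1-3)] by (simp add: r_def)
  also have "\<dots> = expectation (\<lambda>x. ?g x * ?n x - r * ?g x)"
    using i1 by (subst Bochner_Integration.integral_diff[symmetric]) (auto simp: gain_def algebra_simps)
  also have "\<dots> = expectation (\<lambda>x. ?g x * ?n x) - r * expectation ?g" using i1 g by simp
  finally have eq: "- expectation (\<lambda>x. act s T UNIV x * (?n x - r)) = expectation (\<lambda>x. ?g x * ?n x) - r * expectation ?g" .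
  have int: "\<exists>k::nat. ?n x = real k" for x by (auto simp: cnt_def)
  have "expectation ?g \<le> expectation (\<lambda>x. ?g x * ?n x)"
  proof (rule integral_mono_AE)
    show "AE x in M. ?g x \<le> ?g x * ?n x" using AE_gain[OF assms(1,3), of T]
    proof eventually_elim
      fix x assume gx: "0 \<le> ?g x \<and> ?g x \<le> ?n x"
      obtain k where k: "?n x = real k" using int by blast
      show "?g x \<le> ?g x * ?n x"
      proof (cases "k = 0")
        case False
        then have "1 \<le> ?n x" using k by simp
        then show ?thesis using gx mult_left_mono[of 1 "?n x" "?g x"] by simp
      qed (use gx k in simp)
    qed
  qed (use g i1 in auto)
  moreover have gr: "expectation ?g \<le> r"
  proof -
    have "expectation ?g \<le> expectation ?n" using AE_gain[OF assms(1,3), of T] g n by (intro integral_mono_AE) auto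
    then show ?thesis using n by simp
  qed
  moreover have g0: "0 \<le> expectation ?g" using AE_gain[OF assms(1,3), of T] by (intro integral_nonneg_AE) auto
  moreover have r0: "0 \<le> r" by (simp add: r_def)
  moreover have "r * expectation ?g \<le> r\<^sup>2" using gr r0 by (simp add: power2_eq_square mult_left_mono)
  ultimately show "expectation ?g - r\<^sup>2 \<le> - expectation (\<lambda>x. act s T UNIV x * (?n x - r))" unfolding eq by linarith
  have "expectation (\<lambda>x. ?g x * ?n x) \<le> expectation (\<lambda>x. ?g x + ?n x * (?n x - 1))"
  proof (rule integral_mono_AE)
    show "AE x in M. ?g x * ?n x \<le> ?g x + ?n x * (?n x - 1)" using AE_gain[OF assms(1,3), of T]
    proof eventually_elim
      fix x assume gx: "0 \<le> ?g x \<and> ?g x \<le> ?n x"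
      obtain k where k: "?n x = real k" using int by blast
      show "?g x * ?n x \<le> ?g x + ?n x * (?n x - 1)"
      proof (cases "k = 0")
        case False
        then have "0 \<le> ?n x - 1" using k by simp
        then have "?g x * (?n x - 1) \<le> ?n x * (?n x - 1)" using gx by (intro mult_right_mono) auto
        then show ?thesis by (simp add: algebra_simps)
      qed (use gx k in simp)
    qed
  qed (use g n i1 in auto)
  also have "\<dots> = expectation ?g + r\<^sup>2" using g n by simp
  finally show "- expectation (\<lambda>x. act s T UNIV x * (?n x - r)) \<le> expectation ?g + r\<^sup>2"
    unfolding eq using r0 g0 mult_nonneg_nonneg[OF r0 g0] by linarith
qed

lemma covariance_partition:
  fixes I :: "'b set"
  assumes "s > 0" "finite I" "\<And>i. i \<in> I \<Longrightarrow> c i \<in> sets borel" "\<And>i. i \<in> I \<Longrightarrow> bounded (c i)" "disjoint_family_on c I"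
  defines "D \<equiv> (\<Union>i\<in>I. c i)"
  shows "(\<Sum>i\<in>I. expectation (gain s T (c i))) - (\<Sum>i\<in>I. (measure lborel (c i))\<^sup>2) \<le>
      - expectation (\<lambda>x. act s T UNIV x * (cnt D x - measure lborel D))"
    and "- expectation (\<lambda>x. act s T UNIV x * (cnt D x - measure lborel D)) \<le>
      (\<Sum>i\<in>I. expectation (gain s T (c i))) + (\<Sum>i\<in>I. (measure lborel (c i))\<^sup>2)"
proof -
  have cnt: "cnt D x = (\<Sum>i\<in>I. cnt (c i) x)" if x: "x \<in> space M" for x
  proof -
    have "\<omega> x \<inter> D = (\<Union>i\<in>I. \<omega> x \<inter> c i)" by (auto simp: D_def)
    also have "card \<dots> = (\<Sum>i\<in>I. card (\<omega> x \<inter> c i))"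
    proof (rule card_UN_disjoint)
      show "\<forall>i\<in>I. finite (\<omega> x \<inter> c i)" using assms(4) omega_LF[OF x] by (simp add: LF_def)
      show "\<forall>i\<in>I. \<forall>j\<in>I. i \<noteq> j \<longrightarrow> (\<omega> x \<inter> c i) \<inter> (\<omega> x \<inter> c j) = {}"
        using assms(5) by (fastforce simp: disjoint_family_on_def)
    qed (rule assms)
    finally show ?thesis by (simp add: cnt_def)
  qed
  have meas: "measure lborel D = (\<Sum>i\<in>I. measure lborel (c i))"
    unfolding D_def
  proof (rule measure_finite_Union)
    show "emeasure lborel (c i) \<noteq> \<infinity>" if "i \<in> I" for i
      using emeasure_bounded_finite[OF assms(4)[OF that]] by simp
  qed (use assms in auto)
  have "expectation (\<lambda>x. act s T UNIV x * (cnt D x - measure lborel D)) =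
      expectation (\<lambda>x. \<Sum>i\<in>I. act s T UNIV x * (cnt (c i) x - measure lborel (c i)))"
    by (intro Bochner_Integration.integral_cong) (simp_all add: cnt meas sum_subtractf flip: sum_distrib_left)
  also have "\<dots> = (\<Sum>i\<in>I. expectation (\<lambda>x. act s T UNIV x * (cnt (c i) x - measure lborel (c i))))"
  proof (rule Bochner_Integration.integral_sum)
    fix i assume i: "i \<in> I"
    note n = cnt_moments[OF assms(3)[OF i] assms(4)[OF i]]
    have [measurable]: "cnt (c i) \<in> borel_measurable M" "act s T UNIV \<in> borel_measurable M"
      using assms i by (auto intro: cnt_measurable act_measurable)
    show "integrable M (\<lambda>x. act s T UNIV x * (cnt (c i) x - measure lborel (c i)))"
      using n(6) act_square_integrable[OF assms(1), of UNIV T] by (intro integrable_prod_of_squares) auto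
  qed
  finally have eq: "- expectation (\<lambda>x. act s T UNIV x * (cnt D x - measure lborel D)) =
      (\<Sum>i\<in>I. - expectation (\<lambda>x. act s T UNIV x * (cnt (c i) x - measure lborel (c i))))"
    by (simp add: sum_negf)
  show "(\<Sum>i\<in>I. expectation (gain s T (c i))) - (\<Sum>i\<in>I. (measure lborel (c i))\<^sup>2) \<le>
      - expectation (\<lambda>x. act s T UNIV x * (cnt D x - measure lborel D))"
    unfolding eq sum_subtractf[symmetric] using assms by (intro sum_mono covariance_cell(1)) auto
  show "- expectation (\<lambda>x. act s T UNIV x * (cnt D x - measure lborel D)) \<le>
      (\<Sum>i\<in>I. expectation (gain s T (c i))) + (\<Sum>i\<in>I. (measure lborel (c i))\<^sup>2)"
    unfolding eq sum.distrib[symmetric] using assms by (intro sum_mono covariance_cell(2)) auto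
qed

lemma sum_gain_le:
  assumes "x \<in> space M" "0 \<le> K x" "tame 64 (K x) (\<omega> x)" "s > 0" "finite I" "disjoint_family_on c I"
    and ps: "ps \<in> chains (\<omega> x)" "cact (\<omega> x) s T = cval s T ps"
  shows "(\<Sum>i\<in>I. gain s T (c i) x) \<le> card (set ps \<inter> (\<Union>i\<in>I. c i))"
proof -
  have "(\<Sum>i\<in>I. gain s T (c i) x) \<le> (\<Sum>i\<in>I. real (card (set ps \<inter> c i)))"
  proof (rule sum_mono)
    fix i
    have "cact (\<omega> x - c i) s T \<le> cact (\<omega> x) s T + card (set ps \<inter> c i)"
      using assms by (intro cact_remove[of 64 "K x"]) auto
    then show "gain s T (c i) x \<le> real (card (set ps \<inter> c i))" by (simp add: gain_def act_def Diff_eq)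
  qed
  also have "\<dots> = real (card (\<Union>i\<in>I. set ps \<inter> c i))"
    using assms(5,6) by (subst card_UN_disjoint) (auto simp: disjoint_family_on_def)
  also have "(\<Union>i\<in>I. set ps \<inter> c i) = set ps \<inter> (\<Union>i\<in>I. c i)" by auto
  finally show ?thesis by simp
qed

text \<open>The competitor is the empty chain of value at most \<open>t / (2 * c)\<close>; the
  factor \<open>s = c * t\<close> cancels the \<open>1 / c\<close>, so the bounds are uniform in
  \<open>c < 1\<close>. Here \<open>2 + 4 * 64^2 \<le> 129^2\<close>, \<open>8256 = 64 * 129\<close>
  and \<open>65 = 64 + 1\<close>.\<close>

lemma optimal_chain_bounds:
  assumes x: "0 \<le> K x" "tame 64 (K x) (\<omega> x)" and c: "0 < c" "c < 1" "t > 0" and d: "infdist 0 T \<le> t"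
    and ps: "ps \<in> chains (\<omega> x)" "cact (\<omega> x) (c * t) T = cval (c * t) T ps"
  shows "tlen T 0 ps \<le> 129 * t + K x" "real (length ps) \<le> 8256 * t + 65 * K x"
proof -
  let ?s = "c * t" and ?L = "tlen T 0 ps"
  have s: "?s > 0" using c by simp
  have "(infdist 0 T)\<^sup>2 \<le> t\<^sup>2" using d by (intro power_mono infdist_nonneg)
  then have "cval ?s T [] \<le> t\<^sup>2 / (2 * ?s)" using s by (simp add: cval_def divide_right_mono)
  moreover have "t\<^sup>2 / (2 * ?s) = t / (2 * c)" using c by (simp add: power2_eq_square)
  moreover have "cval ?s T ps \<le> cval ?s T []"
    unfolding ps(2)[symmetric] using x s by (intro cact_le[of 64 "K x"]) auto
  ultimately have "cval ?s T ps \<le> t / (2 * c)" by simp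
  then have "?L\<^sup>2 \<le> 4 * ?s * (t / (2 * c) + 64\<^sup>2 * ?s + K x)"
    using x s c ps by (intro length_bound) auto
  also have "\<dots> = 2 * t\<^sup>2 + 16384 * (c * c) * t\<^sup>2 + 4 * c * t * K x"
    using c by (simp add: power2_eq_square field_simps)
  also have "\<dots> \<le> 2 * t\<^sup>2 + 16384 * 1 * t\<^sup>2 + 4 * 1 * t * K x"
  proof -
    have "c * c \<le> 1" using c by (simp add: mult_le_one)
    then have "16384 * (c * c) * t\<^sup>2 \<le> 16384 * 1 * t\<^sup>2" by (intro mult_right_mono) auto
    moreover have "4 * c * t * K x \<le> 4 * 1 * t * K x" using c x by (intro mult_right_mono) auto
    ultimately show ?thesis by linarith
  qed
  also have "\<dots> \<le> (129 * t + K x)\<^sup>2"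
  proof -
    have "0 \<le> t * K x" "0 \<le> t\<^sup>2" "0 \<le> (K x)\<^sup>2" using c x by auto
    then show ?thesis by (simp add: power2_sum power_mult_distrib)
  qed
  finally show L: "?L \<le> 129 * t + K x" using c x by (auto intro: power2_le_imp_le)
  have "real (length ps) \<le> 64 * plen 0 ps + K x" using x(2) ps(1) by (auto simp: tame_def)
  also have "\<dots> \<le> 64 * ?L + K x" using plen_le_tlen[of 0 ps T] by simp
  finally show "real (length ps) \<le> 8256 * t + 65 * K x" using L by simp
qed

text \<open>The condition \<open>good_cell\<close> involves only the points outside \<open>c\<close>; it ensures that any point in \<open>c\<close>
  lowers the action by at least 1/2.\<close>

definition good_cell :: "real \<Rightarrow> complex set \<Rightarrow> complex set \<Rightarrow> complex \<Rightarrow> real \<Rightarrow> complex set \<Rightarrow> bool" where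
  "good_cell s T c z r P \<longleftrightarrow> (\<exists>ps\<in>chains (P \<inter> - c). \<exists>i\<le>length ps.
     (tlen T 0 (take i ps @ z # drop i ps) + r)\<^sup>2 / (2 * s) - real (length ps) < cact (P \<inter> - c) s T + 1 / 2)"

lemma good_cell_sets:
  assumes "s > 0" "c \<in> sets borel"
  shows "{P\<in>LF. good_cell s T c z r P} \<in> sets (cfg (- c))"
proof -
  let ?E = "\<lambda>q. {P\<in>LF. \<exists>ps\<in>chains (P \<inter> - c). \<exists>i\<le>length ps.
     (tlen T 0 (take i ps @ z # drop i ps) + r)\<^sup>2 / (2 * s) - real (length ps) < q}"
  have c: "- c \<in> sets borel" using assms(2) by auto
  have 1: "?E q \<in> sets (cfg (- c))" for q
    using c by (intro open_chain_event chain_open_insertion assms(1))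
  have [measurable]: "(\<lambda>P. cact (P \<inter> - c) s T) \<in> borel_measurable (cfg (- c))"
    by (rule cact_measurable[OF assms(1) c])
  have "{P\<in>space (cfg (- c)). q < cact (P \<inter> - c) s T + 1 / 2} \<in> sets (cfg (- c))" for q by measurable
  then have 2: "{P\<in>LF. q < cact (P \<inter> - c) s T + 1 / 2} \<in> sets (cfg (- c))" for q by simp
  \<comment> \<open>The threshold is itself random; a rational between the two sides separates the
    open chain condition from it.\<close>
  have "{P\<in>LF. good_cell s T c z r P} = (\<Union>q\<in>\<rat>. ?E q \<inter> {P\<in>LF. q < cact (P \<inter> - c) s T + 1 / 2})"
  proof (intro equalityI subsetI)
    fix P assume "P \<in> {P\<in>LF. good_cell s T c z r P}"
    then obtain ps i where ps: "P \<in> LF" "ps \<in> chains (P \<inter> - c)" "i \<le> length ps"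
      "(tlen T 0 (take i ps @ z # drop i ps) + r)\<^sup>2 / (2 * s) - real (length ps) < cact (P \<inter> - c) s T + 1 / 2"
      by (auto simp: good_cell_def)
    obtain q where q: "q \<in> \<rat>" "(tlen T 0 (take i ps @ z # drop i ps) + r)\<^sup>2 / (2 * s) - real (length ps) < q"
      "q < cact (P \<inter> - c) s T + 1 / 2" using Rats_dense_in_real[OF ps(4)] by blast
    then show "P \<in> (\<Union>q\<in>\<rat>. ?E q \<inter> {P\<in>LF. q < cact (P \<inter> - c) s T + 1 / 2})" using ps by blast
  next
    fix P assume "P \<in> (\<Union>q\<in>\<rat>. ?E q \<inter> {P\<in>LF. q < cact (P \<inter> - c) s T + 1 / 2})"
    then show "P \<in> {P\<in>LF. good_cell s T c z r P}" unfolding good_cell_def by (auto intro: less_trans)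
  qed
  also have "\<dots> \<in> sets (cfg (- c))"
    using 1 2 by (intro sets.countable_UN' sets.Int countable_rat) auto
  finally show ?thesis .
qed

text \<open>Replacing \<open>z\<close> by the actual point lengthens the chain by at most
  \<open>r\<close>, the margin already included in \<open>good_cell\<close>. The detour thus costs
  less than 1/2 and collects 1.\<close>

lemma gain_ge_half:
  assumes x: "x \<in> space M" "0 \<le> K x" "tame 64 (K x) (\<omega> x)" and "s > 0"
    and r: "\<And>y. y \<in> c \<Longrightarrow> dist y z \<le> r / 2"
    and good: "good_cell s T c z r (\<omega> x)" and ne: "card (\<omega> x \<inter> c) \<noteq> 0"
  shows "1 / 2 \<le> gain s T c x"
proof -
  obtain ps i where ps: "ps \<in> chains (\<omega> x \<inter> - c)" "i \<le> length ps"
    "(tlen T 0 (take i ps @ z # drop i ps) + r)\<^sup>2 / (2 * s) - real (length ps) < cact (\<omega> x \<inter> - c) s T + 1 / 2"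
    using good by (auto simp: good_cell_def)
  obtain y where y: "y \<in> \<omega> x" "y \<in> c" using ne by (metis card.empty disjoint_iff)
  define qs where "qs = take i ps @ y # drop i ps"
  have len: "length qs = length ps + 1" using ps(2) by (simp add: qs_def)
  have "y \<notin> set ps" using y ps(1) by (auto simp: chains_def)
  moreover have "distinct (take i ps @ drop i ps)" using ps(1) by (simp add: chains_def)
  ultimately have "distinct qs" unfolding qs_def distinct_append by (auto dest: in_set_takeD in_set_dropD)
  moreover have "set qs \<subseteq> \<omega> x" using ps(1) y by (auto simp: qs_def chains_def dest: in_set_takeD in_set_dropD)
  ultimately have qs: "qs \<in> chains (\<omega> x)" by (simp add: chains_def)
  have "tlen T 0 qs \<le> tlen T 0 (take i ps @ z # drop i ps) + 2 * dist y z"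
    unfolding qs_def by (rule tlen_insert_perturb)
  then have "tlen T 0 qs \<le> tlen T 0 (take i ps @ z # drop i ps) + r" using r[OF y(2)] by simp
  then have "(tlen T 0 qs)\<^sup>2 \<le> (tlen T 0 (take i ps @ z # drop i ps) + r)\<^sup>2"
    by (intro power_mono tlen_nonneg)
  then have "cval s T qs \<le> (tlen T 0 (take i ps @ z # drop i ps) + r)\<^sup>2 / (2 * s) - real (length ps) - 1"
    using assms(4) len by (simp add: cval_def divide_right_mono)
  then have "cval s T qs \<le> cact (\<omega> x \<inter> - c) s T - 1 / 2" using ps(3) by simp
  moreover have "cact (\<omega> x) s T \<le> cval s T qs" using x assms(4) qs by (intro cact_le[of 64 "K x"]) auto
  ultimately show ?thesis by (simp add: gain_def act_def)
qed

text \<open>Goodness depends only on the outside of \<open>c\<close>, so it is independent of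
  occupation, which has probability at least half the area; the gain is then at least 1/2.
  \<open>G\<close> also asks \<open>c\<close> to be empty because goodness will be read off from the
  chain optimal for the full configuration.\<close>

lemma expectation_gain_ge:
  fixes T c :: "complex set" and s r :: real and z :: complex
  assumes "s > 0" and c: "c \<in> sets borel" "bounded c" "measure lborel c \<le> 1"
    and r: "\<And>y. y \<in> c \<Longrightarrow> dist y z \<le> r / 2"
  defines "G \<equiv> {x\<in>space M. good_cell s T c z r (\<omega> x) \<and> card (\<omega> x \<inter> c) = 0}"
  shows "G \<in> events" "measure lborel c / 4 * prob G \<le> expectation (gain s T c)"
proof -
  define E where "E = {P\<in>LF. good_cell s T c z r P}"
  define N where "N = {P\<in>LF. card (P \<inter> c) \<noteq> 0}"
  have E: "E \<in> sets (cfg (- c))" unfolding E_def by (rule good_cell_sets[OF assms(1) c(1)])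
  have cm: "(\<lambda>P. card (P \<inter> c)) \<in> measurable (cfg c) (count_space UNIV)"
    using c by (intro count_measurable_cfg) auto
  then have "{P\<in>space (cfg c). card (P \<inter> c) \<noteq> 0} \<in> sets (cfg c)" by measurable
  then have N: "N \<in> sets (cfg c)" by (simp add: N_def)
  have [measurable]: "E \<in> sets (cfg UNIV)" "N \<in> sets (cfg UNIV)"
    using E N sets_cfg_mono[of "- c" UNIV] sets_cfg_mono[of c UNIV] by auto
  have EN: "{x\<in>space M. \<omega> x \<in> E \<and> \<omega> x \<in> N} \<in> events" by measurable
  have "G = {x\<in>space M. \<omega> x \<in> E \<and> \<omega> x \<notin> N}" by (auto simp: G_def E_def N_def)
  then show G: "G \<in> events" by simp
  define v where "v = measure lborel c"
  have v: "0 \<le> v" "v \<le> 1" using c by (auto simp: v_def)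
  have "prob {x\<in>space M. \<omega> x \<in> E \<and> \<omega> x \<in> N} = prob {x\<in>space M. \<omega> x \<in> E} * prob {x\<in>space M. \<omega> x \<in> N}"
    by (rule cfg_indep_prob[OF _ E N]) auto
  also have "prob {x\<in>space M. \<omega> x \<in> N} = prob {x\<in>space M. card (\<omega> x \<inter> c) \<noteq> 0}"
    by (intro arg_cong[where f=prob]) (auto simp: N_def)
  also have "\<dots> = 1 - exp (- v)" unfolding v_def by (rule prob_nonempty[OF c(1,2)])
  finally have eq: "prob {x\<in>space M. \<omega> x \<in> E \<and> \<omega> x \<in> N} = prob {x\<in>space M. \<omega> x \<in> E} * (1 - exp (- v))" .
  have "v / 2 \<le> 1 - exp (- v)"
  proof -
    have "1 + v \<le> exp v" by (rule exp_ge_add_one_self)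
    then have "exp (- v) * (1 + v) \<le> 1" by (simp add: exp_minus field_simps)
    then have "v / (1 + v) \<le> 1 - exp (- v)" using v by (simp add: field_simps)
    moreover have "v / 2 \<le> v / (1 + v)" using v by (intro divide_left_mono) auto
    ultimately show ?thesis by linarith
  qed
  moreover have "prob G \<le> prob {x\<in>space M. \<omega> x \<in> E}"
  proof (rule finite_measure_mono)
    show "{x\<in>space M. \<omega> x \<in> E} \<in> events" by measurable
  qed (auto simp: G_def E_def)
  ultimately have "prob G * (v / 2) \<le> prob {x\<in>space M. \<omega> x \<in> E \<and> \<omega> x \<in> N}"
    unfolding eq using v by (intro mult_mono) auto
  moreover have "1 / 2 * prob {x\<in>space M. \<omega> x \<in> E \<and> \<omega> x \<in> N} \<le> expectation (gain s T c)"
  proof -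
    have "1 / 2 * prob {x\<in>space M. \<omega> x \<in> E \<and> \<omega> x \<in> N} =
        expectation (\<lambda>x. 1 / 2 * indicator {x\<in>space M. \<omega> x \<in> E \<and> \<omega> x \<in> N} x)"
      using EN by simp
    also have "\<dots> \<le> expectation (gain s T c)"
    proof (rule integral_mono_AE)
      show "AE x in M. 1 / 2 * indicator {x\<in>space M. \<omega> x \<in> E \<and> \<omega> x \<in> N} x \<le> gain s T c x"
        using AE_gain[OF assms(1) c(2), of T] AE_tame AE_space
      proof eventually_elim
        fix x assume x: "0 \<le> gain s T c x \<and> gain s T c x \<le> cnt c x" "0 \<le> K x \<and> tame 64 (K x) (\<omega> x)" "x \<in> space M"
        show "1 / 2 * indicator {x\<in>space M. \<omega> x \<in> E \<and> \<omega> x \<in> N} x \<le> gain s T c x"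
        proof (cases "\<omega> x \<in> E \<and> \<omega> x \<in> N")
          case True
          then have "1 / 2 \<le> gain s T c x"
            using x assms(1) r by (intro gain_ge_half[where z=z and r=r]) (auto simp: E_def N_def)
          then show ?thesis using True x by simp
        qed (use x in simp)
      qed
      show "integrable M (\<lambda>x. 1 / 2 * indicator {x\<in>space M. \<omega> x \<in> E \<and> \<omega> x \<in> N} x :: real)"
        using EN by (intro integrable_mult_right integrable_real_indicator) (auto simp: less_top[symmetric])
    qed (use gain_integrable[OF assms(1) c(1)] in simp)
    finally show ?thesis .
  qed
  ultimately show "measure lborel c / 4 * prob G \<le> expectation (gain s T c)" by (simp add: v_def mult.commute)
qed

end

section \<open>Squares along the optimal chain\<close>

lemma measure_square:
  assumes "d > 0"
  defines "e \<equiv> Complex (d / 2) (d / 2)"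
  shows "emeasure lborel (box (y - e) (y + e)) = ennreal (d\<^sup>2)"
proof -
  have "emeasure lborel (box (y - e) (y + e)) = (\<Prod>b\<in>Basis. ((y + e) - (y - e)) \<bullet> b)"
    using assms by (intro emeasure_lborel_box) (auto simp: Basis_complex_def inner_complex_def)
  also have "(\<Prod>b\<in>Basis. ((y + e) - (y - e)) \<bullet> b) = d\<^sup>2"
    by (simp add: Basis_complex_def inner_complex_def e_def power2_eq_square)
  finally show ?thesis .
qed

text \<open>A polygon crossing the slab carries disjoint squares of side \<open>d\<close> along it.\<close>

lemma squares_along:
  assumes d: "0 < d" "4 * d \<le> t"
    and y: "\<And>r. t / 2 \<le> r \<Longrightarrow> r \<le> t \<Longrightarrow> \<exists>y. Re y = r \<and> Q y"
    and U: "U \<in> sets borel" "\<And>y z. Q y \<Longrightarrow> t / 2 + d / 2 \<le> Re y \<Longrightarrow> Re y + d / 2 \<le> t \<Longrightarrow>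
      \<bar>Re z - Re y\<bar> < d / 2 \<Longrightarrow> \<bar>Im z - Im y\<bar> < d / 2 \<Longrightarrow> z \<in> U"
  shows "ennreal (d * t / 4) \<le> emeasure lborel U"
proof -
  \<comment> \<open>The number of squares of side \<open>d\<close> that fit over
    \<open>[t/2, t]\<close>; since \<open>4 * d \<le> t\<close>, their bases still cover a length of
    at least \<open>t / 4\<close>.\<close>
  define J where "J = nat \<lfloor>t / (2 * d)\<rfloor>"
  have Jle: "real J * d \<le> t / 2"
  proof -
    have "real J \<le> t / (2 * d)" using d by (simp add: J_def)
    then show ?thesis using d by (simp add: field_simps)
  qed
  have Jge: "t / 2 - d \<le> real J * d"
  proof -
    have "t / (2 * d) - 1 \<le> real J" using d unfolding J_def by linarith
    then have "(t / (2 * d) - 1) * d \<le> real J * d" using d by (intro mult_right_mono) auto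
    then show ?thesis using d by (simp add: left_diff_distrib)
  qed
  define \<rho> where "\<rho> = (\<lambda>j::nat. t / 2 + (real j + 1 / 2) * d)"
  have \<rho>: "t / 2 + d / 2 \<le> \<rho> j" "\<rho> j + d / 2 \<le> t" if "j < J" for j
  proof -
    have "0 \<le> real j * d" using d by simp
    then show "t / 2 + d / 2 \<le> \<rho> j" by (simp add: \<rho>_def algebra_simps)
    have "(real j + 1) * d \<le> real J * d" using that d by (intro mult_right_mono) auto
    then show "\<rho> j + d / 2 \<le> t" using Jle by (simp add: \<rho>_def algebra_simps)
  qed
  have "\<exists>y. Re y = \<rho> j \<and> Q y" if "j < J" for j using \<rho>[OF that] d by (intro y) auto
  then obtain Y where Y: "\<And>j. j < J \<Longrightarrow> Re (Y j) = \<rho> j \<and> Q (Y j)" by metis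
  define e where "e = Complex (d / 2) (d / 2)"
  define S where "S = (\<lambda>j. box (Y j - e) (Y j + e))"
  have inS: "z \<in> S j \<longleftrightarrow> \<bar>Re z - Re (Y j)\<bar> < d / 2 \<and> \<bar>Im z - Im (Y j)\<bar> < d / 2" for z j
    unfolding S_def in_box_complex_iff e_def abs_diff_less_iff by auto
  have "disjoint_family_on S {..<J}"
  proof -
    have "S i \<inter> S j = {}" if "i < J" "j < J" "i < j" for i j
    proof -
      have "(real i + 1) * d \<le> real j * d" using that d by (intro mult_right_mono) auto
      then have "\<rho> i + d \<le> \<rho> j" by (simp add: \<rho>_def algebra_simps)
      then have le: "Re (Y i) + d \<le> Re (Y j)" using Y[OF that(1)] Y[OF that(2)] by simp
      have False if z: "z \<in> S i" "z \<in> S j" for z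
      proof -
        have "\<bar>Re z - Re (Y i)\<bar> < d / 2" "\<bar>Re z - Re (Y j)\<bar> < d / 2" using z by (simp_all only: inS)
        then show False using le by linarith
      qed
      then show ?thesis by blast
    qed
    then show ?thesis unfolding disjoint_family_on_def
      by (metis Int_commute lessThan_iff linorder_neqE_nat)
  qed
  then have "(\<Sum>j<J. emeasure lborel (S j)) = emeasure lborel (\<Union>j<J. S j)"
    by (intro sum_emeasure) (auto simp: S_def)
  moreover have "(\<Sum>j<J. emeasure lborel (S j)) = ennreal (real J * d\<^sup>2)"
    using measure_square[OF d(1)] by (simp add: S_def e_def ennreal_of_nat_eq_real_of_nat ennreal_mult)
  moreover have "(\<Union>j<J. S j) \<subseteq> U"
    using U(2) Y \<rho> by (fastforce simp: inS)
  then have "emeasure lborel (\<Union>j<J. S j) \<le> emeasure lborel U" using U(1) by (intro emeasure_mono) auto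
  moreover have "d * t / 4 \<le> real J * d\<^sup>2"
  proof -
    have "(t / 2 - d) * d \<le> (real J * d) * d" using Jge d by (intro mult_right_mono) auto
    moreover have "4 * d * d \<le> t * d" using d by (intro mult_right_mono) auto
    ultimately show ?thesis by (simp add: power2_eq_square algebra_simps)
  qed
  ultimately show ?thesis by (metis ennreal_leI order_trans)
qed

lemma measure_cell_Int_le:
  assumes "D \<in> sets borel" shows "measure lborel (cell m i \<inter> D) \<le> 1 / 4 ^ m"
proof -
  have "cell m i \<in> fmeasurable lborel"
    by (rule fmeasurableI[OF _ emeasure_bounded_finite[OF cell_bounded]]) simp
  then have "measure lborel (cell m i \<inter> D) \<le> measure lborel (cell m i)"
    using assms by (intro measure_mono_fmeasurable) auto
  then show ?thesis using measure_cell_le order_trans by blast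
qed

lemma finite_cidx_image:
  assumes "bounded D" shows "finite (cidx m ` D)"
proof -
  obtain r where r: "\<And>z. z \<in> D \<Longrightarrow> cmod z \<le> r" using assms by (auto simp: bounded_iff)
  have fl: "\<lfloor>2 ^ m * a\<rfloor> \<le> \<lfloor>2 ^ m * b\<rfloor>" if "a \<le> b" for a b :: real
    using that by (intro floor_mono mult_left_mono) auto
  have "cidx m ` D \<subseteq> {\<lfloor>2 ^ m * - r\<rfloor>..\<lfloor>2 ^ m * r\<rfloor>} \<times> {\<lfloor>2 ^ m * - r\<rfloor>..\<lfloor>2 ^ m * r\<rfloor>}"
  proof
    fix i assume "i \<in> cidx m ` D"
    then obtain z where z: "z \<in> D" "i = cidx m z" by blast
    have "\<bar>Re z\<bar> \<le> r" "\<bar>Im z\<bar> \<le> r" using r[OF z(1)] abs_Re_le_cmod[of z] abs_Im_le_cmod[of z] by auto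
    then have "- r \<le> Re z" "Re z \<le> r" "- r \<le> Im z" "Im z \<le> r" by auto
    with fl show "i \<in> {\<lfloor>2 ^ m * - r\<rfloor>..\<lfloor>2 ^ m * r\<rfloor>} \<times> {\<lfloor>2 ^ m * - r\<rfloor>..\<lfloor>2 ^ m * r\<rfloor>}"
      unfolding z(2) cidx_def mem_Times_iff atLeastAtMost_iff fst_conv snd_conv by blast
  qed
  then show ?thesis by (rule finite_subset) simp
qed

context poisson begin

text \<open>The optimal chain to \<open>T\<close> stays in the strip and crosses every vertical of
  the slab. Each cell meeting a small square about a crossing point is either good and empty, or
  occupied; an occupied cell has area at most \<open>1 / 4 ^ m\<close>, which accounts for the
  subtracted count.\<close>

lemma good_cells_cover:
  fixes m :: nat and t w c :: real and D T :: "complex set" and x :: 'a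
  assumes x: "x \<in> space M" "0 \<le> K x" "tame 64 (K x) (\<omega> x)" "K x \<le> t"
    and c: "0 < c" "c < 1" and t: "t \<ge> 1" and w: "w \<ge> 1"
    and T: "T \<subseteq> Lambda_line t" "\<And>y. \<bar>y\<bar> \<le> w \<Longrightarrow> Complex t y \<in> T"
    and strip: "cact (\<omega> x \<inter> strip w) (c * t) (Lambda_line t) = cact (\<omega> x) (c * t) (Lambda_line t)"
    and m: "8 / 2 ^ m \<le> c / 1000"
    and z0: "\<And>i. i \<in> cidx m ` D \<Longrightarrow> z0 i \<in> cell m i"
    and D: "D = cbox (Complex (t / 2) (- (2 * w))) (Complex t (2 * w))"
  defines "I \<equiv> cidx m ` D" and "a \<equiv> (\<lambda>i. measure lborel (cell m i \<inter> D))"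
  shows "c / 1000 * t / 4 - 1 / 4 ^ m * cnt D x \<le>
    (\<Sum>i\<in>I. a i * (if good_cell (c * t) T (cell m i \<inter> D) (z0 i) (4 / 2 ^ m) (\<omega> x) \<and> card (\<omega> x \<inter> (cell m i \<inter> D)) = 0 then 1 else 0))"
proof -
  \<comment> \<open>With \<open>L \<le> 130 * t\<close> a lengthening by \<open>3 * d\<close> adds
    at most \<open>(780 + 9) * d * t < c * t\<close> to the squared length, hence less than 1/2 to
    the value.\<close>
  define d where "d = c / 1000"
  have d: "0 < d" "4 * d \<le> t" "8 / 2 ^ m \<le> d" "d < 1" using c t m by (auto simp: d_def)
  let ?s = "c * t"
  have s: "?s > 0" using c t by simp
  obtain ps where ps: "ps \<in> chains (\<omega> x)" "set ps \<subseteq> strip w" "cact (\<omega> x) ?s T = cval ?s T ps"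
    and near: "\<And>x. x \<in> strip w \<Longrightarrow> \<exists>z\<in>T \<inter> strip w. dist x z = infdist x T \<and> Re z = t"
    using strip_optimal_chain[OF omega_LF[OF x(1)] x(3) _ x(2) s _ strip T] w by auto
  define L where "L = tlen T 0 ps"
  have "infdist 0 T \<le> t"
  proof -
    have "Complex t 0 \<in> T" using T(2)[of 0] w by simp
    then have "infdist 0 T \<le> dist 0 (Complex t 0)" by (rule infdist_le)
    then show ?thesis using t by (simp add: cmod_def)
  qed
  then have L: "0 \<le> L" "L \<le> 130 * t"
    using optimal_chain_bounds(1)[OF x(2,3) c _ _ ps(1,3)] t x(4) by (auto simp: L_def tlen_nonneg)
  define C where "C = (\<lambda>i. cell m i \<inter> D)"
  define good where "good = (\<lambda>i. good_cell ?s T (C i) (z0 i) (4 / 2 ^ m) (\<omega> x) \<and> card (\<omega> x \<inter> C i) = 0)"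
  define occ where "occ = (\<lambda>i. card (\<omega> x \<inter> C i) \<noteq> 0)"
  have bD: "bounded D" unfolding D by simp
  have finI: "finite I" unfolding I_def by (rule finite_cidx_image[OF bD])
  define Q where "Q = (\<lambda>y. y \<in> strip w \<and> (\<exists>l1 l2. ps = l1 @ l2 \<and> tlen T 0 (l1 @ y # l2) \<le> L))"
  define U where "U = (\<Union>i\<in>{i\<in>I. good i \<or> occ i}. C i)"
  have Cb: "C i \<in> sets borel" for i unfolding C_def D by simp
  have cover: "z \<in> U" if Qy: "Q y" and z: "\<bar>Re z - Re y\<bar> < d / 2" "\<bar>Im z - Im y\<bar> < d / 2"
    and ry: "t / 2 + d / 2 \<le> Re y" "Re y + d / 2 \<le> t" for y z
  proof -
    have zD: "z \<in> D"
      using ry z Qy w d unfolding D Q_def strip_def in_cbox_complex_iff abs_less_iff by (auto simp: abs_le_iff)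
    define i where "i = cidx m z"
    have i: "i \<in> I" "z \<in> C i" using zD by (auto simp: i_def I_def C_def cell_def)
    have "good i" if no: "\<not> occ i"
    proof -
      have "finite (\<omega> x \<inter> C i)"
        using omega_LF[OF x(1)] bD by (auto simp: LF_def C_def intro: finite_subset[of _ "\<omega> x \<inter> D"])
      then have emp: "\<omega> x \<inter> C i = {}" using no by (simp add: occ_def)
      \<comment> \<open>In an empty cell nothing is removed, so the chain optimal for the full
        configuration is optimal off the cell as well.\<close>
      then have same: "\<omega> x \<inter> - C i = \<omega> x" by auto
      obtain l1 l2 where l: "ps = l1 @ l2" "tlen T 0 (l1 @ y # l2) \<le> L" using Qy by (auto simp: Q_def)
      have "dist (z0 i) z < 2 / 2 ^ m"
        using z0 i zD by (intro cell_dist[of _ m i]) (auto simp: I_def C_def)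
      moreover have "dist z y < d" using cmod_le[of "z - y"] z by (simp add: dist_norm)
      ultimately have "dist (z0 i) y \<le> 2 / 2 ^ m + d" using dist_triangle[of "z0 i" y z] by simp
      \<comment> \<open>A detour to \<open>z0 i\<close> costs twice its distance from
        \<open>y\<close>; the further \<open>4 / 2 ^ m\<close> is the margin for the unknown
        position of a point in the cell.\<close>
      then have "tlen T 0 (l1 @ z0 i # l2) + 4 / 2 ^ m \<le> L + (8 / 2 ^ m + 2 * d)"
        using tlen_insert_perturb[of T 0 l1 "z0 i" l2 y] l(2) by simp
      also have "\<dots> \<le> L + 3 * d" using d by simp
      finally have "(tlen T 0 (l1 @ z0 i # l2) + 4 / 2 ^ m)\<^sup>2 \<le> (L + 3 * d)\<^sup>2"
        using tlen_nonneg[of T 0 "l1 @ z0 i # l2"] by (intro power_mono) auto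
      also have "\<dots> < L\<^sup>2 + ?s"
      proof -
        have "6 * d * L \<le> 6 * d * (130 * t)" using L d by (intro mult_left_mono) auto
        moreover have "9 * d * d \<le> 9 * d * t" using d t by (intro mult_left_mono) auto
        moreover have "6 * d * (130 * t) + 9 * d * t < c * t" using c t by (simp add: d_def)
        ultimately show ?thesis by (simp add: power2_eq_square algebra_simps)
      qed
      finally have lt: "(tlen T 0 (l1 @ z0 i # l2) + 4 / 2 ^ m)\<^sup>2 < L\<^sup>2 + ?s" .
      have "(tlen T 0 (l1 @ z0 i # l2) + 4 / 2 ^ m)\<^sup>2 / (2 * ?s) < (L\<^sup>2 + ?s) / (2 * ?s)"
        by (rule divide_strict_right_mono[OF lt]) (use s in simp)
      also have "(L\<^sup>2 + ?s) / (2 * ?s) = L\<^sup>2 / (2 * ?s) + 1 / 2" using c t by (simp add: add_divide_distrib)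
      finally have "(tlen T 0 (l1 @ z0 i # l2) + 4 / 2 ^ m)\<^sup>2 / (2 * ?s) - real (length ps) < cact (\<omega> x) ?s T + 1 / 2"
        using ps(3) by (simp add: cval_def L_def)
      then have "good_cell ?s T (C i) (z0 i) (4 / 2 ^ m) (\<omega> x)"
        unfolding good_cell_def same using ps(1) l(1) by (intro bexI[of _ ps] exI[of _ "length l1"]) auto
      then show "good i" using no by (simp add: good_def occ_def)
    qed
    then show ?thesis using i unfolding U_def by blast
  qed
  have "\<exists>y. Re y = r \<and> Q y" if "t / 2 \<le> r" "r \<le> t" for r
  proof -
    have "\<exists>l1 l2 y. ps = l1 @ l2 \<and> Re y = r \<and> y \<in> strip w \<and> tlen T 0 (l1 @ y # l2) \<le> tlen T 0 ps"
      using that t w by (intro tlen_insert_crossing[where z=0 and t=t, OF convex_strip _ near _ ps(2)]) (auto simp: strip_def)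
    then show ?thesis unfolding Q_def L_def by blast
  qed
  then have "ennreal (d * t / 4) \<le> emeasure lborel U"
    using cover finI Cb by (intro squares_along[OF d(1,2), where Q=Q]) (auto simp: U_def)
  also have "emeasure lborel U = ennreal (measure lborel U)"
  proof -
    have "U \<subseteq> D" by (auto simp: U_def C_def)
    then have "bounded U" using bD bounded_subset by blast
    then have "emeasure lborel U < \<infinity>" by (rule emeasure_bounded_finite)
    then show ?thesis by (intro emeasure_eq_ennreal_measure) auto
  qed
  finally have "d * t / 4 \<le> measure lborel U" by (simp add: ennreal_le_iff)
  also have "\<dots> \<le> (\<Sum>i\<in>{i\<in>I. good i \<or> occ i}. measure lborel (C i))"
    unfolding U_def using finI Cb bD
    by (intro measure_UNION_le) (auto)
  also have "\<dots> \<le> (\<Sum>i\<in>I. a i * (if good i then 1 else 0) + 1 / 4 ^ m * real (card (\<omega> x \<inter> C i)))"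
  proof -
    have ai: "a i = measure lborel (C i)" for i by (simp add: a_def C_def)
    have le: "measure lborel (C i) \<le> 1 / 4 ^ m" for i
      unfolding C_def by (rule measure_cell_Int_le) (simp add: D)
    have "(\<Sum>i\<in>{i\<in>I. good i \<or> occ i}. measure lborel (C i)) \<le>
      (\<Sum>i\<in>{i\<in>I. good i \<or> occ i}. a i * (if good i then 1 else 0) + 1 / 4 ^ m * real (card (\<omega> x \<inter> C i)))"
    proof (rule sum_mono)
      fix i assume i: "i \<in> {i\<in>I. good i \<or> occ i}"
      show "measure lborel (C i) \<le> a i * (if good i then 1 else 0) + 1 / 4 ^ m * real (card (\<omega> x \<inter> C i))"
      proof (cases "good i")
        case False
        then have "1 \<le> real (card (\<omega> x \<inter> C i))" using i by (auto simp: occ_def)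
        then have "1 / 4 ^ m * 1 \<le> 1 / 4 ^ m * real (card (\<omega> x \<inter> C i))" by (intro mult_left_mono) auto
        then show ?thesis using le[of i] False by simp
      qed (simp add: ai)
    qed
    also have "\<dots> \<le> (\<Sum>i\<in>I. a i * (if good i then 1 else 0) + 1 / 4 ^ m * real (card (\<omega> x \<inter> C i)))"
      using finI by (intro sum_mono2) (auto simp: a_def)
    finally show ?thesis .
  qed
  also have "\<dots> = (\<Sum>i\<in>I. a i * (if good i then 1 else 0)) + 1 / 4 ^ m * cnt D x"
  proof -
    have "\<omega> x \<inter> D = (\<Union>i\<in>I. \<omega> x \<inter> C i)" by (auto simp: I_def C_def cell_def)
    also have "card \<dots> = (\<Sum>i\<in>I. card (\<omega> x \<inter> C i))"
    proof (rule card_UN_disjoint[OF finI])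
      show "\<forall>i\<in>I. finite (\<omega> x \<inter> C i)"
        using omega_LF[OF x(1)] bD by (auto simp: LF_def C_def intro: finite_subset[of _ "\<omega> x \<inter> D"])
      show "\<forall>i\<in>I. \<forall>j\<in>I. i \<noteq> j \<longrightarrow> (\<omega> x \<inter> C i) \<inter> (\<omega> x \<inter> C j) = {}" by (auto simp: C_def cell_def)
    qed
    finally show ?thesis by (simp add: cnt_def sum.distrib sum_distrib_left)
  qed
  finally show ?thesis unfolding d_def good_def C_def by simp
qed

end

section \<open>The variance bound\<close>

text \<open>The last bound makes the second-order errors of \<open>covariance_partition\<close> as
  small as desired by refining the mesh.\<close>

lemma cell_partition:
  fixes D :: "complex set" and m :: nat
  assumes D: "D \<in> sets borel" "bounded D"
  defines "I \<equiv> cidx m ` D" and "C \<equiv> (\<lambda>i. cell m i \<inter> D)"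
  shows "finite I" "\<And>i. C i \<in> sets borel" "\<And>i. bounded (C i)" "disjoint_family_on C I" "(\<Union>i\<in>I. C i) = D"
    "(\<Sum>i\<in>I. (measure lborel (C i))\<^sup>2) \<le> 1 / 4 ^ m * measure lborel D"
proof -
  show fin: "finite I" unfolding I_def by (rule finite_cidx_image[OF D(2)])
  show C: "C i \<in> sets borel" for i using D by (simp add: C_def)
  show b: "bounded (C i)" for i using D(2) by (simp add: C_def bounded_Int)
  show disj: "disjoint_family_on C I" unfolding disjoint_family_on_def C_def cell_def by blast
  show un: "(\<Union>i\<in>I. C i) = D" unfolding I_def C_def cell_def by blast
  have "measure lborel D = (\<Sum>i\<in>I. measure lborel (C i))"
    unfolding un[symmetric]
  proof (rule measure_finite_Union[OF fin _ disj])
    show "emeasure lborel (C i) \<noteq> \<infinity>" if "i \<in> I" for i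
      using emeasure_bounded_finite[OF b, of i] by (simp add: less_top)
  qed (use C in auto)
  moreover have "(\<Sum>i\<in>I. (measure lborel (C i))\<^sup>2) \<le> (\<Sum>i\<in>I. 1 / 4 ^ m * measure lborel (C i))"
    unfolding power2_eq_square C_def
    by (intro sum_mono mult_right_mono measure_cell_Int_le D(1)) auto
  ultimately show "(\<Sum>i\<in>I. (measure lborel (C i))\<^sup>2) \<le> 1 / 4 ^ m * measure lborel D"
    by (simp add: sum_distrib_left)
qed

context poisson begin

definition strip_event :: "real \<Rightarrow> real \<Rightarrow> real \<Rightarrow> 'a set" where
  "strip_event s t w = {x\<in>space M. cact (\<omega> x \<inter> strip w) s (Lambda_line t) = cact (\<omega> x) s (Lambda_line t)}"

lemma strip_event_sets:
  assumes "s > 0" shows "strip_event s t w \<in> events"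
proof -
  have [measurable]: "(\<lambda>P. cact P s (Lambda_line t)) \<in> borel_measurable (cfg UNIV)"
    by (rule cact_measurable_UNIV[OF assms])
  have [measurable]: "(\<lambda>P. cact (P \<inter> strip w) s (Lambda_line t)) \<in> borel_measurable (cfg UNIV)"
    by (rule measurable_cfg_mono[OF cact_measurable]) (auto intro: assms)
  show ?thesis unfolding strip_event_def by measurable
qed

text \<open>\<open>good_cells_cover\<close> in expectation. The term
  \<open>expectation K / t\<close> pays, as in Markov's inequality, for configurations with
  \<open>K x > t\<close>.\<close>

lemma sum_gain_ge:
  fixes m :: nat and t w c :: real and D T :: "complex set"
  assumes c: "0 < c" "c < 1" and t: "t \<ge> 1" and w: "w \<ge> 1"
    and T: "T \<subseteq> Lambda_line t" "\<And>y. \<bar>y\<bar> \<le> w \<Longrightarrow> Complex t y \<in> T"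
    and m: "8 / 2 ^ m \<le> c / 1000"
    and D: "D = cbox (Complex (t / 2) (- (2 * w))) (Complex t (2 * w))"
  shows "1 / 4 * (c / 1000 * t / 4 * (prob (strip_event (c * t) t w) - expectation K / t) - 1 / 4 ^ m * measure lborel D)
    \<le> (\<Sum>i\<in>cidx m ` D. expectation (gain (c * t) T (cell m i \<inter> D)))"
proof -
  let ?s = "c * t" and ?A = "strip_event (c * t) t w"
  have s: "?s > 0" using c t by simp
  have Db: "D \<in> sets borel" "bounded D" unfolding D by simp_all
  define I where "I = cidx m ` D"
  define C where "C = (\<lambda>i. cell m i \<inter> D)"
  have part: "finite I" "\<And>i. C i \<in> sets borel" "\<And>i. bounded (C i)" "disjoint_family_on C I" "(\<Union>i\<in>I. C i) = D"
    "(\<Sum>i\<in>I. (measure lborel (C i))\<^sup>2) \<le> 1 / 4 ^ m * measure lborel D"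
    using cell_partition[OF Db, of m] unfolding I_def C_def by blast+
  define z0 where "z0 = (\<lambda>i. SOME z. z \<in> cell m i)"
  have z0: "z0 i \<in> cell m i" if "i \<in> cidx m ` D" for i
    using that unfolding z0_def by (intro someI_ex[of "\<lambda>z. z \<in> cell m i"]) (auto simp: cell_def)
  define G where "G = (\<lambda>i. {x\<in>space M. good_cell ?s T (C i) (z0 i) (4 / 2 ^ m) (\<omega> x) \<and> card (\<omega> x \<inter> C i) = 0})"
  have rad: "dist y (z0 i) \<le> (4 / 2 ^ m) / 2" if "i \<in> I" "y \<in> C i" for i y
  proof -
    have "dist y (z0 i) < 2 / 2 ^ m" using that z0 by (intro cell_dist[of _ m i]) (auto simp: C_def I_def)
    then show ?thesis by simp
  qed
  have one: "measure lborel (C i) \<le> 1" for i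
  proof -
    have "measure lborel (C i) \<le> 1 / 4 ^ m" unfolding C_def by (rule measure_cell_Int_le[OF Db(1)])
    also have "\<dots> \<le> 1" by simp
    finally show ?thesis .
  qed
  have Gs: "G i \<in> events" and gain: "measure lborel (C i) / 4 * prob (G i) \<le> expectation (gain ?s T (C i))"
    if i: "i \<in> I" for i
    unfolding G_def
    using expectation_gain_ge[OF s part(2,3) one rad[OF i], of i T] by blast+
  have A: "?A \<in> events" by (rule strip_event_sets[OF s])
  note cD = cnt_moments[OF Db]
  define d where "d = c / 1000 * t / 4"
  have d: "d \<ge> 0" using c t by (simp add: d_def)
  have iG: "integrable M (\<lambda>x. measure lborel (C i) * indicator (G i) x)" if "i \<in> I" for i
    using Gs[OF that] by (intro integrable_mult_right integrable_real_indicator) (auto simp: less_top[symmetric])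
  have iA: "integrable M (indicator ?A :: 'a \<Rightarrow> real)"
    using A by (intro integrable_real_indicator) (auto simp: less_top[symmetric])
  have "d * (prob ?A - expectation K / t) - 1 / 4 ^ m * measure lborel D =
      expectation (\<lambda>x. d * (indicator ?A x - K x / t) - 1 / 4 ^ m * cnt D x)"
    using A iA K_integrable cD by simp
  also have "\<dots> \<le> expectation (\<lambda>x. \<Sum>i\<in>I. measure lborel (C i) * indicator (G i) x)"
  proof (rule integral_mono_AE)
    show "AE x in M. d * (indicator ?A x - K x / t) - 1 / 4 ^ m * cnt D x
        \<le> (\<Sum>i\<in>I. measure lborel (C i) * indicator (G i) x)"
      using AE_tame AE_space
    proof eventually_elim
      fix x assume x: "0 \<le> K x \<and> tame 64 (K x) (\<omega> x)" "x \<in> space M"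
      have c0: "0 \<le> 1 / 4 ^ m * cnt D x" by (simp add: cnt_def)
      have Kt: "0 \<le> K x / t" using x t by simp
      show "d * (indicator ?A x - K x / t) - 1 / 4 ^ m * cnt D x
        \<le> (\<Sum>i\<in>I. measure lborel (C i) * indicator (G i) x)"
      proof (cases "x \<in> ?A \<and> K x \<le> t")
        case True
        then have "d - 1 / 4 ^ m * cnt D x \<le> (\<Sum>i\<in>I. measure lborel (C i) * indicator (G i) x)"
          using good_cells_cover[OF x(2) _ _ _ c t w T _ m z0 D] x
          by (simp add: d_def strip_event_def I_def C_def G_def indicator_def of_bool_def)
        moreover have "d * (indicator ?A x - K x / t) \<le> d * 1"
          using Kt True by (intro mult_left_mono d) auto
        ultimately show ?thesis by simp
      next
        case False
        \<comment> \<open>Outside the strip event the indicator vanishes; otherwise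
          \<open>K x > t\<close>. In both cases the claimed lower bound is at most 0.\<close>
        have "indicator ?A x \<le> K x / t"
        proof (cases "x \<in> ?A")
          case True
          then have "t \<le> K x" using False by simp
          then show ?thesis using t True by simp
        qed (use Kt in simp)
        then have "d * (indicator ?A x - K x / t) \<le> 0" using d by (simp add: mult_nonneg_nonpos)
        moreover have "0 \<le> (\<Sum>i\<in>I. measure lborel (C i) * indicator (G i) x)"
          by (intro sum_nonneg) auto
        ultimately show ?thesis using c0 by linarith
      qed
    qed
  qed (use iA iG K_integrable cD in auto)
  also have "\<dots> = (\<Sum>i\<in>I. measure lborel (C i) * prob (G i))"
    using iG Gs by (simp add: Bochner_Integration.integral_sum)
  finally have "1 / 4 * (d * (prob ?A - expectation K / t) - 1 / 4 ^ m * measure lborel D)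
    \<le> 1 / 4 * (\<Sum>i\<in>I. measure lborel (C i) * prob (G i))" by (intro mult_left_mono) auto
  also have "\<dots> = (\<Sum>i\<in>I. measure lborel (C i) / 4 * prob (G i))" by (simp add: sum_distrib_left)
  also have "\<dots> \<le> (\<Sum>i\<in>I. expectation (gain ?s T (C i)))" by (intro sum_mono gain)
  finally show ?thesis by (simp add: d_def I_def C_def)
qed

text \<open>The process rotated back by \<open>cnj u\<close> has the same law and the unrotated
  target. On its strip event the optimal chain misses all cells and no gain arises; elsewhere the
  number of points of the chain is bounded linearly.\<close>

lemma sum_gain_rotated_le:
  fixes I :: "'b set" and C :: "'b \<Rightarrow> complex set" and u :: complex and t w c :: real
  assumes c: "0 < c" "c < 1" and t: "t \<ge> 1" and w: "w \<ge> 0"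
    and T: "T \<subseteq> Lambda_line t" "\<And>y. \<bar>y\<bar> \<le> w \<Longrightarrow> Complex t y \<in> T"
    and u: "cmod u = 1" "Re u \<noteq> -1"
    and C: "finite I" "disjoint_family_on C I" "\<And>i. i \<in> I \<Longrightarrow> C i \<in> sets borel"
    and away: "\<And>i z. i \<in> I \<Longrightarrow> z \<in> C i \<Longrightarrow> \<bar>Im (cnj u * z)\<bar> > w"
  shows "(\<Sum>i\<in>I. expectation (gain (c * t) ((*) u ` T) (C i)))
    \<le> 8256 * t * (1 - prob (strip_event (c * t) t w)) + 65 * expectation K"
proof -
  let ?s = "c * t" and ?T = "(*) u ` T"
  have s: "?s > 0" using c t by simp
  have P': "poisson M (\<lambda>x. (*) (cnj u) ` \<omega> x)"
    by (rule poisson_rotation[OF poisson_axioms]) (use u in auto)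
  then interpret R: poisson M "\<lambda>x. (*) (cnj u) ` \<omega> x" .
  let ?A = "R.strip_event ?s t w"
  have A: "?A \<in> events" by (rule R.strip_event_sets[OF s])
  have pA: "prob ?A = prob (strip_event ?s t w)"
    unfolding R.strip_event_def strip_event_def by (rule prob_strip_rotation[OF P' poisson_axioms s])
  have T0: "Complex t 0 \<in> T" using T(2)[of 0] w by simp
  then have Tne: "T \<noteq> {}" by auto
  have uu: "u * (cnj u * z) = z" for z
    using u(1) by (simp add: mult.assoc[symmetric] flip: complex_norm_square)
  have "(\<Sum>i\<in>I. expectation (gain ?s ?T (C i))) = expectation (\<lambda>x. \<Sum>i\<in>I. gain ?s ?T (C i) x)"
    using gain_integrable(3)[OF s C(3)] by (intro Bochner_Integration.integral_sum[symmetric]) auto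
  also have "\<dots> \<le> expectation (\<lambda>x. 8256 * t * (1 - indicator ?A x) + 65 * K x)"
  proof (rule integral_mono_AE)
    show "AE x in M. (\<Sum>i\<in>I. gain ?s ?T (C i) x) \<le> 8256 * t * (1 - indicator ?A x) + 65 * K x"
      using AE_tame AE_space
    proof eventually_elim
      fix x assume x: "0 \<le> K x \<and> tame 64 (K x) (\<omega> x)" "x \<in> space M"
      then have LF: "\<omega> x \<in> LF" by simp
      note sum_le = sum_gain_le[OF x(2) _ _ s C(1,2)]
      show "(\<Sum>i\<in>I. gain ?s ?T (C i) x) \<le> 8256 * t * (1 - indicator ?A x) + 65 * K x"
      proof (cases "x \<in> ?A")
        case True
        let ?P = "(*) (cnj u) ` \<omega> x"
        have rot: "(*) u ` ?P = \<omega> x" by (simp add: image_image uu)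
        have P: "?P \<in> LF" "tame 64 (K x) ?P" "(0::real) \<le> 64" "0 \<le> K x"
          "cact (?P \<inter> strip w) ?s (Lambda_line t) = cact ?P ?s (Lambda_line t)"
          using LF x u True by (auto intro: tame_rotation simp: R.strip_event_def)
        obtain qs where qs: "qs \<in> chains ?P" "set qs \<subseteq> strip w" "cact ?P ?s T = cval ?s T qs"
          by (rule strip_optimal_chain[OF P(1-4) s w P(5) T]) blast
        define ps where "ps = map ((*) u) qs"
        have "ps \<in> chains (\<omega> x)" using chains_rotation[OF u(1), of ?P] qs(1) by (simp add: ps_def rot)
        moreover have "cact (\<omega> x) ?s ?T = cval ?s ?T ps"
          using cact_rotation[OF u(1) Tne, of ?P ?s] qs(3) cval_rotation[OF u(1) Tne, of ?s qs]
          by (simp add: ps_def rot)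
        ultimately have "(\<Sum>i\<in>I. gain ?s ?T (C i) x) \<le> card (set ps \<inter> (\<Union>i\<in>I. C i))"
          using sum_le x by blast
        moreover have "set ps \<inter> (\<Union>i\<in>I. C i) = {}"
        proof -
          have "\<bar>Im (cnj u * z)\<bar> \<le> w" if z: "z \<in> set ps" for z
          proof -
            obtain q where q: "q \<in> set qs" "z = u * q" using z by (auto simp: ps_def)
            then have "cnj u * z = q" using uu[of q] by (simp add: ac_simps)
            then show ?thesis using q(1) qs(2) by (auto simp: strip_def)
          qed
          then show ?thesis using away by (meson UN_E disjoint_iff not_le)
        qed
        ultimately have "(\<Sum>i\<in>I. gain ?s ?T (C i) x) \<le> 0" by simp
        then show ?thesis using x True by simp
      next
        case False
        obtain ps where ps: "ps \<in> chains (\<omega> x)" "cact (\<omega> x) ?s ?T = cval ?s ?T ps"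
          using cact_attained[of 64 "K x" "\<omega> x" ?s ?T] x s LF by auto
        have "infdist (u * 0) ?T \<le> dist 0 (Complex t 0)"
          unfolding infdist_rotation[OF u(1) Tne] by (rule infdist_le[OF T0])
        then have "infdist 0 ?T \<le> t" using t by (simp add: cmod_def)
        then have "real (length ps) \<le> 8256 * t + 65 * K x"
          using optimal_chain_bounds(2)[OF _ _ c _ _ ps] x t by simp
        moreover have "(\<Sum>i\<in>I. gain ?s ?T (C i) x) \<le> card (set ps \<inter> (\<Union>i\<in>I. C i))"
          using sum_le ps x by blast
        moreover have "card (set ps \<inter> (\<Union>i\<in>I. C i)) \<le> length ps"
          by (meson card_length card_mono finite_set inf_le1 order_trans)
        ultimately show ?thesis using False by simp
      qed
    qed
  qed (use A K_integrable gain_integrable(3)[OF s C(3)] in \<open>auto simp: less_top[symmetric]\<close>)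
  also have "\<dots> = 8256 * t * (1 - prob ?A) + 65 * expectation K"
    using A K_integrable prob_space by (simp add: less_top[symmetric])
  finally show ?thesis by (simp add: pA)
qed

text \<open>Cauchy--Schwarz against the number of points in the slab \<open>D\<close>, which the optimal chain of the second
  problem avoids.\<close>

lemma variance_difference_ge:
  fixes T T' D :: "complex set" and u :: complex and t w c B :: real
  assumes c: "0 < c" "c < 1" and t: "t \<ge> 1" and w: "w \<ge> 1"
    and T: "T \<subseteq> Lambda_line t" "\<And>y. \<bar>y\<bar> \<le> w \<Longrightarrow> Complex t y \<in> T"
    and T': "T' \<subseteq> Lambda_line t" "\<And>y. \<bar>y\<bar> \<le> w \<Longrightarrow> Complex t y \<in> T'"
    and u: "cmod u = 1" "Re u \<noteq> -1"
    and D: "D = cbox (Complex (t / 2) (- (2 * w))) (Complex t (2 * w))"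
    and away: "\<And>z. z \<in> D \<Longrightarrow> \<bar>Im (cnj u * z)\<bar> > w"
    and p: "p = prob (strip_event (c * t) t w)"
    and B: "0 \<le> B" "B \<le> 1 / 4 * (c / 1000 * t / 4 * (p - expectation K / t) - 1)
      - (8256 * t * (1 - p) + 65 * expectation K) - 2"
  shows "B\<^sup>2 / (2 * t * w) \<le> variance (\<lambda>x. cact (\<omega> x) (c * t) T - cact (\<omega> x) (c * t) ((*) u ` T'))"
proof -
  let ?s = "c * t" and ?T' = "(*) u ` T'"
  have s: "?s > 0" using c t by simp
  have Db: "D \<in> sets borel" "bounded D" unfolding D by simp_all
  have mD: "measure lborel D = 2 * t * w"
  proof -
    have "measure lborel D = (\<Prod>b\<in>Basis. (Complex t (2 * w) - Complex (t / 2) (- (2 * w))) \<bullet> b)"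
      unfolding D using t w by (intro measure_lborel_cbox) (auto simp: Basis_complex_def inner_complex_def)
    also have "\<dots> = 2 * t * w" by (simp add: Basis_complex_def inner_complex_def)
    finally show ?thesis .
  qed
  \<comment> \<open>The mesh must be fine compared with the detour width and make the total
    second-order error at most 1.\<close>
  obtain m :: nat where m: "8 / 2 ^ m \<le> c / 1000" "1 / 4 ^ m * measure lborel D \<le> 1"
  proof -
    define X where "X = max (8000 / c) (2 * t * w)"
    obtain m :: nat where m: "X < 2 ^ m" using real_arch_pow[of 2 X] by auto
    show ?thesis
    proof (rule that[of m])
      have "8000 / c < 2 ^ m" using m by (simp add: X_def)
      then show "8 / 2 ^ m \<le> c / 1000" using c by (simp add: field_simps)
      have "2 * t * w < 2 ^ m" using m by (simp add: X_def)
      also have "(2::real) ^ m \<le> 4 ^ m" by (intro power_mono) auto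
      finally show "1 / 4 ^ m * measure lborel D \<le> 1" by (simp add: mD field_simps)
    qed
  qed
  define I where "I = cidx m ` D"
  define C where "C = (\<lambda>i. cell m i \<inter> D)"
  have part: "finite I" "\<And>i. C i \<in> sets borel" "\<And>i. bounded (C i)" "disjoint_family_on C I" "(\<Union>i\<in>I. C i) = D"
    "(\<Sum>i\<in>I. (measure lborel (C i))\<^sup>2) \<le> 1 / 4 ^ m * measure lborel D"
    using cell_partition[OF Db, of m] unfolding I_def C_def by blast+
  define X where "X = act ?s T UNIV"
  define Y where "Y = act ?s ?T' UNIV"
  define n where "n = (\<lambda>x. cnt D x - measure lborel D)"
  have [measurable]: "X \<in> borel_measurable M" "Y \<in> borel_measurable M" "cnt D \<in> borel_measurable M"
    unfolding X_def Y_def using s Db by (auto intro: act_measurable cnt_measurable)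
  have [measurable]: "n \<in> borel_measurable M" unfolding n_def by measurable
  have sq: "integrable M (\<lambda>x. (X x)\<^sup>2)" "integrable M (\<lambda>x. (Y x)\<^sup>2)"
    unfolding X_def Y_def using s by (auto intro: act_square_integrable)
  note cD = cnt_moments[OF Db]
  have nsq: "integrable M (\<lambda>x. (n x)\<^sup>2)" using cD by (simp add: n_def)
  have iXn: "integrable M (\<lambda>x. X x * n x)" "integrable M (\<lambda>x. Y x * n x)"
    using sq nsq by (auto intro: integrable_prod_of_squares)
  have iXY: "integrable M (\<lambda>x. X x * Y x)" using sq by (auto intro: integrable_prod_of_squares)
  have "- expectation (\<lambda>x. X x * n x) \<ge>
      (\<Sum>i\<in>I. expectation (gain ?s T (C i))) - (\<Sum>i\<in>I. (measure lborel (C i))\<^sup>2)"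
    using covariance_partition(1)[OF s part(1) part(2) part(3) part(4), of T] unfolding part(5) X_def n_def .
  moreover have "- expectation (\<lambda>x. Y x * n x) \<le>
      (\<Sum>i\<in>I. expectation (gain ?s ?T' (C i))) + (\<Sum>i\<in>I. (measure lborel (C i))\<^sup>2)"
    using covariance_partition(2)[OF s part(1) part(2) part(3) part(4), of ?T'] unfolding part(5) Y_def n_def .
  \<comment> \<open>This error enters once for each of the two actions, which is the
    \<open>- 2\<close> in the bound on \<open>B\<close>.\<close>
  moreover have "(\<Sum>i\<in>I. (measure lborel (C i))\<^sup>2) \<le> 1" using part(6) m(2) by linarith
  moreover have "1 / 4 * (c / 1000 * t / 4 * (p - expectation K / t) - 1) \<le> (\<Sum>i\<in>I. expectation (gain ?s T (C i)))"
  proof -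
    have "1 / 4 * (c / 1000 * t / 4 * (p - expectation K / t) - 1)
      \<le> 1 / 4 * (c / 1000 * t / 4 * (p - expectation K / t) - 1 / 4 ^ m * measure lborel D)"
      using m(2) by (intro mult_left_mono diff_left_mono) auto
    also have "\<dots> \<le> (\<Sum>i\<in>I. expectation (gain ?s T (C i)))"
      unfolding p I_def C_def by (rule sum_gain_ge[OF c t w _ _ m(1) D]) (use T in auto)
    finally show ?thesis .
  qed
  moreover have "(\<Sum>i\<in>I. expectation (gain ?s ?T' (C i))) \<le> 8256 * t * (1 - p) + 65 * expectation K"
    unfolding p using w part away
    by (intro sum_gain_rotated_le c t T' u) (auto simp: C_def)
  ultimately have "B \<le> - expectation (\<lambda>x. X x * n x) + expectation (\<lambda>x. Y x * n x)" using B(2) by linarith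
  also have "\<dots> = - expectation (\<lambda>x. (X x - Y x) * n x)" using iXn by (simp add: left_diff_distrib)
  finally have "B\<^sup>2 \<le> (- expectation (\<lambda>x. (X x - Y x) * n x))\<^sup>2" using B(1) by (intro power_mono)
  then have "B\<^sup>2 / (2 * t * w) \<le> (expectation (\<lambda>x. (X x - Y x) * n x))\<^sup>2 / (2 * t * w)"
    using t w by (intro divide_right_mono) auto
  also have "\<dots> \<le> variance (\<lambda>x. X x - Y x)"
  proof (rule variance_ge_covariance)
    show "integrable M (\<lambda>x. (X x - Y x)\<^sup>2)" using sq iXY by (simp add: power2_diff mult.assoc)
    show "expectation n = 0" using cD prob_space by (simp add: n_def)
    show "expectation (\<lambda>x. (n x)\<^sup>2) \<le> 2 * t * w" using cD mD by (simp add: n_def)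
  qed (use nsq t w in auto)
  finally show ?thesis by (simp add: X_def Y_def act_def)
qed

end

section \<open>Geometry of the rotated slab and conclusion\<close>

lemma sin_ge_half:
  assumes "0 \<le> x" "x \<le> 1" shows "x / 2 \<le> sin (x::real)"
proof -
  have "sin 0 - 0 / 2 \<le> sin x - x / 2"
  proof (rule DERIV_nonneg_imp_nondecreasing[OF assms(1)])
    fix y :: real assume y: "0 \<le> y" "y \<le> x"
    have "cos (pi / 3) \<le> cos y" using y assms pi_gt3 by (intro cos_monotone_0_pi_le) auto
    then have "0 \<le> cos y - 1 / 2" by (simp add: cos_60)
    moreover have "((\<lambda>x. sin x - x / 2) has_real_derivative cos y - 1 / 2) (at y)"
      by (auto intro!: derivative_eq_intros)
    ultimately show "\<exists>d. ((\<lambda>x. sin x - x / 2) has_real_derivative d) (at y) \<and> 0 \<le> d" by blast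
  qed
  then show ?thesis by simp
qed

text \<open>On the slab \<open>Re z * sin \<theta>\<close> is at least
  \<open>t * \<theta> / 4 > 3 * w\<close>, while the other term is at most \<open>2 * w\<close>;
  this is where the 12 comes from.\<close>

lemma rotated_strip_away:
  assumes "0 \<le> \<theta>" "\<theta> \<le> 1" "12 * w < t * \<theta>" "0 \<le> t"
    and z: "z \<in> cbox (Complex (t / 2) (- (2 * w))) (Complex t (2 * w))"
  shows "w < \<bar>Im (cnj (cis \<theta>) * z)\<bar>"
proof -
  have z: "t / 2 \<le> Re z" "\<bar>Im z\<bar> \<le> 2 * w" using z by (auto simp: in_cbox_complex_iff)
  have "t / 2 * (\<theta> / 2) \<le> Re z * sin \<theta>"
    using z assms sin_ge_half[of \<theta>] by (intro mult_mono) auto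
  moreover have "\<bar>Im z * cos \<theta>\<bar> \<le> \<bar>Im z\<bar> * 1"
    unfolding abs_mult by (intro mult_left_mono) auto
  moreover have "Im (cnj (cis \<theta>) * z) = Im z * cos \<theta> - Re z * sin \<theta>" by simp
  ultimately show ?thesis using z assms(3) by linarith
qed

lemma S_set_vseg: "S_set \<gamma>' t = vseg t (- (t powr \<gamma>') / 2) (3 * t powr \<gamma>' / 2)"
  by (auto simp: S_set_def vseg_def Complex_eq mult.commute)

lemma S'_set_vseg: "S'_set \<gamma>' \<theta> t = (*) (cis \<theta>) ` vseg t (- 3 * t powr \<gamma>' / 2) (t powr \<gamma>' / 2)"
  by (auto simp: S'_set_def vseg_def Complex_eq cis_conv_exp mult.commute)

theorem theorem5p1:
  fixes M :: "'a measure" and \<omega> :: "'a \<Rightarrow> complex set"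
  assumes "poisson_pp M \<omega>"
  shows "\<exists>cstar::real. 0 < cstar \<and> cstar \<le> 1 \<and>
    (\<forall>(c::real) (\<gamma>::real) (\<gamma>'::real) (t::nat \<Rightarrow> real).
       0 < c \<longrightarrow> c < cstar \<longrightarrow> 0 < \<gamma> \<longrightarrow> \<gamma> < \<gamma>' \<longrightarrow> \<gamma>' < 1 \<longrightarrow>
       filterlim t at_top sequentially \<longrightarrow>
       (\<lambda>n. measure M {x\<in>space M.
              minimizer (\<omega> x) (Lambda_line (t n)) (c * t n) ` {0 .. c * t n}
                \<subseteq> cylinder 1 (t n powr \<gamma>)}) \<longlonglongrightarrow> 1 \<longrightarrow>
       (\<exists>C>0. eventually (\<lambda>n.
          prob_space.variance M
            (\<lambda>x. Action (\<omega> x) (c * t n) (S_set \<gamma>' (t n))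
                 - Action (\<omega> x) (c * t n) (S'_set \<gamma>' (t n powr (- (1 - \<gamma>'))) (t n)))
          \<ge> C * t n powr (1 - \<gamma>)) sequentially))"
proof -
  interpret prob_space M using assms by (simp add: poisson_pp_def)
  interpret poisson M \<omega> by unfold_locales (rule assms)
  show ?thesis
  proof (rule exI[of _ 1], intro conjI allI impI)
    fix c \<gamma> \<gamma>' :: real and t :: "nat \<Rightarrow> real"
    assume c: "0 < c" "c < 1" and \<gamma>: "0 < \<gamma>" "\<gamma> < \<gamma>'" "\<gamma>' < 1"
      and t: "filterlim t at_top sequentially"
      and hyp: "(\<lambda>n. prob {x\<in>space M. minimizer (\<omega> x) (Lambda_line (t n)) (c * t n) ` {0 .. c * t n}
                \<subseteq> cylinder 1 (t n powr \<gamma>)}) \<longlonglongrightarrow> 1"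
    define p where "p = (\<lambda>n. prob (strip_event (c * t n) (t n) (t n powr \<gamma>)))"
    define \<kappa> where "\<kappa> = expectation K"
    define B where "B = (\<lambda>n. 1 / 4 * (c / 1000 * t n / 4 * (p n - \<kappa> / t n) - 1)
      - (8256 * t n * (1 - p n) + 65 * \<kappa>) - 2)"
    have t1: "eventually (\<lambda>n. t n \<ge> 1) sequentially" using t by (simp add: filterlim_at_top)
    have p: "p \<longlonglongrightarrow> 1"
    proof (rule tendsto_sandwich[OF _ _ hyp])
      show "eventually (\<lambda>n. prob {x\<in>space M. minimizer (\<omega> x) (Lambda_line (t n)) (c * t n) ` {0 .. c * t n}
                \<subseteq> cylinder 1 (t n powr \<gamma>)} \<le> p n) sequentially"
        using t1
      proof eventually_elim
        case (elim n)
        then show ?case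
          unfolding p_def strip_event_def cylinder_1 using c by (intro minimizer_event_le) auto
      qed
    qed (auto simp: p_def)
    have inv: "(\<lambda>n. 1 / t n) \<longlonglongrightarrow> 0"
      using tendsto_inverse_0_at_top[OF t] by (simp add: inverse_eq_divide)
    have "(\<lambda>n. 1 / 4 * (c / 1000 / 4 * (p n - \<kappa> * (1 / t n)) - 1 / t n)
        - (8256 * (1 - p n) + 65 * \<kappa> * (1 / t n)) - 2 * (1 / t n))
      \<longlonglongrightarrow> 1 / 4 * (c / 1000 / 4 * (1 - \<kappa> * 0) - 0) - (8256 * (1 - 1) + 65 * \<kappa> * 0) - 2 * 0"
      by (intro tendsto_intros p inv)
    \<comment> \<open>The limit is \<open>c / 16000\<close>; half of it is kept. Since
      \<open>p n\<close> tends to 1, the linear bound on the rotated side is of smaller order than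
      \<open>t n\<close>.\<close>
    then have "eventually (\<lambda>n. c / 32000 < 1 / 4 * (c / 1000 / 4 * (p n - \<kappa> * (1 / t n)) - 1 / t n)
        - (8256 * (1 - p n) + 65 * \<kappa> * (1 / t n)) - 2 * (1 / t n)) sequentially"
      by (rule order_tendstoD(1)) (use c in simp)
    then have evB: "eventually (\<lambda>n. c / 32000 * t n \<le> B n) sequentially"
      using t1
    proof eventually_elim
      case (elim n)
      then have "c / 32000 * t n \<le> (1 / 4 * (c / 1000 / 4 * (p n - \<kappa> * (1 / t n)) - 1 / t n)
        - (8256 * (1 - p n) + 65 * \<kappa> * (1 / t n)) - 2 * (1 / t n)) * t n"
        by (intro mult_right_mono) auto
      also have "\<dots> = B n" using elim(2) by (simp add: B_def field_simps)
      finally show ?case .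
    qed
    have "filterlim (\<lambda>x::real. x powr (\<gamma>' - \<gamma>)) at_top at_top" using \<gamma> by real_asymp
    then have "filterlim (\<lambda>n. t n powr (\<gamma>' - \<gamma>)) at_top sequentially" using t by (rule filterlim_compose)
    then have ev12: "eventually (\<lambda>n. 12 < t n powr (\<gamma>' - \<gamma>)) sequentially"
      by (simp add: filterlim_at_top_dense)
    \<comment> \<open>The square of the covariance bound over twice
      \<open>t n powr (1 + \<gamma>)\<close>.\<close>
    define C where "C = (c / 32000)\<^sup>2 / 2"
    have "eventually (\<lambda>n. variance (\<lambda>x. Action (\<omega> x) (c * t n) (S_set \<gamma>' (t n))
                 - Action (\<omega> x) (c * t n) (S'_set \<gamma>' (t n powr (- (1 - \<gamma>'))) (t n)))
          \<ge> C * t n powr (1 - \<gamma>)) sequentially"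
      using t1 evB ev12
    proof eventually_elim
      case (elim n)
      define r where "r = t n"
      define w where "w = r powr \<gamma>"
      define b where "b = r powr \<gamma>'"
      define \<theta> where "\<theta> = r powr (- (1 - \<gamma>'))"
      have r: "1 \<le> r" using elim by (simp add: r_def)
      then have w: "1 \<le> w" using \<gamma> by (simp add: w_def ge_one_powr_ge_zero)
      have "b = r powr (\<gamma>' - \<gamma>) * w" by (simp add: b_def w_def flip: powr_add)
      then have bw: "12 * w < b" using elim(3) w by (simp add: r_def)
      \<comment> \<open>The angle is such that the displacement at distance \<open>r\<close> is
        exactly the scale of the segments.\<close>
      have r\<theta>: "r * \<theta> = b"
        using powr_mult_base[of r "\<gamma>' - 1"] r by (simp add: \<theta>_def b_def)
      have "\<theta> \<le> r powr 0" unfolding \<theta>_def using r \<gamma> by (intro powr_mono) auto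
      then have \<theta>: "0 \<le> \<theta>" "\<theta> \<le> 1" using r by (auto simp: \<theta>_def)
      define T where "T = vseg r (- b / 2) (3 * b / 2)"
      define T' where "T' = vseg r (- 3 * b / 2) (b / 2)"
      define u where "u = cis \<theta>"
      have sub: "T \<subseteq> Lambda_line r" "T' \<subseteq> Lambda_line r" by (simp_all add: T_def T'_def vseg_subset)
      \<comment> \<open>The shorter arm of either segment is \<open>b / 2\<close>, longer than
        \<open>6 * w\<close>.\<close>
      have mem: "Complex r y \<in> T" "Complex r y \<in> T'" if "\<bar>y\<bar> \<le> w" for y
        unfolding T_def T'_def vseg_def using that bw w by (auto intro!: imageI simp: abs_le_iff)
      have u: "cmod u = 1" "Re u \<noteq> -1"
        using cos_gt_zero_pi[of \<theta>] \<theta> pi_gt3 by (auto simp: u_def)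
      have "C * r powr (1 - \<gamma>) = (c / 32000 * r)\<^sup>2 / (2 * r * w)"
        using r by (simp add: C_def w_def powr_diff power2_eq_square field_simps)
      also have "\<dots> \<le> (B n)\<^sup>2 / (2 * r * w)"
        using elim(2) r w c by (intro divide_right_mono power_mono) (auto simp: r_def)
      also have "\<dots> \<le> variance (\<lambda>x. cact (\<omega> x) (c * r) T - cact (\<omega> x) (c * r) ((*) u ` T'))"
      proof (rule variance_difference_ge[OF c r w sub(1) mem(1) sub(2) mem(2) u refl])
        show "w < \<bar>Im (cnj u * z)\<bar>"
          if "z \<in> cbox (Complex (r / 2) (- (2 * w))) (Complex r (2 * w))" for z
          unfolding u_def using \<theta> bw r\<theta> r that by (intro rotated_strip_away) auto
        have "0 \<le> c / 32000 * t n" using elim(1) c by simp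
        then show "0 \<le> B n" using elim(2) by linarith
      qed (auto simp: B_def \<kappa>_def p_def r_def w_def)
      also have "\<dots> = variance (\<lambda>x. Action (\<omega> x) (c * r) T - Action (\<omega> x) (c * r) ((*) u ` T'))"
      proof -
        have eq: "Action (\<omega> x) (c * r) T - Action (\<omega> x) (c * r) ((*) u ` T') =
            cact (\<omega> x) (c * r) T - cact (\<omega> x) (c * r) ((*) u ` T')" if x: "x \<in> space M" for x
        proof -
          have s: "0 < r" "0 < c * r" "- b / 2 < 3 * b / 2" "- 3 * b / 2 < b / 2" using r c bw w by auto
          \<comment> \<open>The unrotated segment is treated as rotated by 1.\<close>
          have "Action (\<omega> x) (c * r) ((*) 1 ` T) = cact (\<omega> x) (c * r) ((*) 1 ` T)"
            unfolding T_def by (rule Action_vseg_rotated[OF omega_LF[OF x] _ s(3,1,2)]) simp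
          moreover have "(*) 1 ` T = T" by simp
          ultimately show ?thesis
            using Action_vseg_rotated[OF omega_LF[OF x] u(1) s(4,1,2)] by (simp add: T'_def)
        qed
        show ?thesis using eq by (simp cong: Bochner_Integration.integral_cong)
      qed
      finally show ?case
        by (simp add: r_def T_def T'_def u_def b_def \<theta>_def S_set_vseg S'_set_vseg)
    qed
    moreover have "0 < C" using c by (simp add: C_def)
    ultimately show "\<exists>C>0. eventually (\<lambda>n. variance (\<lambda>x. Action (\<omega> x) (c * t n) (S_set \<gamma>' (t n))
                 - Action (\<omega> x) (c * t n) (S'_set \<gamma>' (t n powr (- (1 - \<gamma>'))) (t n)))
          \<ge> C * t n powr (1 - \<gamma>)) sequentially" by blast
  qed auto
qed

end
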